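(* Let $k$ be a positive integer, let $G$ be a $50k$-connected graph and let $S \subseteq V(G)$. At least one of the following holds: (i) $G$ contains $k$ pairwise vertex-disjoint odd $S$-cycles; (ii) there is a set $X \subseteq V(G)$ with $|X| \le 2k-2$ such that $G - X$ contains no odd $S$-cycle.
   Context: All graphs are finite and simple. An $S$-cycle is a cycle containing at least one vertex of $S$; an odd $S$-cycle is one of odd length. *)

theory Defs
  imports Main
begin

definition simple_graph :: "'a set \<Rightarrow> ('a \<Rightarrow> 'a \<Rightarrow> bool) \<Rightarrow> bool" where
  "simple_graph V E \<longleftrightarrow> finite V \<and> (\<forall>u v. E u v \<longrightarrow> u \<in> V \<and> v \<in> V)
     \<and> (\<forall>u v. E u v \<longrightarrow> E v u) \<and> (\<forall>v. \<not> E v v)"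

definition del_verts_E :: "('a \<Rightarrow> 'a \<Rightarrow> bool) \<Rightarrow> 'a set \<Rightarrow> 'a \<Rightarrow> 'a \<Rightarrow> bool" where
  "del_verts_E E X = (\<lambda>u v. E u v \<and> u \<notin> X \<and> v \<notin> X)"

definition connected_graph :: "'a set \<Rightarrow> ('a \<Rightarrow> 'a \<Rightarrow> bool) \<Rightarrow> bool" where
  "connected_graph V E \<longleftrightarrow>
     (\<forall>u\<in>V. \<forall>v\<in>V. (\<lambda>x y. E x y \<and> x \<in> V \<and> y \<in> V)\<^sup>*\<^sup>* u v)"

definition k_connected :: "nat \<Rightarrow> 'a set \<Rightarrow> ('a \<Rightarrow> 'a \<Rightarrow> bool) \<Rightarrow> bool" where
  "k_connected k V E \<longleftrightarrow> card V > k \<and>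
     (\<forall>X. X \<subseteq> V \<and> card X < k \<longrightarrow> connected_graph (V - X) (del_verts_E E X))"

definition is_cycle :: "'a set \<Rightarrow> ('a \<Rightarrow> 'a \<Rightarrow> bool) \<Rightarrow> 'a list \<Rightarrow> bool" where
  "is_cycle V E c \<longleftrightarrow> length c \<ge> 3 \<and> distinct c \<and> set c \<subseteq> V \<and>
     (\<forall>i < length c. E (c ! i) (c ! ((i + 1) mod length c)))"

definition odd_S_cycle :: "'a set \<Rightarrow> ('a \<Rightarrow> 'a \<Rightarrow> bool) \<Rightarrow> 'a set \<Rightarrow> 'a list \<Rightarrow> bool" where
  "odd_S_cycle V E S c \<longleftrightarrow> is_cycle V E c \<and> odd (length c) \<and> set c \<inter> S \<noteq> {}"

end

theory Submission
  imports Defs "HOL-Library.Disjoint_Sets"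
begin

text \<open>
  A \<^emph>\<open>host\<close> is a bipartite subgraph on a set \<open>U\<close> in which any \<open>2 k\<close> disjoint pairs of vertices can be joined
  by disjoint paths; such subgraphs come from the theorem of Thomas and Wollan that massed graphs are linked,
  applied with a constant near \<open>6.2\<close> per linked pair. A path between two vertices of \<open>U\<close> whose parity contradicts the colouring of the host
  is closed by a host path to an odd cycle. So it suffices to find \<open>k\<close> disjoint paths with ends in \<open>U\<close>, each
  meeting \<open>S\<close>, together with disjoint parity-breaking paths for those among them that are not parity-breaking.

  If no \<open>6 k - 2\<close> vertices meet all odd cycles, a maximum cut yields the host, the theorem on packing odd
  \<open>A\<close>-paths yields \<open>3 k\<close> breaking paths, and \<open>k\<close> disjoint two-legged paths through \<open>S\<close> can be routed
  so as to spare \<open>k\<close> of these. If some set \<open>X\<close> of \<open>6 k - 2\<close> vertices does, then \<open>V - X\<close> is the host; unless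
  alternative (ii) holds, the extended colouring has \<open>k\<close> disjoint monochromatic edges, and these provide the breaking paths.
\<close>

section \<open>Paths and connected sets\<close>

text \<open>The constants. Each of the \<open>k\<close> cycles uses at most two host paths, so there
  are at most \<open>2 * k\<close> pairs and \<open>4 * k\<close> terminals. Massed graphs are
  linked once a vertex outside the terminals accounts, on average, for more than about 12.4 k edges.
  A maximum cut of a graph of minimum degree \<open>50 * k\<close> keeps degree
  \<open>25 * k\<close>, that is 12.5 k edges per vertex, and the slack pays for the edges inside
  the terminal set. The \<open>k\<close> two-legged paths consist of \<open>2 * k\<close> legs, and
  a cheapest linkage hits at most one breaking path per leg; so \<open>3 * k\<close> breaking paths
  leave \<open>k\<close> untouched. If there are not \<open>3 * k\<close> of them, the packing
  theorem gives a hitting set of at most \<open>2 * (3 * k) - 2\<close> vertices, and this number is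
  the border between the two cases. The bound \<open>2 * k - 2\<close> in alternative (ii) is the
  number of vertices covered by \<open>k - 1\<close> disjoint monochromatic edges: while no such set
  destroys all odd \<open>S\<close>-cycles, the greedy choice of these edges does not stop before
  the \<open>k\<close>-th one.\<close>

definition gpath :: "('a \<Rightarrow> 'a \<Rightarrow> bool) \<Rightarrow> 'a list \<Rightarrow> bool" where
  "gpath E p \<longleftrightarrow> p \<noteq> [] \<and> distinct p \<and> successively E p"

definition conn :: "('a \<Rightarrow> 'a \<Rightarrow> bool) \<Rightarrow> 'a set \<Rightarrow> bool" where
  "conn E C \<longleftrightarrow> (\<forall>u\<in>C. \<forall>v\<in>C. (\<lambda>a b. E a b \<and> a \<in> C \<and> b \<in> C)\<^sup>*\<^sup>* u v)"

lemma conn_singleton [simp]: "conn E {x}"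
  by (auto simp: conn_def)

lemma conn_mono: "conn E C \<Longrightarrow> (\<And>a b. a \<in> C \<Longrightarrow> b \<in> C \<Longrightarrow> E a b \<Longrightarrow> E' a b) \<Longrightarrow> conn E' C"
proof -
  assume a: "conn E C" and b: "\<And>a b. a \<in> C \<Longrightarrow> b \<in> C \<Longrightarrow> E a b \<Longrightarrow> E' a b"
  have "(\<lambda>a b. E a b \<and> a \<in> C \<and> b \<in> C) \<le> (\<lambda>a b. E' a b \<and> a \<in> C \<and> b \<in> C)" using b by auto
  from rtranclp_mono[OF this] a show ?thesis unfolding conn_def by blast
qed

lemma rtranclp_sub: "(\<lambda>a b. E a b \<and> a \<in> C \<and> b \<in> C)\<^sup>*\<^sup>* u v \<Longrightarrow> C \<subseteq> D
   \<Longrightarrow> (\<lambda>a b. E a b \<and> a \<in> D \<and> b \<in> D)\<^sup>*\<^sup>* u v"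
  by (rule rtranclp_mono[THEN predicate2D, rotated]) auto

lemma conn_Un:
  assumes "conn E C" "conn E D" "C \<inter> D \<noteq> {}"
  shows "conn E (C \<union> D)"
proof -
  obtain w where w: "w \<in> C" "w \<in> D" using assms by auto
  let ?R = "\<lambda>a b. E a b \<and> a \<in> C \<union> D \<and> b \<in> C \<union> D"
  have "?R\<^sup>*\<^sup>* u w \<and> ?R\<^sup>*\<^sup>* w u" if "u \<in> C \<union> D" for u
    using that w assms(1,2) rtranclp_sub[of E C _ _ "C \<union> D"] rtranclp_sub[of E D _ _ "C \<union> D"]
    unfolding conn_def by blast
  then show ?thesis unfolding conn_def by (meson rtranclp_trans)
qed

lemma conn_edge: "symp E \<Longrightarrow> E u v \<Longrightarrow> conn E {u,v}"
  unfolding conn_def by (auto intro!: r_into_rtranclp simp: symp_def)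

lemma conn_Un_edge:
  assumes "symp E" "conn E C" "conn E D" "u \<in> C" "v \<in> D" "E u v"
  shows "conn E (C \<union> D)"
proof -
  have "conn E (C \<union> {u,v})" using conn_edge[OF assms(1,6)] assms by (intro conn_Un) auto
  then have "conn E ((C \<union> {u,v}) \<union> D)" by (rule conn_Un) (use assms in auto)
  moreover have "(C \<union> {u,v}) \<union> D = C \<union> D" using assms by auto
  ultimately show ?thesis by simp
qed

lemma conn_insert:
  assumes "symp E" "conn E C" "u \<in> C" "E u v"
  shows "conn E (insert v C)"
  using conn_Un_edge[OF assms(1,2) conn_singleton assms(3) _ assms(4)] by (simp add: insert_commute)

lemma gpath_Cons: "gpath E (x # p) \<longleftrightarrow> x \<notin> set p \<and> (p = [] \<or> E x (hd p) \<and> gpath E p)"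
  by (cases p) (auto simp: gpath_def)

lemma gpath_single [simp]: "gpath E [x]" by (simp add: gpath_def)

lemma gpath_append: "p \<noteq> [] \<Longrightarrow> q \<noteq> [] \<Longrightarrow>
  gpath E (p @ q) \<longleftrightarrow> gpath E p \<and> gpath E q \<and> set p \<inter> set q = {} \<and> E (last p) (hd q)"
  by (auto simp: gpath_def successively_append_iff)

lemma gpath_rev: "symp E \<Longrightarrow> gpath E (rev p) \<longleftrightarrow> gpath E p"
proof -
  assume "symp E"
  then have "(\<lambda>x y. E y x) = E" by (auto simp: symp_def fun_eq_iff)
  from arg_cong[OF this, of "\<lambda>R. successively R p"] show ?thesis
    unfolding gpath_def successively_rev by simp
qed

lemma gpath_mono: "gpath E p \<Longrightarrow> (\<And>a b. a \<in> set p \<Longrightarrow> b \<in> set p \<Longrightarrow> E a b \<Longrightarrow> E' a b) \<Longrightarrow> gpath E' p"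
  unfolding gpath_def using successively_mono by (metis (no_types, lifting) successively_cong)

lemma gpath_conn: "symp E \<Longrightarrow> gpath E p \<Longrightarrow> conn E (set p)"
proof (induction p)
  case (Cons x p)
  show ?case
  proof (cases "p = []")
    case False
    then have *: "gpath E p" "E x (hd p)" using Cons by (auto simp: gpath_Cons)
    have "conn E (insert x (set p))"
      using Cons.prems(1) Cons.IH[OF Cons.prems(1) *(1)] False *(2)
      by (intro conn_insert[of E _ "hd p"]) (auto simp: symp_def)
    then show ?thesis by simp
  qed simp
qed (simp add: gpath_def)

lemma gpath_split_at:
  assumes "gpath E p" "x \<in> set p"
  obtains q r where "p = q @ x # r" "gpath E (q @ [x])" "gpath E (x # r)"
proof -
  obtain q r where "p = q @ x # r" using assms split_list by metis
  then show ?thesis using assms that[of q r]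
    by (cases "q = []"; cases "r = []") (auto simp: gpath_def successively_append_iff successively_Cons)
qed

lemma rtranclp_gpath:
  assumes "(\<lambda>a b. E a b \<and> a \<in> C \<and> b \<in> C)\<^sup>*\<^sup>* u v" "u \<in> C"
  shows "\<exists>p. gpath E p \<and> hd p = u \<and> last p = v \<and> set p \<subseteq> C"
  using assms
proof (induction rule: rtranclp_induct)
  case base then show ?case by (intro exI[of _ "[u]"]) auto
next
  case (step y z)
  then obtain p where p: "gpath E p" "hd p = u" "last p = y" "set p \<subseteq> C" by auto
  show ?case
  proof (cases "z \<in> set p")
    case True
    \<comment> \<open>The walk returns to the path, which is cut back to \<open>z\<close>.\<close>
    then obtain q r where qr: "p = q @ z # r" "gpath E (q @ [z])" by (rule gpath_split_at[OF p(1)])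
    then show ?thesis using p by (intro exI[of _ "q @ [z]"]) (cases q, auto)
  next
    case False
    have "p \<noteq> []" using p by (auto simp: gpath_def)
    then show ?thesis using False p step by (intro exI[of _ "p @ [z]"]) (auto simp: gpath_append)
  qed
qed

lemma conn_gpath:
  assumes "conn E C" "u \<in> C" "v \<in> C"
  obtains p where "gpath E p" "hd p = u" "last p = v" "set p \<subseteq> C"
proof -
  have "(\<lambda>a b. E a b \<and> a \<in> C \<and> b \<in> C)\<^sup>*\<^sup>* u v" using assms by (simp add: conn_def)
  from rtranclp_gpath[OF this assms(2)] that show thesis by blast
qed

section \<open>The Tutte-Berge formula\<close>

text \<open>A matching is encoded as an involution that fixes the uncovered vertices.\<close>

definition matching :: "'a set \<Rightarrow> ('a \<Rightarrow> 'a \<Rightarrow> bool) \<Rightarrow> ('a \<Rightarrow> 'a) \<Rightarrow> bool" where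
  "matching V E m \<longleftrightarrow> (\<forall>v. m (m v) = v) \<and> (\<forall>v. m v \<noteq> v \<longrightarrow> v \<in> V \<and> E v (m v))"

definition unmatched :: "'a set \<Rightarrow> ('a \<Rightarrow> 'a) \<Rightarrow> 'a set" where
  "unmatched V m = {v \<in> V. m v = v}"

definition max_matching :: "'a set \<Rightarrow> ('a \<Rightarrow> 'a \<Rightarrow> bool) \<Rightarrow> ('a \<Rightarrow> 'a) \<Rightarrow> bool" where
  "max_matching V E m \<longleftrightarrow> matching V E m \<and>
     (\<forall>m'. matching V E m' \<longrightarrow> card (unmatched V m) \<le> card (unmatched V m'))"

lemma matching_invol: "matching V E m \<Longrightarrow> m (m v) = v"
  by (simp add: matching_def)

lemma matching_in: "matching V E m \<Longrightarrow> m v \<noteq> v \<Longrightarrow> v \<in> V \<and> m v \<in> V \<and> E v (m v)"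
  unfolding matching_def by metis

lemma matching_id: "matching V E id" by (simp add: matching_def)

lemma ex_max_matching: "\<exists>m. max_matching V E m"
  using ex_has_least_nat[of "matching V E" id "\<lambda>m. card (unmatched V m)"] matching_id
  unfolding max_matching_def by blast

lemma even_card_fixfree:
  assumes "finite S" "\<And>v. v \<in> S \<Longrightarrow> m v \<in> S \<and> m (m v) = v \<and> m v \<noteq> v"
  shows "even (card S)"
  using assms
proof (induction "card S" arbitrary: S rule: less_induct)
  case less
  show ?case
  proof (cases "S = {}")
    case False
    then obtain v where v: "v \<in> S" by auto
    have mv: "m v \<in> S" "m v \<noteq> v" "m (m v) = v" using less.prems(2)[OF v] by auto
    have c: "card S = card (S - {v, m v}) + 2"
      using card_Diff_subset[of "{v, m v}" S] v mv less.prems(1) card_mono[of S "{v, m v}"] by simp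
    have "even (card (S - {v, m v}))"
    proof (rule less.hyps)
      show "card (S - {v, m v}) < card S" using c by simp
      show "finite (S - {v, m v})" using less.prems by simp
      fix u assume u: "u \<in> S - {v, m v}"
      then have "m u \<in> S" "m (m u) = u" "m u \<noteq> u" using less.prems(2) by auto
      then show "m u \<in> S - {v, m v} \<and> m (m u) = u \<and> m u \<noteq> u" using u mv by auto
    qed
    then show ?thesis using c by simp
  qed simp
qed

text \<open>It serves to compare two involutions of one set: their numbers of fixed points have
  equal parity, so a strict gap between them is at least two.\<close>

lemma parity_unmatched:
  assumes "finite K" "\<And>v. m (m v) = v" "m ` K \<subseteq> K"
  shows "even (card {v \<in> K. m v = v} + card K)"
proof -
  have "even (card {v \<in> K. m v \<noteq> v})"
    using assms by (intro even_card_fixfree[of _ m]) auto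
  moreover have "card K = card {v \<in> K. m v = v} + card {v \<in> K. m v \<noteq> v}"
    using assms(1) by (subst card_Un_disjoint[symmetric]) (auto intro: arg_cong[of _ _ card])
  ultimately show ?thesis by simp
qed

lemma matching_image: "matching V E m \<Longrightarrow> m ` V \<subseteq> V"
  by (metis image_subsetI matching_in)

lemma matching_augment:
  assumes "symp E" "matching V E m" "m x = x" "m y = y" "x \<noteq> y" "x \<in> V" "y \<in> V" "E x y"
  shows "matching V E (m(x := y, y := x))"
    "unmatched V (m(x := y, y := x)) = unmatched V m - {x, y}"
proof -
  have "m v \<noteq> x" "m v \<noteq> y" if "v \<noteq> x" "v \<noteq> y" for v
    using assms that matching_invol by metis+
  then show "matching V E (m(x := y, y := x))"
    using assms(2-8) sympD[OF assms(1,8)] unfolding matching_def by auto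
  show "unmatched V (m(x := y, y := x)) = unmatched V m - {x, y}"
    using assms by (auto simp: unmatched_def)
qed

lemma max_matching_no_augment:
  assumes "finite V" "symp E" "max_matching V E m" "m x = x" "m y = y" "x \<noteq> y" "x \<in> V" "y \<in> V"
  shows "\<not> E x y"
proof
  assume "E x y"
  note au = matching_augment[OF assms(2) _ assms(4-8) this]
  have m: "matching V E m" using assms by (simp add: max_matching_def)
  have "card (unmatched V m) \<le> card (unmatched V m - {x, y})"
    using assms(3) au(1)[OF m] au(2)[OF m] unfolding max_matching_def by metis
  moreover have "unmatched V m - {x, y} \<subset> unmatched V m" using assms by (auto simp: unmatched_def)
  moreover have "finite (unmatched V m)" using assms by (simp add: unmatched_def)
  ultimately show False by (meson leD psubset_card_mono)
qed

text \<open>If every vertex is missed by some maximum matching, then this is an equivalence relation whose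
  classes are odd and contain at most one uncovered vertex each.\<close>

definition gallai_eq :: "'a set \<Rightarrow> ('a \<Rightarrow> 'a \<Rightarrow> bool) \<Rightarrow> 'a \<Rightarrow> 'a \<Rightarrow> bool" where
  "gallai_eq V E u v \<longleftrightarrow> u = v \<or> (\<forall>m. max_matching V E m \<longrightarrow> m u \<noteq> u \<or> m v \<noteq> v)"

text \<open>Shifting along an alternating path of length two: the uncovered place moves from
  \<open>x\<close> to the old partner of \<open>y\<close>, so the number of uncovered vertices stays
  the same.\<close>

lemma matching_exchange:
  assumes sym: "symp E" and fin: "finite V" and N: "max_matching V E N"
    and x: "x \<in> V" "N x = x" and y: "N y \<noteq> y" and Exy: "E x y"
  defines "N' \<equiv> N(x := y, y := x, N y := N y)"
  shows "max_matching V E N'"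
proof -
  let ?z = "N y"
  have mN: "matching V E N" using N by (simp add: max_matching_def)
  have inv: "N (N v) = v" for v using mN by (simp add: matching_def)
  have zx: "?z \<noteq> x" using x y inv by metis
  have xy: "x \<noteq> y" using x y by auto
  have yV: "y \<in> V" "?z \<in> V" using matching_in[OF mN y] by auto
  have nz: "N v \<noteq> x \<and> N v \<noteq> y \<and> N v \<noteq> ?z" if "v \<notin> {x,y,?z}" for v
    using that x inv by (metis insertCI)
  have "N' (N' v) = v" for v
    using nz[of v] zx xy y x inv[of y] inv[of v] unfolding N'_def by auto
  moreover have "v \<in> V \<and> E v (N' v)" if "N' v \<noteq> v" for v
  proof -
    consider "v = x" | "v = y" | "v = ?z" | "v \<notin> {x,y,?z}" by auto
    then show ?thesis
    proof cases
      case 4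
      then have "N' v = N v" by (simp add: N'_def)
      then show ?thesis using that matching_in[OF mN, of v] by simp
    qed (use that Exy sympD[OF sym Exy] x yV zx xy y in \<open>auto simp: N'_def\<close>)
  qed
  ultimately have m': "matching V E N'" by (auto simp: matching_def)
  have "unmatched V N' = insert ?z (unmatched V N - {x})"
    using nz zx xy yV y x inv unfolding unmatched_def N'_def by auto
  moreover have "?z \<notin> unmatched V N" using inv[of y] y by (auto simp: unmatched_def)
  moreover have "x \<in> unmatched V N" "finite (unmatched V N)" using x fin by (auto simp: unmatched_def)
  ultimately have "card (unmatched V N') = card (unmatched V N)"
    using card_Suc_Diff1[of "unmatched V N" x] by (simp del: card_Diff_singleton)
  then show ?thesis using m' N unfolding max_matching_def by auto
qed

text \<open>Gallai's lemma. If a maximum \<open>M\<close> missed both \<open>u\<close> and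
  \<open>v\<close>, take a maximum \<open>N\<close> that misses \<open>t\<close> and agrees with
  \<open>M\<close> as often as possible. An exchange at a vertex missed by \<open>N\<close> only,
  other than \<open>t\<close>, increases the agreement.\<close>

lemma gallai_trans:
  assumes fin: "finite V" and sym: "symp E"
    and ut: "gallai_eq V E u t" and tv: "gallai_eq V E t v"
    and tV: "t \<in> V" "u \<in> V" "v \<in> V" and tfree: "\<exists>m. max_matching V E m \<and> m t = t"
  shows "gallai_eq V E u v"
proof (rule ccontr)
  assume "\<not> gallai_eq V E u v"
  then obtain M where M: "max_matching V E M" "M u = u" "M v = v" and uv: "u \<noteq> v"
    unfolding gallai_eq_def by auto
  have tu: "t \<noteq> u" "t \<noteq> v" using M uv ut tv unfolding gallai_eq_def by metis+
  have Mt: "M t \<noteq> t" using ut M tu unfolding gallai_eq_def by metis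
  define ag where "ag N = card {w \<in> V. M w = N w}" for N
  define P where "P N \<longleftrightarrow> max_matching V E N \<and> N t = t" for N
  obtain N0 where "P N0" using tfree P_def by auto
  moreover have "\<forall>N. P N \<longrightarrow> ag N < Suc (card V)" using fin by (auto simp: ag_def less_Suc_eq_le intro: card_mono)
  ultimately obtain N where N: "P N" and Nmax: "\<And>N'. P N' \<Longrightarrow> ag N' \<le> ag N"
    using ex_has_greatest_nat[of P N0 ag "Suc (card V)"] by metis
  have mN: "max_matching V E N" "N t = t" using N by (auto simp: P_def)
  have MN: "matching V E M" "matching V E N" using M mN by (auto simp: max_matching_def)
  have Nuv: "N u \<noteq> u" "N v \<noteq> v" using ut tv mN tu unfolding gallai_eq_def by metis+
  let ?fM = "unmatched V M" and ?fN = "unmatched V N"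
  have ceq: "card ?fM = card ?fN" using M mN MN by (auto simp: max_matching_def intro!: antisym)
  have finf: "finite ?fM" "finite ?fN" using fin by (auto simp: unmatched_def)
  have "card (?fM - ?fN) = card (?fN - ?fM)"
    using ceq finf card_Diff_subset_Int[of ?fM ?fN] card_Diff_subset_Int[of ?fN ?fM] by (simp add: Int_commute)
  moreover have "card {u,v} \<le> card (?fM - ?fN)"
    by (rule card_mono) (use finf M tV Nuv in \<open>auto simp: unmatched_def\<close>)
  ultimately have "2 \<le> card (?fN - ?fM)" using uv by simp
  \<comment> \<open>\<open>u\<close> and \<open>v\<close> are missed by \<open>M\<close> only, so at
    least two vertices are missed by \<open>N\<close> only, and one of these differs from
    \<open>t\<close>.\<close>
  then have "\<not> ?fN - ?fM \<subseteq> {t}" using card_mono[of "{t}" "?fN - ?fM"] by auto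
  then obtain x where x: "x \<in> V" "N x = x" "M x \<noteq> x" "x \<noteq> t" by (auto simp: unmatched_def)
  define y where "y = M x"
  have y: "y \<in> V" "E x y" "y \<noteq> x" using matching_in[OF MN(1) x(3)] x y_def by auto
  have Ny: "N y \<noteq> y" using max_matching_no_augment[OF fin sym mN(1) x(2) _ _ x(1) y(1)] y by metis
  let ?N' = "N(x := y, y := x, N y := N y)"
  have zx: "N y \<noteq> x" "N y \<noteq> t" using x Ny mN matching_invol[OF MN(2)] by metis+
  have zM: "M (N y) \<noteq> y" using zx(1) y_def matching_invol[OF MN(1)] by metis
  have NNy: "N (N y) = y" using matching_invol[OF MN(2)] .
  have "max_matching V E ?N'" by (rule matching_exchange[OF sym fin mN(1) x(1,2) Ny y(2)])
  moreover have "?N' t = t" using mN x zx Ny by auto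
  ultimately have "ag ?N' \<le> ag N" using Nmax by (simp add: P_def)
  \<comment> \<open>The three vertices at which \<open>N\<close> changes were disagreements, and now
    \<open>x\<close> agrees.\<close>
  moreover have "ag N < ag ?N'" unfolding ag_def
  proof (rule psubset_card_mono)
    show "finite {w \<in> V. M w = ?N' w}" using fin by simp
    have "x \<in> {w \<in> V. M w = ?N' w} - {w \<in> V. M w = N w}" using x y_def zx y by auto
    moreover have "{w \<in> V. M w = N w} \<subseteq> {w \<in> V. M w = ?N' w}"
      using x y zM NNy zx matching_invol[OF MN(1), of x] y_def by auto
    ultimately show "{w \<in> V. M w = N w} \<subset> {w \<in> V. M w = ?N' w}" by blast
  qed
  ultimately show False by simp
qed

lemma parity_step: "even (a + c) \<Longrightarrow> even (b + c) \<Longrightarrow> a < b \<Longrightarrow> b = Suc d \<Longrightarrow> a + 1 \<le> (d::nat)"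
  by presburger

text \<open>The parts \<open>KK\<close> may be unions of components, which is what the induction
  produces: a vertex covered by every maximum matching goes into \<open>U\<close>, and if there is
  none, Gallai's classes are the parts and \<open>U\<close> is empty.\<close>

lemma tutte_berge:
  assumes "finite V" "symp E"
  shows "\<exists>m U KK. matching V E m \<and> U \<subseteq> V \<and> \<Union>KK = V - U \<and> disjoint KK \<and> finite KK
     \<and> (\<forall>K\<in>KK. \<forall>L\<in>KK. K \<noteq> L \<longrightarrow> (\<forall>u\<in>K. \<forall>v\<in>L. \<not> E u v))
     \<and> card (unmatched V m) + card U \<le> card {K \<in> KK. odd (card K)}"
  using assms
proof (induction "card V" arbitrary: V rule: less_induct)
  case less
  note fin = less.prems(1) and sym = less.prems(2)
  show ?case
  proof (cases "\<exists>v\<in>V. \<forall>m. max_matching V E m \<longrightarrow> m v \<noteq> v")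
    case True
    then obtain v where v: "v \<in> V" and vcov: "\<And>m. max_matching V E m \<Longrightarrow> m v \<noteq> v" by auto
    have "card (V - {v}) < card V" using v fin by (meson card_Diff1_less)
    from less.hyps[OF this] fin sym obtain m U KK where
      m: "matching (V - {v}) E m" and U: "U \<subseteq> V - {v}" "\<Union>KK = V - {v} - U" and
      KK: "disjoint KK" "finite KK" "\<forall>K\<in>KK. \<forall>L\<in>KK. K \<noteq> L \<longrightarrow> (\<forall>u\<in>K. \<forall>v\<in>L. \<not> E u v)" and
      c: "card (unmatched (V - {v}) m) + card U \<le> card {K \<in> KK. odd (card K)}"
      by auto
    have mv: "m v = v" using m by (auto simp: matching_def)
    have mV: "matching V E m" using m by (auto simp: matching_def)
    obtain M where M: "max_matching V E M" using ex_max_matching by metis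
    \<comment> \<open>As a matching of \<open>V\<close>, \<open>m\<close> misses \<open>v\<close>
      and so is not maximum. By parity a maximum one misses at least two vertices fewer; one of the
      two is made up by \<open>v\<close> itself, the other pays for \<open>v\<close> in
      \<open>U\<close>.\<close>
    have "\<not> max_matching V E m" using vcov mv by auto
    then have lt: "card (unmatched V M) < card (unmatched V m)"
      using M mV unfolding max_matching_def by (meson le_less_trans not_le)
    have fu: "finite (unmatched V m)" using fin by (simp add: unmatched_def)
    have um: "unmatched V m = insert v (unmatched (V - {v}) m)" using mv v by (auto simp: unmatched_def)
    have cm: "card (unmatched V m) = Suc (card (unmatched (V - {v}) m))"
      unfolding um using fin by (subst card_insert_disjoint) (auto simp: unmatched_def)
    have mM: "matching V E M" using M by (simp add: max_matching_def)
    have "even (card (unmatched V M) + card V)" "even (card (unmatched V m) + card V)"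
      unfolding unmatched_def
      using parity_unmatched[OF fin, of M] parity_unmatched[OF fin, of m]
        matching_image[OF mM] matching_image[OF mV] matching_invol[OF mM] matching_invol[OF mV] by auto
    then have "card (unmatched V M) + 1 \<le> card (unmatched (V - {v}) m)" using lt cm parity_step by blast
    moreover have "card (insert v U) = Suc (card U)" using U fin finite_subset
      by (metis Diff_iff card_insert_disjoint finite_Diff insertI1 subsetD)
    ultimately have "card (unmatched V M) + card (insert v U) \<le> card {K \<in> KK. odd (card K)}"
      using c by simp
    then show ?thesis using mM U KK v
      by (intro exI[of _ M] exI[of _ "insert v U"] exI[of _ KK]) auto
  next
    case False
    then have free: "\<exists>m. max_matching V E m \<and> m v = v" if "v \<in> V" for v using that by auto
    \<comment> \<open>Every vertex is missed by some maximum matching, which is the condition under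
      which \<open>gallai_trans\<close> makes the relation transitive on all of
      \<open>V\<close>.\<close>
    define R where "R = {(u,v). u \<in> V \<and> v \<in> V \<and> gallai_eq V E u v}"
    have eqR: "equiv V R"
      unfolding equiv_def
    proof (intro conjI)
      show "R \<subseteq> V \<times> V" "refl_on V R" "sym R"
        by (auto simp: R_def refl_on_def gallai_eq_def sym_def)
      show "trans R"
        using gallai_trans[OF fin sym _ _ _ _ _ free] by (auto simp: R_def trans_def)
    qed
    define KK where "KK = V // R"
    have UN: "\<Union>KK = V - {}" using Union_quotient[OF eqR] by (simp add: KK_def)
    have dis: "disjoint KK" unfolding KK_def using quotient_disj[OF eqR] by (auto simp: disjoint_def)
    have finK: "finite KK" unfolding KK_def using fin eqR by (simp add: finite_quotient equiv_def)
    have same: "R `` {w} = K" if "K \<in> KK" "w \<in> K" for K w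
      using that eqR unfolding KK_def by (metis Image_singleton_iff equiv_class_eq quotientE)
    have adj: "(u,v) \<in> R" if "u \<in> V" "v \<in> V" "E u v" for u v
      using that max_matching_no_augment[OF fin sym] unfolding R_def gallai_eq_def by blast
    have noedge: "\<forall>K\<in>KK. \<forall>L\<in>KK. K \<noteq> L \<longrightarrow> (\<forall>u\<in>K. \<forall>v\<in>L. \<not> E u v)"
    proof (intro ballI impI)
      fix K L u v assume *: "K \<in> KK" "L \<in> KK" "K \<noteq> L" "u \<in> K" "v \<in> L"
      have "u \<in> V" "v \<in> V" using * UN by auto
      then show "\<not> E u v" using adj[of u v] same * equiv_class_eq[OF eqR, of u v] by metis
    qed
    have miss1: "u = v" if "K \<in> KK" "u \<in> K" "v \<in> K" "max_matching V E m" "m u = u" "m v = v" for K u v m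
      using that same[of K u] by (auto simp: R_def gallai_eq_def)
    have mK: "m ` K \<subseteq> K" if "K \<in> KK" "max_matching V E m" for K m
    proof
      fix w assume "w \<in> m ` K"
      then obtain u where u: "u \<in> K" "w = m u" by auto
      show "w \<in> K"
      proof (cases "m u = u")
        case False
        have mm: "matching V E m" using that by (simp add: max_matching_def)
        have "(u, m u) \<in> R" using matching_in[OF mm False] adj by auto
        then show ?thesis using same[of K u] u that by auto
      qed (use u in auto)
    qed
    have finKin: "finite K" if "K \<in> KK" for K using that UN fin by (metis Diff_empty Union_upper finite_subset)
    have parK: "even (card {v \<in> K. m v = v} + card K)" if "K \<in> KK" "max_matching V E m" for K m
    proof -
      have "m (m v) = v" for v using that by (auto simp: max_matching_def matching_def)
      then show ?thesis using parity_unmatched[of K m] finKin mK that by blast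
    qed
    have le1: "card {v \<in> K. m v = v} \<le> 1" if "K \<in> KK" "max_matching V E m" for K m
    proof -
      have "\<forall>u\<in>{v \<in> K. m v = v}. \<forall>v\<in>{v \<in> K. m v = v}. u = v" using miss1 that by blast
      then show ?thesis by (metis (no_types, lifting) card_eq_0_iff card_le_Suc0_iff_eq One_nat_def finKin finite_subset that(1) mem_Collect_eq subsetI)
    qed
    have oddK: "odd (card K)" if K: "K \<in> KK" for K
    proof -
      have "K \<noteq> {}" using K eqR in_quotient_imp_non_empty KK_def by metis
      then obtain v where v: "v \<in> K" by auto
      then have "v \<in> V" using K UN by auto
      then obtain m where m: "max_matching V E m" "m v = v" using free by auto
      have "v \<in> {v \<in> K. m v = v}" using v m by simp
      then have "card {v \<in> K. m v = v} \<noteq> 0" using finKin[OF K] by (metis (no_types, lifting) card_0_eq empty_iff finite_subset mem_Collect_eq subsetI)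
      then have "card {v \<in> K. m v = v} = 1" using le1[OF K m(1)] by simp
      then show ?thesis using parK[OF K m(1)] by simp
    qed
    obtain M where M: "max_matching V E M" using ex_max_matching by metis
    have "card (unmatched V M) = card (\<Union>K\<in>KK. {v \<in> K. M v = v})"
      using UN by (intro arg_cong[of _ _ card]) (auto simp: unmatched_def)
    also have "\<dots> \<le> (\<Sum>K\<in>KK. card {v \<in> K. M v = v})" by (rule card_UN_le[OF finK])
    also have "\<dots> \<le> (\<Sum>K\<in>KK. 1)" by (intro sum_mono le1[OF _ M])
    also have "\<dots> = card {K \<in> KK. odd (card K)}" using oddK by (simp add: Collect_conv_if conj_absorb cong: conj_cong)
    finally show ?thesis using M UN dis finK noedge
      by (intro exI[of _ M] exI[of _ "{}"] exI[of _ KK]) (auto simp: max_matching_def)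
  qed
qed

section \<open>Alternating chains, and the theorems of Koenig, Hall and Menger\<close>

text \<open>A chain is a list of \<open>m\<close>-pairs; consecutive pairs are joined by \<open>m0\<close>, and \<open>m0\<close> fixes both extreme vertices.\<close>

definition alt_chain :: "('a \<Rightarrow> 'a) \<Rightarrow> ('a \<Rightarrow> 'a) \<Rightarrow> ('a \<times> 'a) list \<Rightarrow> bool" where
  "alt_chain m0 m cs \<longleftrightarrow> cs \<noteq> [] \<and> (\<forall>c\<in>set cs. m (fst c) = snd c)
     \<and> successively (\<lambda>c d. m0 (snd c) = fst d) cs
     \<and> m0 (fst (hd cs)) = fst (hd cs) \<and> m0 (snd (last cs)) = snd (last cs)
     \<and> distinct (map fst cs @ map snd cs)"

definition chain_verts :: "('a \<times> 'a) list \<Rightarrow> 'a set" where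
  "chain_verts cs = fst ` set cs \<union> snd ` set cs"

lemma alt_chain_rev:
  assumes "alt_chain m0 m cs" "\<And>v. m (m v) = v" "\<And>v. m0 (m0 v) = v"
  shows "alt_chain m0 m (map prod.swap (rev cs))"
proof -
  have f: "map fst (map prod.swap (rev cs)) = rev (map snd cs)"
          "map snd (map prod.swap (rev cs)) = rev (map fst cs)"
    by (simp_all add: rev_map comp_def)
  have s: "successively (\<lambda>c d. m0 (snd c) = fst d) (map prod.swap (rev cs))"
  proof -
    have "successively (\<lambda>c d. m0 (snd d) = fst c) (rev cs)"
      using assms(1) by (simp add: alt_chain_def)
    then show ?thesis
      unfolding successively_map by (rule successively_mono) (metis assms(3) fst_swap snd_swap)
  qed
  have ne: "cs \<noteq> []" using assms(1) by (simp add: alt_chain_def)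
  have hl: "hd (map prod.swap (rev cs)) = prod.swap (last cs)" "last (map prod.swap (rev cs)) = prod.swap (hd cs)"
    using ne by (simp_all add: hd_map hd_rev last_map last_rev)
  have "\<forall>c\<in>set (map prod.swap (rev cs)). m (fst c) = snd c"
    using assms(1,2) by (auto simp: alt_chain_def) (metis fst_conv snd_conv assms(2))
  then show ?thesis using assms(1) s ne
    unfolding alt_chain_def f hl by auto
qed

lemma chain_verts_rev: "chain_verts (map prod.swap (rev cs)) = chain_verts cs"
  unfolding chain_verts_def by force

text \<open>In the union of two matchings every component is a path or a cycle, and the surplus of
  \<open>m0\<close>-fixed vertices forces \<open>r\<close> paths with both ends fixed by
  \<open>m0\<close>. The induction follows such a path from an end \<open>a\<close>: it deletes the
  first \<open>m\<close>-pair and lets the next vertex on the path be the new end.\<close>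

lemma alternating_chains:
  assumes "finite X" "\<And>v. m (m v) = v" "\<And>v. m0 (m0 v) = v" "m ` X \<subseteq> X" "m0 ` X \<subseteq> X"
    and "card {x \<in> X. m x = x} + 2 * r \<le> card {x \<in> X. m0 x = x}"
  shows "\<exists>CS. (\<forall>i<r. alt_chain m0 m (CS i) \<and> chain_verts (CS i) \<subseteq> X)
           \<and> disjoint_family_on (\<lambda>i. chain_verts (CS i)) {..<r}"
  using assms
proof (induction "card X" arbitrary: X m0 r rule: less_induct)
  case less
  note fin = less.prems(1) and inv = less.prems(2) and inv0 = less.prems(3)
    and mX = less.prems(4) and m0X = less.prems(5) and cr = less.prems(6)
  show ?case
  proof (cases "r = 0")
    case False
    have "\<not> {x \<in> X. m0 x = x} \<subseteq> {x \<in> X. m x = x}"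
      using cr False fin card_mono[of "{x \<in> X. m x = x}" "{x \<in> X. m0 x = x}"] by auto
    then obtain a where a: "a \<in> X" "m0 a = a" "m a \<noteq> a" by auto
    define y where "y = m a"
    have y: "y \<in> X" "y \<noteq> a" "m y = a" using a mX inv by (auto simp: y_def)
    let ?X = "X - {a, y}"
    have less: "card ?X < card X"
      using a fin by (metis Diff_iff Diff_subset insertI1 psubsetI psubset_card_mono)
    have mX': "m ` ?X \<subseteq> ?X"
    proof
      fix w assume "w \<in> m ` ?X"
      then obtain v where v: "v \<in> X" "v \<noteq> a" "v \<noteq> y" "w = m v" by auto
      have "w \<noteq> a" "w \<noteq> y" using v y_def inv y by metis+
      then show "w \<in> ?X" using v mX by auto
    qed
    have fixm: "{x \<in> ?X. m x = x} = {x \<in> X. m x = x}" using a y by auto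
    show ?thesis
    proof (cases "m0 y = y")
      case True
      have m0X': "m0 ` ?X \<subseteq> ?X"
      proof
        fix w assume "w \<in> m0 ` ?X"
        then obtain v where v: "v \<in> X" "v \<noteq> a" "v \<noteq> y" "w = m0 v" by auto
        have "w \<noteq> a" "w \<noteq> y" using v a True inv0 by metis+
        then show "w \<in> ?X" using v m0X by auto
      qed
      have "{x \<in> ?X. m0 x = x} = {x \<in> X. m0 x = x} - {a, y}" by auto
      moreover have "card ({x \<in> X. m0 x = x} - {a, y}) = card {x \<in> X. m0 x = x} - 2"
        using a y True fin by (subst card_Diff_subset) auto
      ultimately have "card {x \<in> ?X. m x = x} + 2 * (r - 1) \<le> card {x \<in> ?X. m0 x = x}"
        using cr False fixm by simp
      from less.hyps[OF less _ inv inv0 mX' m0X' this] fin obtain CS where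
        CS: "\<forall>i<r - 1. alt_chain m0 m (CS i) \<and> chain_verts (CS i) \<subseteq> ?X"
          "disjoint_family_on (\<lambda>i. chain_verts (CS i)) {..<r - 1}" by auto
      define CS' where "CS' = CS(r - 1 := [(a, y)])"
      have 1: "alt_chain m0 m [(a,y)]" using a y True by (simp add: alt_chain_def y_def)
      have cv2: "chain_verts [(a,y)] = {a,y}" by (auto simp: chain_verts_def)
      have "alt_chain m0 m (CS' i) \<and> chain_verts (CS' i) \<subseteq> X" if "i < r" for i
      proof (cases "i = r - 1")
        case True then show ?thesis using 1 cv2 a y by (simp add: CS'_def)
      next
        case neq: False
        then have "i < r - 1" using that by simp
        then show ?thesis using CS(1) neq by (auto simp: CS'_def)
      qed
      moreover have "chain_verts (CS' i) \<inter> chain_verts (CS' j) = {}" if ij: "i < r" "j < r" "i \<noteq> j" for i j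
      proof -
        consider "i = r - 1" "j < r - 1" | "j = r - 1" "i < r - 1" | "i < r - 1" "j < r - 1"
          using ij by linarith
        then show ?thesis
        proof cases
          case 1 then show ?thesis using CS(1) cv2 by (auto simp: CS'_def)
        next
          case 2
          then show ?thesis using CS(1) cv2 by (auto simp: CS'_def)
        next
          case 3 then show ?thesis using CS(2) ij by (auto simp: CS'_def disjoint_family_on_def)
        qed
      qed
      ultimately show ?thesis by (intro exI[of _ CS']) (auto simp: disjoint_family_on_def)
    next
      case neq: False
      define z where "z = m0 y"
      have z: "z \<in> X" "z \<noteq> y" "m0 z = y" "z \<noteq> a"
        using neq y m0X inv0 a by (auto simp: z_def) (metis inv0)
      \<comment> \<open>The \<open>m0\<close>-pair of \<open>y\<close> and \<open>z\<close> is
        dissolved, so \<open>z\<close> becomes an end once \<open>a\<close> and \<open>y\<close> are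
        removed.\<close>
      define n0 where "n0 = m0(y := y, z := z)"
      have n0z: "n0 z = z" "n0 y = y" by (auto simp: n0_def)
      have n0o: "n0 v = m0 v" if "v \<noteq> y" "v \<noteq> z" for v using that by (simp add: n0_def)
      have m0o: "m0 v \<noteq> y" "m0 v \<noteq> z" if "v \<noteq> y" "v \<noteq> z" for v using that z inv0 z_def by metis+
      have invn: "n0 (n0 v) = v" for v using n0z n0o m0o inv0 by (cases "v = y"; cases "v = z") auto
      have n0X': "n0 ` ?X \<subseteq> ?X"
      proof
        fix w assume "w \<in> n0 ` ?X"
        then obtain v where v: "v \<in> X" "v \<noteq> a" "v \<noteq> y" "w = n0 v" by auto
        show "w \<in> ?X"
        proof (cases "v = z")
          case False
          have "w = m0 v" using v False n0o by simp
          moreover have "m0 v \<noteq> a" using v a inv0 by metis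
          ultimately show ?thesis using v m0X m0o[OF v(3) False] by auto
        qed (use v z n0z in auto)
      qed
      \<comment> \<open>\<open>z\<close> takes the place of \<open>a\<close> among the fixed
        vertices, so the surplus \<open>2 * r\<close> survives.\<close>
      have "{x \<in> ?X. n0 x = x} = insert z ({x \<in> X. m0 x = x} - {a})"
      proof -
        have "n0 x = x \<longleftrightarrow> x = z \<or> m0 x = x" if "x \<in> ?X" for x
          using n0o[of x] n0z that by (cases "x = z") auto
        then show ?thesis using z neq a by auto
      qed
      moreover have "card (insert z ({x \<in> X. m0 x = x} - {a})) = card {x \<in> X. m0 x = x}"
        using z a fin card_Suc_Diff1[of "{x \<in> X. m0 x = x}" a]
        by (subst card_insert_disjoint) auto
      ultimately have "card {x \<in> ?X. m x = x} + 2 * r \<le> card {x \<in> ?X. n0 x = x}"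
        using cr fixm by simp
      from less.hyps[OF less _ inv invn mX' n0X' this] fin obtain CS where
        CS: "\<And>i. i < r \<Longrightarrow> alt_chain n0 m (CS i)" "\<And>i. i < r \<Longrightarrow> chain_verts (CS i) \<subseteq> ?X" and
        CSd: "disjoint_family_on (\<lambda>i. chain_verts (CS i)) {..<r}" by auto
      have *: "\<exists>cs. alt_chain m0 m cs \<and> (if z \<in> chain_verts (CS i) then chain_verts cs \<subseteq> insert a (insert y (chain_verts (CS i)))
              else chain_verts cs \<subseteq> chain_verts (CS i))" if i: "i < r" for i
      proof -
        \<comment> \<open>\<open>m0\<close> and \<open>n0\<close> differ only at \<open>y\<close>
          and \<open>z\<close>, and \<open>y\<close> is not on the chain. So the chain remains one
          for \<open>m0\<close> unless \<open>z\<close> is an end, in which case it continues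
          through \<open>y\<close> to \<open>a\<close>.\<close>
        have core: "alt_chain m0 m cs \<or> (fst (hd cs) = z \<and> alt_chain m0 m ((a,y) # cs)) \<or> snd (last cs) = z"
          if c: "alt_chain n0 m cs" "chain_verts cs \<subseteq> ?X" for cs
        proof (rule ccontr)
          assume neg: "\<not> ?thesis"
          have ne: "cs \<noteq> []" using c by (simp add: alt_chain_def)
          have dist: "distinct (map fst cs @ map snd cs)" using c by (simp add: alt_chain_def)
          have ymem: "snd d \<noteq> y" "fst d \<noteq> y" "fst d \<noteq> a" "snd d \<noteq> a" if "d \<in> set cs" for d
            using c(2) that by (auto simp: chain_verts_def)
          have suc: "successively (\<lambda>c d. m0 (snd c) = fst d) cs"
          proof -
            have "successively (\<lambda>c d. n0 (snd c) = fst d) cs" using c by (simp add: alt_chain_def)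
            then show ?thesis
            proof (rule successively_mono)
              fix d e assume de: "d \<in> set cs" "e \<in> set cs" "n0 (snd d) = fst e"
              have "snd d \<noteq> z"
              proof
                assume "snd d = z"
                then have "snd d = fst e" using de n0z by simp
                then show False using dist de by (metis (no_types, lifting) disjoint_iff distinct_append image_eqI image_set)
              qed
              then show "m0 (snd d) = fst e" using de n0o ymem(1)[OF de(1)] by simp
            qed
          qed
          have hin: "hd cs \<in> set cs" "last cs \<in> set cs" using ne by auto
          have lz: "snd (last cs) \<noteq> z" using neg by auto
          then have l: "m0 (snd (last cs)) = snd (last cs)"
            using c n0o ymem[OF hin(2)] by (simp add: alt_chain_def)
          show False
          proof (cases "fst (hd cs) = z")
            case True
            have notin: "a \<notin> fst ` set cs" "a \<notin> snd ` set cs" "y \<notin> fst ` set cs" "y \<notin> snd ` set cs"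
              using ymem by blast+
            have cm: "\<forall>c\<in>set cs. m (fst c) = snd c" using c by (simp add: alt_chain_def)
            have "distinct (map fst ((a,y) # cs) @ map snd ((a,y) # cs))"
              using dist notin y(2) by auto
            moreover have "successively (\<lambda>c d. m0 (snd c) = fst d) ((a,y) # cs)"
              using suc ne True z_def by (cases cs) auto
            ultimately have "alt_chain m0 m ((a,y) # cs)"
              unfolding alt_chain_def using a y_def l ne cm by auto
            then show False using neg True by auto
          next
            case False
            then have "m0 (fst (hd cs)) = fst (hd cs)"
              using c n0o ymem[OF hin(1)] by (simp add: alt_chain_def)
            then have "alt_chain m0 m cs" using suc l dist ne c by (auto simp: alt_chain_def)
            then show False using neg by auto
          qed
        qed
        let ?c = "CS i" and ?d = "map prod.swap (rev (CS i))"
        have ne: "?c \<noteq> []" using CS(1)[OF i] by (simp add: alt_chain_def)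
        have cv: "chain_verts ((a,y) # cs) = insert a (insert y (chain_verts cs))" for cs
          by (auto simp: chain_verts_def)
        have zin: "z \<in> chain_verts ?c" if "fst (hd ?c) = z \<or> snd (last ?c) = z"
          using that ne by (auto simp: chain_verts_def)
        have hl: "hd ?d = prod.swap (last ?c)" "last ?d = prod.swap (hd ?c)"
          using ne by (simp_all add: hd_map hd_rev last_map last_rev)
        have zz: "\<not> (fst (hd ?c) = z \<and> snd (last ?c) = z)"
        proof
          assume A: "fst (hd ?c) = z \<and> snd (last ?c) = z"
          have "fst (hd ?c) \<in> set (map fst ?c)" "snd (last ?c) \<in> set (map snd ?c)" using ne by auto
          moreover have "set (map fst ?c) \<inter> set (map snd ?c) = {}"
            using CS(1)[OF i] by (simp add: alt_chain_def)
          ultimately show False using A by auto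
        qed
        consider "alt_chain m0 m ?c" | "fst (hd ?c) = z" "alt_chain m0 m ((a,y) # ?c)" | "snd (last ?c) = z"
          using core[OF CS(1)[OF i] CS(2)[OF i]] by auto
        then show ?thesis
        proof cases
          case 1 then show ?thesis by (intro exI[of _ ?c]) auto
        next
          case 2 then show ?thesis using zin by (intro exI[of _ "(a,y) # ?c"]) (auto simp: cv)
        next
          case 3
          \<comment> \<open>Reversal brings \<open>z\<close> to the front; by \<open>zz\<close> it
            is not at both ends.\<close>
          have "alt_chain n0 m ?d" using alt_chain_rev[OF CS(1)[OF i] inv invn] .
          from core[OF this] have "alt_chain m0 m ?d \<or> alt_chain m0 m ((a,y) # ?d)"
            using CS(2)[OF i] chain_verts_rev[of ?c] hl zz 3 by auto
          then show ?thesis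
          proof
            assume "alt_chain m0 m ?d"
            then show ?thesis by (intro exI[of _ ?d]) (auto simp: chain_verts_rev)
          next
            assume "alt_chain m0 m ((a,y) # ?d)"
            then show ?thesis using zin 3
              by (intro exI[of _ "(a,y) # ?d"]) (auto simp: cv chain_verts_rev)
          qed
        qed
      qed
      then obtain CS' where CS': "\<And>i. i < r \<Longrightarrow> alt_chain m0 m (CS' i)"
        "\<And>i. i < r \<Longrightarrow> (if z \<in> chain_verts (CS i) then chain_verts (CS' i) \<subseteq> insert a (insert y (chain_verts (CS i)))
              else chain_verts (CS' i) \<subseteq> chain_verts (CS i))" by metis
      have sub: "chain_verts (CS' i) \<subseteq> insert a (insert y (chain_verts (CS i)))" if "i < r" for i
        using CS'(2)[OF that] by (auto split: if_splits)
      have "chain_verts (CS' i) \<subseteq> X" if "i < r" for i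
        using sub[OF that] CS(2)[OF that] a y by auto
      moreover have "chain_verts (CS' i) \<inter> chain_verts (CS' j) = {}" if "i < r" "j < r" "i \<noteq> j" for i j
      proof -
        have d: "chain_verts (CS i) \<inter> chain_verts (CS j) = {}"
          using CSd that by (auto simp: disjoint_family_on_def)
        \<comment> \<open>Only the one chain through \<open>z\<close> can have grown, and it has
          grown by \<open>a\<close> and \<open>y\<close>, which lie on no other chain.\<close>
        then consider "z \<notin> chain_verts (CS i)" | "z \<notin> chain_verts (CS j)" by auto
        then show ?thesis
        proof cases
          case 1
          then have "chain_verts (CS' i) \<subseteq> chain_verts (CS i)" using CS'(2)[OF that(1)] by simp
          then show ?thesis using d sub[OF that(2)] CS(2)[OF that(1)] by auto
        next
          case 2
          then have "chain_verts (CS' j) \<subseteq> chain_verts (CS j)" using CS'(2)[OF that(2)] by simp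
          then show ?thesis using d sub[OF that(1)] CS(2)[OF that(2)] by auto
        qed
      qed
      ultimately show ?thesis using CS'(1)
        by (intro exI[of _ CS']) (auto simp: disjoint_family_on_def)
    qed
  qed (auto simp: disjoint_family_on_def)
qed

section \<open>Projecting alternating chains to paths\<close>

lemma alt_chain_nth:
  assumes "alt_chain m0 m cs"
  shows "i < length cs \<Longrightarrow> m (fst (cs ! i)) = snd (cs ! i)"
    "Suc i < length cs \<Longrightarrow> m0 (snd (cs ! i)) = fst (cs ! Suc i)"
    "m0 (fst (cs ! 0)) = fst (cs ! 0)" "m0 (snd (cs ! (length cs - 1))) = snd (cs ! (length cs - 1))"
    "i < length cs \<Longrightarrow> j < length cs \<Longrightarrow> fst (cs ! i) \<noteq> snd (cs ! j)"
    "i < length cs \<Longrightarrow> j < length cs \<Longrightarrow> snd (cs ! i) = snd (cs ! j) \<longleftrightarrow> i = j"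
    "i < length cs \<Longrightarrow> j < length cs \<Longrightarrow> fst (cs ! i) = fst (cs ! j) \<longleftrightarrow> i = j"
    "0 < length cs"
proof -
  have d: "distinct (map fst cs)" "distinct (map snd cs)" "fst ` set cs \<inter> snd ` set cs = {}" and ne: "cs \<noteq> []"
    using assms by (auto simp: alt_chain_def)
  show "m (fst (cs ! i)) = snd (cs ! i)" if "i < length cs" using assms that by (auto simp: alt_chain_def)
  show "m0 (snd (cs ! i)) = fst (cs ! Suc i)" if "Suc i < length cs"
    using assms that by (auto simp: alt_chain_def successively_conv_nth)
  show "m0 (fst (cs ! 0)) = fst (cs ! 0)" "m0 (snd (cs ! (length cs - 1))) = snd (cs ! (length cs - 1))"
    using assms ne by (auto simp: alt_chain_def hd_conv_nth last_conv_nth)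
  show "fst (cs ! i) \<noteq> snd (cs ! j)" if "i < length cs" "j < length cs"
    using d(3) nth_mem[OF that(1)] nth_mem[OF that(2)] by (metis IntI empty_iff imageI)
  show "snd (cs ! i) = snd (cs ! j) \<longleftrightarrow> i = j" if "i < length cs" "j < length cs"
    using d(2) that by (metis length_map nth_eq_iff_index_eq nth_map)
  show "fst (cs ! i) = fst (cs ! j) \<longleftrightarrow> i = j" if "i < length cs" "j < length cs"
    using d(1) that by (metis length_map nth_eq_iff_index_eq nth_map)
  show "0 < length cs" using ne by simp
qed

lemma image_set_nth: "x \<in> f ` set xs \<longleftrightarrow> (\<exists>i<length xs. x = f (xs ! i))"
  by (metis image_iff in_set_conv_nth)

lemma chain_verts_nth: "u \<in> chain_verts cs \<longleftrightarrow> (\<exists>i<length cs. u = fst (cs ! i) \<or> u = snd (cs ! i))"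
  unfolding chain_verts_def Un_iff image_set_nth by blast

text \<open>A chain is never left through an \<open>m0\<close>-pair; this is why disjoint chains
  keep disjoint projections when \<open>m0\<close>-pairs are identified.\<close>

lemma alt_chain_closed:
  assumes "alt_chain m0 m cs" "\<And>v. m0 (m0 v) = v" "u \<in> chain_verts cs"
  shows "m0 u \<in> chain_verts cs"
    "m0 u = u \<Longrightarrow> u = fst (cs ! 0) \<or> u = snd (cs ! (length cs - 1))"
proof -
  note nt = alt_chain_nth[OF assms(1)]
  obtain i where i: "i < length cs" "u = fst (cs ! i) \<or> u = snd (cs ! i)"
    using assms(3) by (auto simp: chain_verts_nth)
  consider "u = fst (cs ! 0)" | j where "i = Suc j" "u = fst (cs ! i)" | "u = snd (cs ! (length cs - 1))"
    | "Suc i < length cs" "u = snd (cs ! i)"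
    using i by (metis Suc_lessI diff_Suc_1 not0_implies_Suc)
  then have "m0 u \<in> chain_verts cs \<and> (m0 u = u \<longrightarrow> u = fst (cs ! 0) \<or> u = snd (cs ! (length cs - 1)))"
  proof cases
    case 1 then show ?thesis using nt(3) assms(3) by simp
  next
    case 2
    then have "m0 u = snd (cs ! j)" using nt(2)[of j] i assms(2) by metis
    moreover have "snd (cs ! j) \<in> chain_verts cs" using 2 i unfolding chain_verts_nth by (intro exI[of _ j]) auto
    ultimately show ?thesis using 2 i nt(5)[of i j] by auto
  next
    case 3 then show ?thesis using nt(4) assms(3) by simp
  next
    case 4
    then have "m0 u = fst (cs ! Suc i)" using nt(2)[of i] by simp
    moreover have "fst (cs ! Suc i) \<in> chain_verts cs" using 4 unfolding chain_verts_nth by (intro exI[of _ "Suc i"]) auto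
    ultimately show ?thesis using 4 nt(5)[of "Suc i" i] by auto
  qed
  then show "m0 u \<in> chain_verts cs" "m0 u = u \<Longrightarrow> u = fst (cs ! 0) \<or> u = snd (cs ! (length cs - 1))" by auto
qed

text \<open>The map \<open>f\<close> identifies exactly the vertices paired by \<open>m0\<close>.
  The second vertex of a pair and the first vertex of the next one thus have the same image, and the
  \<open>m\<close>-pairs become the edges of a path.\<close>

lemma chain_project:
  assumes c: "alt_chain m0 m cs" and inv: "\<And>v. m0 (m0 v) = v" and sub: "chain_verts cs \<subseteq> X"
    and f1o: "\<forall>x\<in>X. f (m0 x) = f x"
    and f2o: "\<forall>x\<in>X. \<forall>y\<in>X. f x = f y \<longrightarrow> x \<noteq> y \<longrightarrow> m0 x = y"
    and f3o: "\<forall>x\<in>X. f (m x) \<noteq> f x \<longrightarrow> E (f x) (f (m x))"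
  defines "p \<equiv> f (fst (cs ! 0)) # map (\<lambda>c. f (snd c)) cs"
  shows "gpath E p" "set p = f ` chain_verts cs" "last p = f (snd (cs ! (length cs - 1)))"
    "hd p = f (fst (cs ! 0))" "length p = Suc (length cs)" "hd p \<noteq> last p"
proof -
  note f1 = f1o[rule_format] and f2 = f2o[rule_format] and f3 = f3o[rule_format]
  note nt = alt_chain_nth[OF c]
  have inX: "fst (cs ! i) \<in> X" "snd (cs ! i) \<in> X" if "i < length cs" for i
    using sub that by (auto simp: chain_verts_nth subset_iff)
  have d0: "f (fst (cs ! 0)) \<noteq> f (snd (cs ! i))" if "i < length cs" for i
    using f2[OF inX(1)[OF nt(8)] inX(2)[OF that]] nt(3) nt(5)[OF nt(8) that] by metis
  have d1: "f (snd (cs ! i)) \<noteq> f (snd (cs ! j))" if "i < length cs" "j < length cs" "i \<noteq> j" for i j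
  proof
    assume "f (snd (cs ! i)) = f (snd (cs ! j))"
    then have e: "m0 (snd (cs ! i)) = snd (cs ! j)" using f2 inX that nt(6)[of i j] by metis
    show False
    proof (cases "Suc i < length cs")
      case True then show False using nt(2)[of i] nt(5)[of "Suc i" j] e that by simp
    next
      case False
      then have "i = length cs - 1" using that by simp
      then show False using nt(4) nt(6)[of i j] e that by simp
    qed
  qed
  have fst_eq: "f (fst (cs ! Suc i)) = f (snd (cs ! i))" if "Suc i < length cs" for i
    using nt(2)[OF that] f1[OF inX(2)[of i]] that by simp
  have "distinct (map (\<lambda>c. f (snd c)) cs)" using d1 by (auto simp: distinct_conv_nth)
  moreover have "f (fst (cs ! 0)) \<notin> set (map (\<lambda>c. f (snd c)) cs)" using d0 by (auto simp: image_set_nth)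
  ultimately have "distinct p" unfolding p_def by simp
  moreover have "successively E p"
  proof -
    have "E (p ! i) (p ! Suc i)" if "Suc i < length p" for i
    proof -
      have i: "i < length cs" using that by (simp add: p_def)
      have a: "p ! i = f (fst (cs ! i))"
      proof (cases i)
        case (Suc j) then show ?thesis using i fst_eq[of j] by (simp add: p_def)
      qed (simp add: p_def)
      have b: "p ! Suc i = f (m (fst (cs ! i)))" using i nt(1) by (simp add: p_def)
      have "f (m (fst (cs ! i))) \<noteq> f (fst (cs ! i))"
        using nt(1)[OF i] d0 d1 fst_eq i by (cases i) (metis lessI Suc_lessD n_not_Suc_n)+
      then show ?thesis using f3[OF inX(1)[OF i]] a b by simp
    qed
    then show ?thesis by (simp add: successively_conv_nth)
  qed
  ultimately show "gpath E p" by (simp add: gpath_def p_def)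
  show "set p = f ` chain_verts cs"
  proof -
    have "f (fst (cs ! i)) \<in> set p" if "i < length cs" for i
      using that fst_eq by (cases i) (auto simp: p_def)
    moreover have "f (snd (cs ! i)) \<in> set p" if "i < length cs" for i using that by (simp add: p_def)
    ultimately have "f ` chain_verts cs \<subseteq> set p" by (auto simp: chain_verts_nth)
    moreover have "set p \<subseteq> f ` chain_verts cs" unfolding p_def
      using nt(8) by (auto simp: chain_verts_def)
    ultimately show ?thesis by auto
  qed
  show l: "last p = f (snd (cs ! (length cs - 1)))" "hd p = f (fst (cs ! 0))" "length p = Suc (length cs)"
    using nt(8) by (auto simp: p_def last_map last_conv_nth)
  show "hd p \<noteq> last p" using l d0 nt(8) by simp
qed

section \<open>The theorems of Koenig and Hall\<close>

lemma twice_min_le: "n = a + b \<Longrightarrow> c = min a b \<Longrightarrow> 2 * c + (if odd n then 1 else 0) \<le> (n::nat)"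
proof (cases "odd n")
  case True
  assume *: "n = a + b" "c = min a b"
  then have "2 * c \<le> n" by (simp add: min_def)
  moreover have "2 * c \<noteq> n" using True by auto
  ultimately show ?thesis by simp
qed (simp add: min_def)

text \<open>The cover is \<open>U\<close> together with the smaller colour class of each part of the
  Tutte-Berge decomposition; an odd part saves one vertex against half its size. The last inequality
  says that the cover has at most as many vertices as the matching has edges.\<close>

lemma konig:
  assumes fin: "finite V" and sym: "symp E"
    and bip: "\<And>u v. u \<in> V \<Longrightarrow> v \<in> V \<Longrightarrow> E u v \<Longrightarrow> side u \<noteq> (side v :: bool)"
  shows "\<exists>m C. matching V E m \<and> C \<subseteq> V \<and> (\<forall>u\<in>V. \<forall>v\<in>V. E u v \<longrightarrow> u \<in> C \<or> v \<in> C)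
     \<and> 2 * card C + card (unmatched V m) \<le> card V"
proof -
  obtain m U KK where m: "matching V E m" and U: "U \<subseteq> V" "\<Union>KK = V - U" and KK: "disjoint KK" "finite KK"
    "\<forall>K\<in>KK. \<forall>L\<in>KK. K \<noteq> L \<longrightarrow> (\<forall>u\<in>K. \<forall>v\<in>L. \<not> E u v)"
    and c: "card (unmatched V m) + card U \<le> card {K \<in> KK. odd (card K)}"
    using tutte_berge[OF fin sym] by (elim exE conjE) (rule that)
  define sm where "sm K = (if card {v\<in>K. side v} \<le> card {v\<in>K. \<not> side v} then {v\<in>K. side v} else {v\<in>K. \<not> side v})" for K
  have finK: "finite K" if "K \<in> KK" for K using that U fin by (metis Diff_subset Union_upper finite_subset subset_trans)
  have smc: "2 * card (sm K) + (if odd (card K) then 1 else 0) \<le> card K" if "K \<in> KK" for K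
  proof -
    have "card K = card {v\<in>K. side v} + card {v\<in>K. \<not> side v}"
      using finK[OF that] by (subst card_Un_disjoint[symmetric]) (auto intro: arg_cong[of _ _ card])
    moreover have "card (sm K) = min (card {v\<in>K. side v}) (card {v\<in>K. \<not> side v})" by (auto simp: sm_def)
    ultimately show ?thesis by (rule twice_min_le)
  qed
  define C where "C = U \<union> (\<Union>K\<in>KK. sm K)"
  have smsub: "sm K \<subseteq> K" for K by (auto simp: sm_def)
  have cov: "u \<in> C \<or> v \<in> C" if uv: "u \<in> V" "v \<in> V" "E u v" for u v
  proof (rule ccontr)
    assume n: "\<not> (u \<in> C \<or> v \<in> C)"
    then have "u \<notin> U" "v \<notin> U" by (simp_all add: C_def)
    then have "u \<in> \<Union>KK" "v \<in> \<Union>KK" using uv(1,2) U(2) by simp_all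
    then obtain K L where KL: "K \<in> KK" "L \<in> KK" "u \<in> K" "v \<in> L" by (elim UnionE)
    then have "K = L" using KK(3) uv by auto
    then show False using bip[OF uv] KL n by (auto simp: C_def sm_def split: if_splits)
  qed
  have "card C \<le> card U + (\<Sum>K\<in>KK. card (sm K))" unfolding C_def
    using card_Un_le[of U "\<Union>K\<in>KK. sm K"] card_UN_le[OF KK(2), of sm] by linarith
  then have "2 * card C + card {K \<in> KK. odd (card K)} \<le> 2 * card U + (\<Sum>K\<in>KK. 2 * card (sm K) + (if odd (card K) then 1 else 0))"
    using KK(2) by (simp add: sum.distrib sum_distrib_left[symmetric] sum.If_cases Int_def)
  also have "\<dots> \<le> 2 * card U + (\<Sum>K\<in>KK. card K)" using smc by (intro add_left_mono sum_mono)
  also have "(\<Sum>K\<in>KK. card K) = card (V - U)"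
    using card_Union_disjoint[of KK] KK finK U by (auto simp: disjoint_def pairwise_def disjnt_def)
  also have "\<dots> = card V - card U" using U fin by (simp add: card_Diff_subset finite_subset)
  finally have "2 * card C + card {K \<in> KK. odd (card K)} \<le> 2 * card U + (card V - card U)" .
  moreover have "card U \<le> card V" using U fin by (simp add: card_mono)
  ultimately have "2 * card C + card (unmatched V m) \<le> card V" using c by linarith
  moreover have "C \<subseteq> V" unfolding C_def using U smsub by blast
  ultimately show ?thesis using m cov by blast
qed

text \<open>The deficiency form of Hall's theorem: \<open>I\<close>, the indices outside a minimum
  cover, contains every unmatched index, and the matched indices in \<open>I\<close> already use up
  all candidates of \<open>I\<close>.\<close>

lemma hall_defect:
  fixes R :: "'i set" and N :: "'i \<Rightarrow> 'a set"
  assumes fin: "finite R" "\<And>i. i \<in> R \<Longrightarrow> finite (N i)"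
  obtains R0 I f where "R0 \<subseteq> R" "I \<subseteq> R" "R - R0 \<subseteq> I" "inj_on f R0" "\<And>i. i \<in> R0 \<Longrightarrow> f i \<in> N i"
    "f ` (R0 \<inter> I) = (\<Union>i\<in>I. N i)"
proof -
  let ?M = "\<Union>i\<in>R. N i"
  define V where "V = Inl ` R \<union> Inr ` ?M"
  define E where "E u v = (case (u, v) of (Inl i, Inr b) \<Rightarrow> i \<in> R \<and> b \<in> N i | (Inr b, Inl i) \<Rightarrow> i \<in> R \<and> b \<in> N i | _ \<Rightarrow> False)" for u v
  have E1: "E (Inl i) w \<longleftrightarrow> (\<exists>b. w = Inr b \<and> i \<in> R \<and> b \<in> N i)" for i w by (cases w) (auto simp: E_def)
  have sym: "symp E" by (auto simp: symp_def E_def split: sum.splits)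
  have finM: "finite ?M" and finV: "finite V" using fin by (auto simp: V_def)
  have "isl u \<noteq> isl v" if "E u v" for u v using that by (auto simp: E_def split: sum.splits)
  then have "\<exists>m C. matching V E m \<and> C \<subseteq> V \<and> (\<forall>u\<in>V. \<forall>v\<in>V. E u v \<longrightarrow> u \<in> C \<or> v \<in> C)
     \<and> 2 * card C + card (unmatched V m) \<le> card V" by (intro konig[OF finV sym, of isl])
  then
  obtain m C where m: "matching V E m" and C: "C \<subseteq> V" and C2: "\<forall>u\<in>V. \<forall>v\<in>V. E u v \<longrightarrow> u \<in> C \<or> v \<in> C"
    and c: "2 * card C + card (unmatched V m) \<le> card V"
    by (elim exE conjE) (rule that)
  define R0 where "R0 = {i \<in> R. m (Inl i) \<noteq> Inl i}"
  define f where "f i = projr (m (Inl i))" for i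
  define I where "I = {i \<in> R. Inl i \<notin> C}"
  have mf: "m (Inl i) = Inr (f i) \<and> f i \<in> N i" if "i \<in> R0" for i
    using matching_in[OF m, of "Inl i"] that E1 by (auto simp: R0_def f_def)
  have inj: "inj_on f R0" by (rule inj_onI) (metis mf matching_invol[OF m] sum.inject(1))
  define Cr where "Cr = {b \<in> ?M. Inr b \<in> C}"
  have cC: "card C = card (R - I) + card Cr"
  proof -
    have "x \<in> C \<longleftrightarrow> x \<in> Inl ` (R - I) \<union> Inr ` Cr" for x
      using C by (cases x) (auto simp: I_def Cr_def V_def)
    then have "C = Inl ` (R - I) \<union> Inr ` Cr" by blast
    moreover have "finite Cr" using finM by (rule rev_finite_subset) (auto simp: Cr_def)
    moreover have "card (Inl ` (R - I) \<union> Inr ` Cr) = card (Inl ` (R - I) :: ('i + 'a) set) + card (Inr ` Cr :: ('i + 'a) set)"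
      by (rule card_Un_disjoint) (use fin calculation in auto)
    ultimately show ?thesis by (simp add: card_image)
  qed
  have Y: "(\<Union>i\<in>I. N i) \<subseteq> Cr"
  proof
    fix b assume "b \<in> (\<Union>i\<in>I. N i)"
    then obtain i where i: "i \<in> I" "b \<in> N i" by auto
    then show "b \<in> Cr" using C2[rule_format, of "Inl i" "Inr b"] by (auto simp: I_def Cr_def V_def E1)
  qed
  have cV: "card V - card (unmatched V m) \<le> 2 * card R0"
  proof -
    have "V - unmatched V m \<subseteq> Inl ` R0 \<union> Inr ` f ` R0"
    proof
      fix w assume w: "w \<in> V - unmatched V m"
      then have mw: "m w \<noteq> w" "m w \<in> V" "E w (m w)" using matching_in[OF m] by (auto simp: unmatched_def)
      show "w \<in> Inl ` R0 \<union> Inr ` f ` R0"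
      proof (cases w)
        case (Inl i) then show ?thesis using w by (auto simp: R0_def unmatched_def V_def)
      next
        case (Inr b)
        then obtain i where i: "m w = Inl i" "i \<in> R" using mw by (auto simp: E_def split: sum.splits)
        then have "m (Inl i) = w" using matching_invol[OF m, of w] by simp
        then have "i \<in> R0" "f i = b" using i Inr by (auto simp: R0_def f_def)
        then show ?thesis using Inr by auto
      qed
    qed
    then have "card (V - unmatched V m) \<le> card (Inl ` R0 \<union> Inr ` f ` R0)"
      by (rule card_mono[rotated]) (use fin in \<open>simp add: R0_def\<close>)
    also have "\<dots> \<le> card R0 + card R0"
      using fin by (intro order.trans[OF card_Un_le] add_mono order.trans[OF card_image_le])
        (auto simp: R0_def intro: card_image_le)
    finally show ?thesis using finV by (subst (asm) card_Diff_subset) (auto simp: unmatched_def)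
  qed
  \<comment> \<open>The cover is no larger than the matching, while every matched index needs a
    cover vertex of its own; so the inclusions \<open>s1\<close>, \<open>Y\<close> and
    \<open>s2\<close> are equalities.\<close>
  have "card C \<le> card R0" using cV c by linarith
  moreover have "card R0 = card (R0 - I) + card (R0 \<inter> I)"
    using fin by (subst card_Un_disjoint[symmetric]) (auto simp: R0_def intro!: arg_cong[of _ _ card])
  moreover have s1: "f ` (R0 \<inter> I) \<subseteq> (\<Union>i\<in>I. N i)" using mf by auto
  moreover have ci: "card (f ` (R0 \<inter> I)) = card (R0 \<inter> I)" using inj by (intro card_image) (auto simp: inj_on_def)
  moreover have s2: "R0 - I \<subseteq> R - I" by (auto simp: R0_def)
  moreover have "card (R0 - I) \<le> card (R - I)" using s2 fin by (intro card_mono) auto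
  moreover have finY: "finite Cr" using finM by (rule rev_finite_subset) (auto simp: Cr_def)
  moreover have "card (f ` (R0 \<inter> I)) \<le> card Cr" using s1 Y finY by (intro card_mono) auto
  ultimately have "card (R0 - I) = card (R - I)" "card (f ` (R0 \<inter> I)) = card Cr" using cC by linarith+
  note e = this
  have e1: "R0 - I = R - I" by (rule card_subset_eq[OF _ s2 e(1)]) (use fin in simp)
  have e2: "f ` (R0 \<inter> I) = Cr" by (rule card_subset_eq[OF finY _ e(2)]) (rule subset_trans[OF s1 Y])
  show thesis
  proof (rule that[of R0 I f])
    show "R0 \<subseteq> R" "I \<subseteq> R" by (auto simp: R0_def I_def)
    show "R - R0 \<subseteq> I" using e1 by blast
    show "inj_on f R0" by (rule inj)
    show "\<And>i. i \<in> R0 \<Longrightarrow> f i \<in> N i" using mf by blast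
    show "f ` (R0 \<inter> I) = (\<Union>i\<in>I. N i)" using s1 Y e2 by blast
  qed
qed

section \<open>Menger's theorem\<close>

lemma gpath_trim:
  assumes "gpath E p" "hd p \<in> A" "last p \<in> B"
  shows "\<exists>q. gpath E q \<and> set q \<subseteq> set p \<and> hd q \<in> A \<and> last q \<in> B \<and> set q \<inter> A = {hd q} \<and> set q \<inter> B = {last q}"
  using assms
proof (induction "length p" arbitrary: p rule: less_induct)
  case less
  have ne: "p \<noteq> []" using less.prems by (simp add: gpath_def)
  have self: "hd p \<in> set p" "last p \<in> set p" using ne by auto
  show ?case
  proof (cases "set p \<inter> A = {hd p} \<and> set p \<inter> B = {last p}")
    case False
    then consider x where "x \<in> set p" "x \<in> A" "x \<noteq> hd p" | x where "x \<in> set p" "x \<in> B" "x \<noteq> last p"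
      using less.prems self by blast
    then show ?thesis
    proof cases
      case 1
      obtain q r where qr: "p = q @ x # r" "gpath E (x # r)" using gpath_split_at[OF less.prems(1) 1(1)] by metis
      have "q \<noteq> []" using 1 qr by auto
      then have "length (x # r) < length p" "last (x # r) = last p" using qr by auto
      from less.hyps[OF this(1) qr(2)] 1 less.prems this(2) obtain s where
        "gpath E s \<and> set s \<subseteq> set (x # r) \<and> hd s \<in> A \<and> last s \<in> B \<and> set s \<inter> A = {hd s} \<and> set s \<inter> B = {last s}" by auto
      then show ?thesis using qr(1) by (intro exI[of _ s]) auto
    next
      case 2
      obtain q r where qr: "p = q @ x # r" "gpath E (q @ [x])" using gpath_split_at[OF less.prems(1) 2(1)] by metis
      have "r \<noteq> []" using 2 qr by auto
      then have "length (q @ [x]) < length p" "hd (q @ [x]) = hd p" using qr by (auto simp: hd_append)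
      from less.hyps[OF this(1) qr(2)] 2 less.prems this(2) obtain s where
        "gpath E s \<and> set s \<subseteq> set (q @ [x]) \<and> hd s \<in> A \<and> last s \<in> B \<and> set s \<inter> A = {hd s} \<and> set s \<inter> B = {last s}" by auto
      then show ?thesis using qr(1) by (intro exI[of _ s]) auto
    qed
  qed (use less.prems in blast)
qed

lemma chains_project_disjoint:
  assumes "alt_chain m0 m cs" "alt_chain m0 m cs'" "\<And>v. m0 (m0 v) = v"
    and "chain_verts cs \<subseteq> X" "chain_verts cs' \<subseteq> X" "chain_verts cs \<inter> chain_verts cs' = {}"
    and f2: "\<forall>x\<in>X. \<forall>y\<in>X. f x = f y \<longrightarrow> x \<noteq> y \<longrightarrow> m0 x = y"
  shows "f ` chain_verts cs \<inter> f ` chain_verts cs' = {}"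
proof (rule ccontr)
  assume "\<not> ?thesis"
  then obtain u v where uv: "u \<in> chain_verts cs" "v \<in> chain_verts cs'" "f u = f v" by auto
  then have "u \<noteq> v" using assms(6) by auto
  then have "m0 u = v" using f2 uv assms(4,5) by blast
  then show False using alt_chain_closed(1)[OF assms(1,3) uv(1)] uv assms(6) by auto
qed

text \<open>Split every vertex outside \<open>A \<union> B\<close> into two copies, matched by \<open>m0\<close>. The chains between \<open>m0\<close> and
  a maximum matching project to disjoint paths, and a minimum vertex cover projects to a separator.\<close>

lemma menger_disjoint:
  fixes E :: "'a \<Rightarrow> 'a \<Rightarrow> bool"
  assumes fin: "finite V" and sym: "symp E" and AB: "A \<subseteq> V" "B \<subseteq> V" "A \<inter> B = {}"
    and sepn: "\<And>X. X \<subseteq> V \<Longrightarrow> (\<And>p. gpath E p \<Longrightarrow> set p \<subseteq> V \<Longrightarrow> hd p \<in> A \<Longrightarrow> last p \<in> B \<Longrightarrow> set p \<inter> X \<noteq> {})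
       \<Longrightarrow> n \<le> card X"
  shows "\<exists>P. (\<forall>i<n. gpath E (P i) \<and> set (P i) \<subseteq> V \<and> hd (P i) \<in> A \<and> last (P i) \<in> B) \<and>
     disjoint_family_on (\<lambda>i. set (P i)) {..<n}"
proof -
  define VV where "VV = (V - B) \<times> {True} \<union> (V - A) \<times> {False}"
  define EE where "EE x y \<longleftrightarrow> snd x \<noteq> snd y \<and> (fst x = fst y \<or> E (fst x) (fst y))" for x y :: "'a \<times> bool"
  define I where "I = V - A - B"
  define m0 where "m0 x = (if fst x \<in> I then (fst x, \<not> snd x) else x)" for x :: "'a \<times> bool"
  have finVV: "finite VV" using fin by (simp add: VV_def)
  have symEE: "symp EE" using sym by (auto simp: symp_def EE_def)
  have "\<exists>m C. matching VV EE m \<and> C \<subseteq> VV \<and> (\<forall>u\<in>VV. \<forall>v\<in>VV. EE u v \<longrightarrow> u \<in> C \<or> v \<in> C)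
     \<and> 2 * card C + card (unmatched VV m) \<le> card VV"
    by (rule konig[OF finVV symEE, of snd]) (simp add: EE_def)
  then obtain m C where m: "matching VV EE m" and C: "C \<subseteq> VV" and Cc: "\<forall>u\<in>VV. \<forall>v\<in>VV. EE u v \<longrightarrow> u \<in> C \<or> v \<in> C"
    and c: "2 * card C + card (unmatched VV m) \<le> card VV" by (elim exE conjE) (rule that)
  define CT where "CT = {v. (v, True) \<in> C}"
  define CF where "CF = {v. (v, False) \<in> C}"
  have sub: "CT \<subseteq> V - B" "CF \<subseteq> V - A" using C by (auto simp: CT_def CF_def VV_def)
  have finC: "finite CT" "finite CF" using sub fin finite_subset by blast+
  \<comment> \<open>The places where the cover blocks a passing path: inner vertices with both
    copies covered, and covered vertices of \<open>A\<close> and \<open>B\<close>.\<close>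
  define X where "X = (CT \<inter> CF \<inter> I) \<union> (CT \<inter> A) \<union> (CF \<inter> B)"
  have "n \<le> card X"
  proof (rule sepn)
    show "X \<subseteq> V" using AB by (auto simp: X_def I_def)
    fix p assume p: "gpath E p" "set p \<subseteq> V" "hd p \<in> A" "last p \<in> B"
    from gpath_trim[OF p(1,3,4)] obtain q where q: "gpath E q" "set q \<subseteq> set p" "hd q \<in> A" "last q \<in> B"
      "set q \<inter> A = {hd q}" "set q \<inter> B = {last q}" by auto
    show "set p \<inter> X \<noteq> {}"
    proof
      assume "set p \<inter> X = {}"
      then have qX: "set q \<inter> X = {}" using q by auto
      have nX: "w \<notin> X" if "w \<in> set q" for w using qX that by blast
      have qV: "q ! i \<in> V" if "i < length q" for i using q(2) p(2) that nth_mem by blast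
      have ne: "q \<noteq> []" using q by (simp add: gpath_def)
      have hl: "hd q = q ! 0" "last q = q ! (length q - 1)" using ne by (auto simp: hd_conv_nth last_conv_nth)
      have dist: "distinct q" using q by (simp add: gpath_def)
      have edge: "E (q ! i) (q ! Suc i)" if "Suc i < length q" for i
        using q(1) that by (auto simp: gpath_def successively_conv_nth)
      have inA: "q ! i \<in> A \<longleftrightarrow> i = 0" if "i < length q" for i
        using q(3,5) that hl dist nth_eq_iff_index_eq[OF dist that, of 0] by (metis IntI length_greater_0_conv ne nth_mem singletonD)
      have inB: "q ! i \<in> B \<longleftrightarrow> i = length q - 1" if "i < length q" for i
        using q(4,6) that hl dist nth_eq_iff_index_eq[OF dist that, of "length q - 1"]
        by (metis IntI diff_less length_greater_0_conv less_numeral_extra(1) ne nth_mem singletonD)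
      have step: "q ! Suc i \<in> CF" if "Suc i < length q" "q ! i \<notin> CT" for i
      proof -
        have "(q ! i, True) \<in> VV" "(q ! Suc i, False) \<in> VV"
          using qV[of i] qV[of "Suc i"] that inA[of "Suc i"] inB[of i] by (auto simp: VV_def)
        moreover have "EE (q ! i, True) (q ! Suc i, False)" using edge that by (simp add: EE_def)
        ultimately show ?thesis using Cc that(2) by (auto simp: CT_def CF_def)
      qed
      \<comment> \<open>A path that avoids \<open>X\<close> would carry covered \<open>False\<close>
        copies along to its last vertex, because an inner vertex with both copies covered lies in
        \<open>X\<close>.\<close>
      have "q ! i \<in> CF" if "0 < i" "i < length q" for i
        using that
      proof (induction i)
        case (Suc i)
        show ?case
        proof (rule step[OF Suc.prems(2)])
          show "q ! i \<notin> CT"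
          proof (cases "i = 0")
            case True then show ?thesis using nX[of "q ! 0"] inA[of 0] Suc.prems ne by (auto simp: X_def)
          next
            case False
            then have "q ! i \<in> CF" using Suc by simp
            moreover have "q ! i \<in> I" using inA[of i] inB[of i] qV[of i] Suc.prems False by (auto simp: I_def)
            ultimately show ?thesis using nX[of "q ! i"] Suc.prems by (auto simp: X_def)
          qed
        qed
      qed simp
      moreover have "0 < length q - 1" using q(3,4) AB(3) hl ne by (metis IntI empty_iff gr0I)
      ultimately have "last q \<in> CF" using hl by auto
      then show False using q(4) nX[of "last q"] ne by (auto simp: X_def)
    qed
  qed
  moreover have "card X = card (CT \<inter> CF \<inter> I) + card (CT \<inter> A) + card (CF \<inter> B)"
    unfolding X_def using finC AB(3) by (subst card_Un_disjoint; (subst card_Un_disjoint)?) (auto simp: I_def)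
  moreover have cC: "card C = card CT + card CF"
  proof -
    have "C = CT \<times> {True} \<union> CF \<times> {False}"
    proof (intro set_eqI)
      fix x show "x \<in> C \<longleftrightarrow> x \<in> CT \<times> {True} \<union> CF \<times> {False}" by (cases x; cases "snd x") (auto simp: CT_def CF_def)
    qed
    then show ?thesis using finC by (simp add: card_Un_disjoint card_cartesian_product Int_def)
  qed
  moreover have "card CT = card (CT \<inter> I) + card (CT \<inter> A)"
    using sub finC AB(3) by (subst card_Un_disjoint[symmetric]) (auto simp: I_def intro!: arg_cong[of _ _ card])
  moreover have "card CF = card (CF \<inter> I) + card (CF \<inter> B)"
    using sub finC AB(3) by (subst card_Un_disjoint[symmetric]) (auto simp: I_def intro!: arg_cong[of _ _ card])
  moreover have "card (CT \<inter> I) + card (CF \<inter> I) = card I + card (CT \<inter> CF \<inter> I)"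
  proof -
    \<comment> \<open>The two copies of an inner vertex are adjacent, so the cover contains one of
      them.\<close>
    have "I \<subseteq> CT \<union> CF"
    proof
      fix v assume v: "v \<in> I"
      then have "(v, True) \<in> VV" "(v, False) \<in> VV" by (auto simp: I_def VV_def)
      moreover have "EE (v, True) (v, False)" by (simp add: EE_def)
      ultimately show "v \<in> CT \<union> CF" using Cc by (auto simp: CT_def CF_def)
    qed
    then have "(CT \<inter> I) \<union> (CF \<inter> I) = I" "(CT \<inter> I) \<inter> (CF \<inter> I) = CT \<inter> CF \<inter> I" by auto
    then show ?thesis using card_Un_Int[of "CT \<inter> I" "CF \<inter> I"] finC by simp
  qed
  moreover have "card VV = 2 * card I + card A + card B"
  proof -
    have "card VV = card (V - B) + card (V - A)" unfolding VV_def using fin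
      by (subst card_Un_disjoint) (auto simp: card_cartesian_product)
    moreover have "V - B = I \<union> A" "V - A = I \<union> B" "I \<inter> A = {}" "I \<inter> B = {}" using AB by (auto simp: I_def)
    moreover have "finite I" "finite A" "finite B" using fin AB finite_subset by (auto simp: I_def)
    ultimately show ?thesis by (simp add: card_Un_disjoint)
  qed
  moreover have "card {x \<in> VV. m0 x = x} = card A + card B"
  proof -
    have "{x \<in> VV. m0 x = x} = A \<times> {True} \<union> B \<times> {False}"
      using AB by (auto simp: VV_def m0_def I_def split: if_splits)
    moreover have "finite A" "finite B" using fin AB finite_subset by blast+
    ultimately show ?thesis by (simp add: card_Un_disjoint card_cartesian_product Int_def)
  qed
  ultimately have cnt: "card {x \<in> VV. m x = x} + 2 * n \<le> card {x \<in> VV. m0 x = x}"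
    using c unfolding unmatched_def by linarith
  have inv0: "m0 (m0 v) = v" for v by (simp add: m0_def)
  have m0V: "m0 ` VV \<subseteq> VV" by (auto simp: VV_def m0_def I_def)
  obtain CS where CS: "\<forall>i<n. alt_chain m0 m (CS i) \<and> chain_verts (CS i) \<subseteq> VV"
    and CSd: "disjoint_family_on (\<lambda>i. chain_verts (CS i)) {..<n}"
    using alternating_chains[OF finVV matching_invol[OF m] inv0 matching_image[OF m] m0V cnt] by auto
  have f1: "\<forall>x\<in>VV. fst (m0 x) = fst x" by (simp add: m0_def)
  have f2: "\<forall>x\<in>VV. \<forall>y\<in>VV. fst x = fst y \<longrightarrow> x \<noteq> y \<longrightarrow> m0 x = y"
    by (auto simp: VV_def m0_def I_def)
  have f3: "\<forall>x\<in>VV. fst (m x) \<noteq> fst x \<longrightarrow> E (fst x) (fst (m x))"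
  proof (intro ballI impI)
    fix x assume that: "x \<in> VV" "fst (m x) \<noteq> fst x"
    then have "m x \<noteq> x" by auto
    then show "E (fst x) (fst (m x))" using matching_in[OF m, of x] that by (auto simp: EE_def)
  qed
  have path: "\<exists>p. gpath E p \<and> set p = fst ` chain_verts cs \<and> hd p \<in> A \<and> last p \<in> B"
    if cs: "alt_chain m0 m cs" "chain_verts cs \<subseteq> VV" for cs
  proof -
    note nt = alt_chain_nth[OF cs(1)]
    note pr = chain_project[OF cs(1) inv0 cs(2) f1 f2 f3]
    let ?p = "fst (fst (cs ! 0)) # map (\<lambda>c. fst (snd c)) cs"
    have inVV: "fst (cs ! i) \<in> VV" "snd (cs ! i) \<in> VV" if "i < length cs" for i
      using subsetD[OF cs(2)] that unfolding chain_verts_nth by blast+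
    have flip: "snd (snd (cs ! i)) \<noteq> snd (fst (cs ! i))" if "i < length cs" for i
    proof -
      have "m (fst (cs ! i)) \<noteq> fst (cs ! i)" using nt(1)[OF that] nt(5)[OF that that] by metis
      then show ?thesis using matching_in[OF m] nt(1)[OF that] by (auto simp: EE_def)
    qed
    \<comment> \<open>Along a chain both \<open>m\<close> and \<open>m0\<close> change the layer, so
      all \<open>m\<close>-pairs lead from one fixed layer to the other. The vertices fixed by
      \<open>m0\<close> are those of \<open>A\<close> in layer \<open>True\<close> and those of
      \<open>B\<close> in layer \<open>False\<close>; hence the two ends lie on different
      sides.\<close>
    have lay: "snd (fst (cs ! i)) = snd (fst (cs ! 0))" if "i < length cs" for i
      using that
    proof (induction i)
      case (Suc i)
      have "m0 (snd (cs ! i)) = fst (cs ! Suc i)" "fst (cs ! Suc i) \<noteq> snd (cs ! i)"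
        using nt(2)[OF Suc.prems] nt(5)[of "Suc i" i] Suc.prems by auto
      moreover have "snd (m0 x) \<noteq> snd x" if "m0 x \<noteq> x" for x using that by (cases "fst x \<in> I") (simp_all add: m0_def)
      ultimately have "snd (fst (cs ! Suc i)) \<noteq> snd (snd (cs ! i))" by metis
      then show ?case using flip[of i] Suc by auto
    qed simp
    let ?s = "fst (cs ! 0)" and ?e = "snd (cs ! (length cs - 1))"
    have "snd ?e \<noteq> snd ?s" using flip[of "length cs - 1"] lay[of "length cs - 1"] nt(8) by auto
    moreover have "?s \<in> VV" "?e \<in> VV" "m0 ?s = ?s" "m0 ?e = ?e" using nt inVV by auto
    ultimately have ends: "fst ?s \<in> A \<and> fst ?e \<in> B \<or> fst ?s \<in> B \<and> fst ?e \<in> A"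
      by (auto simp: VV_def m0_def I_def split: if_splits)
    show ?thesis
    proof (cases "fst ?s \<in> A \<and> fst ?e \<in> B")
      case True
      then have "hd ?p \<in> A" "last ?p \<in> B" unfolding pr(3,4) by blast+
      then show ?thesis using pr(1,2) by blast
    next
      case False
      have *: "hd (rev ?p) = last ?p" "last (rev ?p) = hd ?p" by (simp_all only: hd_rev last_rev)
      have "hd (rev ?p) \<in> A" "last (rev ?p) \<in> B"
        unfolding * pr(3,4) using ends False by blast+
      moreover have "gpath E (rev ?p)" using gpath_rev[OF sym] pr(1) by blast
      moreover have "set (rev ?p) = fst ` chain_verts cs" unfolding set_rev by (rule pr(2))
      ultimately show ?thesis by blast
    qed
  qed
  then have "\<forall>i<n. \<exists>p. gpath E p \<and> set p = fst ` chain_verts (CS i) \<and> hd p \<in> A \<and> last p \<in> B"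
    using CS by blast
  then obtain P where P: "\<And>i. i < n \<Longrightarrow> gpath E (P i) \<and> set (P i) = fst ` chain_verts (CS i) \<and> hd (P i) \<in> A \<and> last (P i) \<in> B"
    by metis
  have "set (P i) \<subseteq> V" if "i < n" for i
  proof -
    have "fst ` chain_verts (CS i) \<subseteq> fst ` VV" using CS that by (intro image_mono) blast
    then show ?thesis using P[OF that] by (auto simp: VV_def)
  qed
  moreover have "set (P i) \<inter> set (P j) = {}" if "i < n" "j < n" "i \<noteq> j" for i j
    using chains_project_disjoint[of m0 m "CS i" "CS j" VV fst] CS CSd that inv0 f2 P
    by (auto simp: disjoint_family_on_def)
  ultimately show ?thesis using P by (intro exI[of _ P]) (auto simp: disjoint_family_on_def)
qed

text \<open>Each vertex of \<open>A \<inter> B\<close> is a path by itself; the other paths come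
  from the disjoint case outside \<open>A \<inter> B\<close>, and all are trimmed at the
  end.\<close>

lemma menger:
  fixes E :: "'a \<Rightarrow> 'a \<Rightarrow> bool"
  assumes fin: "finite V" and sym: "symp E" and AB: "A \<subseteq> V" "B \<subseteq> V"
    and sepn: "\<And>X. X \<subseteq> V \<Longrightarrow> (\<And>p. gpath E p \<Longrightarrow> set p \<subseteq> V \<Longrightarrow> hd p \<in> A \<Longrightarrow> last p \<in> B \<Longrightarrow> set p \<inter> X \<noteq> {})
       \<Longrightarrow> n \<le> card X"
  shows "\<exists>P. (\<forall>i<n. gpath E (P i) \<and> set (P i) \<subseteq> V \<and> hd (P i) \<in> A \<and> last (P i) \<in> B \<and>
       set (P i) \<inter> A = {hd (P i)} \<and> set (P i) \<inter> B = {last (P i)}) \<and>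
     disjoint_family_on (\<lambda>i. set (P i)) {..<n}"
proof -
  let ?Z = "A \<inter> B"
  have finZ: "finite ?Z" using fin AB finite_subset by blast
  obtain e where e: "bij_betw e {..<card ?Z} ?Z"
    using finZ by (metis atLeast0LessThan ex_bij_betw_nat_finite)
  \<comment> \<open>Truncated subtraction: if \<open>A \<inter> B\<close> has at least
    \<open>n\<close> vertices, the one-vertex paths are enough.\<close>
  define r where "r = n - card ?Z"
  have "\<exists>P. (\<forall>i<r. gpath E (P i) \<and> set (P i) \<subseteq> V - ?Z \<and> hd (P i) \<in> A - B \<and> last (P i) \<in> B - A) \<and>
     disjoint_family_on (\<lambda>i. set (P i)) {..<r}"
  proof (rule menger_disjoint)
    show "finite (V - ?Z)" "symp E" using fin sym by auto
    show "A - B \<subseteq> V - ?Z" "B - A \<subseteq> V - ?Z" "(A - B) \<inter> (B - A) = {}" using AB by auto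
    fix X assume X: "X \<subseteq> V - ?Z" and s: "\<And>p. gpath E p \<Longrightarrow> set p \<subseteq> V - ?Z \<Longrightarrow> hd p \<in> A - B \<Longrightarrow> last p \<in> B - A \<Longrightarrow> set p \<inter> X \<noteq> {}"
    have "n \<le> card (X \<union> ?Z)"
    proof (rule sepn)
      show "X \<union> ?Z \<subseteq> V" using X AB by auto
      fix p assume p: "gpath E p" "set p \<subseteq> V" "hd p \<in> A" "last p \<in> B"
      show "set p \<inter> (X \<union> ?Z) \<noteq> {}"
      proof (cases "set p \<inter> ?Z = {}")
        case True
        have "hd p \<in> set p" "last p \<in> set p" using p by (auto simp: gpath_def)
        then have "hd p \<in> A - B" "last p \<in> B - A" "set p \<subseteq> V - ?Z" using p True by auto
        then show ?thesis using s p by blast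
      qed auto
    qed
    also have "\<dots> \<le> card X + card ?Z" by (rule card_Un_le)
    finally show "r \<le> card X" by (simp add: r_def)
  qed
  then obtain P where P: "\<And>i. i < r \<Longrightarrow> gpath E (P i) \<and> set (P i) \<subseteq> V - ?Z \<and> hd (P i) \<in> A - B \<and> last (P i) \<in> B - A"
    and Pd: "disjoint_family_on (\<lambda>i. set (P i)) {..<r}" by auto
  define Q where "Q i = (if i < r then P i else [e (i - r)])" for i
  have ei: "e (i - r) \<in> ?Z" if "i < n" "\<not> i < r" for i
    using that e by (auto simp: r_def bij_betw_def intro: imageI)
  have Q: "gpath E (Q i) \<and> set (Q i) \<subseteq> V \<and> hd (Q i) \<in> A \<and> last (Q i) \<in> B" if "i < n" for i
    using P[of i] ei[OF that] AB by (auto simp: Q_def)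
  have Qd: "set (Q i) \<inter> set (Q j) = {}" if "i < n" "j < n" "i \<noteq> j" for i j
  proof -
    consider "i < r" "j < r" | "i < r" "\<not> j < r" | "\<not> i < r" "j < r" | "\<not> i < r" "\<not> j < r" by blast
    then show ?thesis
    proof cases
      case 1 then show ?thesis using Pd that by (auto simp: Q_def disjoint_family_on_def)
    next
      case 2 then show ?thesis using P[of i] ei[of j] that by (auto simp: Q_def)
    next
      case 3 then show ?thesis using P[of j] ei[of i] that by (auto simp: Q_def)
    next
      case 4
      then have "i - r < card ?Z" "j - r < card ?Z" "i - r \<noteq> j - r" using that by (auto simp: r_def)
      then have "e (i - r) \<noteq> e (j - r)"
        using e inj_onD[of e "{..<card ?Z}" "i - r" "j - r"] by (auto simp: bij_betw_def)
      then show ?thesis using 4 by (auto simp: Q_def)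
    qed
  qed
  have "\<exists>q. gpath E q \<and> set q \<subseteq> set (Q i) \<and> hd q \<in> A \<and> last q \<in> B \<and> set q \<inter> A = {hd q} \<and> set q \<inter> B = {last q}"
    if "i < n" for i using gpath_trim Q[OF that] by metis
  then obtain q where q: "\<And>i. i < n \<Longrightarrow> gpath E (q i) \<and> set (q i) \<subseteq> set (Q i) \<and> hd (q i) \<in> A \<and> last (q i) \<in> B
     \<and> set (q i) \<inter> A = {hd (q i)} \<and> set (q i) \<inter> B = {last (q i)}" by metis
  have "set (q i) \<subseteq> V" if "i < n" for i using q[OF that] Q[OF that] by blast
  moreover have "set (q i) \<inter> set (q j) = {}" if "i < n" "j < n" "i \<noteq> j" for i j
    using q[OF that(1)] q[OF that(2)] Qd[OF that] by blast
  ultimately show ?thesis using q by (intro exI[of _ q]) (auto simp: disjoint_family_on_def)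
qed

section \<open>Separations and landing paths\<close>

definition separation :: "'a set \<Rightarrow> ('a \<Rightarrow> 'a \<Rightarrow> bool) \<Rightarrow> 'a set \<Rightarrow> 'a set \<Rightarrow> bool" where
  "separation V E A B \<longleftrightarrow> A \<union> B = V \<and> (\<forall>u\<in>A - B. \<forall>v\<in>B - A. \<not> E u v)"

text \<open>The left side consists of \<open>X\<close> and of all that is reachable from
  \<open>Z\<close> outside \<open>X\<close>.\<close>

lemma separator_separation:
  assumes sym: "symp E" and Z: "Z \<subseteq> V" "X \<subseteq> V" "M \<subseteq> V"
    and X: "\<And>p. gpath E p \<Longrightarrow> set p \<subseteq> V \<Longrightarrow> hd p \<in> Z \<Longrightarrow> last p \<in> M \<Longrightarrow> set p \<inter> X \<noteq> {}"
  shows "\<exists>A B. separation V E A B \<and> Z \<subseteq> A \<and> M \<subseteq> B \<and> A \<inter> B = X"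
proof -
  define R where "R = {v \<in> V - X. \<exists>p. gpath E p \<and> set p \<subseteq> V - X \<and> hd p \<in> Z \<and> last p = v}"
  have ext: "v \<in> R" if uv: "u \<in> R" "v \<in> V - X" "E u v" for u v
  proof -
    obtain p where p: "gpath E p" "set p \<subseteq> V - X" "hd p \<in> Z" "last p = u" using uv by (auto simp: R_def)
    have ne: "p \<noteq> []" using p by (simp add: gpath_def)
    show ?thesis
    proof (cases "v \<in> set p")
      case True
      obtain q r where qr: "p = q @ v # r" "gpath E (q @ [v])" using gpath_split_at[OF p(1) True] by metis
      have "hd (q @ [v]) = hd p" using qr by (simp add: hd_append)
      then show ?thesis using p qr uv unfolding R_def by (intro CollectI conjI exI[of _ "q @ [v]"]) auto
    next
      case False
      then show ?thesis using p uv ne unfolding R_def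
        by (intro CollectI conjI exI[of _ "p @ [v]"]) (auto simp: gpath_append)
    qed
  qed
  have ZR: "Z - X \<subseteq> R"
  proof
    fix z assume "z \<in> Z - X"
    then show "z \<in> R" using Z unfolding R_def by (intro CollectI conjI exI[of _ "[z]"]) auto
  qed
  have MR: "M \<inter> R = {}" using X unfolding R_def by blast
  have RX: "R \<inter> X = {}" "R \<subseteq> V" by (auto simp: R_def)
  have "separation V E (R \<union> X) (V - R)"
    unfolding separation_def using RX Z ext by blast
  moreover have "(R \<union> X) \<inter> (V - R) = X" using RX Z by auto
  ultimately show ?thesis using ZR MR Z by (intro exI[of _ "R \<union> X"] exI[of _ "V - R"]) auto
qed

text \<open>Menger's theorem inside \<open>B\<close>: a smaller cut between the separator and
  \<open>M\<close> would extend, with \<open>A\<close> added to its left side, to a separation of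
  \<open>V\<close> of smaller order that still separates \<open>T\<close> from
  \<open>M\<close>.\<close>

lemma landing:
  fixes E :: "'a \<Rightarrow> 'a \<Rightarrow> bool"
  assumes fin: "finite V" and sym: "symp E" and sep: "separation V E A B" and TM: "T \<subseteq> A" "M \<subseteq> B"
    and min: "\<And>A' B'. separation V E A' B' \<Longrightarrow> T \<subseteq> A' \<Longrightarrow> M \<subseteq> B' \<Longrightarrow> card (A \<inter> B) \<le> card (A' \<inter> B')"
  shows "\<exists>g. (\<forall>x\<in>A \<inter> B. gpath E (g x) \<and> hd (g x) = x \<and> last (g x) \<in> M \<and> set (g x) \<subseteq> B \<and>
      set (g x) \<inter> (A \<inter> B) = {x} \<and> set (g x) \<inter> M = {last (g x)}) \<and>
     disjoint_family_on (\<lambda>x. set (g x)) (A \<inter> B)"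
proof -
  have AB: "A \<union> B = V" "\<And>u v. u \<in> A - B \<Longrightarrow> v \<in> B - A \<Longrightarrow> \<not> E u v" using sep by (auto simp: separation_def)
  have finB: "finite B" using fin AB by auto
  let ?n = "card (A \<inter> B)"
  have "\<exists>P. (\<forall>i<?n. gpath E (P i) \<and> set (P i) \<subseteq> B \<and> hd (P i) \<in> A \<inter> B \<and> last (P i) \<in> M \<and>
       set (P i) \<inter> (A \<inter> B) = {hd (P i)} \<and> set (P i) \<inter> M = {last (P i)}) \<and>
     disjoint_family_on (\<lambda>i. set (P i)) {..<?n}"
  proof (rule menger[OF finB sym])
    show "A \<inter> B \<subseteq> B" "M \<subseteq> B" using TM by auto
    fix X assume X: "X \<subseteq> B" and s: "\<And>p. gpath E p \<Longrightarrow> set p \<subseteq> B \<Longrightarrow> hd p \<in> A \<inter> B \<Longrightarrow> last p \<in> M \<Longrightarrow> set p \<inter> X \<noteq> {}"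
    have "\<exists>A' B'. separation B E A' B' \<and> A \<inter> B \<subseteq> A' \<and> M \<subseteq> B' \<and> A' \<inter> B' = X"
      by (rule separator_separation[OF sym _ X TM(2)]) (simp, rule s)
    then obtain A' B' where s': "separation B E A' B'" "A \<inter> B \<subseteq> A'" "M \<subseteq> B'" "A' \<inter> B' = X"
      by (elim exE conjE) (rule that)
    have "separation V E (A \<union> A') B'"
      unfolding separation_def
    proof (intro conjI ballI)
      show "A \<union> A' \<union> B' = V" using s' AB by (auto simp: separation_def)
      fix u v assume "u \<in> A \<union> A' - B'" "v \<in> B' - (A \<union> A')"
      then show "\<not> E u v" using s' AB(2)[of u v] by (auto simp: separation_def)
    qed
    moreover have "(A \<union> A') \<inter> B' = X" using s' by (auto simp: separation_def)
    ultimately show "?n \<le> card X" using min[of "A \<union> A'" B'] TM s' by auto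
  qed
  then obtain P where P: "\<And>i. i < ?n \<Longrightarrow> gpath E (P i) \<and> set (P i) \<subseteq> B \<and> hd (P i) \<in> A \<inter> B \<and> last (P i) \<in> M \<and>
       set (P i) \<inter> (A \<inter> B) = {hd (P i)} \<and> set (P i) \<inter> M = {last (P i)}"
    and Pd: "disjoint_family_on (\<lambda>i. set (P i)) {..<?n}" by auto
  have hdin: "hd (P i) \<in> set (P i)" if "i < ?n" for i using P[OF that] by (auto simp: gpath_def)
  have inj: "inj_on (\<lambda>i. hd (P i)) {..<?n}"
  proof (rule inj_onI)
    fix i j assume ij: "i \<in> {..<?n}" "j \<in> {..<?n}" "hd (P i) = hd (P j)"
    show "i = j"
    proof (rule ccontr)
      assume "i \<noteq> j"
      then have "set (P i) \<inter> set (P j) = {}" using Pd ij by (auto simp: disjoint_family_on_def)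
      then show False using hdin[of i] hdin[of j] ij by auto
    qed
  qed
  \<comment> \<open>There are as many disjoint paths as separator vertices, so every separator
    vertex begins a path.\<close>
  have "(\<lambda>i. hd (P i)) ` {..<?n} = A \<inter> B"
  proof (rule card_subset_eq)
    show "finite (A \<inter> B)" using finB by auto
    show "(\<lambda>i. hd (P i)) ` {..<?n} \<subseteq> A \<inter> B" using P by auto
    show "card ((\<lambda>i. hd (P i)) ` {..<?n}) = card (A \<inter> B)" using card_image[OF inj] by simp
  qed
  then have "\<forall>x\<in>A \<inter> B. \<exists>i<?n. hd (P i) = x" by (metis (no_types, lifting) imageE lessThan_iff)
  then obtain h where h: "\<And>x. x \<in> A \<inter> B \<Longrightarrow> h x < ?n \<and> hd (P (h x)) = x" by metis
  have "set (P (h x)) \<inter> set (P (h y)) = {}" if "x \<in> A \<inter> B" "y \<in> A \<inter> B" "x \<noteq> y" for x y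
  proof -
    have "h x \<noteq> h y" using h[OF that(1)] h[OF that(2)] that(3) by auto
    then show ?thesis using Pd h[OF that(1)] h[OF that(2)] by (simp add: disjoint_family_on_def)
  qed
  then have "disjoint_family_on (\<lambda>x. set (P (h x))) (A \<inter> B)" unfolding disjoint_family_on_def by blast
  moreover have "\<forall>x\<in>A \<inter> B. gpath E (P (h x)) \<and> hd (P (h x)) = x \<and> last (P (h x)) \<in> M \<and> set (P (h x)) \<subseteq> B \<and>
      set (P (h x)) \<inter> (A \<inter> B) = {x} \<and> set (P (h x)) \<inter> M = {last (P (h x))}"
  proof
    fix x assume "x \<in> A \<inter> B"
    then show "gpath E (P (h x)) \<and> hd (P (h x)) = x \<and> last (P (h x)) \<in> M \<and> set (P (h x)) \<subseteq> B \<and>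
      set (P (h x)) \<inter> (A \<inter> B) = {x} \<and> set (P (h x)) \<inter> M = {last (P (h x))}"
      using P[of "h x"] h[of x] by simp
  qed
  ultimately show ?thesis by (intro exI[of _ "\<lambda>x. P (h x)"] conjI)
qed

section \<open>Packing paths that break a colouring\<close>

text \<open>\<open>length\<close> counts vertices. A properly coloured path has an odd number of
  them exactly if its ends have equal colours, so the last conjunct is the opposite parity.\<close>

definition breaking :: "('a \<Rightarrow> 'a \<Rightarrow> bool) \<Rightarrow> 'a set \<Rightarrow> ('a \<Rightarrow> bool) \<Rightarrow> 'a list \<Rightarrow> bool" where
  "breaking E A col p \<longleftrightarrow> gpath E p \<and> hd p \<in> A \<and> last p \<in> A \<and> hd p \<noteq> last p \<and>
     set p \<inter> A = {hd p, last p} \<and> (even (length p) \<longleftrightarrow> col (hd p) = col (last p))"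

text \<open>Here \<open>w K\<close> is the size of the boundary of a part \<open>K\<close>. Odd
  parts have a nonempty boundary, so taking all but one boundary vertex of each part saves one
  vertex for each odd part.\<close>

lemma sum_boundary:
  fixes w :: "'b \<Rightarrow> nat"
  assumes "finite KK" "\<And>K. K \<in> KK \<Longrightarrow> odd (c K) \<Longrightarrow> w K \<ge> 1"
  shows "(\<Sum>K\<in>KK. w K - 1) + card {K \<in> KK. odd (c K :: nat)} \<le> (\<Sum>K\<in>KK. w K)"
proof -
  have "card {K \<in> KK. odd (c K)} = (\<Sum>K\<in>KK. if odd (c K) then 1 else 0)"
    using assms(1) by (simp add: sum.If_cases Int_def)
  then have "(\<Sum>K\<in>KK. w K - 1) + card {K \<in> KK. odd (c K)} = (\<Sum>K\<in>KK. (w K - 1) + (if odd (c K) then 1 else 0))"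
    by (simp add: sum.distrib)
  also have "\<dots> \<le> (\<Sum>K\<in>KK. w K)" using assms(2) by (intro sum_mono) force
  finally show ?thesis .
qed

lemma parity_split: "even a \<Longrightarrow> a + b = c \<Longrightarrow> b = w \<Longrightarrow> even (w + c :: nat)"
  by auto

lemma parity_gap: "\<not> u + 2 * r \<le> a \<Longrightarrow> even (u + v) \<Longrightarrow> even (a + v) \<Longrightarrow> a + 2 \<le> u + 2 * (r::nat)"
  by presburger

text \<open>Vertices outside \<open>A\<close> get one copy in each of two layers, and \<open>a \<in> A\<close> occurs only in the layer \<open>col a\<close>.
  Edges keep the layer and the two copies of a vertex are adjacent, so an alternating chain from \<open>A\<close> to \<open>A\<close>
  projects to a path whose parity does not fit the colouring.\<close>

lemma odd_paths_packing:
  fixes E :: "'a \<Rightarrow> 'a \<Rightarrow> bool"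
  assumes fin: "finite V" and sym: "symp E" and AV: "A \<subseteq> V"
  shows "(\<exists>P. (\<forall>i<r. breaking E A col (P i) \<and> set (P i) \<subseteq> V) \<and> disjoint_family_on (\<lambda>i. set (P i)) {..<r})
    \<or> (\<exists>X\<subseteq>V. card X + 2 \<le> 2 * r \<and> (\<forall>p. breaking E A col p \<and> set p \<subseteq> V \<longrightarrow> set p \<inter> X \<noteq> {}))"
proof -
  define VV where "VV = {(v, i) |v i. v \<in> V \<and> (v \<in> A \<longrightarrow> i = col v)}"
  define EE where "EE x y \<longleftrightarrow> (snd x = snd y \<and> E (fst x) (fst y)) \<or> (fst x = fst y \<and> snd x \<noteq> snd y)" for x y :: "'a \<times> bool"
  define m0 where "m0 x = (if fst x \<in> V - A then (fst x, \<not> snd x) else x)" for x :: "'a \<times> bool"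
  have finVV: "finite VV"
    by (rule finite_subset[of _ "V \<times> UNIV"]) (use fin in \<open>auto simp: VV_def\<close>)
  have symEE: "symp EE" using sym by (auto simp: symp_def EE_def)
  obtain m U KK where m: "matching VV EE m" and U: "U \<subseteq> VV" "\<Union>KK = VV - U" and KK: "disjoint KK" "finite KK"
    "\<forall>K\<in>KK. \<forall>L\<in>KK. K \<noteq> L \<longrightarrow> (\<forall>u\<in>K. \<forall>v\<in>L. \<not> EE u v)"
    and c: "card (unmatched VV m) + card U \<le> card {K \<in> KK. odd (card K)}"
    using tutte_berge[OF finVV symEE] by (elim exE conjE) (rule that)
  have inv0: "m0 (m0 v) = v" for v by (cases v) (auto simp: m0_def)
  have m0V: "m0 ` VV \<subseteq> VV" by (auto simp: VV_def m0_def)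
  have f2: "\<forall>x\<in>VV. \<forall>y\<in>VV. fst x = fst y \<longrightarrow> x \<noteq> y \<longrightarrow> m0 x = y"
    by (auto simp: VV_def m0_def)
  have fixm0: "{x \<in> VV. m0 x = x} = (\<lambda>a. (a, col a)) ` A" using AV by (auto simp: VV_def m0_def)
  have cfix: "card {x \<in> VV. m0 x = x} = card A"
    unfolding fixm0 by (rule card_image) (auto simp: inj_on_def)
  have finA: "finite A" using fin AV finite_subset by blast
  show ?thesis
  proof (cases "card (unmatched VV m) + 2 * r \<le> card A")
    case True
    then have cnt: "card {x \<in> VV. m x = x} + 2 * r \<le> card {x \<in> VV. m0 x = x}"
      using cfix by (simp add: unmatched_def)
    obtain CS where CS: "\<forall>i<r. alt_chain m0 m (CS i) \<and> chain_verts (CS i) \<subseteq> VV"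
      and CSd: "disjoint_family_on (\<lambda>i. chain_verts (CS i)) {..<r}"
      using alternating_chains[OF finVV matching_invol[OF m] inv0 matching_image[OF m] m0V cnt] by auto
    have f1: "\<forall>x\<in>VV. fst (m0 x) = fst x" by (simp add: m0_def)
    have f3: "\<forall>x\<in>VV. fst (m x) \<noteq> fst x \<longrightarrow> E (fst x) (fst (m x))"
    proof (intro ballI impI)
      fix x assume that: "x \<in> VV" "fst (m x) \<noteq> fst x"
      then have "m x \<noteq> x" by auto
      then show "E (fst x) (fst (m x))" using matching_in[OF m, of x] that by (auto simp: EE_def)
    qed
    have path: "\<exists>p. breaking E A col p \<and> set p = fst ` chain_verts cs"
      if cs: "alt_chain m0 m cs" "chain_verts cs \<subseteq> VV" for cs
    proof -
      note nt = alt_chain_nth[OF cs(1)]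
      note pr = chain_project[OF cs(1) inv0 cs(2) f1 f2 f3]
      let ?p = "fst (fst (cs ! 0)) # map (\<lambda>c. fst (snd c)) cs"
      have inVV: "fst (cs ! i) \<in> VV" "snd (cs ! i) \<in> VV" if "i < length cs" for i
        using subsetD[OF cs(2)] that unfolding chain_verts_nth by blast+
      \<comment> \<open>An \<open>m\<close>-pair joining the two copies of one vertex would at the
        same time be an \<open>m0\<close>-pair, which a chain excludes. So every
        \<open>m\<close>-pair of the chain comes from an edge and stays in its layer.\<close>
      have layer: "snd (snd (cs ! i)) = snd (fst (cs ! i))" if i: "i < length cs" for i
      proof -
        have ne: "fst (cs ! i) \<noteq> snd (cs ! i)" using nt(5)[OF i i] .
        have "fst (fst (cs ! i)) \<noteq> fst (snd (cs ! i))"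
        proof
          assume "fst (fst (cs ! i)) = fst (snd (cs ! i))"
          then have e: "m0 (fst (cs ! i)) = snd (cs ! i)" using f2 inVV[OF i] ne by auto
          show False
          proof (cases i)
            case 0 then show False using e ne nt(3) by simp
          next
            case (Suc j)
            then have "m0 (fst (cs ! i)) = snd (cs ! j)" using nt(2)[of j] i inv0 by metis
            then show False using e nt(6)[of i j] i Suc by simp
          qed
        qed
        moreover have "m (fst (cs ! i)) = snd (cs ! i)" using nt(1)[OF i] .
        ultimately show ?thesis using matching_in[OF m, of "fst (cs ! i)"] ne by (auto simp: EE_def)
      qed
      have flip: "snd (fst (cs ! Suc i)) \<noteq> snd (snd (cs ! i))" if "Suc i < length cs" for i
      proof -
        have "m0 (snd (cs ! i)) = fst (cs ! Suc i)" "fst (cs ! Suc i) \<noteq> snd (cs ! i)"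
          using nt(2)[OF that] nt(5)[of "Suc i" i] that by auto
        moreover have "snd (m0 x) \<noteq> snd x" if "m0 x \<noteq> x" for x
        proof (cases "fst x \<in> V - A")
          case True then show ?thesis by (simp add: m0_def)
        next
          case False
          then have "m0 x = x" unfolding m0_def by (rule if_not_P)
          then show ?thesis using that by simp
        qed
        ultimately show ?thesis by metis
      qed
      have lay: "snd (snd (cs ! i)) = (snd (fst (cs ! 0)) \<noteq> odd i)" if "i < length cs" for i
        using that
      proof (induction i)
        case 0 then show ?case using layer by simp
      next
        case (Suc i)
        then show ?case using layer[of "Suc i"] flip[of i] by auto
      qed
      let ?s = "fst (cs ! 0)" and ?e = "snd (cs ! (length cs - 1))"
      have se: "?s \<in> VV" "?e \<in> VV" "m0 ?s = ?s" "m0 ?e = ?e" using nt inVV by auto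
      then have "?s \<in> (\<lambda>a. (a, col a)) ` A" "?e \<in> (\<lambda>a. (a, col a)) ` A" unfolding fixm0[symmetric] by auto
      then have ends: "fst ?s \<in> A" "fst ?e \<in> A" "snd ?s = col (fst ?s)" "snd ?e = col (fst ?e)" by auto
      have "set ?p \<inter> A = {hd ?p, last ?p}"
      proof
        show "{hd ?p, last ?p} \<subseteq> set ?p \<inter> A" using ends pr(3,4) by (metis IntI hd_in_set insert_subset last_in_set list.discI empty_subsetI)
        show "set ?p \<inter> A \<subseteq> {hd ?p, last ?p}"
        proof
          fix v assume "v \<in> set ?p \<inter> A"
          then have "v \<in> fst ` chain_verts cs" "v \<in> A" unfolding pr(2) by blast+
          then obtain x where x: "x \<in> chain_verts cs" "fst x = v" "v \<in> A" by blast
          then have "m0 x = x" unfolding m0_def by (intro if_not_P) simp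
          then have "x = ?s \<or> x = ?e" using alt_chain_closed(2)[OF cs(1) inv0 x(1)] by simp
          then show "v \<in> {hd ?p, last ?p}" unfolding pr(3,4) using x(2) by blast
        qed
      qed
      moreover have "even (length ?p) \<longleftrightarrow> col (hd ?p) = col (last ?p)"
      proof -
        have "col (fst ?e) = (col (fst ?s) \<noteq> odd (length cs - 1))"
          using lay[of "length cs - 1"] nt(8) ends by simp
        moreover have "odd (length cs - 1) \<longleftrightarrow> even (length cs)" using nt(8) by simp
        ultimately show ?thesis unfolding pr(3,4,5) by auto
      qed
      moreover have "hd ?p \<in> A" "last ?p \<in> A" unfolding pr(3,4) using ends by auto
      ultimately have "breaking E A col ?p" using pr(1,6) unfolding breaking_def by blast
      then show ?thesis using pr(2) by blast
    qed
    then have "\<forall>i<r. \<exists>p. breaking E A col p \<and> set p = fst ` chain_verts (CS i)" using CS by blast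
    then obtain P where P: "\<And>i. i < r \<Longrightarrow> breaking E A col (P i) \<and> set (P i) = fst ` chain_verts (CS i)" by metis
    have "set (P i) \<subseteq> V" if "i < r" for i
    proof -
      have "fst ` chain_verts (CS i) \<subseteq> fst ` VV" using CS that by (intro image_mono) blast
      then show ?thesis using P[OF that] by (auto simp: VV_def)
    qed
    moreover have "set (P i) \<inter> set (P j) = {}" if "i < r" "j < r" "i \<noteq> j" for i j
      using chains_project_disjoint[of m0 m "CS i" "CS j" VV fst] CS CSd that inv0 f2 P
      by (auto simp: disjoint_family_on_def)
    ultimately show ?thesis using P by (intro disjI1 exI[of _ P]) (auto simp: disjoint_family_on_def)
  next
    case False
    have par: "even (card (unmatched VV m) + card VV)" "even (card {x \<in> VV. m0 x = x} + card VV)"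
      using parity_unmatched[OF finVV, of m] parity_unmatched[OF finVV, of m0] matching_invol[OF m]
        matching_image[OF m] inv0 m0V by (auto simp: unmatched_def)
    \<comment> \<open>By parity, failing to have a surplus of \<open>2 * r\<close> means missing it
      by two; this is the origin of the even bound \<open>2 * r - 2\<close>.\<close>
    have "card A + 2 \<le> card (unmatched VV m) + 2 * r"
      using False par cfix parity_gap by metis
    then have c1: "card A + 2 + card U \<le> card {K \<in> KK. odd (card K)} + 2 * r" using c by linarith
    \<comment> \<open>The boundary of the part \<open>K\<close>, where a path can enter or leave
      it.\<close>
    define wt where "wt K = {v \<in> V. if v \<in> A then (v, col v) \<in> K else (\<exists>i. (v, i) \<in> K \<and> (v, \<not> i) \<in> U)}" for K
    define UA where "UA = {v \<in> A. (v, col v) \<in> U}"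
    define U1 where "U1 = {v \<in> V - A. \<exists>i. (v, i) \<in> U \<and> (v, \<not> i) \<notin> U}"
    define U2 where "U2 = {v \<in> V - A. \<forall>i. (v, i) \<in> U}"
    have part: "\<exists>K\<in>KK. x \<in> K" if "x \<in> VV" "x \<notin> U" for x using that U(2) by (metis DiffI UnionE)
    have Ksub: "K \<subseteq> VV - U" if "K \<in> KK" for K using that U(2) by (metis Union_upper)
    have adj: "y \<in> K" if kx: "K \<in> KK" "x \<in> K" "EE x y" "y \<in> VV" "y \<notin> U" for K x y
    proof -
      obtain L where L: "L \<in> KK" "y \<in> L" using part[OF kx(4,5)] by blast
      then have "K = L" using KK(3) kx by blast
      then show ?thesis using L by simp
    qed
    have Kuniq: "K = L" if "K \<in> KK" "L \<in> KK" "x \<in> K" "x \<in> L" for K L x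
      using KK(1) that by (auto simp: disjoint_def)
    have finK: "finite K" if "K \<in> KK" for K using Ksub[OF that] finVV finite_subset by blast
    have vert: "EE (v, i) (v, \<not> i)" for v i by (simp add: EE_def)
    \<comment> \<open>Off the boundary, \<open>m0\<close> pairs the vertices of \<open>K\<close>
      among themselves.\<close>
    have wpar: "even (card (wt K) + card K)" if K: "K \<in> KK" for K
    proof -
      let ?W = "{x \<in> K. m0 x \<notin> K \<or> m0 x = x}"
      have "even (card (K - ?W))"
        using finK[OF K] inv0 by (intro even_card_fixfree[of _ m0]) auto
      moreover have "card (K - ?W) + card ?W = card K"
        using finK[OF K] by (subst card_Un_disjoint[symmetric]) (auto intro: arg_cong[of _ _ card])
      moreover have "card ?W = card (wt K)"
      proof -
        have "inj_on fst ?W"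
        proof (rule inj_onI)
          fix x y assume xy: "x \<in> ?W" "y \<in> ?W" "fst x = fst y"
          show "x = y"
          proof (rule ccontr)
            assume "x \<noteq> y"
            then have "m0 x = y" using xy Ksub[OF K] f2 by blast
            then show False using xy \<open>x \<noteq> y\<close> by auto
          qed
        qed
        then have "card (fst ` ?W) = card ?W" by (rule card_image)
        moreover have "fst ` ?W = wt K"
        proof (intro set_eqI iffI)
          fix v assume "v \<in> fst ` ?W"
          then obtain i where i: "(v, i) \<in> K" "m0 (v, i) \<notin> K \<or> m0 (v,i) = (v,i)" by auto
          have vi: "(v, i) \<in> VV" using Ksub[OF K] i by auto
          show "v \<in> wt K"
          proof (cases "v \<in> A")
            case True then show ?thesis using i vi by (auto simp: wt_def VV_def)
          next
            case False
            then have v': "v \<in> V - A" "m0 (v, i) = (v, \<not> i)" "(v, \<not> i) \<in> VV" using vi by (auto simp: VV_def m0_def)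
            then have "(v, \<not> i) \<in> U" using i adj[OF K i(1) vert] by auto
            then show ?thesis using i v' by (auto simp: wt_def)
          qed
        next
          fix v assume v: "v \<in> wt K"
          show "v \<in> fst ` ?W"
          proof (cases "v \<in> A")
            case True then show ?thesis using v by (auto simp: wt_def m0_def image_iff intro!: bexI[of _ "(v, col v)"])
          next
            case False
            then obtain i where i: "(v, i) \<in> K" "(v, \<not> i) \<in> U" "v \<in> V" using v by (auto simp: wt_def)
            then have "m0 (v, i) \<notin> K" using Ksub[OF K] False by (auto simp: m0_def)
            then show ?thesis using i by (auto simp: image_iff intro!: bexI[of _ "(v, i)"])
          qed
        qed
        ultimately show ?thesis by (simp only:)
      qed
      ultimately show ?thesis by (rule parity_split)
    qed
    have wdisj: "wt K \<inter> wt L = {}" if KL: "K \<in> KK" "L \<in> KK" "K \<noteq> L" for K L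
    proof (rule ccontr)
      assume "wt K \<inter> wt L \<noteq> {}"
      then obtain v where v: "v \<in> wt K" "v \<in> wt L" by auto
      show False
      proof (cases "v \<in> A")
        case True then show False using v Kuniq[OF KL(1,2)] KL(3) by (auto simp: wt_def)
      next
        case False
        then obtain i j where ij: "(v,i) \<in> K" "(v, \<not> i) \<in> U" "(v,j) \<in> L" "(v, \<not> j) \<in> U"
          using v by (auto simp: wt_def)
        have "(v,i) \<notin> U" "(v,j) \<notin> U" using Ksub KL ij by auto
        then have "i = j" using ij by (cases i; cases j) auto
        then show False using Kuniq[OF KL(1,2)] KL(3) ij by auto
      qed
    qed
    have wsub: "wt K \<subseteq> (A - UA) \<union> U1" if "K \<in> KK" for K
    proof
      fix v assume v: "v \<in> wt K"
      show "v \<in> (A - UA) \<union> U1"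
      proof (cases "v \<in> A")
        case True then show ?thesis using v Ksub[OF that] by (auto simp: wt_def UA_def)
      next
        case False
        then obtain i where i: "(v, i) \<in> K" "(v, \<not> i) \<in> U" "v \<in> V" using v by (auto simp: wt_def)
        then have "(v, \<not> \<not> i) \<notin> U" using Ksub[OF that] by auto
        then show ?thesis using i False unfolding U1_def by blast
      qed
    qed
    have finw: "finite (wt K)" for K using fin by (simp add: wt_def)
    have finUs: "finite UA" "finite U1" "finite U2" "finite U"
      using finA fin finVV U finite_subset by (auto simp: UA_def U1_def U2_def)
    have "(\<Sum>K\<in>KK. card (wt K)) = card (\<Union>K\<in>KK. wt K)"
      by (rule card_UN_disjoint[symmetric]) (use KK(2) finw wdisj in auto)
    also have "\<dots> \<le> card ((A - UA) \<union> U1)"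
      by (rule card_mono) (use finA finUs wsub in auto)
    also have "\<dots> \<le> card (A - UA) + card U1" by (rule card_Un_le)
    also have "card (A - UA) = card A - card UA" by (rule card_Diff_subset) (use finUs in \<open>auto simp: UA_def\<close>)
    finally have sumw: "(\<Sum>K\<in>KK. card (wt K)) \<le> card A - card UA + card U1" .
    have leA: "card UA \<le> card A" using finA by (intro card_mono) (auto simp: UA_def)
    have leU: "card U1 + card U2 \<le> card U"
    proof -
      have "U1 \<union> U2 \<subseteq> fst ` U" by (force simp: U1_def U2_def)
      then have "card (U1 \<union> U2) \<le> card U" using finUs card_mono card_image_le le_trans finite_imageI by metis
      moreover have "card (U1 \<union> U2) = card U1 + card U2"
        by (rule card_Un_disjoint) (use finUs in \<open>auto simp: U1_def U2_def\<close>)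
      ultimately show ?thesis by simp
    qed
    \<comment> \<open>For an empty boundary the choice is arbitrary, and nothing is removed by
      it.\<close>
    define sel where "sel K = (SOME v. v \<in> wt K)" for K
    \<comment> \<open>A breaking path that avoids \<open>UA\<close> and \<open>U2\<close> must meet
      the boundary of some part twice; so all boundary vertices but one of every part hit
      it.\<close>
    define X where "X = UA \<union> U2 \<union> (\<Union>K\<in>KK. wt K - {sel K})"
    have cw: "card (wt K - {sel K}) = card (wt K) - 1" for K
    proof (cases "wt K = {}")
      case False
      then have "sel K \<in> wt K" unfolding sel_def by (simp add: some_in_eq)
      then show ?thesis using finw by simp
    qed simp
    have "card X \<le> card UA + card U2 + (\<Sum>K\<in>KK. card (wt K - {sel K}))"
      unfolding X_def using card_Un_le[of "UA \<union> U2" "\<Union>K\<in>KK. wt K - {sel K}"] card_Un_le[of UA U2]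
        card_UN_le[OF KK(2), of "\<lambda>K. wt K - {sel K}"] by linarith
    moreover have "(\<Sum>K\<in>KK. card (wt K) - 1) + card {K \<in> KK. odd (card K)} \<le> (\<Sum>K\<in>KK. card (wt K))"
    proof (rule sum_boundary[OF KK(2)])
      fix K assume "K \<in> KK" "odd (card K)"
      then have "odd (card (wt K))" using wpar[of K] by auto
      then show "1 \<le> card (wt K)" by (cases "card (wt K)") auto
    qed
    ultimately have cX: "card X + 2 \<le> 2 * r" using sumw leA leU c1 unfolding cw by linarith
    have two: "u \<in> X \<or> v \<in> X" if "K \<in> KK" "u \<in> wt K" "v \<in> wt K" "u \<noteq> v" for K u v
      using that unfolding X_def by auto
    have hit: "set p \<inter> X \<noteq> {}" if p: "breaking E A col p" "set p \<subseteq> V" for p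
    proof
      assume pX: "set p \<inter> X = {}"
      have nX: "p ! i \<notin> X" if "i < length p" for i using pX that nth_mem by blast
      define l where "l = length p - 1"
      have ne: "p \<noteq> []" and dist: "distinct p" using p by (auto simp: breaking_def gpath_def)
      have hl: "hd p = p ! 0" "last p = p ! l" using ne by (auto simp: hd_conv_nth last_conv_nth l_def)
      have l0: "0 < l" using p(1) hl unfolding breaking_def by (metis gr0I)
      then have len: "length p = Suc l" by (simp add: l_def)
      have inV: "p ! i \<in> V" if "i \<le> l" for i using p(2) nth_mem[of i p] that len by auto
      have inA: "p ! i \<notin> A" if "0 < i" "i < l" for i
      proof
        assume "p ! i \<in> A"
        then have "p ! i \<in> {p ! 0, p ! l}" using p(1) that len nth_mem[of i p] hl unfolding breaking_def by (metis IntI less_SucI)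
        then show False using that len dist nth_eq_iff_index_eq[OF dist] by auto
      qed
      have endA: "p ! 0 \<in> A" "p ! l \<in> A" using p(1) hl by (auto simp: breaking_def)
      have edge: "E (p ! i) (p ! Suc i)" if "i < l" for i
        using p(1) that len by (auto simp: breaking_def gpath_def successively_conv_nth)
      have neq: "p ! i \<noteq> p ! j" if "i \<le> l" "j \<le> l" "i \<noteq> j" for i j
        using that dist len nth_eq_iff_index_eq[of p i j] by auto
      \<comment> \<open>The layer in which the edge from \<open>p ! i\<close> to the next vertex is
        followed: the lifted path changes its layer at every inner vertex. The parity of a breaking
        path makes it end in the layer of its last vertex.\<close>
      define s where "s i = (col (p ! 0) \<noteq> odd i)" for i :: nat
      have sS: "s (Suc i) = (\<not> s i)" for i by (auto simp: s_def)
      have colend: "col (p ! l) = s (l - 1)"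
      proof -
        have "even (Suc l) \<longleftrightarrow> col (p ! 0) = col (p ! l)" using p(1) hl len by (simp add: breaking_def)
        moreover have "odd (l - 1) \<longleftrightarrow> even l" using l0 by simp
        ultimately show ?thesis unfolding s_def by auto
      qed
      have xin: "(p ! i, s i) \<in> VV" if "i < l" for i
        using inV[of i] inA[of i] that by (cases "i = 0") (auto simp: VV_def s_def)
      have yin: "(p ! Suc i, s i) \<in> VV" if "i < l" for i
        using inV[of "Suc i"] inA[of "Suc i"] that colend by (cases "Suc i = l") (auto simp: VV_def)
      have EExy: "EE (p ! i, s i) (p ! Suc i, s i)" if "i < l" for i using edge[OF that] by (simp add: EE_def)
      \<comment> \<open>The lifted path is at present in a part \<open>K\<close> whose boundary it
        has already met. A second contact with that boundary is impossible outside \<open>X\<close>,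
        so it leaves \<open>K\<close> only through a vertex with a copy in \<open>U\<close>, and
        then enters the next part through its boundary. The end in \<open>A\<close> finally is the
        second contact.\<close>
      have main: "\<exists>K\<in>KK. (p ! i, s i) \<in> K \<and> (\<exists>j\<le>i. p ! j \<in> wt K)" if "i < l" for i
        using that
      proof (induction i)
        case 0
        have "p ! 0 \<notin> UA" using nX[of 0] len by (auto simp: X_def)
        then have "(p ! 0, s 0) \<notin> U" using endA by (auto simp: UA_def s_def)
        then obtain K where "K \<in> KK" "(p ! 0, s 0) \<in> K" using part xin[OF 0] by blast
        then show ?case using endA inV[of 0] by (intro bexI[of _ K]) (auto simp: wt_def s_def)
      next
        case (Suc i)
        then obtain K j where K: "K \<in> KK" "(p ! i, s i) \<in> K" "j \<le> i" "p ! j \<in> wt K" by auto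
        have nA: "p ! Suc i \<notin> A" "p ! Suc i \<in> V" using inA inV Suc by auto
        show ?case
        proof (cases "(p ! Suc i, s i) \<in> U")
          case True
          have "p ! Suc i \<notin> U2" using nX[of "Suc i"] len Suc by (auto simp: X_def)
          then have "\<not> (\<forall>b. (p ! Suc i, b) \<in> U)" using nA by (simp add: U2_def)
          then obtain b where b: "(p ! Suc i, b) \<notin> U" by blast
          then have "b = (\<not> s i)" using True by (cases b; cases "s i") auto
          then have "(p ! Suc i, \<not> s i) \<notin> U" using b by simp
          then have "(p ! Suc i, s (Suc i)) \<notin> U" by (simp only: sS not_False_eq_True)
          from part[OF xin[OF Suc.prems] this] obtain K' where K': "K' \<in> KK" "(p ! Suc i, s (Suc i)) \<in> K'" by blast
          then have "p ! Suc i \<in> wt K'" using True nA by (auto simp: wt_def sS)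
          then show ?thesis using K' by blast
        next
          case False
          then have y: "(p ! Suc i, s i) \<in> K" using adj[OF K(1,2) EExy yin] Suc by auto
          show ?thesis
          proof (cases "(p ! Suc i, \<not> s i) \<in> U")
            case True
            then have "p ! Suc i \<in> wt K" using y nA by (auto simp: wt_def)
            moreover have "p ! Suc i \<noteq> p ! j" using neq K Suc.prems by auto
            ultimately have False using two[OF K(1) _ K(4)] nX[of "Suc i"] nX[of j] K(3) Suc.prems len by auto
            then show ?thesis ..
          next
            case False
            then have "(p ! Suc i, s (Suc i)) \<in> K"
              using adj[OF K(1) y vert] xin[OF Suc.prems] by (simp add: sS)
            then show ?thesis using K by (meson le_SucI)
          qed
        qed
      qed
      have ll: "l - 1 < l" "Suc (l - 1) = l" using l0 by auto
      obtain K j where K: "K \<in> KK" "(p ! (l - 1), s (l - 1)) \<in> K" "j \<le> l - 1" "p ! j \<in> wt K"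
        using main[OF ll(1)] by auto
      have "p ! l \<notin> UA" using nX[of l] len by (auto simp: X_def)
      then have "(p ! l, s (l - 1)) \<notin> U" using endA colend by (auto simp: UA_def)
      then have "(p ! l, s (l - 1)) \<in> K" using adj[OF K(1,2)] EExy[OF ll(1)] yin[OF ll(1)] ll(2) by simp
      then have "p ! l \<in> wt K" using endA colend inV[of l] by (auto simp: wt_def)
      moreover have "p ! l \<noteq> p ! j" using neq K(3) l0 by auto
      ultimately show False using two[OF K(1) _ K(4)] nX[of l] nX[of j] K(3) len by auto
    qed
    have "X \<subseteq> V" using AV by (auto simp: X_def UA_def U2_def wt_def)
    then show ?thesis using cX hit by blast
  qed
qed

section \<open>Linking terminals in dense graphs\<close>

definition pairs :: "(nat \<Rightarrow> 'a) \<Rightarrow> (nat \<Rightarrow> 'a) \<Rightarrow> nat set \<Rightarrow> 'a set \<Rightarrow> bool" where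
  "pairs x y I T \<longleftrightarrow> finite I \<and> (\<forall>i\<in>I. x i \<in> T \<and> y i \<in> T \<and> x i \<noteq> y i) \<and>
     (\<forall>i\<in>I. \<forall>j\<in>I. i \<noteq> j \<longrightarrow> {x i, y i} \<inter> {x j, y j} = {})"

text \<open>Connected sets rather than paths, because they are easily carried through contractions
  and clique replacements; paths are taken out of them only in \<open>host_path\<close>. The sets
  also avoid the terminals outside the given pairs.\<close>

definition linked :: "'a set \<Rightarrow> ('a \<Rightarrow> 'a \<Rightarrow> bool) \<Rightarrow> 'a set \<Rightarrow> bool" where
  "linked V E T \<longleftrightarrow> (\<forall>I x y. pairs x y I T \<longrightarrow>
     (\<exists>C. (\<forall>i\<in>I. C i \<subseteq> V \<and> x i \<in> C i \<and> y i \<in> C i \<and> conn E (C i) \<and> C i \<inter> T = {x i, y i})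
        \<and> disjoint_family_on C I))"

definition nbrs :: "'a set \<Rightarrow> ('a \<Rightarrow> 'a \<Rightarrow> bool) \<Rightarrow> 'a \<Rightarrow> 'a set" where
  "nbrs D E v = {u \<in> D. E v u}"

lemma finite_nbrs [simp]: "finite D \<Longrightarrow> finite (nbrs D E v)" by (simp add: nbrs_def)

lemma pairs_card:
  assumes "pairs x y I T" "finite T"
  shows "2 * card I \<le> card T"
proof -
  have fI: "finite I" using assms by (simp add: pairs_def)
  have "card (\<Union>i\<in>I. {x i, y i}) = (\<Sum>i\<in>I. card {x i, y i})"
    by (rule card_UN_disjoint) (use assms in \<open>auto simp: pairs_def\<close>)
  also have "\<dots> = (\<Sum>i\<in>I. 2)" by (rule sum.cong) (use assms in \<open>auto simp: pairs_def\<close>)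
  finally have "card (\<Union>i\<in>I. {x i, y i}) = 2 * card I" by simp
  moreover have "card (\<Union>i\<in>I. {x i, y i}) \<le> card T"
    by (rule card_mono) (use assms in \<open>auto simp: pairs_def\<close>)
  ultimately show ?thesis by simp
qed

text \<open>The indices are served one after another. At each choice one index is still waiting, so
  at most \<open>b + 3 * card S - 3\<close> vertices are forbidden, and this is the room that the
  hypothesis has to handle.\<close>

lemma greedy_disjoint:
  assumes "finite S" "finite F" "U0 \<subseteq> F" "card U0 \<le> b"
    and "\<And>i U. i \<in> S \<Longrightarrow> U \<subseteq> F \<Longrightarrow> card U + 3 \<le> b + 3 * card S \<Longrightarrow> \<exists>X. X \<subseteq> F - U \<and> card X \<le> 3 \<and> Q i X"
  shows "\<exists>X. (\<forall>i\<in>S. X i \<subseteq> F - U0 \<and> Q i (X i)) \<and> disjoint_family_on X S"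
proof -
  have "\<exists>X. (\<forall>i\<in>S'. X i \<subseteq> F - U0 \<and> card (X i) \<le> 3 \<and> Q i (X i)) \<and> disjoint_family_on X S'"
    if "S' \<subseteq> S" for S'
    using finite_subset[OF that assms(1)] that
  proof (induction S' rule: finite_induct)
    case empty then show ?case by (auto simp: disjoint_family_on_def)
  next
    case (insert i S')
    then obtain X where X: "\<And>j. j \<in> S' \<Longrightarrow> X j \<subseteq> F - U0 \<and> card (X j) \<le> 3 \<and> Q j (X j)" "disjoint_family_on X S'"
      by auto
    let ?U = "U0 \<union> (\<Union>j\<in>S'. X j)"
    have "card ?U \<le> card U0 + (\<Sum>j\<in>S'. card (X j))"
      using card_Un_le[of U0 "\<Union>j\<in>S'. X j"] card_UN_le[OF insert.hyps(1), of X] by linarith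
    also have "(\<Sum>j\<in>S'. card (X j)) \<le> (\<Sum>j\<in>S'. 3)" using X by (intro sum_mono) auto
    finally have "card ?U \<le> b + 3 * card S'" using assms(4) by simp
    moreover have "Suc (card S') \<le> card S"
      using card_mono[OF assms(1) insert.prems] insert.hyps by simp
    ultimately have "card ?U + 3 \<le> b + 3 * card S" by linarith
    moreover have "?U \<subseteq> F" using X assms(3) by auto
    ultimately obtain Z where Z: "Z \<subseteq> F - ?U" "card Z \<le> 3" "Q i Z"
      using assms(5)[of i ?U] insert.prems by auto
    have "disjoint_family_on (X(i := Z)) (insert i S')"
      unfolding disjoint_family_on_def
    proof (intro ballI impI)
      fix a b assume ab: "a \<in> insert i S'" "b \<in> insert i S'" "a \<noteq> b"
      have disj: "X j \<inter> Z = {}" if "j \<in> S'" for j using Z(1) that by auto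
      show "(X(i := Z)) a \<inter> (X(i := Z)) b = {}"
        using ab disj[of a] disj[of b] X(2) insert.hyps unfolding disjoint_family_on_def
        by (cases "a = i"; cases "b = i") auto
    qed
    moreover have "(X(i := Z)) j \<subseteq> F - U0 \<and> card ((X(i := Z)) j) \<le> 3 \<and> Q j ((X(i := Z)) j)" if "j \<in> insert i S'" for j
      using X(1)[of j] Z that by auto
    ultimately show ?case by (intro exI[of _ "X(i := Z)"]) blast
  qed
  then show ?thesis by (metis order_refl)
qed

lemma card_Int_ge:
  assumes "finite D" "A \<subseteq> D" "B \<subseteq> D"
  shows "card A + card B \<le> card (A \<inter> B) + card D"
proof -
  have "finite A" "finite B" using assms finite_subset by auto
  then have "card A + card B = card (A \<union> B) + card (A \<inter> B)" by (rule card_Un_Int)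
  moreover have "card (A \<union> B) \<le> card D" using assms by (intro card_mono) auto
  ultimately show ?thesis by simp
qed

text \<open>Two vertices of \<open>D\<close> have at least \<open>\<mu>\<close> common neighbours. Hall's theorem joins as many pairs as possible
  through a single vertex; the remaining pairs are joined greedily by paths with three inner vertices.\<close>

lemma dense_linked:
  assumes fin: "finite D" and sym: "symp E" and irr: "irreflp E"
    and deg: "\<And>v. v \<in> D \<Longrightarrow> \<delta> \<le> card (nbrs D E v)"
    and dens: "card D + \<mu> \<le> 2 * \<delta>" and mu: "8 * K < 3 * \<mu> + 14" and big: "3 * K \<le> card D"
    and W: "W \<subseteq> D" "card W \<le> 2 * K"
  shows "linked D E W"
  unfolding linked_def
proof (intro allI impI)
  fix I :: "nat set" and x y assume pr: "pairs x y I W"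
  have finI: "finite I" using pr by (simp add: pairs_def)
  have finW: "finite W" using W fin finite_subset by blast
  have rI: "2 * card I \<le> card W" by (rule pairs_card[OF pr finW])
  let ?N = "nbrs D E"
  have symE: "E u v \<longleftrightarrow> E v u" for u v using sym by (auto dest: sympD)
  have irrE: "\<not> E v v" for v using irr by (simp add: irreflp_def)
  have xy: "x i \<in> W" "y i \<in> W" "x i \<noteq> y i" if "i \<in> I" for i using pr that by (auto simp: pairs_def)
  have xyd: "{x i, y i} \<inter> {x j, y j} = {}" if "i \<in> I" "j \<in> I" "i \<noteq> j" for i j using pr that by (auto simp: pairs_def)
  define R where "R = {i \<in> I. \<not> E (x i) (y i)}"
  define Nn where "Nn i = (?N (x i) \<inter> ?N (y i)) - W" for i
  have finR: "finite R" "R \<subseteq> I" using finI by (auto simp: R_def)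
  have finN: "finite (Nn i)" for i using fin by (simp add: Nn_def)
  \<comment> \<open>\<open>J\<close> contains all pairs left without a common neighbour of their
    own, and the common neighbours of pairs in \<open>J\<close> are all in use.\<close>
  obtain R0 J f where H: "R0 \<subseteq> R" "J \<subseteq> R" "R - R0 \<subseteq> J" "inj_on f R0" "\<And>i. i \<in> R0 \<Longrightarrow> f i \<in> Nn i"
    "f ` (R0 \<inter> J) = (\<Union>i\<in>J. Nn i)"
    by (rule hall_defect[OF finR(1), of Nn], rule finN, rule that)
  define Y where "Y = (\<Union>i\<in>J. Nn i)"
  \<comment> \<open>No vertex of \<open>F\<close> is adjacent to both ends of a pair in
    \<open>J\<close>.\<close>
  define F where "F = D - W - Y"
  define d where "d = card (R - R0)"
  have finJ: "finite J" and finR0: "finite R0" using finite_subset[OF H(2) finR(1)] finite_subset[OF H(1) finR(1)] by auto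
  have finF: "finite F" and finY: "finite Y" using fin finN finJ by (auto simp: F_def Y_def)
  have cY: "card Y = card (R0 \<inter> J)"
    unfolding Y_def H(6)[symmetric] using H(4) by (intro card_image) (auto simp: inj_on_def)
  have cJ: "card J = card Y + d"
  proof -
    have "J = (R0 \<inter> J) \<union> (R - R0)" using H by auto
    then have "card J = card (R0 \<inter> J) + card (R - R0)"
      by (metis Diff_disjoint Int_assoc Int_commute card_Un_disjoint finJ finR(1) finite_Diff finite_Int inf_bot_right)
    then show ?thesis using cY d_def by simp
  qed
  have cR: "card (R0 - J) + card J \<le> card I"
  proof -
    have "card (R0 - J) + card J = card ((R0 - J) \<union> J)"
      by (rule card_Un_disjoint[symmetric]) (use finR0 finJ in auto)
    also have "\<dots> \<le> card I" by (rule card_mono) (use H finR finI in auto)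
    finally show ?thesis .
  qed
  have NW: "W \<inter> Y = {}" "Y \<subseteq> D" by (auto simp: Y_def Nn_def nbrs_def)
  have cF: "card F + card W + card Y = card D"
  proof -
    have "card D = card (F \<union> (W \<union> Y))" using W NW by (intro arg_cong[of _ _ card]) (auto simp: F_def)
    also have "\<dots> = card F + card (W \<union> Y)" by (rule card_Un_disjoint) (use finF finW finY in \<open>auto simp: F_def\<close>)
    also have "card (W \<union> Y) = card W + card Y" by (rule card_Un_disjoint) (use finW finY NW in auto)
    finally show ?thesis by simp
  qed
  have key: "\<exists>X. X \<subseteq> F - U \<and> card X \<le> 3 \<and> conn E ({x i, y i} \<union> X)"
    if i: "i \<in> R - R0" and U: "U \<subseteq> F" "card U + 3 \<le> card (R0 - J) + 3 * card (R - R0)" for i U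
  proof -
    have iJ: "i \<in> J" "i \<in> I" "i \<in> R" using i H finR by auto
    have xi: "x i \<in> D" "y i \<in> D" "x i \<in> W" "y i \<in> W" "x i \<noteq> y i" "\<not> E (x i) (y i)" "\<not> E (y i) (x i)"
      using xy[OF iJ(2)] W iJ(3) symE by (auto simp: R_def)
    have d1: "1 \<le> d" unfolding d_def using i finR by (metis One_nat_def Suc_leI card_gt_0_iff empty_iff finite_Diff)
    \<comment> \<open>The common neighbours of a pair left over all lie in \<open>W\<close> or
      \<open>Y\<close>; since there are many of them, \<open>Y\<close> is large.\<close>
    have cY4: "\<mu> + 4 \<le> card Y + card W"
    proof -
      let ?D = "D - {x i, y i}"
      have "?N (x i) \<subseteq> ?D" "?N (y i) \<subseteq> ?D" using xi irrE by (auto simp: nbrs_def)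
      then have "card (?N (x i)) + card (?N (y i)) \<le> card (?N (x i) \<inter> ?N (y i)) + card ?D"
        using fin by (intro card_Int_ge) auto
      moreover have "card ?D + 2 = card D"
        using xi fin card_Diff_subset[of "{x i, y i}" D] card_mono[of D "{x i, y i}"] by auto
      ultimately have "\<mu> + 2 \<le> card (?N (x i) \<inter> ?N (y i))" using dens deg[OF xi(1)] deg[OF xi(2)] by linarith
      also have "\<dots> \<le> card (Nn i \<union> (W - {x i, y i}))"
        by (rule card_mono) (use finN finW xi irrE in \<open>auto simp: Nn_def nbrs_def\<close>)
      also have "\<dots> \<le> card (Nn i) + card (W - {x i, y i})" by (rule card_Un_le)
      finally have "\<mu> + 2 \<le> card (Nn i) + card (W - {x i, y i})" .
      moreover have "card (W - {x i, y i}) + 2 = card W"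
        using xi finW card_Diff_subset[of "{x i, y i}" W] card_mono[of W "{x i, y i}"] by auto
      moreover have "card (Nn i) \<le> card Y" using iJ finY by (intro card_mono) (auto simp: Y_def)
      ultimately show ?thesis by linarith
    qed
    \<comment> \<open>A vertex of \<open>F\<close> misses an end of every pair in \<open>J\<close>,
      so it loses at most \<open>card W - card J\<close> neighbours to \<open>W\<close>; the gain
      outweighs \<open>Y\<close> by \<open>d\<close>.\<close>
    have degF: "\<delta> + d \<le> card (?N f \<inter> F) + card W" if f: "f \<in> F" for f
    proof -
      have fD: "f \<in> D" "f \<notin> W" "f \<notin> Y" using f by (auto simp: F_def)
      define g where "g h = (if E f (x h) then y h else x h)" for h
      have gn: "g h \<in> W - ?N f" if "h \<in> J" for h
      proof -
        have hI: "h \<in> I" using that H finR by auto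
        have "\<not> (E f (x h) \<and> E f (y h))"
        proof
          assume "E f (x h) \<and> E f (y h)"
          then have "f \<in> Nn h" using fD xy[OF hI] symE by (auto simp: Nn_def nbrs_def)
          then show False using fD that by (auto simp: Y_def)
        qed
        then show ?thesis using xy[OF hI] by (auto simp: g_def nbrs_def)
      qed
      have "inj_on g J"
      proof (rule inj_onI)
        fix a b assume ab: "a \<in> J" "b \<in> J" "g a = g b"
        show "a = b"
        proof (rule ccontr)
          assume "a \<noteq> b"
          moreover have "a \<in> I" "b \<in> I" using subsetD[OF H(2)] subsetD[OF finR(2)] ab(1,2) by simp_all
          ultimately have "{x a, y a} \<inter> {x b, y b} = {}" using xyd by simp
          then show False using ab(3) by (auto simp: g_def split: if_splits)
        qed
      qed
      then have "card J = card (g ` J)" by (simp add: card_image)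
      also have "\<dots> \<le> card (W - ?N f)" by (rule card_mono) (use finW gn in auto)
      finally have a: "card J \<le> card (W - ?N f)" .
      have b: "card (W \<inter> ?N f) + card (W - ?N f) = card W"
        using finW by (metis card_Int_Diff add.commute card_Diff_subset_Int)
      have "?N f \<subseteq> (?N f \<inter> F) \<union> (W \<inter> ?N f) \<union> Y" by (auto simp: F_def nbrs_def)
      then have "card (?N f) \<le> card ((?N f \<inter> F) \<union> (W \<inter> ?N f) \<union> Y)"
        using finF finW finY by (intro card_mono) auto
      also have "\<dots> \<le> card (?N f \<inter> F) + card (W \<inter> ?N f) + card Y"
        using card_Un_le[of "(?N f \<inter> F) \<union> (W \<inter> ?N f)" Y] card_Un_le[of "?N f \<inter> F" "W \<inter> ?N f"] by linarith
      finally show ?thesis using deg[OF fD(1)] a b cJ by linarith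
    qed
    have rK: "card J \<le> K" using cR rI W(2) by linarith
    have "0 < card F" using cF big rK W(2) cJ d1 by linarith
    then obtain f0 where f0: "f0 \<in> F" by (metis card.empty ex_in_conv less_numeral_extra(3))
    have "card (?N f0 \<inter> F) < card F"
      using finF f0 irrE by (intro psubset_card_mono) (auto simp: nbrs_def)
    then have \<delta>big: "\<mu> + card J + 1 \<le> \<delta>" using degF[OF f0] cF dens cJ by linarith
    have cU: "card U + 3 \<le> card (R0 - J) + 3 * d" using U d_def by simp
    \<comment> \<open>This estimate determines the hypothesis \<open>8 * K < 3 * \<mu> + 14\<close>:
      insert \<open>card J = card Y + d\<close>, the bound \<open>cY4\<close>, and
      \<open>card I \<le> K\<close>, \<open>card W \<le> 2 * K\<close>.\<close>
    have see: "\<exists>z. z \<in> ?N v \<inter> F - U" if v: "v \<in> {x i, y i}" for v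
    proof -
      have vD: "v \<in> D" using v xi by auto
      have "?N v \<subseteq> (?N v \<inter> F) \<union> (W - {x i, y i}) \<union> Y"
        using v xi irrE by (auto simp: F_def nbrs_def)
      then have "card (?N v) \<le> card ((?N v \<inter> F) \<union> (W - {x i, y i}) \<union> Y)"
        using finF finW finY by (intro card_mono) auto
      also have "\<dots> \<le> card (?N v \<inter> F) + card (W - {x i, y i}) + card Y"
        using card_Un_le[of "(?N v \<inter> F) \<union> (W - {x i, y i})" Y] card_Un_le[of "?N v \<inter> F" "W - {x i, y i}"] by linarith
      finally have "\<delta> \<le> card (?N v \<inter> F) + card (W - {x i, y i}) + card Y" using deg[OF vD] by linarith
      moreover have "card (W - {x i, y i}) + 2 = card W"
        using xi finW card_Diff_subset[of "{x i, y i}" W] card_mono[of W "{x i, y i}"] by auto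
      ultimately have "card U < card (?N v \<inter> F)"
        using \<delta>big cU cJ cR cY4 rI W(2) mu by linarith
      then show ?thesis using finF U(1) by (metis Diff_eq_empty_iff card_mono ex_in_conv finite_subset leD)
    qed
    obtain z where z: "E (x i) z" "z \<in> F" "z \<notin> U" using see[of "x i"] by (auto simp: nbrs_def)
    obtain z' where z': "E (y i) z'" "z' \<in> F" "z' \<notin> U" using see[of "y i"] by (auto simp: nbrs_def)
    have noc: "\<not> (E (x i) g \<and> E (y i) g)" if "g \<in> F" for g
      using that iJ by (auto simp: F_def Y_def Nn_def nbrs_def)
    have zz: "z \<noteq> z'" using noc[OF z(2)] z z' by auto
    show ?thesis
    proof (cases "E z z'")
      case True
      have a: "conn E (insert z {x i})" by (rule conn_insert[OF sym conn_singleton _ z(1)]) simp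
      have b: "conn E (insert z' (insert z {x i}))" by (rule conn_insert[OF sym a _ True]) simp
      have "conn E (insert (y i) (insert z' (insert z {x i})))"
        by (rule conn_insert[OF sym b, of z']) (use z' symE in auto)
      then have "conn E ({x i, y i} \<union> {z, z'})" by (simp add: insert_commute)
      then show ?thesis using z z' zz by (intro exI[of _ "{z, z'}"]) auto
    next
      case False
      let ?A = "?N z \<inter> F" and ?B = "?N z' \<inter> F"
      have "?A \<subseteq> F - {z, z'}" "?B \<subseteq> F - {z, z'}" using False irrE symE by (auto simp: nbrs_def)
      then have "card ?A + card ?B \<le> card (?A \<inter> ?B) + card (F - {z, z'})" using finF by (intro card_Int_ge) auto
      moreover have "card (F - {z, z'}) + 2 = card F"
        using z z' zz finF card_Diff_subset[of "{z, z'}" F] card_mono[of F "{z, z'}"] by auto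
      \<comment> \<open>The outer inner vertices \<open>z\<close> and \<open>z'\<close> have enough
        common neighbours in \<open>F\<close> to find one outside \<open>U\<close>.\<close>
      ultimately have "card U < card (?A \<inter> ?B)"
        using degF[OF z(2)] degF[OF z'(2)] cF cU cJ cR cY4 rI W(2) mu dens by linarith
      then have "\<exists>g. g \<in> ?A \<inter> ?B - U" using finF U(1)
        by (metis Diff_eq_empty_iff card_mono ex_in_conv finite_subset leD)
      then obtain g where g: "E z g" "E z' g" "g \<in> F" "g \<notin> U" by (auto simp: nbrs_def)
      have a: "conn E (insert z {x i})" by (rule conn_insert[OF sym conn_singleton _ z(1)]) simp
      have b: "conn E (insert g (insert z {x i}))" by (rule conn_insert[OF sym a _ g(1)]) simp
      have c: "conn E (insert z' (insert g (insert z {x i})))"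
        by (rule conn_insert[OF sym b, of g]) (use g symE in auto)
      have "conn E (insert (y i) (insert z' (insert g (insert z {x i}))))"
        by (rule conn_insert[OF sym c, of z']) (use z' symE in auto)
      then have "conn E ({x i, y i} \<union> {z, z', g})" by (simp add: insert_commute)
      moreover have "card {z, z', g} \<le> 3" by (simp add: card_insert_if)
      ultimately show ?thesis using z z' g by (intro exI[of _ "{z, z', g}"]) auto
    qed
  qed
  have "\<exists>X. (\<forall>i\<in>R - R0. X i \<subseteq> F - f ` (R0 - J) \<and> conn E ({x i, y i} \<union> X i)) \<and> disjoint_family_on X (R - R0)"
  proof (rule greedy_disjoint[of "R - R0" F "f ` (R0 - J)" "card (R0 - J)"])
    show "f ` (R0 - J) \<subseteq> F"
    proof
      fix b assume "b \<in> f ` (R0 - J)"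
      then obtain i where i: "i \<in> R0" "i \<notin> J" "b = f i" by auto
      have "b \<notin> Y"
      proof
        assume "b \<in> Y"
        then have "b \<in> f ` (R0 \<inter> J)" unfolding Y_def H(6) .
        then show False using i inj_onD[OF H(4)] by blast
      qed
      then show "b \<in> F" using H(5)[OF i(1)] i by (auto simp: F_def Nn_def nbrs_def)
    qed
    show "card (f ` (R0 - J)) \<le> card (R0 - J)" using finR0 by (intro card_image_le) auto
    show "finite (R - R0)" "finite F" using finR finF by auto
    show "\<exists>X. X \<subseteq> F - U \<and> card X \<le> 3 \<and> conn E ({x i, y i} \<union> X)"
      if "i \<in> R - R0" "U \<subseteq> F" "card U + 3 \<le> card (R0 - J) + 3 * card (R - R0)" for i U
      using that by (rule key)
  qed
  then obtain X where XX: "\<forall>i\<in>R - R0. X i \<subseteq> F - f ` (R0 - J) \<and> conn E ({x i, y i} \<union> X i)"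
    and Xd: "disjoint_family_on X (R - R0)" by (elim exE conjE) (rule that)
  note X = XX[rule_format]
  define Z where "Z i = (if i \<notin> R then {} else if i \<in> R0 then {f i} else X i)" for i
  define C where "C i = {x i, y i} \<union> Z i" for i
  have ZDW: "Z i \<subseteq> D - W" for i
    using H(5)[of i] X[of i] by (auto simp: Z_def F_def Nn_def nbrs_def)
  have connC: "conn E (C i)" if i: "i \<in> I" for i
  proof -
    consider "i \<notin> R" | "i \<in> R0" "i \<in> R" | "i \<in> R - R0" by blast
    then show ?thesis
    proof cases
      case 1
      then have "E (x i) (y i)" using i by (simp add: R_def)
      then show ?thesis using 1 conn_edge[OF sym] by (simp add: C_def Z_def)
    next
      case 2
      then have "E (x i) (f i)" "E (f i) (y i)" using H(5)[of i] symE by (auto simp: Nn_def nbrs_def)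
      then have e: "E (x i) (f i)" "E (f i) (y i)" by auto
      have a: "conn E (insert (f i) {x i})" by (rule conn_insert[OF sym conn_singleton _ e(1)]) simp
      have "conn E (insert (y i) (insert (f i) {x i}))" by (rule conn_insert[OF sym a _ e(2)]) simp
      then show ?thesis using 2 by (simp add: C_def Z_def insert_commute)
    next
      case 3 then show ?thesis using X[of i] by (auto simp: C_def Z_def)
    qed
  qed
  have Zd: "Z i \<inter> Z j = {}" if ij: "i \<in> I" "j \<in> I" "i \<noteq> j" for i j
  proof -
    have fX: "f a \<notin> X b" if "a \<in> R0" "b \<in> R - R0" for a b
    proof (cases "a \<in> J")
      case True
      then have "f a \<in> Y" using that H(6) unfolding Y_def by blast
      then show ?thesis using X[OF that(2)] by (auto simp: F_def)
    next
      case False then show ?thesis using X[OF that(2)] that by auto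
    qed
    consider "i \<notin> R \<or> j \<notin> R" | "i \<in> R0" "j \<in> R0" "i \<in> R" "j \<in> R" | "i \<in> R0" "j \<in> R - R0" "i \<in> R"
      | "j \<in> R0" "i \<in> R - R0" "j \<in> R" | "i \<in> R - R0" "j \<in> R - R0" by blast
    then show ?thesis
    proof cases
      case 1 then show ?thesis by (auto simp: Z_def)
    next
      case 2 then show ?thesis using ij inj_onD[OF H(4)] by (auto simp: Z_def)
    next
      case 3 then show ?thesis using fX by (auto simp: Z_def)
    next
      case 4 then show ?thesis using fX by (auto simp: Z_def)
    next
      case 5 then show ?thesis using Xd ij by (auto simp: Z_def disjoint_family_on_def)
    qed
  qed
  have "C i \<inter> C j = {}" if ij: "i \<in> I" "j \<in> I" "i \<noteq> j" for i j
    using Zd[OF ij] xyd[OF ij] ZDW[of i] ZDW[of j] xy[OF ij(1)] xy[OF ij(2)] unfolding C_def by blast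
  moreover have "C i \<subseteq> D \<and> x i \<in> C i \<and> y i \<in> C i \<and> conn E (C i) \<and> C i \<inter> W = {x i, y i}" if "i \<in> I" for i
    using connC[OF that] ZDW[of i] xy[OF that] W unfolding C_def by blast
  ultimately show "\<exists>C. (\<forall>i\<in>I. C i \<subseteq> D \<and> x i \<in> C i \<and> y i \<in> C i \<and> conn E (C i) \<and> C i \<inter> W = {x i, y i})
        \<and> disjoint_family_on C I"
    unfolding disjoint_family_on_def by (intro exI[of _ C]) blast
qed

text \<open>The situation in a minimal counterexample: \<open>L\<close> is the closed neighbourhood
  of a vertex of degree at most \<open>2 * c\<close>, and \<open>W\<close> are the terminals to
  which the linking problem has been carried. The degree conditions \<open>h1\<close> and
  \<open>h2\<close> come from \<open>contract_bound\<close>; the term \<open>2 * K\<close> in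
  \<open>h2\<close> accounts for what lies in \<open>W\<close>.\<close>

locale first_level =
  fixes L :: "'a set" and E :: "'a \<Rightarrow> 'a \<Rightarrow> bool" and W :: "'a set" and c K :: nat
    and I :: "nat set" and x y :: "nat \<Rightarrow> 'a"
  assumes fin: "finite L" and sym: "symp E" and irr: "irreflp E"
    and cardL: "card L \<le> 2 * c + 1" and WL: "W \<subseteq> L" and cardW: "card W \<le> 2 * K"
    and h1: "\<And>f. f \<in> L - W \<Longrightarrow> c + 1 \<le> card (nbrs L E f)"
    and h2: "\<And>v. v \<in> W \<Longrightarrow> c + 2 \<le> card (nbrs (L - W) E v) + 2 * K"
    and cK: "6 * K \<le> c + 2" and prs: "pairs x y I W"
begin

lemma symE: "E u v \<longleftrightarrow> E v u" using sym by (auto dest: sympD)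
lemma irrE: "\<not> E v v" using irr by (simp add: irreflp_def)
lemma finW: "finite W" using WL fin finite_subset by blast
lemma finI: "finite I" using prs by (simp add: pairs_def)
lemma r2: "2 * card I \<le> card W" by (rule pairs_card[OF prs finW])
lemma xy: "i \<in> I \<Longrightarrow> x i \<in> W \<and> y i \<in> W \<and> x i \<noteq> y i" using prs by (simp add: pairs_def)
lemma xyd: "i \<in> I \<Longrightarrow> h \<in> I \<Longrightarrow> i \<noteq> h \<Longrightarrow> {x i, y i} \<inter> {x h, y h} = {}"
  using prs by (simp add: pairs_def)

definition link_system :: "nat set \<Rightarrow> (nat \<Rightarrow> 'a list) \<Rightarrow> bool" where
  "link_system J P \<longleftrightarrow> (\<forall>i\<in>J. gpath E (P i) \<and> hd (P i) = x i \<and> last (P i) = y i \<and> set (P i) \<subseteq> L \<and>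
     set (P i) \<inter> W = {x i, y i}) \<and> disjoint_family_on (\<lambda>i. set (P i)) J"

definition total_length :: "nat set \<Rightarrow> (nat \<Rightarrow> 'a list) \<Rightarrow> nat" where
  "total_length J P = (\<Sum>i\<in>J. length (P i))"

definition Free :: "nat set \<Rightarrow> (nat \<Rightarrow> 'a list) \<Rightarrow> 'a set" where
  "Free J P = L - W - (\<Union>i\<in>J. set (P i))"

lemma finFree: "finite (Free J P)" using fin by (simp add: Free_def)

lemma link_systemD:
  assumes "link_system J P" "i \<in> J"
  shows "gpath E (P i)" "hd (P i) = x i" "last (P i) = y i" "set (P i) \<subseteq> L" "set (P i) \<inter> W = {x i, y i}"
    "P i \<noteq> []" "distinct (P i)"
  using assms by (auto simp: link_system_def gpath_def)

lemma link_system_disj: "link_system J P \<Longrightarrow> i \<in> J \<Longrightarrow> h \<in> J \<Longrightarrow> i \<noteq> h \<Longrightarrow> set (P i) \<inter> set (P h) = {}"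
  by (auto simp: link_system_def disjoint_family_on_def)

lemma link_system_replace:
  assumes S: "link_system J P" and i: "i \<in> J" "i \<in> I" and f: "f \<in> Free J P"
    and q: "gpath E q" "hd q = x i" "last q = y i" "set q \<subseteq> insert f (set (P i))"
  shows "link_system J (P(i := q))"
proof -
  have fi: "f \<in> L" "f \<notin> W" "f \<notin> set (P h)" if "h \<in> J" for h using f that by (auto simp: Free_def)
  have "x i \<in> set q" "y i \<in> set q" using q by (metis gpath_def hd_in_set, metis gpath_def last_in_set)
  then have W: "set q \<inter> W = {x i, y i}"
    using q(4) link_systemD(5)[OF S i(1)] fi[OF i(1)] xy[OF i(2)] by blast
  have QL: "set q \<subseteq> L" using q(4) link_systemD(4)[OF S i(1)] fi[OF i(1)] by blast
  have d: "set q \<inter> set (P h) = {}" if "h \<in> J" "h \<noteq> i" for h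
    using link_system_disj[OF S that(1) i(1) that(2)] q(4) fi[OF that(1)] by blast
  have "disjoint_family_on (\<lambda>h. set ((P(i := q)) h)) J"
    unfolding disjoint_family_on_def
  proof (intro ballI impI)
    fix a b assume ab: "a \<in> J" "b \<in> J" "a \<noteq> b"
    show "set ((P(i := q)) a) \<inter> set ((P(i := q)) b) = {}"
      using d[OF ab(1)] d[OF ab(2)] link_system_disj[OF S ab] ab(3) by (cases "a = i"; cases "b = i") auto
  qed
  moreover have "gpath E ((P(i := q)) h) \<and> hd ((P(i := q)) h) = x h \<and> last ((P(i := q)) h) = y h \<and>
     set ((P(i := q)) h) \<subseteq> L \<and> set ((P(i := q)) h) \<inter> W = {x h, y h}" if "h \<in> J" for h
    using q W QL link_systemD[OF S that] by (cases "h = i") simp_all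
  ultimately show ?thesis by (simp add: link_system_def)
qed

lemma total_length_update: "finite J \<Longrightarrow> i \<in> J \<Longrightarrow> total_length J (P(i := q)) + length (P i) = total_length J P + length q"
  unfolding total_length_def by (simp add: sum.remove)

lemma link_system_extend:
  assumes S: "link_system J P" and J: "J \<subseteq> I" and i: "i \<in> I - J"
    and X: "X \<subseteq> Free J P" "conn E ({x i, y i} \<union> X)"
  shows "\<exists>p. link_system (insert i J) (P(i := p)) \<and> total_length (insert i J) (P(i := p)) \<le> total_length J P + card X + 2"
proof -
  obtain p where p: "gpath E p" "hd p = x i" "last p = y i" "set p \<subseteq> {x i, y i} \<union> X"
    by (rule conn_gpath[OF X(2), of "x i" "y i"]) auto
  have finX: "finite X" using X(1) finFree finite_subset by blast
  have XF: "X \<inter> W = {}" "X \<subseteq> L" "X \<inter> set (P h) = {}" if "h \<in> J" for h using X(1) that by (auto simp: Free_def)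
  have XW: "X \<inter> W = {}" "X \<subseteq> L" using X(1) by (auto simp: Free_def)
  have xyi: "x i \<in> W" "y i \<in> W" using xy i by auto
  have ends: "x i \<in> set p" "y i \<in> set p" using p by (metis gpath_def hd_in_set, metis gpath_def last_in_set)
  have pW: "set p \<inter> W = {x i, y i}" using ends p(4) XW xyi by blast
  have pL: "set p \<subseteq> L" using p(4) XW xyi WL by blast
  have d: "set p \<inter> set (P h) = {}" if h: "h \<in> J" for h
  proof -
    have "h \<in> I" "h \<noteq> i" using h J i by auto
    then have "{x i, y i} \<inter> {x h, y h} = {}" using xyd i by auto
    then have "{x i, y i} \<inter> set (P h) = {}" using link_systemD(5)[OF S h] xyi by blast
    then show ?thesis using p(4) XF(3)[OF h] by blast
  qed
  have "disjoint_family_on (\<lambda>h. set ((P(i := p)) h)) (insert i J)"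
    unfolding disjoint_family_on_def
  proof (intro ballI impI)
    fix a b assume ab: "a \<in> insert i J" "b \<in> insert i J" "a \<noteq> b"
    show "set ((P(i := p)) a) \<inter> set ((P(i := p)) b) = {}"
      using d[of a] d[of b] link_system_disj[OF S, of a b] ab by (cases "a = i"; cases "b = i") auto
  qed
  moreover have "gpath E ((P(i := p)) h) \<and> hd ((P(i := p)) h) = x h \<and> last ((P(i := p)) h) = y h \<and>
     set ((P(i := p)) h) \<subseteq> L \<and> set ((P(i := p)) h) \<inter> W = {x h, y h}" if "h \<in> insert i J" for h
    using p pW pL link_systemD[OF S, of h] that by (cases "h = i") simp_all
  ultimately have "link_system (insert i J) (P(i := p))" by (simp add: link_system_def)
  moreover have "length p \<le> card X + 2"
  proof -
    have "length p = card (set p)" using p(1) by (simp add: gpath_def distinct_card)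
    also have "\<dots> \<le> card ({x i, y i} \<union> X)" using p(4) finX by (intro card_mono) auto
    also have "\<dots> \<le> card {x i, y i} + card X" by (rule card_Un_le)
    also have "card {x i, y i} \<le> 2" by (simp add: card_insert_if)
    finally show ?thesis by simp
  qed
  moreover have "total_length (insert i J) (P(i := p)) = length p + total_length J P"
  proof -
    have "finite J" using J finI finite_subset by blast
    moreover have "(\<Sum>h\<in>J. length ((P(i := p)) h)) = (\<Sum>h\<in>J. length (P h))"
      using i by (intro sum.cong) auto
    ultimately show ?thesis using i by (simp add: total_length_def)
  qed
  ultimately show ?thesis by (intro exI[of _ p]) simp
qed

section \<open>What free vertices see of a shortest link system\<close>

definition min_system :: "nat set \<Rightarrow> (nat \<Rightarrow> 'a list) \<Rightarrow> bool" where
  "min_system J P \<longleftrightarrow> link_system J P \<and> (\<forall>P'. link_system J P' \<longrightarrow> total_length J P \<le> total_length J P')"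

definition hits :: "'a list \<Rightarrow> 'a \<Rightarrow> nat set" where
  "hits p f = {n. n < length p \<and> E f (p ! n)}"

lemma card_hits: "distinct p \<Longrightarrow> card (nbrs (set p) E f) = card (hits p f)"
proof -
  assume d: "distinct p"
  have "nbrs (set p) E f = (!) p ` hits p f" by (auto simp: nbrs_def hits_def in_set_conv_nth)
  moreover have "inj_on ((!) p) (hits p f)" using d by (auto simp: inj_on_def hits_def nth_eq_iff_index_eq)
  ultimately show ?thesis by (simp add: card_image)
qed

text \<open>Otherwise the detour through \<open>f\<close> would replace at least two inner vertices
  of the path by one.\<close>

lemma hits_near:
  assumes M: "min_system J P" and J: "J \<subseteq> I" and i: "i \<in> J" and f: "f \<in> Free J P"
    and ab: "a \<in> hits (P i) f" "b \<in> hits (P i) f"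
  shows "b < a + 3"
proof (rule ccontr)
  assume n: "\<not> ?thesis"
  have S: "link_system J P" using M by (simp add: min_system_def)
  let ?p = "P i"
  let ?q = "take (Suc a) ?p @ [f] @ drop b ?p"
  have len: "a < length ?p" "b < length ?p" "E f (?p ! a)" "E f (?p ! b)" using ab by (auto simp: hits_def)
  have ff: "f \<notin> set ?p" using f i by (auto simp: Free_def)
  note sd = link_systemD[OF S i]
  have g1: "gpath E (take (Suc a) ?p)" and g2: "gpath E (drop b ?p)"
    using sd(1) len append_take_drop_id[of "Suc a" ?p] append_take_drop_id[of b ?p]
    unfolding gpath_def by (metis (no_types, lifting) successively_append_iff distinct_take take_eq_Nil nat.simps(3) sd(6),
      metis (no_types, lifting) successively_append_iff distinct_drop drop_eq_Nil not_less)
  have ne: "take (Suc a) ?p \<noteq> []" "drop b ?p \<noteq> []" using len by auto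
  have l1: "last (take (Suc a) ?p) = ?p ! a" using len by (simp add: take_Suc_conv_app_nth)
  have h1: "hd (drop b ?p) = ?p ! b" using len by (simp add: hd_drop_conv_nth)
  have disj: "set (take (Suc a) ?p) \<inter> set (drop b ?p) = {}"
    using n sd(7) by (intro set_take_disj_set_drop_if_distinct) auto
  have sub: "set (take (Suc a) ?p) \<subseteq> set ?p" "set (drop b ?p) \<subseteq> set ?p" by (auto dest: in_set_takeD in_set_dropD)
  have gf: "gpath E ([f] @ drop b ?p)"
    using g2 ne len ff sub h1 by (subst gpath_append) auto
  have "gpath E ?q"
    using g1 gf ne l1 len ff sub disj symE by (subst gpath_append) auto
  moreover have "hd ?q = x i" using sd len by (simp add: hd_append)
  moreover have "last ?q = y i" using sd len by (simp add: last_append)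
  moreover have "set ?q \<subseteq> insert f (set ?p)" using sub by auto
  ultimately have "link_system J (P(i := ?q))" using link_system_replace[OF S i _ f] i J by blast
  then have "total_length J P \<le> total_length J (P(i := ?q))" using M by (simp add: min_system_def)
  moreover have "finite J" using J finI finite_subset by blast
  ultimately have "length ?p \<le> length ?q" using total_length_update[OF _ i, of P ?q] by simp
  then show False using n len by simp
qed

lemma hits_window:
  assumes M: "min_system J P" and J: "J \<subseteq> I" and i: "i \<in> J" and f: "f \<in> Free J P"
  shows "\<exists>m. hits (P i) f \<subseteq> {m..<m + 3}" "card (nbrs (set (P i)) E f) \<le> 3"
    "card (nbrs (set (P i)) E f) \<le> length (P i)"
proof -
  show w: "\<exists>m. hits (P i) f \<subseteq> {m..<m + 3}"
  proof (cases "hits (P i) f = {}")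
    case False
    have "finite (hits (P i) f)" by (simp add: hits_def)
    then have "Min (hits (P i) f) \<in> hits (P i) f" using False by simp
    then have "hits (P i) f \<subseteq> {Min (hits (P i) f)..<Min (hits (P i) f) + 3}"
      using hits_near[OF M J i f] \<open>finite (hits (P i) f)\<close> by auto
    then show ?thesis by blast
  qed auto
  have S: "link_system J P" using M by (simp add: min_system_def)
  note ch = card_hits[OF link_systemD(7)[OF S i], of f]
  obtain m where "hits (P i) f \<subseteq> {m..<m + 3}" using w by blast
  then have "card (hits (P i) f) \<le> card {m..<m + 3}" by (intro card_mono) auto
  then show "card (nbrs (set (P i)) E f) \<le> 3" using ch by simp
  have "card (hits (P i) f) \<le> card {..<length (P i)}" by (intro card_mono) (auto simp: hits_def)
  then show "card (nbrs (set (P i)) E f) \<le> length (P i)" using ch by simp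
qed

lemma len2: "link_system J P \<Longrightarrow> J \<subseteq> I \<Longrightarrow> i \<in> J \<Longrightarrow> 2 \<le> length (P i)"
proof -
  assume a: "link_system J P" "J \<subseteq> I" "i \<in> J"
  have "hd (P i) \<noteq> last (P i)" using link_systemD[OF a(1,3)] xy a by auto
  then show ?thesis using link_systemD(6)[OF a(1,3)] by (cases "P i"; cases "tl (P i)") auto
qed

text \<open>The ends of the paths are counted in \<open>card W\<close> and again in
  \<open>total_length\<close>; this is the term \<open>2 * card J\<close>.\<close>

lemma card_Free:
  assumes S: "link_system J P" and J: "J \<subseteq> I"
  shows "card (Free J P) + card W + total_length J P = card L + 2 * card J"
proof -
  have finJ: "finite J" using J finI finite_subset by blast
  let ?U = "\<Union>i\<in>J. set (P i)"
  have "card ?U = (\<Sum>i\<in>J. card (set (P i)))"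
    by (rule card_UN_disjoint) (use finJ link_system_disj[OF S] in auto)
  also have "\<dots> = total_length J P" unfolding total_length_def
    by (rule sum.cong) (use link_systemD(7)[OF S] in \<open>auto simp: distinct_card\<close>)
  finally have cU: "card ?U = total_length J P" .
  have "?U \<inter> W = (\<Union>i\<in>J. {x i, y i})" using link_systemD(5)[OF S] by blast
  moreover have "card (\<Union>i\<in>J. {x i, y i}) = (\<Sum>i\<in>J. card {x i, y i})"
    by (rule card_UN_disjoint) (use finJ xyd J in blast)+
  moreover have "(\<Sum>i\<in>J. card {x i, y i}) = (\<Sum>i\<in>J. 2)"
    by (rule sum.cong) (use xy J in auto)
  ultimately have cI: "card (?U \<inter> W) = 2 * card J" by simp
  have finU: "finite ?U" using finJ by auto
  have "?U \<union> W \<subseteq> L" using link_systemD(4)[OF S] WL by blast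
  moreover have "Free J P = L - (?U \<union> W)" by (auto simp: Free_def)
  ultimately have "card (Free J P) + card (?U \<union> W) = card L"
    using fin finU finW card_mono[of L "?U \<union> W"] by (simp add: card_Diff_subset)
  moreover have "card ?U + card W = card (?U \<union> W) + card (?U \<inter> W)" by (rule card_Un_Int[OF finU finW])
  ultimately show ?thesis using cU cI by linarith
qed

text \<open>The invariant in \<open>linked_or_dense\<close> lets the total length grow by six for
  each linked pair, with a reserve of two. Joining through four free vertices costs six with the two
  ends; joining through six costs eight and is affordable while the reserve is untouched.\<close>

definition open_pairs :: "nat set \<Rightarrow> (nat \<Rightarrow> 'a list) \<Rightarrow> bool" where
  "open_pairs J P \<longleftrightarrow> (\<forall>i\<in>I - J. \<forall>X. X \<subseteq> Free J P \<longrightarrow>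
     card X \<le> 4 \<or> card X \<le> 6 \<and> total_length J P + 2 * card I \<le> 6 * card J + card W \<longrightarrow> \<not> conn E ({x i, y i} \<union> X))"

abbreviation closed_nbrs :: "'a set \<Rightarrow> 'a \<Rightarrow> 'a set" where "closed_nbrs F f \<equiv> insert f (nbrs F E f)"

lemma conn_chain3: "E u z \<Longrightarrow> E v z \<Longrightarrow> conn E ({u, v} \<union> {z})"
  using conn_insert[OF sym conn_insert[OF sym conn_singleton[of E u], of u z], of z v] symE
  by (simp add: insert_commute)

lemma conn_closed_nbrs: "z \<in> F \<Longrightarrow> g \<in> closed_nbrs F z \<Longrightarrow> conn E {z, g}"
  using conn_edge[OF sym, of z g] by (auto simp: nbrs_def)

text \<open>A free vertex adjacent to both ends of an open pair would join that pair, so it misses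
  one end of each pair outside \<open>J\<close>.\<close>

lemma degree_into_Free:
  assumes S: "link_system J P" and J: "J \<subseteq> I" and op: "open_pairs J P" and f: "f \<in> Free J P"
  shows "c + 1 + card J + card I \<le> card (nbrs (Free J P) E f) + (\<Sum>i\<in>J. card (nbrs (set (P i)) E f)) + card W"
proof -
  have finJ: "finite J" using J finI finite_subset by blast
  let ?F = "Free J P" and ?N = "nbrs L E f"
  define W1 where "W1 = (\<Union>i\<in>J. {x i, y i})"
  have W1: "W1 \<subseteq> W" "finite W1" using xy J finJ by (auto simp: W1_def)
  have cW1: "card W1 = 2 * card J"
  proof -
    have "card W1 = (\<Sum>i\<in>J. card {x i, y i})" unfolding W1_def
      by (rule card_UN_disjoint) (use finJ xyd J in blast)+
    also have "\<dots> = (\<Sum>i\<in>J. 2)" by (rule sum.cong) (use xy J in auto)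
    finally show ?thesis by simp
  qed
  define g where "g i = (if E f (x i) then y i else x i)" for i
  have gn: "g i \<in> W - W1 - ?N" if i: "i \<in> I - J" for i
  proof -
    have "\<not> (E f (x i) \<and> E f (y i))"
    proof
      assume "E f (x i) \<and> E f (y i)"
      then have "conn E ({x i, y i} \<union> {f})" using symE by (intro conn_chain3) auto
      moreover have "{f} \<subseteq> Free J P" "card {f} \<le> 4" using f by auto
      ultimately show False using op i unfolding open_pairs_def by blast
    qed
    moreover have "{x i, y i} \<inter> W1 = {}" using xyd i J unfolding W1_def by blast
    ultimately show ?thesis using xy[of i] i by (auto simp: g_def nbrs_def)
  qed
  have "inj_on g (I - J)"
  proof (rule inj_onI)
    fix a b assume ab: "a \<in> I - J" "b \<in> I - J" "g a = g b"
    show "a = b"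
    proof (rule ccontr)
      assume "a \<noteq> b"
      then have "{x a, y a} \<inter> {x b, y b} = {}" using xyd ab by simp
      then show False using ab(3) by (auto simp: g_def split: if_splits)
    qed
  qed
  then have "card (I - J) = card (g ` (I - J))" by (simp add: card_image)
  also have "\<dots> \<le> card (W - W1 - ?N)" by (rule card_mono) (use finW gn in auto)
  finally have a: "card (I - J) \<le> card (W - W1 - ?N)" .
  have cIJ: "card (I - J) + card J = card I"
    using J finI finJ by (simp add: card_Diff_subset card_mono)
  have b: "card ((W - W1) \<inter> ?N) + card (W - W1 - ?N) = card (W - W1)"
    using finW by (metis card_Int_Diff add.commute card_Diff_subset_Int finite_Diff)
  have c: "card (W - W1) + card W1 = card W" using W1 finW by (simp add: card_Diff_subset card_mono)
  have "?N \<subseteq> nbrs ?F E f \<union> ((W - W1) \<inter> ?N) \<union> (\<Union>i\<in>J. nbrs (set (P i)) E f)"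
  proof
    fix v assume v: "v \<in> ?N"
    consider "v \<in> ?F" | "v \<in> W - W1" | "v \<in> W1" | i where "i \<in> J" "v \<in> set (P i)"
      using v by (auto simp: nbrs_def Free_def)
    then show "v \<in> nbrs ?F E f \<union> ((W - W1) \<inter> ?N) \<union> (\<Union>i\<in>J. nbrs (set (P i)) E f)"
    proof cases
      case 3
      then obtain i where "i \<in> J" "v \<in> {x i, y i}" by (auto simp: W1_def)
      then have "i \<in> J" "v \<in> set (P i)" using link_systemD(5)[OF S, of i] by auto
      then show ?thesis using v by (auto simp: nbrs_def)
    qed (use v in \<open>auto simp: nbrs_def\<close>)
  qed
  then have "card ?N \<le> card (nbrs ?F E f \<union> ((W - W1) \<inter> ?N) \<union> (\<Union>i\<in>J. nbrs (set (P i)) E f))"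
    by (rule card_mono[rotated]) (use finFree finW finJ in \<open>auto simp: nbrs_def\<close>)
  also have "\<dots> \<le> card (nbrs ?F E f) + card ((W - W1) \<inter> ?N) + card (\<Union>i\<in>J. nbrs (set (P i)) E f)"
    using card_Un_le[of "nbrs ?F E f \<union> ((W - W1) \<inter> ?N)" "\<Union>i\<in>J. nbrs (set (P i)) E f"]
      card_Un_le[of "nbrs ?F E f" "(W - W1) \<inter> ?N"] by linarith
  also have "card (\<Union>i\<in>J. nbrs (set (P i)) E f) \<le> (\<Sum>i\<in>J. card (nbrs (set (P i)) E f))"
    by (rule card_UN_le[OF finJ])
  finally have "card ?N \<le> card (nbrs ?F E f) + card ((W - W1) \<inter> ?N) + (\<Sum>i\<in>J. card (nbrs (set (P i)) E f))" by simp
  moreover have "c + 1 \<le> card ?N" using h1 f by (auto simp: Free_def)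
  ultimately show ?thesis using a b c cW1 cIJ by linarith
qed

text \<open>By \<open>hits_window\<close> this bounds the number of path vertices that a free vertex
  sees.\<close>

definition capped_length :: "nat set \<Rightarrow> (nat \<Rightarrow> 'a list) \<Rightarrow> nat" where
  "capped_length J P = (\<Sum>i\<in>J. min 3 (length (P i)))"

lemma capped_length_bounds:
  assumes "link_system J P" "J \<subseteq> I"
  shows "3 * capped_length J P \<le> total_length J P + 6 * card J" "capped_length J P \<le> 3 * card J"
proof -
  have "3 * capped_length J P = (\<Sum>i\<in>J. 3 * min 3 (length (P i)))" by (simp add: capped_length_def sum_distrib_left)
  also have "\<dots> \<le> (\<Sum>i\<in>J. length (P i) + 6)" by (intro sum_mono) auto
  finally show "3 * capped_length J P \<le> total_length J P + 6 * card J" by (simp add: total_length_def sum.distrib)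
  have "capped_length J P \<le> (\<Sum>i\<in>J. 3)" unfolding capped_length_def by (intro sum_mono) auto
  then show "capped_length J P \<le> 3 * card J" by simp
qed

lemma card_closed_nbrs:
  assumes M: "min_system J P" and J: "J \<subseteq> I" and op: "open_pairs J P" and f: "f \<in> Free J P"
  shows "c + 2 + card J + card I \<le> card (closed_nbrs (Free J P) f) + capped_length J P + card W"
    "finite (closed_nbrs (Free J P) f)" "closed_nbrs (Free J P) f \<subseteq> Free J P"
    "card (closed_nbrs (Free J P) f) = Suc (card (nbrs (Free J P) E f))"
proof -
  have S: "link_system J P" using M by (simp add: min_system_def)
  have "(\<Sum>i\<in>J. card (nbrs (set (P i)) E f)) \<le> capped_length J P" unfolding capped_length_def
    using hits_window(2,3)[OF M J _ f] by (intro sum_mono) auto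
  moreover show c: "card (closed_nbrs (Free J P) f) = Suc (card (nbrs (Free J P) E f))"
    using finFree irrE by (intro card_insert_disjoint) (auto simp: nbrs_def)
  ultimately show "c + 2 + card J + card I \<le> card (closed_nbrs (Free J P) f) + capped_length J P + card W"
    using degree_into_Free[OF S J op f] by linarith
  show "finite (closed_nbrs (Free J P) f)" "closed_nbrs (Free J P) f \<subseteq> Free J P" using finFree f by (auto simp: nbrs_def)
qed

text \<open>Adding the three bounds of \<open>card_closed_nbrs\<close> and using
  \<open>3 * min 3 n \<le> n + 6\<close>, the total length cancels against \<open>card_Free\<close>.
  What remains is the hypothesis \<open>6 * K \<le> c + 2\<close>, with a surplus of 8.\<close>

lemma three_closures:
  assumes M: "min_system J P" and J: "J \<subseteq> I" and JI: "card J < card I" and op: "open_pairs J P"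
    and f: "u \<in> Free J P" "v \<in> Free J P" "w \<in> Free J P"
  shows "card (Free J P) + 8 \<le> card (closed_nbrs (Free J P) u) + card (closed_nbrs (Free J P) v) + card (closed_nbrs (Free J P) w)"
proof -
  have S: "link_system J P" using M by (simp add: min_system_def)
  show ?thesis
    using card_closed_nbrs(1)[OF M J op f(1)] card_closed_nbrs(1)[OF M J op f(2)] card_closed_nbrs(1)[OF M J op f(3)]
      capped_length_bounds(1)[OF S J] card_Free[OF S J] cardL JI r2 cardW cK by linarith
qed

text \<open>When no further pair can be joined cheaply, closed neighbourhoods of three free vertices cannot be
  disjoint, so the free vertices fall into two dense parts with no edges in between.\<close>

definition free_split :: "nat set \<Rightarrow> (nat \<Rightarrow> 'a list) \<Rightarrow> 'a \<Rightarrow> 'a \<Rightarrow> 'a set \<Rightarrow> 'a set \<Rightarrow> bool" where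
  "free_split J P s t D1 D2 \<longleftrightarrow> D1 \<union> D2 = Free J P \<and> D1 \<inter> D2 = {} \<and> (\<forall>u\<in>D1. \<forall>v\<in>D2. \<not> E u v) \<and>
     nbrs (Free J P) E s \<subseteq> D1 \<and> nbrs (Free J P) E t \<subseteq> D2 \<and>
     2 \<le> card (nbrs (Free J P) E s) \<and> 2 \<le> card (nbrs (Free J P) E t) \<and>
     (\<forall>u\<in>D1. \<forall>v\<in>D1. 2 \<le> card (closed_nbrs (Free J P) u \<inter> closed_nbrs (Free J P) v)) \<and>
     (\<forall>u\<in>D2. \<forall>v\<in>D2. 2 \<le> card (closed_nbrs (Free J P) u \<inter> closed_nbrs (Free J P) v))"

lemma free_split_commute: "free_split J P s t D1 D2 \<Longrightarrow> free_split J P t s D2 D1"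
  unfolding free_split_def using symE by (simp add: Un_commute Int_commute) blast

text \<open>The length invariant bounds the number of inner path vertices, which are the only
  neighbours in \<open>L - W\<close> that are not free.\<close>

lemma sees_free:
  assumes S: "link_system J P" and J: "J \<subseteq> I" and JI: "card J < card I"
    and t: "total_length J P + 2 * card I \<le> 6 * card J + card W + 2" and v: "v \<in> W"
  shows "2 \<le> card (nbrs (Free J P) E v)"
proof -
  have finJ: "finite J" using J finI finite_subset by blast
  let ?B = "(\<Union>i\<in>J. set (P i)) - W"
  have "nbrs (L - W) E v \<subseteq> nbrs (Free J P) E v \<union> ?B" by (auto simp: nbrs_def Free_def)
  then have "card (nbrs (L - W) E v) \<le> card (nbrs (Free J P) E v \<union> ?B)"
    by (rule card_mono[rotated]) (use finFree finJ in auto)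
  also have "\<dots> \<le> card (nbrs (Free J P) E v) + card ?B" by (rule card_Un_le)
  finally have 1: "card (nbrs (L - W) E v) \<le> card (nbrs (Free J P) E v) + card ?B" .
  have "?B \<union> Free J P \<union> W = L" "?B \<inter> Free J P = {}" using link_systemD(4)[OF S] WL by (auto simp: Free_def)
  then have "card L = card (?B \<union> Free J P \<union> W)" by simp
  also have "\<dots> = card (?B \<union> Free J P) + card W"
    by (rule card_Un_disjoint) (use finFree finJ finW in \<open>auto simp: Free_def\<close>)
  also have "card (?B \<union> Free J P) = card ?B + card (Free J P)"
    by (rule card_Un_disjoint) (use finFree finJ in \<open>auto simp: Free_def\<close>)
  finally have "card L = card ?B + card (Free J P) + card W" .
  then have "card ?B + 2 * card J = total_length J P" using card_Free[OF S J] by linarith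
  then show ?thesis using 1 h2[OF v] t JI r2 cardW cK by linarith
qed

lemma conn_Un_common: "conn E C \<Longrightarrow> conn E D \<Longrightarrow> z \<in> C \<Longrightarrow> z \<in> D \<Longrightarrow> conn E (C \<union> D)"
  by (rule conn_Un) auto

lemma ex_free_split:
  assumes M: "min_system J P" and J: "J \<subseteq> I" and JI: "card J < card I" and op: "open_pairs J P"
    and t: "total_length J P + 2 * card I \<le> 6 * card J + card W + 2" and i: "i \<in> I - J"
  shows "\<exists>D1 D2. free_split J P (x i) (y i) D1 D2"
proof -
  have S: "link_system J P" using M by (simp add: min_system_def)
  let ?F = "Free J P"
  have xyW: "x i \<in> W" "y i \<in> W" using xy i by auto
  note sx = sees_free[OF S J JI t xyW(1)] and sy = sees_free[OF S J JI t xyW(2)]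
  note clc = card_closed_nbrs[OF M J op] and three = three_closures[OF M J JI op]
  have nocon: "\<not> conn E ({x i, y i} \<union> X)" if "X \<subseteq> ?F" "card X \<le> 4" for X
    using op i that unfolding open_pairs_def by blast
  \<comment> \<open>Overlapping closed neighbourhoods of \<open>z1\<close> and \<open>z2\<close>
    would join the pair through three free vertices.\<close>
  have ncl: "False" if z: "z1 \<in> nbrs ?F E (x i)" "z2 \<in> nbrs ?F E (y i)" "g \<in> closed_nbrs ?F z1" "g \<in> closed_nbrs ?F z2" for z1 z2 g
  proof -
    have zF: "z1 \<in> ?F" "z2 \<in> ?F" "E (x i) z1" "E (y i) z2" using z by (auto simp: nbrs_def)
    have "conn E ({x i, z1} \<union> {z1, g})" by (rule conn_Un_common[OF conn_edge[OF sym zF(3)] conn_closed_nbrs[OF zF(1) z(3)], of z1]) auto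
    moreover have "conn E ({y i, z2} \<union> {z2, g})" by (rule conn_Un_common[OF conn_edge[OF sym zF(4)] conn_closed_nbrs[OF zF(2) z(4)], of z2]) auto
    ultimately have "conn E (({x i, z1} \<union> {z1, g}) \<union> ({y i, z2} \<union> {z2, g}))" by (rule conn_Un_common[of _ _ g]) auto
    moreover have "({x i, z1} \<union> {z1, g}) \<union> ({y i, z2} \<union> {z2, g}) = {x i, y i} \<union> {z1, z2, g}" by auto
    ultimately have "conn E ({x i, y i} \<union> {z1, z2, g})" by simp
    moreover have "{z1, z2, g} \<subseteq> ?F" using zF clc(3)[OF zF(1)] z(3) by blast
    moreover have "card {z1, z2, g} \<le> 4" by (simp add: card_insert_if)
    ultimately show False using nocon by blast
  qed
  have "nbrs ?F E (x i) \<noteq> {}" "nbrs ?F E (y i) \<noteq> {}" using sx sy by auto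
  then obtain z1 z2 where z: "z1 \<in> nbrs ?F E (x i)" "z2 \<in> nbrs ?F E (y i)" by auto
  have zF: "z1 \<in> ?F" "z2 \<in> ?F" "E (x i) z1" "E (y i) z2" using z by (auto simp: nbrs_def)
  have dis: "closed_nbrs ?F z1 \<inter> closed_nbrs ?F z2 = {}" using ncl[OF z] by blast
  have "card (closed_nbrs ?F z1) + card (closed_nbrs ?F z2) \<le> card ?F"
  proof -
    have "card (closed_nbrs ?F z1) + card (closed_nbrs ?F z2) = card (closed_nbrs ?F z1 \<union> closed_nbrs ?F z2)"
      by (rule card_Un_disjoint[symmetric]) (use clc zF dis in auto)
    also have "\<dots> \<le> card ?F" by (rule card_mono) (use finFree clc(3)[OF zF(1)] clc(3)[OF zF(2)] in auto)
    finally show ?thesis .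
  qed
  \<comment> \<open>Two disjoint closed neighbourhoods among the free vertices force the paths to be
    short. The reserve of two is then intact, and joining sets of six vertices are excluded as
    well.\<close>
  then have small: "total_length J P + 2 * card I \<le> 6 * card J + card W"
    using clc(1)[OF zF(1)] clc(1)[OF zF(2)] capped_length_bounds(2)[OF S J] card_Free[OF S J] cardL by linarith
  have nocon6: "\<not> conn E ({x i, y i} \<union> X)" if "X \<subseteq> ?F" "card X \<le> 6" for X
    using op i that small unfolding open_pairs_def by blast
  \<comment> \<open>Free vertices at distance at most two from \<open>v\<close>. As three closed
    neighbourhoods cannot be pairwise disjoint, those around \<open>z1\<close> and \<open>z2\<close>
    cover all free vertices.\<close>
  define D where "D v = {z \<in> ?F. closed_nbrs ?F z \<inter> closed_nbrs ?F v \<noteq> {}}" for v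
  have two: "closed_nbrs ?F u \<inter> closed_nbrs ?F v \<noteq> {} \<or> closed_nbrs ?F u \<inter> closed_nbrs ?F w \<noteq> {} \<or> closed_nbrs ?F v \<inter> closed_nbrs ?F w \<noteq> {}"
    if uvw: "u \<in> ?F" "v \<in> ?F" "w \<in> ?F" for u v w
  proof (rule ccontr)
    assume n: "\<not> ?thesis"
    have "card (closed_nbrs ?F u) + card (closed_nbrs ?F v) + card (closed_nbrs ?F w) = card (closed_nbrs ?F u \<union> closed_nbrs ?F v) + card (closed_nbrs ?F w)"
      using card_Un_disjoint[OF clc(2)[OF uvw(1)] clc(2)[OF uvw(2)]] n by simp
    also have "\<dots> = card (closed_nbrs ?F u \<union> closed_nbrs ?F v \<union> closed_nbrs ?F w)"
    proof (rule card_Un_disjoint[symmetric])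
      show "finite (closed_nbrs ?F u \<union> closed_nbrs ?F v)" "finite (closed_nbrs ?F w)" using clc(2)[OF uvw(1)] clc(2)[OF uvw(2)] clc(2)[OF uvw(3)] by simp_all
      show "(closed_nbrs ?F u \<union> closed_nbrs ?F v) \<inter> closed_nbrs ?F w = {}" using n by blast
    qed
    also have "\<dots> \<le> card ?F"
      by (rule card_mono[OF finFree]) (use clc(3)[OF uvw(1)] clc(3)[OF uvw(2)] clc(3)[OF uvw(3)] in simp)
    finally show False using three[OF uvw] by linarith
  qed
  have U: "D z1 \<union> D z2 = ?F"
  proof
    show "?F \<subseteq> D z1 \<union> D z2"
    proof
      fix z assume zz: "z \<in> ?F"
      then show "z \<in> D z1 \<union> D z2" using two[OF zz zF(1,2)] dis by (auto simp: D_def)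
    qed
  qed (auto simp: D_def)
  have arm: "conn E ({x i, z1} \<union> {z1, a} \<union> {z, a})" if "z \<in> ?F" "a \<in> closed_nbrs ?F z" "a \<in> closed_nbrs ?F z1" for z a
    by (rule conn_Un_common[OF conn_Un_common[OF conn_edge[OF sym zF(3)] conn_closed_nbrs[OF zF(1) that(3)], of z1] conn_closed_nbrs[OF that(1,2)], of a]) auto
  have arm': "conn E ({y i, z2} \<union> {z2, b} \<union> {z, b})" if "z \<in> ?F" "b \<in> closed_nbrs ?F z" "b \<in> closed_nbrs ?F z2" for z b
    by (rule conn_Un_common[OF conn_Un_common[OF conn_edge[OF sym zF(4)] conn_closed_nbrs[OF zF(2) that(3)], of z2] conn_closed_nbrs[OF that(1,2)], of b]) auto
  have DD: "D z1 \<inter> D z2 = {}"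
  proof (rule ccontr)
    assume "D z1 \<inter> D z2 \<noteq> {}"
    then obtain w a b where w: "w \<in> ?F" "a \<in> closed_nbrs ?F w" "a \<in> closed_nbrs ?F z1" "b \<in> closed_nbrs ?F w" "b \<in> closed_nbrs ?F z2" by (auto simp: D_def)
    have "conn E (({x i, z1} \<union> {z1, a} \<union> {w, a}) \<union> ({y i, z2} \<union> {z2, b} \<union> {w, b}))"
      by (rule conn_Un_common[OF arm[OF w(1,2,3)] arm'[OF w(1,4,5)], of w]) auto
    moreover have "({x i, z1} \<union> {z1, a} \<union> {w, a}) \<union> ({y i, z2} \<union> {z2, b} \<union> {w, b}) = {x i, y i} \<union> {z1, z2, a, b, w}" by auto
    ultimately have "conn E ({x i, y i} \<union> {z1, z2, a, b, w})" by simp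
    moreover have "{z1, z2, a, b, w} \<subseteq> ?F" using zF w clc(3)[OF w(1)] by blast
    moreover have "card {z1, z2, a, b, w} \<le> 6" by (simp add: card_insert_if)
    ultimately show False using nocon6 by blast
  qed
  have noE: "\<not> E u v" if uv: "u \<in> D z1" "v \<in> D z2" for u v
  proof
    assume e: "E u v"
    obtain a where a: "u \<in> ?F" "a \<in> closed_nbrs ?F u" "a \<in> closed_nbrs ?F z1" using uv by (auto simp: D_def)
    obtain b where b: "v \<in> ?F" "b \<in> closed_nbrs ?F v" "b \<in> closed_nbrs ?F z2" using uv by (auto simp: D_def)
    have "conn E (({x i, z1} \<union> {z1, a} \<union> {u, a}) \<union> ({y i, z2} \<union> {z2, b} \<union> {v, b}))"
      by (rule conn_Un_edge[OF sym arm[OF a] arm'[OF b] _ _ e]) auto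
    moreover have "({x i, z1} \<union> {z1, a} \<union> {u, a}) \<union> ({y i, z2} \<union> {z2, b} \<union> {v, b}) = {x i, y i} \<union> {z1, z2, a, b, u, v}" by auto
    ultimately have "conn E ({x i, y i} \<union> {z1, z2, a, b, u, v})" by simp
    moreover have "{z1, z2, a, b, u, v} \<subseteq> ?F" using zF a b clc(3)[OF a(1)] clc(3)[OF b(1)] by blast
    moreover have "card {z1, z2, a, b, u, v} \<le> 6" by (simp add: card_insert_if)
    ultimately show False using nocon6 by blast
  qed
  have nx: "nbrs ?F E (x i) \<subseteq> D z1"
  proof
    fix z assume zx: "z \<in> nbrs ?F E (x i)"
    then have "z \<in> ?F" by (simp add: nbrs_def)
    moreover have "z \<notin> D z2" using ncl[OF zx z(2)] by (auto simp: D_def)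
    ultimately show "z \<in> D z1" using U by blast
  qed
  have ny: "nbrs ?F E (y i) \<subseteq> D z2"
  proof
    fix z assume zx: "z \<in> nbrs ?F E (y i)"
    then have "z \<in> ?F" by (simp add: nbrs_def)
    moreover have "z \<notin> D z1" using ncl[OF z(1) zx] by (auto simp: D_def)
    ultimately show "z \<in> D z2" using U by blast
  qed
  have zD: "z1 \<in> D z1" "z2 \<in> D z2" using nx ny z by auto
  \<comment> \<open>The closed neighbourhood of a vertex \<open>w\<close> on the other side fits
    into \<open>D''\<close>; the surplus in \<open>three_closures\<close> is then an overlap of the
    two neighbourhoods in \<open>D'\<close>.\<close>
  have same: "2 \<le> card (closed_nbrs ?F u \<inter> closed_nbrs ?F v)"
    if D': "D' \<union> D'' = ?F" "D' \<inter> D'' = {}" "\<And>a b. a \<in> D' \<Longrightarrow> b \<in> D'' \<Longrightarrow> \<not> E a b" and uvw: "u \<in> D'" "v \<in> D'" "w \<in> D''"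
    for D' D'' u v w
  proof -
    have uF: "u \<in> ?F" "v \<in> ?F" "w \<in> ?F" using uvw D' by auto
    have sub: "closed_nbrs ?F a \<subseteq> D'" if "a \<in> D'" for a using that D' by (auto simp: nbrs_def)
    have sub2: "closed_nbrs ?F w \<subseteq> D''" using uvw D' symE by (auto simp: nbrs_def)
    have finD: "finite D'" "finite D''" using D'(1) finFree by (metis finite_Un)+
    have "card (closed_nbrs ?F u) + card (closed_nbrs ?F v) \<le> card (closed_nbrs ?F u \<inter> closed_nbrs ?F v) + card D'"
      by (rule card_Int_ge) (use finD sub uvw in auto)
    moreover have "card D' + card D'' = card ?F" using D' finD by (metis card_Un_disjoint)
    moreover have "card (closed_nbrs ?F w) \<le> card D''" by (rule card_mono) (use finD sub2 in auto)
    ultimately show ?thesis using three[OF uF] by linarith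
  qed
  have "\<not> E a b" if "a \<in> D z2" "b \<in> D z1" for a b using noE[OF that(2,1)] symE by simp
  then have s2: "2 \<le> card (closed_nbrs ?F u \<inter> closed_nbrs ?F v)" if "u \<in> D z2" "v \<in> D z2" for u v
    using same[of "D z2" "D z1" u v z1] U DD that zD(1) by (simp add: Un_commute Int_commute)
  have "free_split J P (x i) (y i) (D z1) (D z2)"
    unfolding free_split_def using U DD noE nx ny sx sy same[OF U DD noE _ _ zD(2)] s2 by blast
  then show ?thesis by blast
qed


lemma free_split_in:
  assumes "free_split J P s t D1 D2"
  shows "D1 \<subseteq> Free J P" "D2 \<subseteq> Free J P" "finite D1" "finite D2" "card (Free J P) = card D1 + card D2"
    "u \<in> D1 \<Longrightarrow> nbrs (Free J P) E u = nbrs D1 E u"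
proof -
  have *: "D1 \<union> D2 = Free J P" "D1 \<inter> D2 = {}" using assms by (auto simp: free_split_def)
  then show "D1 \<subseteq> Free J P" "D2 \<subseteq> Free J P" by auto
  show f: "finite D1" "finite D2" using *(1) finFree by (metis finite_Un)+
  show "card (Free J P) = card D1 + card D2" using card_Un_disjoint[OF f *(2)] *(1) by simp
  show "nbrs (Free J P) E u = nbrs D1 E u" if "u \<in> D1" using assms that by (auto simp: free_split_def nbrs_def)
qed

lemma free_split_nonempty: "free_split J P s t D1 D2 \<Longrightarrow> D1 \<noteq> {}"
  unfolding free_split_def by (metis (no_types, lifting) card.empty not_numeral_le_zero subset_empty)

text \<open>Two vertices of one part have two common closed neighbours, so one of these differs from
  \<open>f\<close>. Hence each part stays together when \<open>f\<close> is exchanged for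
  \<open>b\<close>, and the neighbours of \<open>s\<close> and \<open>t\<close> decide on which side
  it lies.\<close>

lemma free_split_move:
  assumes S: "free_split J P s t D1 D2" and S': "free_split J P' s t D1' D2'"
    and F': "Free J P' = insert b (Free J P - {f})" and fD: "f \<in> D1"
  shows "D1 - {f} \<subseteq> D1'" "D2 \<subseteq> D2'"
proof -
  let ?F = "Free J P" and ?F' = "Free J P'"
  have s1: "D1 \<union> D2 = ?F" "D1 \<inter> D2 = {}" "nbrs ?F E s \<subseteq> D1" "nbrs ?F E t \<subseteq> D2"
    "2 \<le> card (nbrs ?F E s)" "2 \<le> card (nbrs ?F E t)"
    "\<And>u v. u \<in> D1 \<Longrightarrow> v \<in> D1 \<Longrightarrow> 2 \<le> card (closed_nbrs ?F u \<inter> closed_nbrs ?F v)"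
    "\<And>u v. u \<in> D2 \<Longrightarrow> v \<in> D2 \<Longrightarrow> 2 \<le> card (closed_nbrs ?F u \<inter> closed_nbrs ?F v)"
    "\<And>u v. u \<in> D1 \<Longrightarrow> v \<in> D2 \<Longrightarrow> \<not> E u v"
    using S by (simp_all add: free_split_def)
  have s2: "D1' \<union> D2' = ?F'" "D1' \<inter> D2' = {}" "nbrs ?F' E s \<subseteq> D1'" "nbrs ?F' E t \<subseteq> D2'"
    "\<And>u v. u \<in> D1' \<Longrightarrow> v \<in> D2' \<Longrightarrow> \<not> E u v"
    using S' by (simp_all add: free_split_def)
  have clos: "w \<in> D1'" if "u \<in> D1'" "w \<in> ?F'" "E u w \<or> u = w" for u w using that s2 by blast
  have clos2: "w \<in> D2'" if "u \<in> D2'" "w \<in> ?F'" "E u w \<or> u = w" for u w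
    using that s2(1,2) s2(5)[of w u] symE by blast
  have pick: "\<exists>g. g \<in> X - {f}" if "2 \<le> card X" for X
  proof (rule ccontr)
    assume "\<not> ?thesis"
    then have "X \<subseteq> {f}" by auto
    then have "card X \<le> card {f}" by (intro card_mono) auto
    then show False using that by simp
  qed
  obtain z where z: "z \<in> nbrs ?F E s" "z \<noteq> f" using pick[OF s1(5)] by auto
  have zD: "z \<in> D1" "z \<in> D1'" using z s1(3) s2(3) F' by (auto simp: nbrs_def)
  show "D1 - {f} \<subseteq> D1'"
  proof
    fix u assume u: "u \<in> D1 - {f}"
    obtain g where g: "g \<in> closed_nbrs ?F z" "g \<in> closed_nbrs ?F u" "g \<noteq> f" using pick[OF s1(7)[OF zD(1), of u]] u by auto
    have "g \<in> ?F'" "u \<in> ?F'" using g u s1(1) F' by (auto simp: nbrs_def)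
    moreover have "E z g \<or> z = g" "E g u \<or> g = u" using g symE by (auto simp: nbrs_def)
    ultimately show "u \<in> D1'" using clos zD(2) by blast
  qed
  obtain z' where z': "z' \<in> nbrs ?F E t" using s1(6) by fastforce
  have z'D: "z' \<in> D2" "z' \<in> D2'" "z' \<noteq> f" using z' s1(2,4) s2(4) F' fD by (auto simp: nbrs_def)
  show "D2 \<subseteq> D2'"
  proof
    fix u assume u: "u \<in> D2"
    obtain g where g: "g \<in> closed_nbrs ?F z'" "g \<in> closed_nbrs ?F u" "g \<noteq> f" using pick[OF s1(8)[OF z'D(1), of u]] u by auto
    have "g \<in> ?F'" "u \<in> ?F'" using g u s1(1,2) F' fD by (auto simp: nbrs_def)
    moreover have "E z' g \<or> z' = g" "E g u \<or> g = u" using g symE by (auto simp: nbrs_def)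
    ultimately show "u \<in> D2'" using clos2 z'D(2) by blast
  qed
qed

lemma min_system_swap:
  assumes M: "min_system J P" and J: "J \<subseteq> I" and i: "i \<in> J" and f: "f \<in> Free J P"
    and a: "0 < a" "Suc a < length (P i)" and adj: "E f (P i ! (a - 1))" "E f (P i ! Suc a)"
  shows "min_system J (P(i := (P i)[a := f]))" "Free J (P(i := (P i)[a := f])) = insert (P i ! a) (Free J P - {f})"
    "total_length J (P(i := (P i)[a := f])) = total_length J P"
proof -
  have S: "link_system J P" using M by (simp add: min_system_def)
  have finJ: "finite J" using J finI finite_subset by blast
  note sd = link_systemD[OF S i]
  let ?p = "P i" and ?q = "(P i)[a := f]"
  have fp: "f \<notin> set ?p" "f \<in> L" "f \<notin> W" using f i by (auto simp: Free_def)
  have ap: "a < length ?p" using a by simp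
  have setq: "set ?q = insert f (set ?p - {?p ! a})" using sd(7) ap by (simp add: set_update_distinct)
  have q: "gpath E ?q"
  proof -
    have "E (?q ! n) (?q ! Suc n)" if "Suc n < length ?q" for n
    proof -
      have e: "E (?p ! n) (?p ! Suc n)" using sd(1) that by (auto simp: gpath_def successively_conv_nth)
      consider "Suc n = a" | "n = a" | "n \<noteq> a" "Suc n \<noteq> a" by blast
      then show ?thesis
      proof cases
        case 1 then show ?thesis using adj symE ap by auto
      next
        case 2 then show ?thesis using adj ap by auto
      next
        case 3 then show ?thesis using e by simp
      qed
    qed
    moreover have "distinct ?q" using sd(7) fp by (simp add: distinct_list_update)
    ultimately show ?thesis using sd(6) by (simp add: gpath_def successively_conv_nth)
  qed
  have hl: "hd ?q = x i" "last ?q = y i"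
    using sd(2,3,6) a by (auto simp: hd_conv_nth last_conv_nth)
  have S': "link_system J (P(i := ?q))"
    by (rule link_system_replace[OF S i _ f q hl]) (use i J setq in auto)
  show t: "total_length J (P(i := ?q)) = total_length J P" using total_length_update[OF finJ i, of P ?q] by simp
  show "min_system J (P(i := ?q))" using S' M t by (simp add: min_system_def)
  have b: "?p ! a \<in> L" "?p ! a \<notin> W" "?p ! a \<in> set ?p"
  proof -
    show "?p ! a \<in> L" "?p ! a \<in> set ?p" using sd(4) ap nth_mem by blast+
    have al: "a < length ?p" "0 < length ?p" "length ?p - 1 < length ?p" "a \<noteq> 0" "a \<noteq> length ?p - 1" using a by auto
    have "?p ! a \<noteq> ?p ! 0" "?p ! a \<noteq> ?p ! (length ?p - 1)"
      using nth_eq_iff_index_eq[OF sd(7) al(1,2)] nth_eq_iff_index_eq[OF sd(7) al(1,3)] al(4,5) by simp_all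
    then have "?p ! a \<noteq> x i" "?p ! a \<noteq> y i"
      using sd(2,3,6) by (auto simp: hd_conv_nth last_conv_nth)
    then show "?p ! a \<notin> W" using sd(5) \<open>?p ! a \<in> set ?p\<close> by blast
  qed
  have bh: "?p ! a \<notin> set (P h)" if "h \<in> J" "h \<noteq> i" for h
    using link_system_disj[OF S i that(1)] that b by blast
  show "Free J (P(i := ?q)) = insert (?p ! a) (Free J P - {f})"
  proof (intro set_eqI)
    fix v
    have "v \<in> (\<Union>h\<in>J. set ((P(i := ?q)) h)) \<longleftrightarrow> (\<exists>h\<in>J - {i}. v \<in> set (P h)) \<or> v \<in> set ?q"
      using i by auto
    moreover have "v \<in> (\<Union>h\<in>J. set (P h)) \<longleftrightarrow> (\<exists>h\<in>J - {i}. v \<in> set (P h)) \<or> v \<in> set ?p"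
      using i by auto
    ultimately show "v \<in> Free J (P(i := ?q)) \<longleftrightarrow> v \<in> insert (?p ! a) (Free J P - {f})"
      unfolding Free_def using setq b bh fp by auto
  qed
qed

section \<open>Finding a dense part\<close>

definition peak :: "(nat \<Rightarrow> 'a list) \<Rightarrow> 'a set \<Rightarrow> nat \<Rightarrow> nat" where
  "peak P D i = Max ((\<lambda>f. card (nbrs (set (P i)) E f)) ` D)"

lemma dense_side_arith:
  assumes "c + 1 + j + i \<le> da + sa + w" "c + 1 + j + i \<le> db + sb + w" "2 * (sa + sb) \<le> t + 7 * j"
    "F + w + t = l + 2 * j" "F = a + b" "l \<le> 2 * c + 1" "j < i" "2 * i \<le> w" "w \<le> 2 * (K::nat)"
  shows "2 * (2 * c + 8) + 2 * (a + b) \<le> 4 * da + 4 * db + 14 * K"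
proof -
  have "8 * c + 8 + 8 * j + 8 * i \<le> 4 * da + 4 * db + 2 * (t + 7 * j) + 8 * w" using assms(1,2,3) by force
  moreover have "2 * (a + b) + 2 * w + 2 * t \<le> 4 * c + 2 + 4 * j" using assms(4,5,6) by simp
  moreover have "10 * j + 10 + 6 * w \<le> 8 * i + 14 * K" using assms(7,8,9) by simp
  ultimately show ?thesis by simp
qed

text \<open>On a path of a minimal system the vertices seen by a free vertex lie among three consecutive ones; if it
  sees the outer two, it can replace the middle one. Choosing the system with a smallest part prevents both parts from
  seeing three vertices of a short path.\<close>

lemma dense_side:
  assumes J: "J \<subseteq> I" and JI: "card J < card I" and S0: "link_system J P0"
    and t: "total_length J P0 + 2 * card I \<le> 6 * card J + card W + 2"
    and op: "\<And>P. min_system J P \<Longrightarrow> open_pairs J P"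
  shows "\<exists>D \<delta>. D \<subseteq> L - W \<and> (\<forall>v\<in>D. \<delta> \<le> card (nbrs D E v)) \<and> 2 * c + 8 + 2 * card D \<le> 4 * \<delta> + 7 * K
     \<and> c + 4 \<le> card D + 3 * K"
proof -
  have finJ: "finite J" using J finI finite_subset by blast
  obtain i0 where i0: "i0 \<in> I - J" using JI J by (metis Diff_eq_empty_iff card_mono ex_in_conv finJ leD)
  let ?x = "x i0" and ?y = "y i0"
  obtain P1 where P1: "link_system J P1" "\<And>P'. link_system J P' \<Longrightarrow> total_length J P1 \<le> total_length J P'"
    using ex_has_least_nat[of "link_system J" P0 "total_length J"] S0 by blast
  have M1: "min_system J P1" using P1 by (simp add: min_system_def)
  have tmin: "total_length J P + 2 * card I \<le> 6 * card J + card W + 2" if "min_system J P" for P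
    using that S0 t unfolding min_system_def by (meson add_le_mono le_trans order_refl)
  define Q where "Q z \<longleftrightarrow> (case z of (P, Da, Db) \<Rightarrow> min_system J P \<and> (free_split J P ?x ?y Da Db \<or> free_split J P ?y ?x Da Db))"
    for z :: "(nat \<Rightarrow> 'a list) \<times> 'a set \<times> 'a set"
  have "\<exists>D1 D2. free_split J P1 ?x ?y D1 D2" by (rule ex_free_split[OF M1 J JI op[OF M1] tmin[OF M1] i0])
  then obtain z0 where "Q z0" using M1 unfolding Q_def by auto
  then obtain z where z: "Q z" "\<And>z'. Q z' \<Longrightarrow> card (fst (snd z)) \<le> card (fst (snd z'))"
    using ex_has_least_nat[of Q z0 "\<lambda>z. card (fst (snd z))"] by blast
  obtain P Da Db where zz: "z = (P, Da, Db)" by (cases z) auto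
  have M: "min_system J P" and sp0: "free_split J P ?x ?y Da Db \<or> free_split J P ?y ?x Da Db" using z(1) by (auto simp: Q_def zz)
  have least: "card Da \<le> card Da'" if "min_system J P'" "free_split J P' ?x ?y Da' Db' \<or> free_split J P' ?y ?x Da' Db'" for P' Da' Db'
    using z(2)[of "(P', Da', Db')"] that by (auto simp: Q_def zz)
  obtain s u where su: "s = ?x \<and> u = ?y \<or> s = ?y \<and> u = ?x" and sp: "free_split J P s u Da Db" using sp0 by blast
  have S: "link_system J P" using M by (simp add: min_system_def)
  note spa = free_split_in[OF sp] and spb = free_split_in[OF free_split_commute[OF sp]]
  have nea: "Da \<noteq> {}" "Db \<noteq> {}" using free_split_nonempty[OF sp] free_split_nonempty[OF free_split_commute[OF sp]] by auto
  \<comment> \<open>Put \<open>f\<close> on the path in place of the vertex \<open>P i ! a\<close>.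
    If \<open>g\<close> sees that vertex, it cannot join the side that \<open>f\<close> has left,
    which is then smaller than \<open>Da\<close>.\<close>
  have noswap: "\<not> E g (P i ! a)"
    if sw: "i \<in> J" "f \<in> Da" "0 < a" "Suc a < length (P i)" "E f (P i ! (a - 1))" "E f (P i ! Suc a)" "g \<in> Db" for i f a g
  proof
    assume e: "E g (P i ! a)"
    let ?P = "P(i := (P i)[a := f])"
    have fF: "f \<in> Free J P" using sw spa by auto
    note sm = min_system_swap[OF M J sw(1) fF sw(3-6)]
    have "\<exists>D1 D2. free_split J ?P ?x ?y D1 D2" by (rule ex_free_split[OF sm(1) J JI op[OF sm(1)] tmin[OF sm(1)] i0])
    then obtain Da' Db' where sp': "free_split J ?P s u Da' Db'" using su free_split_commute by metis
    note mv = free_split_move[OF sp sp' sm(2) sw(2)]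
    have "Da' \<union> Db' = Free J ?P" "\<And>a b. a \<in> Da' \<Longrightarrow> b \<in> Db' \<Longrightarrow> \<not> E a b" "Da' \<inter> Db' = {}" using sp' by (auto simp: free_split_def)
    moreover have "g \<in> Db'" using mv sw by auto
    ultimately have "P i ! a \<notin> Da'" using e symE by blast
    moreover have "Da' \<subseteq> insert (P i ! a) (Free J P - {f})" using sm(2) sp' by (auto simp: free_split_def)
    moreover have "Db \<inter> Da' = {}" using mv(2) \<open>Da' \<inter> Db' = {}\<close> by auto
    moreover have "Free J P = Da \<union> Db" using sp by (auto simp: free_split_def)
    ultimately have "Da' \<subseteq> Da - {f}" by blast
    then have "card Da' < card Da" using spa(3) sw(2) by (meson card_Diff1_less card_mono finite_Diff le_less_trans)
    moreover have "card Da \<le> card Da'" using least[OF sm(1)] sp' su by blast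
    ultimately show False by simp
  qed
  have pk: "card (nbrs (set (P i)) E f) \<le> peak P D i" if "f \<in> D" "finite D" for f D i
    unfolding peak_def using that by (intro Max_ge) auto
  have pkex: "\<exists>f\<in>D. card (nbrs (set (P i)) E f) = peak P D i" if "D \<noteq> {}" "finite D" for D i
  proof -
    have "peak P D i \<in> (\<lambda>f. card (nbrs (set (P i)) E f)) ` D"
      unfolding peak_def using that by (intro Max_in) auto
    then show ?thesis by auto
  qed
  \<comment> \<open>The sum of the peaks is at most 4 for paths with two vertices, 5 for three or
    four, and 6 for longer ones.\<close>
  have wt: "2 * (peak P Da i + peak P Db i) \<le> length (P i) + 7" if i: "i \<in> J" for i
  proof -
    obtain fa fb where fa: "fa \<in> Da" "card (nbrs (set (P i)) E fa) = peak P Da i"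
      and fb: "fb \<in> Db" "card (nbrs (set (P i)) E fb) = peak P Db i"
      using pkex nea spa(3) spb(3) by meson
    have fF: "fa \<in> Free J P" "fb \<in> Free J P" using fa fb spa spb by auto
    note wa = hits_window[OF M J i fF(1)] and wb = hits_window[OF M J i fF(2)]
    have l2: "2 \<le> length (P i)" by (rule len2[OF S J i])
    \<comment> \<open>On a path with at most four vertices the middle of the window of
      \<open>fa\<close> also lies in the window of \<open>fb\<close>, which \<open>noswap\<close>
      forbids.\<close>
    have not33: "\<not> (peak P Da i = 3 \<and> peak P Db i = 3)" if l4: "length (P i) \<le> 4"
    proof
      assume p3: "peak P Da i = 3 \<and> peak P Db i = 3"
      have full: "\<exists>m. hits (P i) f = {m..<m + 3} \<and> m + 3 \<le> length (P i)"
        if ff: "f \<in> Free J P" "card (nbrs (set (P i)) E f) = 3" for f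
      proof -
        obtain m where m: "hits (P i) f \<subseteq> {m..<m + 3}" using hits_window(1)[OF M J i ff(1)] by blast
        have "card (hits (P i) f) = 3" using ff(2) card_hits[OF link_systemD(7)[OF S i], of f] by simp
        then have h: "hits (P i) f = {m..<m + 3}" using m by (intro card_subset_eq) auto
        then have "m + 2 \<in> hits (P i) f" by simp
        then have "m + 3 \<le> length (P i)" unfolding hits_def by simp
        then show ?thesis using h by blast
      qed
      obtain m where m: "hits (P i) fa = {m..<m + 3}" "m + 3 \<le> length (P i)" using full[OF fF(1)] fa p3 by auto
      obtain n where n: "hits (P i) fb = {n..<n + 3}" "n + 3 \<le> length (P i)" using full[OF fF(2)] fb p3 by auto
      have "m \<in> hits (P i) fa" "m + 2 \<in> hits (P i) fa" using m by auto
      then have "E fa (P i ! (Suc m - 1))" "E fa (P i ! Suc (Suc m))" by (auto simp: hits_def)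
      from noswap[OF i fa(1) _ _ this fb(1)] m have "\<not> E fb (P i ! Suc m)" by simp
      moreover have "Suc m \<in> hits (P i) fb" using n m l4 by auto
      ultimately show False by (simp add: hits_def)
    qed
    show ?thesis
    proof (cases "length (P i) \<le> 4")
      case True
      then have "peak P Da i + peak P Db i \<le> 5" using not33 wa(2) wb(2) fa(2) fb(2) by linarith
      moreover have "peak P Da i + peak P Db i \<le> 4" if "length (P i) = 2"
      proof -
        have "card (nbrs (set (P i)) E f) \<le> 2" for f
          using card_mono[of "set (P i)" "nbrs (set (P i)) E f"] link_systemD(7)[OF S i] that by (auto simp: nbrs_def distinct_card)
        from this[of fa] this[of fb] show ?thesis using fa(2) fb(2) by simp
      qed
      ultimately show ?thesis using l2 by (cases "length (P i) = 2") simp_all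
    next
      case False
      have "peak P Da i \<le> 3" "peak P Db i \<le> 3" using wa(2) wb(2) fa(2) fb(2) by simp_all
      then show ?thesis using False by simp
    qed
  qed
  have "2 * ((\<Sum>i\<in>J. peak P Da i) + (\<Sum>i\<in>J. peak P Db i)) = (\<Sum>i\<in>J. 2 * (peak P Da i + peak P Db i))"
    by (simp add: sum.distrib sum_distrib_left algebra_simps)
  also have "\<dots> \<le> (\<Sum>i\<in>J. length (P i) + 7)" using wt by (intro sum_mono) auto
  finally have sumw: "2 * ((\<Sum>i\<in>J. peak P Da i) + (\<Sum>i\<in>J. peak P Db i)) \<le> total_length J P + 7 * card J"
    by (simp add: total_length_def sum.distrib)
  have deg: "c + 1 + card J + card I \<le> card (nbrs D E f) + (\<Sum>i\<in>J. peak P D i) + card W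
      \<and> c + 4 \<le> card D + 3 * K"
    if D: "free_split J P s' u' D D'" and f: "f \<in> D" for D D' s' u' f
  proof -
    note si = free_split_in[OF D]
    have fF: "f \<in> Free J P" using si f by auto
    have "(\<Sum>i\<in>J. card (nbrs (set (P i)) E f)) \<le> (\<Sum>i\<in>J. peak P D i)"
      by (intro sum_mono pk f si(3))
    then have 1: "c + 1 + card J + card I \<le> card (nbrs D E f) + (\<Sum>i\<in>J. peak P D i) + card W"
      using degree_into_Free[OF S J op[OF M] fF] si(6)[OF f] by simp
    have "closed_nbrs (Free J P) f \<subseteq> D" using si(6)[OF f] f by (auto simp: nbrs_def)
    then have "card (closed_nbrs (Free J P) f) \<le> card D" using si(3) by (intro card_mono) auto
    then have "c + 4 \<le> card D + 3 * K"
      using card_closed_nbrs(1)[OF M J op[OF M] fF] capped_length_bounds(2)[OF S J] JI r2 cardW by linarith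
    then show ?thesis using 1 by simp
  qed
  define \<delta>a where "\<delta>a = c + 1 + card J + card I - card W - (\<Sum>i\<in>J. peak P Da i)"
  define \<delta>b where "\<delta>b = c + 1 + card J + card I - card W - (\<Sum>i\<in>J. peak P Db i)"
  have ga: "\<forall>v\<in>Da. \<delta>a \<le> card (nbrs Da E v)" "c + 4 \<le> card Da + 3 * K"
    using deg[OF sp] nea(1) unfolding \<delta>a_def by (force, blast)
  have gb: "\<forall>v\<in>Db. \<delta>b \<le> card (nbrs Db E v)" "c + 4 \<le> card Db + 3 * K"
    using deg[OF free_split_commute[OF sp]] nea(2) unfolding \<delta>b_def by (force, blast)
  have eqa: "c + 1 + card J + card I \<le> \<delta>a + (\<Sum>i\<in>J. peak P Da i) + card W" by (simp add: \<delta>a_def)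
  have eqb: "c + 1 + card J + card I \<le> \<delta>b + (\<Sum>i\<in>J. peak P Db i) + card W" by (simp add: \<delta>b_def)
  have "2 * (2 * c + 8) + 2 * (card Da + card Db) \<le> 4 * \<delta>a + 4 * \<delta>b + 14 * K"
    by (rule dense_side_arith[OF eqa eqb sumw card_Free[OF S J] spa(5) cardL JI r2 cardW])
  \<comment> \<open>Averaging: the bounds for the two parts add up, so one part satisfies its
    half.\<close>
  then have "2 * c + 8 + 2 * card Da \<le> 4 * \<delta>a + 7 * K \<or> 2 * c + 8 + 2 * card Db \<le> 4 * \<delta>b + 7 * K" by (rule_tac disjCI) simp
  moreover have "Da \<subseteq> L - W" "Db \<subseteq> L - W" using spa(1,2) by (auto simp: Free_def)
  ultimately show ?thesis using ga gb by blast
qed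

text \<open>Pairs are linked one at a time. If no minimal system for the pairs linked so far allows
  a cheap next one, \<open>dense_side\<close> applies.\<close>

lemma linked_or_dense:
  "(\<exists>C. (\<forall>i\<in>I. C i \<subseteq> L \<and> x i \<in> C i \<and> y i \<in> C i \<and> conn E (C i) \<and> C i \<inter> W = {x i, y i}) \<and> disjoint_family_on C I)
   \<or> (\<exists>D \<delta>. D \<subseteq> L - W \<and> (\<forall>v\<in>D. \<delta> \<le> card (nbrs D E v)) \<and> 2 * c + 8 + 2 * card D \<le> 4 * \<delta> + 7 * K
     \<and> c + 4 \<le> card D + 3 * K)"
proof (rule disjCI)
  assume nd: "\<not> (\<exists>D \<delta>. D \<subseteq> L - W \<and> (\<forall>v\<in>D. \<delta> \<le> card (nbrs D E v)) \<and> 2 * c + 8 + 2 * card D \<le> 4 * \<delta> + 7 * K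
     \<and> c + 4 \<le> card D + 3 * K)"
  \<comment> \<open>The empty system satisfies the length bound because two vertices of
    \<open>W\<close> belong to each pair.\<close>
  have "\<exists>J P. J \<subseteq> I \<and> card J = j \<and> link_system J P \<and> total_length J P + 2 * card I \<le> 6 * j + card W + 2" if "j \<le> card I" for j
    using that
  proof (induction j)
    case 0
    show ?case using r2 by (intro exI[of _ "{}"] exI) (auto simp: link_system_def disjoint_family_on_def total_length_def)
  next
    case (Suc j)
    then obtain J P0 where J: "J \<subseteq> I" "card J = j" and S0: "link_system J P0" and t: "total_length J P0 + 2 * card I \<le> 6 * card J + card W + 2"
      by auto
    have JI: "card J < card I" using Suc J by simp
    obtain P where M: "min_system J P" and nop: "\<not> open_pairs J P" using dense_side[OF J(1) JI S0 t] nd by blast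
    have S: "link_system J P" using M by (simp add: min_system_def)
    have "total_length J P \<le> total_length J P0" using M S0 by (simp add: min_system_def)
    then have t': "total_length J P + 2 * card I \<le> 6 * card J + card W + 2" using t by linarith
    obtain i X where iX: "i \<in> I - J" "X \<subseteq> Free J P" "conn E ({x i, y i} \<union> X)"
      "card X \<le> 4 \<or> card X \<le> 6 \<and> total_length J P + 2 * card I \<le> 6 * card J + card W"
      using nop unfolding open_pairs_def by blast
    obtain p where p: "link_system (insert i J) (P(i := p))" "total_length (insert i J) (P(i := p)) \<le> total_length J P + card X + 2"
      using link_system_extend[OF S J(1) iX(1,2,3)] by blast
    have "finite J" using J finI finite_subset by blast
    then have "card (insert i J) = Suc j" using iX J by simp
    moreover have "total_length (insert i J) (P(i := p)) + 2 * card I \<le> (6 * card J + 6) + card W + 2"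
      using iX(4)
    proof
      assume "card X \<le> 4" then show ?thesis using p(2) t' J(2) by linarith
    next
      assume "card X \<le> 6 \<and> total_length J P + 2 * card I \<le> 6 * card J + card W" then show ?thesis using p(2) J(2) by linarith
    qed
    moreover have "6 * Suc j = 6 * card J + 6" using J by simp
    moreover have "insert i J \<subseteq> I" using iX(1) J(1) by simp
    ultimately show ?case using p(1) by metis
  qed
  from this[of "card I"] obtain J P where J: "J \<subseteq> I" "card J = card I" and S: "link_system J P" by auto
  have JI: "J = I" using card_subset_eq[OF finI J] .
  have "set (P i) \<subseteq> L \<and> x i \<in> set (P i) \<and> y i \<in> set (P i) \<and> conn E (set (P i)) \<and> set (P i) \<inter> W = {x i, y i}"
    if "i \<in> I" for i
    using link_systemD[OF S, of i] that JI gpath_conn[OF sym, of "P i"] by auto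
  moreover have "disjoint_family_on (\<lambda>i. set (P i)) I" using S JI by (simp add: link_system_def)
  ultimately show "\<exists>C. (\<forall>i\<in>I. C i \<subseteq> L \<and> x i \<in> C i \<and> y i \<in> C i \<and> conn E (C i) \<and> C i \<inter> W = {x i, y i}) \<and> disjoint_family_on C I"
    by (intro exI[of _ "\<lambda>i. set (P i)"] conjI ballI) simp_all
qed

end

section \<open>Massed graphs are linked\<close>

lemma linkedI:
  assumes "\<And>I x y. pairs x y I T \<Longrightarrow>
     \<exists>C. (\<forall>i\<in>I. C i \<subseteq> V \<and> x i \<in> C i \<and> y i \<in> C i \<and> conn E (C i) \<and> C i \<inter> T = {x i, y i}) \<and> disjoint_family_on C I"
  shows "linked V E T"
  using assms by (simp add: linked_def)

lemma linkedE:
  assumes "linked V E T" "pairs x y I T"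
  obtains C where "\<And>i. i \<in> I \<Longrightarrow> C i \<subseteq> V" "\<And>i. i \<in> I \<Longrightarrow> x i \<in> C i" "\<And>i. i \<in> I \<Longrightarrow> y i \<in> C i"
    "\<And>i. i \<in> I \<Longrightarrow> conn E (C i)" "\<And>i. i \<in> I \<Longrightarrow> C i \<inter> T = {x i, y i}"
    "\<And>i j. i \<in> I \<Longrightarrow> j \<in> I \<Longrightarrow> i \<noteq> j \<Longrightarrow> C i \<inter> C j = {}"
proof -
  have "\<exists>C. (\<forall>i\<in>I. C i \<subseteq> V \<and> x i \<in> C i \<and> y i \<in> C i \<and> conn E (C i) \<and> C i \<inter> T = {x i, y i}) \<and> disjoint_family_on C I"
    using assms by (simp add: linked_def)
  then obtain C where "\<forall>i\<in>I. C i \<subseteq> V \<and> x i \<in> C i \<and> y i \<in> C i \<and> conn E (C i) \<and> C i \<inter> T = {x i, y i}"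
    "disjoint_family_on C I" by blast
  then show ?thesis by (intro that[of C]) (auto simp: disjoint_family_on_def)
qed

lemma linked_mono:
  assumes l: "linked V E T" and V: "V \<subseteq> V'" and T: "T' \<subseteq> T"
    and E: "\<And>a b. a \<in> V \<Longrightarrow> b \<in> V \<Longrightarrow> E a b \<Longrightarrow> E' a b"
  shows "linked V' E' T'"
proof (rule linkedI)
  fix I :: "nat set" and x y assume p: "pairs x y I T'"
  then have p': "pairs x y I T" using T by (auto simp: pairs_def)
  obtain C where C: "\<And>i. i \<in> I \<Longrightarrow> C i \<subseteq> V" "\<And>i. i \<in> I \<Longrightarrow> x i \<in> C i" "\<And>i. i \<in> I \<Longrightarrow> y i \<in> C i"
    "\<And>i. i \<in> I \<Longrightarrow> conn E (C i)" "\<And>i. i \<in> I \<Longrightarrow> C i \<inter> T = {x i, y i}"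
    "\<And>i j. i \<in> I \<Longrightarrow> j \<in> I \<Longrightarrow> i \<noteq> j \<Longrightarrow> C i \<inter> C j = {}" by (rule linkedE[OF l p']) (rule that)
  have "conn E' (C i)" if "i \<in> I" for i by (rule conn_mono[OF C(4)[OF that]]) (use C(1)[OF that] E in blast)
  moreover have "C i \<subseteq> V'" if "i \<in> I" for i using C(1)[OF that] V by simp
  moreover have "C i \<inter> T' = {x i, y i}" if "i \<in> I" for i
    using C(5)[OF that] T p that by (auto simp: pairs_def)
  ultimately show "\<exists>C. (\<forall>i\<in>I. C i \<subseteq> V' \<and> x i \<in> C i \<and> y i \<in> C i \<and> conn E' (C i) \<and> C i \<inter> T' = {x i, y i})
      \<and> disjoint_family_on C I"
    using C(2,3,6) by (intro exI[of _ C]) (simp add: disjoint_family_on_def)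
qed

text \<open>Used with the paths of \<open>landing\<close>: they carry linkedness of the ends back to
  the vertices of the separator.\<close>

lemma linked_reroute:
  assumes sym: "symp E" and l: "linked D E ((\<lambda>x. last (g x)) ` X)" and D: "D \<subseteq> V"
    and g: "\<forall>x\<in>X. gpath E (g x) \<and> hd (g x) = x \<and> set (g x) \<subseteq> V \<and> set (g x) \<inter> X = {x} \<and>
      set (g x) \<inter> D = {last (g x)}"
    and dj: "disjoint_family_on (\<lambda>x. set (g x)) X"
  shows "linked V E X"
proof (rule linkedI)
  fix I :: "nat set" and x y assume p: "pairs x y I X"
  define f where "f = (\<lambda>x. last (g x))"
  have fin: "f z \<in> set (g z)" if "z \<in> X" for z using g that by (auto simp: f_def gpath_def)
  have dj': "set (g z) \<inter> set (g z') = {}" if "z \<in> X" "z' \<in> X" "z \<noteq> z'" for z z'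
    using dj that by (simp add: disjoint_family_on_def)
  have finj: "z = z'" if "f z \<in> set (g z')" "z \<in> X" "z' \<in> X" for z z'
    using dj'[OF that(2,3)] fin[OF that(2)] that(1) by blast
  have xy: "x i \<in> X" "y i \<in> X" "x i \<noteq> y i" if "i \<in> I" for i using p that by (auto simp: pairs_def)
  have xyd: "{x i, y i} \<inter> {x j, y j} = {}" if "i \<in> I" "j \<in> I" "i \<noteq> j" for i j using p that by (simp add: pairs_def)
  have finj2: "f z \<noteq> f z'" if "z \<noteq> z'" "z \<in> X" "z' \<in> X" for z z' using finj[of z z'] fin[of z'] that by metis
  have "pairs (f \<circ> x) (f \<circ> y) I (f ` X)"
    unfolding pairs_def
  proof (intro conjI ballI impI)
    show "finite I" using p by (simp add: pairs_def)
    fix i assume i: "i \<in> I"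
    show "(f \<circ> x) i \<in> f ` X" "(f \<circ> y) i \<in> f ` X" using xy[OF i] by auto
    show "(f \<circ> x) i \<noteq> (f \<circ> y) i" using finj2 xy[OF i] by simp
    fix j assume j: "j \<in> I" "i \<noteq> j"
    show "{(f \<circ> x) i, (f \<circ> y) i} \<inter> {(f \<circ> x) j, (f \<circ> y) j} = {}"
      using xyd[OF i j] finj2 xy[OF i] xy[OF j(1)] by simp
  qed
  then obtain C where C: "\<And>i. i \<in> I \<Longrightarrow> C i \<subseteq> D" "\<And>i. i \<in> I \<Longrightarrow> (f \<circ> x) i \<in> C i" "\<And>i. i \<in> I \<Longrightarrow> (f \<circ> y) i \<in> C i"
    "\<And>i. i \<in> I \<Longrightarrow> conn E (C i)" "\<And>i. i \<in> I \<Longrightarrow> C i \<inter> f ` X = {(f \<circ> x) i, (f \<circ> y) i}"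
    "\<And>i j. i \<in> I \<Longrightarrow> j \<in> I \<Longrightarrow> i \<noteq> j \<Longrightarrow> C i \<inter> C j = {}"
    by (rule linkedE[OF l[folded f_def]]) (rule that)
  define C' where "C' i = set (g (x i)) \<union> C i \<union> set (g (y i))" for i
  have gC: "z \<in> {x i, y i}" if zi: "set (g z) \<inter> C i \<noteq> {}" "z \<in> X" "i \<in> I" for z i
  proof -
    obtain w where w: "w \<in> set (g z)" "w \<in> C i" using zi by auto
    then have "w \<in> set (g z) \<inter> D" using C(1)[OF zi(3)] by blast
    then have "w = f z" using g zi(2) by (simp add: f_def)
    then have "f z \<in> {f (x i), f (y i)}" using C(5)[OF zi(3)] w(2) zi(2) by auto
    then show ?thesis using finj2 xy[OF zi(3)] zi(2) by blast
  qed
  have 1: "C' i \<subseteq> V \<and> x i \<in> C' i \<and> y i \<in> C' i \<and> conn E (C' i) \<and> C' i \<inter> X = {x i, y i}" if i: "i \<in> I" for i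
  proof (intro conjI)
    have gx: "gpath E (g z)" "hd (g z) = z" "set (g z) \<subseteq> V" "set (g z) \<inter> X = {z}" if "z \<in> X" for z using g that by auto
    show "C' i \<subseteq> V" using gx(3) xy[OF i] C(1)[OF i] D by (auto simp: C'_def)
    show "x i \<in> C' i" "y i \<in> C' i" using gx(4) xy[OF i] by (auto simp: C'_def)
    have "conn E (set (g (x i)) \<union> C i)"
      by (rule conn_Un[OF gpath_conn[OF sym gx(1)] C(4)[OF i]]) (use xy[OF i] fin C(2)[OF i] in auto)
    then show "conn E (C' i)" unfolding C'_def
      by (rule conn_Un[OF _ gpath_conn[OF sym gx(1)]]) (use xy[OF i] fin C(3)[OF i] in auto)
    show "C' i \<inter> X = {x i, y i}"
    proof
      show "{x i, y i} \<subseteq> C' i \<inter> X" using \<open>x i \<in> C' i\<close> \<open>y i \<in> C' i\<close> xy[OF i] by auto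
      show "C' i \<inter> X \<subseteq> {x i, y i}"
      proof
        fix z assume z: "z \<in> C' i \<inter> X"
        then consider "z \<in> set (g (x i))" | "z \<in> C i" | "z \<in> set (g (y i))" by (auto simp: C'_def)
        then show "z \<in> {x i, y i}"
        proof cases
          case 2
          have "z \<in> set (g z)" using gx(4)[of z] z by auto
          then show ?thesis using gC[of z i] 2 z i by blast
        qed (use gx(4) xy[OF i] z in blast)+
      qed
    qed
  qed
  have 2: "C' i \<inter> C' j = {}" if ij: "i \<in> I" "j \<in> I" "i \<noteq> j" for i j
  proof -
    have d: "x i \<noteq> x j" "x i \<noteq> y j" "y i \<noteq> x j" "y i \<noteq> y j" using xyd[OF ij] by auto
    have n1: "set (g z) \<inter> set (g z') = {}" if "z \<in> {x i, y i}" "z' \<in> {x j, y j}" for z z'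
      using dj'[of z z'] that d xy[OF ij(1)] xy[OF ij(2)] by blast
    have n2: "set (g z) \<inter> C j = {}" if "z \<in> {x i, y i}" for z
    proof (rule ccontr)
      assume "set (g z) \<inter> C j \<noteq> {}"
      from gC[OF this] have "z \<in> {x j, y j}" using that xy[OF ij(1)] ij by blast
      then show False using that d by auto
    qed
    have n3: "set (g z) \<inter> C i = {}" if "z \<in> {x j, y j}" for z
    proof (rule ccontr)
      assume "set (g z) \<inter> C i \<noteq> {}"
      from gC[OF this] have "z \<in> {x i, y i}" using that xy[OF ij(2)] ij by blast
      then show False using that d by auto
    qed
    have n4: "C i \<inter> set (g z) = {}" if "z \<in> {x j, y j}" for z using n3[OF that] by (simp add: Int_commute)
    show ?thesis unfolding C'_def Int_Un_distrib Int_Un_distrib2 by (simp add: n1 n2 n4 C(6)[OF ij])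
  qed
  show "\<exists>C. (\<forall>i\<in>I. C i \<subseteq> V \<and> x i \<in> C i \<and> y i \<in> C i \<and> conn E (C i) \<and> C i \<inter> X = {x i, y i}) \<and> disjoint_family_on C I"
    by (rule exI[of _ C'], unfold disjoint_family_on_def) (intro conjI ballI impI 2 1[THEN conjunct1] 1[THEN conjunct2, THEN conjunct1] 1[THEN conjunct2, THEN conjunct2, THEN conjunct1]
      1[THEN conjunct2, THEN conjunct2, THEN conjunct2, THEN conjunct1] 1[THEN conjunct2, THEN conjunct2, THEN conjunct2, THEN conjunct2]; assumption)
qed

text \<open>Contraction of \<open>v\<close> into \<open>u\<close> inside the same type:
  \<open>u\<close> inherits the neighbours of \<open>v\<close>, and \<open>v\<close> disappears only
  by restricting the vertex set. The condition \<open>a \<noteq> b\<close> removes the loop.\<close>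

definition merge :: "('a \<Rightarrow> 'a \<Rightarrow> bool) \<Rightarrow> 'a \<Rightarrow> 'a \<Rightarrow> 'a \<Rightarrow> 'a \<Rightarrow> bool" where
  "merge E u v = (\<lambda>a b. a \<noteq> b \<and> (E a b \<or> a = u \<and> E v b \<or> b = u \<and> E a v))"

text \<open>The connected set that contains \<open>u\<close>, if any, also receives
  \<open>v\<close>; an inherited edge becomes a path of length two through \<open>v\<close>.\<close>

lemma linked_unmerge:
  assumes sym: "symp E" and e: "E u v" and v: "v \<notin> B" "v \<notin> T" and l: "linked B (merge E u v) T"
  shows "linked (insert v B) E T"
proof (rule linkedI)
  fix I :: "nat set" and x y assume p: "pairs x y I T"
  obtain C where C: "\<And>i. i \<in> I \<Longrightarrow> C i \<subseteq> B" "\<And>i. i \<in> I \<Longrightarrow> x i \<in> C i" "\<And>i. i \<in> I \<Longrightarrow> y i \<in> C i"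
    "\<And>i. i \<in> I \<Longrightarrow> conn (merge E u v) (C i)" "\<And>i. i \<in> I \<Longrightarrow> C i \<inter> T = {x i, y i}"
    "\<And>i j. i \<in> I \<Longrightarrow> j \<in> I \<Longrightarrow> i \<noteq> j \<Longrightarrow> C i \<inter> C j = {}" by (rule linkedE[OF l p]) (rule that)
  define C' where "C' i = (if u \<in> C i then insert v (C i) else C i)" for i
  have "conn E (C' i)" if i: "i \<in> I" for i
  proof -
    define R where "R = (\<lambda>a b. E a b \<and> a \<in> C' i \<and> b \<in> C' i)"
    have step: "R\<^sup>*\<^sup>* a b" if "merge E u v a b" "a \<in> C i" "b \<in> C i" for a b
    proof -
      have "E a b \<or> a = u \<and> E v b \<or> b = u \<and> E a v" using that by (auto simp: merge_def)
      then show ?thesis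
      proof (elim disjE conjE)
        assume "E a b" then show ?thesis using that by (auto simp: C'_def R_def)
      next
        assume "a = u" "E v b"
        then have "R a v" "R v b" using that e by (auto simp: C'_def R_def)
        then show ?thesis by (meson converse_rtranclp_into_rtranclp r_into_rtranclp)
      next
        assume "b = u" "E a v"
        then have "R a v" "R v b" using that e sympD[OF sym] by (auto simp: C'_def R_def)
        then show ?thesis by (meson converse_rtranclp_into_rtranclp r_into_rtranclp)
      qed
    qed
    have "R\<^sup>*\<^sup>* a b" if "a \<in> C i" "b \<in> C i" for a b
    proof -
      have "(\<lambda>a b. merge E u v a b \<and> a \<in> C i \<and> b \<in> C i)\<^sup>*\<^sup>* a b" using C(4)[OF i] that by (auto simp: conn_def)
      then show ?thesis
      proof (induction rule: rtranclp_induct)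
        case (step w z) then show ?case using \<open>\<And>a b. merge E u v a b \<Longrightarrow> a \<in> C i \<Longrightarrow> b \<in> C i \<Longrightarrow> R\<^sup>*\<^sup>* a b\<close>[of w z] by (meson rtranclp_trans)
      qed simp
    qed
    \<comment> \<open>The relation is \<open>E\<close>; the second disjunct is never true.\<close>
    then have "conn (\<lambda>a b. E a b \<or> a \<noteq> a) (C' i)" if "u \<notin> C i" using that by (simp add: conn_def C'_def R_def)
    moreover have "conn E (C' i)" if u: "u \<in> C i"
    proof -
      have "R u v" "R v u" using e u sympD[OF sym] by (auto simp: C'_def R_def)
      then have vu: "R\<^sup>*\<^sup>* u v" "R\<^sup>*\<^sup>* v u" by (meson r_into_rtranclp)+
      have "R\<^sup>*\<^sup>* a u \<and> R\<^sup>*\<^sup>* u a" if "a \<in> C' i" for a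
      proof (cases "a = v")
        case False
        then have "a \<in> C i" using that u by (simp add: C'_def)
        then show ?thesis using \<open>\<And>a b. a \<in> C i \<Longrightarrow> b \<in> C i \<Longrightarrow> R\<^sup>*\<^sup>* a b\<close> u by blast
      qed (use vu in blast)
      then show ?thesis unfolding conn_def R_def[symmetric] by (meson rtranclp_trans)
    qed
    ultimately show ?thesis by auto
  qed
  moreover have "C' i \<subseteq> insert v B \<and> x i \<in> C' i \<and> y i \<in> C' i \<and> C' i \<inter> T = {x i, y i}" if "i \<in> I" for i
    using C(1,2,3,5)[OF that] v by (auto simp: C'_def)
  moreover have "C' i \<inter> C' j = {}" if "i \<in> I" "j \<in> I" "i \<noteq> j" for i j
    using C(6)[OF that] C(1)[OF that(1)] C(1)[OF that(2)] v by (auto simp: C'_def)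
  ultimately show "\<exists>C. (\<forall>i\<in>I. C i \<subseteq> insert v B \<and> x i \<in> C i \<and> y i \<in> C i \<and> conn E (C i) \<and> C i \<inter> T = {x i, y i})
      \<and> disjoint_family_on C I"
    by (intro exI[of _ C']) (auto simp: disjoint_family_on_def)
qed

section \<open>Replacing one side of a separation by a clique\<close>

definition complete_on :: "('a \<Rightarrow> 'a \<Rightarrow> bool) \<Rightarrow> 'a set \<Rightarrow> 'a \<Rightarrow> 'a \<Rightarrow> bool" where
  "complete_on E Q = (\<lambda>u v. E u v \<or> u \<in> Q \<and> v \<in> Q \<and> u \<noteq> v)"

lemma successively_nonclique:
  "successively (complete_on E Q) (p @ [w]) \<Longrightarrow> \<forall>z\<in>set p. z \<notin> Q \<Longrightarrow> successively E (p @ [w])"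
  by (induction p) (auto simp: complete_on_def successively_Cons hd_append)

lemma gpath_first_in:
  assumes p: "gpath (complete_on E Q) p" and m: "set p \<inter> Q \<noteq> {}"
  obtains q w r where "p = q @ w # r" "w \<in> Q" "set q \<inter> Q = {}" "gpath E (q @ [w])"
proof -
  obtain q w r where s: "p = q @ w # r" "w \<in> Q" "\<forall>z\<in>set q. z \<notin> Q"
    using split_list_first_prop[of p "\<lambda>z. z \<in> Q"] m by auto
  have "successively (complete_on E Q) (q @ [w])"
    using p unfolding gpath_def s by (auto simp: successively_append_iff)
  then have "gpath E (q @ [w])" using successively_nonclique[OF _ s(3)] p s by (auto simp: gpath_def)
  then show ?thesis using s that[of q w r] by auto
qed

lemma symp_complete_on: "symp E \<Longrightarrow> symp (complete_on E Q)"
  by (auto simp: complete_on_def symp_def)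

text \<open>A path in \<open>A\<close> that uses clique edges is cut at its first and at its last
  clique vertex. Between these two, one connected set in \<open>B\<close> replaces everything, so
  each pair asks for at most one link in \<open>B\<close>.\<close>

lemma linked_clique_replace:
  assumes sym: "symp E" and AB: "A \<union> B = V" and lB: "linked B E (A \<inter> B)" and T: "T \<subseteq> A"
    and lA: "linked A (complete_on E (A \<inter> B)) T"
  shows "linked V E T"
proof (rule linkedI)
  fix I :: "nat set" and x y assume p: "pairs x y I T"
  let ?Q = "A \<inter> B"
  obtain C where C: "\<And>i. i \<in> I \<Longrightarrow> C i \<subseteq> A" "\<And>i. i \<in> I \<Longrightarrow> x i \<in> C i" "\<And>i. i \<in> I \<Longrightarrow> y i \<in> C i"
    "\<And>i. i \<in> I \<Longrightarrow> conn (complete_on E ?Q) (C i)" "\<And>i. i \<in> I \<Longrightarrow> C i \<inter> T = {x i, y i}"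
    "\<And>i j. i \<in> I \<Longrightarrow> j \<in> I \<Longrightarrow> i \<noteq> j \<Longrightarrow> C i \<inter> C j = {}" by (rule linkedE[OF lA p]) (rule that)
  have sy: "symp (complete_on E ?Q)" by (rule symp_complete_on[OF sym])
  have loc: "\<exists>w w' D. w \<in> C i \<and> w' \<in> C i \<and> D \<subseteq> C i \<and> ((w = w' \<and> x i \<in> D \<and> y i \<in> D \<and> conn E D) \<or>
     (w \<noteq> w' \<and> w \<in> ?Q \<and> w' \<in> ?Q \<and> (\<exists>D1 D2. D = D1 \<union> D2 \<and> x i \<in> D1 \<and> w \<in> D1 \<and> conn E D1 \<and> y i \<in> D2 \<and> w' \<in> D2 \<and> conn E D2)))"
    if i: "i \<in> I" for i
  proof -
    obtain q where q: "gpath (complete_on E ?Q) q" "hd q = x i" "last q = y i" "set q \<subseteq> C i"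
      using conn_gpath[OF C(4)[OF i] C(2)[OF i] C(3)[OF i]] by metis
    have qr: "gpath (complete_on E ?Q) (rev q)" using q(1) gpath_rev[OF sy] by blast
    have ne: "q \<noteq> []" using q by (simp add: gpath_def)
    show ?thesis
    proof (cases "set q \<inter> ?Q = {}")
      case True
      have "gpath E q" by (rule gpath_mono[OF q(1)]) (use True in \<open>auto simp: complete_on_def\<close>)
      moreover have "x i \<in> set q" "y i \<in> set q" using hd_in_set[OF ne] last_in_set[OF ne] q(2,3) by simp_all
      ultimately show ?thesis using gpath_conn[OF sym] q C(2)[OF i]
        by (intro exI[of _ "x i"] exI[of _ "set q"]) auto
    next
      case False
      obtain q1 w r1 where 1: "q = q1 @ w # r1" "w \<in> ?Q" "set q1 \<inter> ?Q = {}" "gpath E (q1 @ [w])"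
        using gpath_first_in[OF q(1) False] by metis
      have "set (rev q) \<inter> ?Q \<noteq> {}" using False by simp
      then obtain q2 w' r2 where 2: "rev q = q2 @ w' # r2" "w' \<in> ?Q" "set q2 \<inter> ?Q = {}" "gpath E (q2 @ [w'])"
        using gpath_first_in[OF qr] by metis
      have c1: "conn E (set (q1 @ [w]))" and c2: "conn E (set (q2 @ [w']))"
        using 1(4) 2(4) by (auto intro: gpath_conn[OF sym] simp del: set_append)
      have hx: "x i \<in> set (q1 @ [w])" using q(2) 1(1) by (cases q1) auto
      have "y i = hd (rev q)" using q(3) ne by (simp add: hd_rev)
      then have hy: "y i \<in> set (q2 @ [w'])" using 2(1) by (cases q2) auto
      have sub: "set (q1 @ [w]) \<subseteq> set q" "set (q2 @ [w']) \<subseteq> set q"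
        using 1(1) arg_cong[OF 2(1), of set] by auto
      show ?thesis
      proof (cases "w = w'")
        case True
        have "conn E (set (q1 @ [w]) \<union> set (q2 @ [w']))" by (rule conn_Un[OF c1 c2]) (use True in auto)
        then show ?thesis using True hx hy sub q(4)
          by (intro exI[of _ w] exI[of _ "set (q1 @ [w]) \<union> set (q2 @ [w'])"]) auto
      next
        case ww: False
        have "\<exists>D1 D2. set (q1 @ [w]) \<union> set (q2 @ [w']) = D1 \<union> D2 \<and> x i \<in> D1 \<and> w \<in> D1 \<and> conn E D1 \<and> y i \<in> D2 \<and> w' \<in> D2 \<and> conn E D2"
          by (intro exI[of _ "set (q1 @ [w])"] exI[of _ "set (q2 @ [w'])"] conjI refl hx hy c1 c2) auto
        moreover have "w \<in> C i" "w' \<in> C i" "set (q1 @ [w]) \<union> set (q2 @ [w']) \<subseteq> C i" using sub q(4) by auto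
        ultimately show ?thesis using ww 1(2) 2(2) by blast
      qed
    qed
  qed
  then obtain w w' D where w: "\<And>i. i \<in> I \<Longrightarrow> w i \<in> C i \<and> w' i \<in> C i \<and> D i \<subseteq> C i \<and> ((w i = w' i \<and> x i \<in> D i \<and> y i \<in> D i \<and> conn E (D i)) \<or>
     (w i \<noteq> w' i \<and> w i \<in> ?Q \<and> w' i \<in> ?Q \<and> (\<exists>D1 D2. D i = D1 \<union> D2 \<and> x i \<in> D1 \<and> w i \<in> D1 \<and> conn E D1 \<and> y i \<in> D2 \<and> w' i \<in> D2 \<and> conn E D2)))"
    by metis
  \<comment> \<open>The pairs whose two clique vertices differ are the ones to be linked in
    \<open>B\<close>.\<close>
  define J where "J = {i \<in> I. w i \<noteq> w' i}"
  have fI: "finite I" using p by (simp add: pairs_def)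
  have "pairs w w' J ?Q"
    unfolding pairs_def
  proof (intro conjI ballI impI)
    show "finite J" using fI by (simp add: J_def)
    fix i assume i: "i \<in> J"
    show "w i \<in> ?Q" "w' i \<in> ?Q" "w i \<noteq> w' i" using i w[of i] by (auto simp: J_def)
    fix j assume j: "j \<in> J" "i \<noteq> j"
    show "{w i, w' i} \<inter> {w j, w' j} = {}" using C(6)[of i j] w[of i] w[of j] i j by (auto simp: J_def)
  qed
  then obtain B' where B': "\<And>i. i \<in> J \<Longrightarrow> B' i \<subseteq> B" "\<And>i. i \<in> J \<Longrightarrow> w i \<in> B' i" "\<And>i. i \<in> J \<Longrightarrow> w' i \<in> B' i"
    "\<And>i. i \<in> J \<Longrightarrow> conn E (B' i)" "\<And>i. i \<in> J \<Longrightarrow> B' i \<inter> ?Q = {w i, w' i}"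
    "\<And>i j. i \<in> J \<Longrightarrow> j \<in> J \<Longrightarrow> i \<noteq> j \<Longrightarrow> B' i \<inter> B' j = {}" by (rule linkedE[OF lB]) (rule that)
  define F where "F i = (if i \<in> J then D i \<union> B' i else D i)" for i
  have DC: "D i \<subseteq> C i" if "i \<in> I" for i using w[OF that] by blast
  \<comment> \<open>The link meets \<open>A\<close> only in two vertices that the set
    \<open>C i\<close> contained already, so disjointness within \<open>A\<close> is
    inherited.\<close>
  have BA: "B' i \<inter> A \<subseteq> C i" if "i \<in> J" for i
  proof -
    have "{w i, w' i} \<subseteq> C i" using w[of i] that by (simp add: J_def)
    then show ?thesis using B'(1)[OF that] B'(5)[OF that] by blast
  qed
  have FA: "F i \<inter> A \<subseteq> C i" if "i \<in> I" for i using DC[OF that] BA[of i] by (auto simp: F_def)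
  have FV: "F i \<subseteq> V" if "i \<in> I" for i using DC[OF that] C(1)[OF that] B'(1)[of i] AB by (auto simp: F_def)
  have Fc: "x i \<in> F i \<and> y i \<in> F i \<and> conn E (F i)" if i: "i \<in> I" for i
  proof (cases "i \<in> J")
    case True
    then have "w i \<noteq> w' i" by (simp add: J_def)
    then obtain D1 D2 where d: "D i = D1 \<union> D2" "x i \<in> D1" "w i \<in> D1" "conn E D1" "y i \<in> D2" "w' i \<in> D2" "conn E D2"
      using w[OF i] by blast
    have "conn E (D1 \<union> B' i)" by (rule conn_Un[OF d(4) B'(4)[OF True]]) (use d B'(2)[OF True] in auto)
    then have "conn E ((D1 \<union> B' i) \<union> D2)" by (rule conn_Un[OF _ d(7)]) (use d B'(3)[OF True] in auto)
    moreover have "(D1 \<union> B' i) \<union> D2 = F i" using True d by (auto simp: F_def)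
    ultimately show ?thesis using d True by (auto simp: F_def)
  next
    case False then show ?thesis using w[OF i] i by (auto simp: F_def J_def)
  qed
  have FT: "F i \<inter> T = {x i, y i}" if i: "i \<in> I" for i
    using FA[OF i] T C(5)[OF i] Fc[OF i] C(2,3)[OF i] by blast
  have "F i \<inter> F j = {}" if ij: "i \<in> I" "j \<in> I" "i \<noteq> j" for i j
  proof -
    have "F i \<inter> F j \<inter> A = {}" using FA[OF ij(1)] FA[OF ij(2)] C(6)[OF ij] by blast
    moreover have "F i \<inter> F j - A = {}"
      using DC[OF ij(1)] DC[OF ij(2)] C(1)[OF ij(1)] C(1)[OF ij(2)] B'(6)[of i j] ij by (auto simp: F_def split: if_splits)
    ultimately show ?thesis by blast
  qed
  note Fd = this
  show "\<exists>C. (\<forall>i\<in>I. C i \<subseteq> V \<and> x i \<in> C i \<and> y i \<in> C i \<and> conn E (C i) \<and> C i \<inter> T = {x i, y i}) \<and> disjoint_family_on C I"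
    by (rule exI[of _ F], unfold disjoint_family_on_def) (intro conjI ballI impI FV FT Fd Fc[THEN conjunct1] Fc[THEN conjunct2, THEN conjunct1] Fc[THEN conjunct2, THEN conjunct2]; assumption)
qed

section \<open>Massed graphs and rigid separations\<close>

lemma ex_min_pair:
  fixes f :: "'a \<Rightarrow> 'b \<Rightarrow> nat"
  assumes "P a b"
  obtains a0 b0 where "P a0 b0" "\<And>a b. P a b \<Longrightarrow> f a0 b0 \<le> f a b"
proof -
  obtain z where "P (fst z) (snd z)" "\<And>y. P (fst y) (snd y) \<Longrightarrow> f (fst z) (snd z) \<le> f (fst y) (snd y)"
    using ex_has_least_nat[of "\<lambda>z. P (fst z) (snd z)" "(a, b)" "\<lambda>z. f (fst z) (snd z)"] assms by auto
  then show ?thesis using that[of "fst z" "snd z"] by (metis fst_conv snd_conv)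
qed

text \<open>Ordered pairs are counted, so \<open>rho\<close> is twice the number of edges; this explains the factor 2 in \<open>massed\<close>.\<close>

definition touch :: "'a set \<Rightarrow> ('a \<Rightarrow> 'a \<Rightarrow> bool) \<Rightarrow> 'a set \<Rightarrow> ('a \<times> 'a) set" where
  "touch V E X = {(u, v). u \<in> V \<and> v \<in> V \<and> E u v \<and> (u \<in> X \<or> v \<in> X)}"

definition rho :: "'a set \<Rightarrow> ('a \<Rightarrow> 'a \<Rightarrow> bool) \<Rightarrow> 'a set \<Rightarrow> nat" where
  "rho V E X = card (touch V E X)"

lemma finite_touch: "finite V \<Longrightarrow> finite (touch V E X)"
  by (rule finite_subset[of _ "V \<times> V"]) (auto simp: touch_def)

lemma rho_le: "finite V' \<Longrightarrow> touch V E X \<subseteq> touch V' E' X' \<Longrightarrow> rho V E X \<le> rho V' E' X'"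
  unfolding rho_def by (rule card_mono[OF finite_touch])

lemma rho_empty [simp]: "rho V E {} = 0" by (simp add: rho_def touch_def)

lemma touch_sep:
  assumes "symp E" "separation V E A B"
  shows "touch V E (B - A) = touch B E (B - A)"
  using assms by (auto simp: touch_def separation_def dest: sympD)

text \<open>The two conditions of Thomas and Wollan: on average more than \<open>c\<close> edges per
  vertex outside \<open>T\<close>, and no such density beyond a separator smaller than
  \<open>T\<close>.\<close>

definition massed :: "nat \<Rightarrow> 'a set \<Rightarrow> ('a \<Rightarrow> 'a \<Rightarrow> bool) \<Rightarrow> 'a set \<Rightarrow> bool" where
  "massed c V E T \<longleftrightarrow> 2 * c * card (V - T) < rho V E (V - T) \<and>
     (\<forall>A B. separation V E A B \<and> T \<subseteq> A \<and> card (A \<inter> B) < card T \<longrightarrow> rho V E (B - A) \<le> 2 * c * card (B - A))"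

text \<open>Such a separation allows a reduction: its right side links the separator, so it can act
  as a clique.\<close>

definition rigid :: "'a set \<Rightarrow> ('a \<Rightarrow> 'a \<Rightarrow> bool) \<Rightarrow> 'a set \<Rightarrow> 'a set \<Rightarrow> 'a set \<Rightarrow> bool" where
  "rigid V E T A B \<longleftrightarrow> separation V E A B \<and> T \<subseteq> A \<and> card (A \<inter> B) \<le> card T \<and> \<not> B \<subseteq> A \<and> linked B E (A \<inter> B)"

lemma separation_extend:
  assumes "separation V E A B" "separation B E A1 B1" "A \<inter> B \<subseteq> A1"
  shows "separation V E (A \<union> A1) B1" "(A \<union> A1) \<inter> B1 = A1 \<inter> B1" "B1 - (A \<union> A1) = B1 - A1" "B1 \<subseteq> B"
  using assms by (auto simp: separation_def)

lemma separation_extend_left: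
  assumes "separation V E A B" "separation A E A1 B1" "A \<inter> B \<subseteq> B1"
  shows "separation V E A1 (B1 \<union> B)" "A1 \<inter> (B1 \<union> B) = A1 \<inter> B1" "A1 \<subseteq> A"
proof -
  show "A1 \<subseteq> A" "A1 \<inter> (B1 \<union> B) = A1 \<inter> B1" using assms by (auto simp: separation_def)
  show "separation V E A1 (B1 \<union> B)"
    unfolding separation_def
  proof (intro conjI ballI)
    show "A1 \<union> (B1 \<union> B) = V" using assms by (auto simp: separation_def)
    fix u v assume "u \<in> A1 - (B1 \<union> B)" "v \<in> B1 \<union> B - A1"
    then show "\<not> E u v" using assms unfolding separation_def by blast
  qed
qed

text \<open>The induction hypothesis quantifies over all graphs on the type with fewer than
  \<open>n\<close> vertices; clique replacement and contraction change the edge relation.\<close>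

locale massed_step =
  fixes c K n :: nat and type :: "'a itself"
  assumes K0: "0 < K" and cK: "31 * K \<le> 5 * c + 4"
    and IH: "\<And>(V::'a set) E T. finite V \<Longrightarrow> symp E \<Longrightarrow> irreflp E \<Longrightarrow> T \<subseteq> V \<Longrightarrow> card T \<le> 2 * K \<Longrightarrow> card V < n \<Longrightarrow>
      massed c V E T \<Longrightarrow> linked V E T"
begin

text \<open>The minimal right side is itself massed with respect to its separator: a dense part
  behind a smaller separator inside \<open>B\<close> would be dense in \<open>V\<close> as well,
  hence equal to \<open>B\<close>, and then its separator would contain \<open>A \<inter> B\<close>.
  The induction hypothesis does the rest.\<close>

lemma minimal_dense_linked:
  fixes V :: "'a set"
  assumes fin: "finite V" and sym: "symp E" and irr: "irreflp E" and sep: "separation V E A B"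
    and AB: "card (A \<inter> B) \<le> 2 * K" and dens: "2 * c * card (B - A) < rho V E (B - A)" and n: "card B < n"
    and min: "\<And>A1 B1. separation V E A1 B1 \<Longrightarrow> A \<subseteq> A1 \<Longrightarrow> B1 \<subseteq> B \<Longrightarrow> card (A1 \<inter> B1) < card (A \<inter> B) \<Longrightarrow>
       2 * c * card (B1 - A1) < rho V E (B1 - A1) \<Longrightarrow> card B \<le> card B1"
  shows "linked B E (A \<inter> B)"
proof (rule IH[OF _ sym irr _ AB n])
  have BV: "B \<subseteq> V" using sep by (auto simp: separation_def)
  show fB: "finite B" using BV fin finite_subset by blast
  show "A \<inter> B \<subseteq> B" by simp
  show "massed c B E (A \<inter> B)"
    unfolding massed_def
  proof (intro conjI allI impI)
    have "B - A \<inter> B = B - A" by auto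
    then show "2 * c * card (B - A \<inter> B) < rho B E (B - A \<inter> B)"
      using dens touch_sep[OF sym sep] by (simp add: rho_def)
    fix A1 B1 assume a: "separation B E A1 B1 \<and> A \<inter> B \<subseteq> A1 \<and> card (A1 \<inter> B1) < card (A \<inter> B)"
    note e = separation_extend[OF sep, of A1 B1]
    show "rho B E (B1 - A1) \<le> 2 * c * card (B1 - A1)"
    proof (rule ccontr)
      assume "\<not> ?thesis"
      then have gt: "2 * c * card (B1 - A1) < rho B E (B1 - A1)" by simp
      also have "\<dots> \<le> rho V E (B1 - A1)" by (rule rho_le[OF fin]) (use BV in \<open>auto simp: touch_def\<close>)
      finally have "card B \<le> card B1" using min[of "A \<union> A1" B1] e a by simp
      then have "B1 = B" using e(4) a fB by (meson card_seteq)
      then have "A \<inter> B \<subseteq> A1 \<inter> B1" using a by auto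
      moreover have "finite (A1 \<inter> B1)" using fB \<open>B1 = B\<close> by simp
      ultimately have "card (A \<inter> B) \<le> card (A1 \<inter> B1)" by (simp add: card_mono)
      then show False using a by simp
    qed
  qed
qed

text \<open>Without rigid separations, the second condition of \<open>massed\<close> extends to
  separators as large as \<open>T\<close>. That \<open>A - B\<close> is nonempty makes the right
  side proper, so that a minimal dense one is linked by induction and thus rigid.\<close>

lemma rho_light:
  fixes V :: "'a set"
  assumes fin: "finite V" and sym: "symp E" and irr: "irreflp E" and T: "card T \<le> 2 * K" and n: "card V \<le> n"
    and nr: "\<And>A B. \<not> rigid V E T A B"
    and AB: "separation V E A B" "T \<subseteq> A" "card (A \<inter> B) \<le> card T" "A - B \<noteq> {}"
  shows "rho V E (B - A) \<le> 2 * c * card (B - A)"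
proof (rule ccontr)
  define P where "P A B \<longleftrightarrow> separation V E A B \<and> T \<subseteq> A \<and> card (A \<inter> B) \<le> card T \<and> A - B \<noteq> {} \<and>
    2 * c * card (B - A) < rho V E (B - A)" for A B
  assume "\<not> ?thesis"
  then have "P A B" using AB by (simp add: P_def)
  then obtain A B where AB: "P A B" and min: "\<And>A' B'. P A' B' \<Longrightarrow> card B \<le> card B'"
    by (rule ex_min_pair[of P A B "\<lambda>A B. card B"]) blast
  have BV: "B \<subset> V" using AB by (auto simp: P_def separation_def)
  have "linked B E (A \<inter> B)"
  proof (rule minimal_dense_linked[OF fin sym irr])
    show "separation V E A B" "2 * c * card (B - A) < rho V E (B - A)" "card (A \<inter> B) \<le> 2 * K" using AB T by (auto simp: P_def)
    show "card B < n" using psubset_card_mono[OF fin BV] n by simp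
    fix A1 B1 assume a: "separation V E A1 B1" "A \<subseteq> A1" "B1 \<subseteq> B" "card (A1 \<inter> B1) < card (A \<inter> B)"
       "2 * c * card (B1 - A1) < rho V E (B1 - A1)"
    have "A - B \<subseteq> A1 - B1" using a by auto
    then show "card B \<le> card B1" using a AB by (intro min[of A1]) (auto simp: P_def)
  qed
  moreover have "\<not> B \<subseteq> A"
  proof
    assume "B \<subseteq> A" then have "B - A = {}" by auto
    moreover have "2 * c * card (B - A) < rho V E (B - A)" using AB by (simp add: P_def)
    ultimately show False by (simp only: rho_empty)
  qed
  ultimately have "rigid V E T A B" using AB by (simp add: P_def rigid_def)
  then show False using nr by blast
qed

text \<open>Take a rigid separation with \<open>A\<close> as small as possible. If its order is that of \<open>T\<close>, route \<open>T\<close> to the separator;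
  otherwise replace \<open>B\<close> by a clique on the separator.\<close>

lemma rigid_linked:
  fixes V :: "'a set"
  assumes fin: "finite V" and sym: "symp E" and irr: "irreflp E" and TV: "T \<subseteq> V" "card T \<le> 2 * K" and n: "card V \<le> n"
    and ms: "massed c V E T" and rg: "rigid V E T A0 B0"
  shows "linked V E T"
proof -
  obtain A B where AB: "rigid V E T A B" and min: "\<And>A' B'. rigid V E T A' B' \<Longrightarrow> card A \<le> card A'"
    using rg by (rule ex_min_pair[of "rigid V E T" A0 B0 "\<lambda>A B. card A"]) blast
  have s: "separation V E A B" "T \<subseteq> A" "card (A \<inter> B) \<le> card T" "\<not> B \<subseteq> A" "linked B E (A \<inter> B)"
    using AB by (auto simp: rigid_def)
  have V: "A \<union> B = V" using s by (simp add: separation_def)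
  have fA: "finite A" "finite B" using V fin by auto
  have smaller: "A1 = A" if "rigid V E T A1 B1" "A1 \<subseteq> A" for A1 B1
    using min[OF that(1)] that(2) fA by (simp add: card_seteq)
  show ?thesis
  proof (cases "card (A \<inter> B) = card T")
    case True
    define P where "P A' B' \<longleftrightarrow> separation A E A' B' \<and> T \<subseteq> A' \<and> A \<inter> B \<subseteq> B'" for A' B'
    have "P T A" using s by (auto simp: P_def separation_def)
    then obtain A' B' where P: "P A' B'" and mn: "\<And>A'' B''. P A'' B'' \<Longrightarrow> card (A' \<inter> B') \<le> card (A'' \<inter> B'')"
      by (rule ex_min_pair[of P T A "\<lambda>A B. card (A \<inter> B)"]) blast
    \<comment> \<open>A minimum separation of \<open>T\<close> from \<open>A \<inter> B\<close>
      inside \<open>A\<close> is continued by disjoint paths to \<open>A \<inter> B\<close>, where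
      \<open>B\<close> takes over the linking. If its order is below that of \<open>T\<close>, it is
      rigid with a smaller left side.\<close>
    have reroute: "linked (A2 \<union> B2 \<union> B) E (A2 \<inter> B2) \<and> linked (B2 \<union> B) E (A2 \<inter> B2)"
      if P2: "P A2 B2" "card (A2 \<inter> B2) \<le> card (A' \<inter> B')" for A2 B2
    proof -
      have "\<exists>g. (\<forall>x\<in>A2 \<inter> B2. gpath E (g x) \<and> hd (g x) = x \<and> last (g x) \<in> A \<inter> B \<and> set (g x) \<subseteq> B2 \<and>
        set (g x) \<inter> (A2 \<inter> B2) = {x} \<and> set (g x) \<inter> (A \<inter> B) = {last (g x)}) \<and>
       disjoint_family_on (\<lambda>x. set (g x)) (A2 \<inter> B2)"
      proof (rule landing[OF fA(1) sym, where T = T])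
        show "separation A E A2 B2" "T \<subseteq> A2" "A \<inter> B \<subseteq> B2" using P2 by (auto simp: P_def)
        fix A'' B'' assume "separation A E A'' B''" "T \<subseteq> A''" "A \<inter> B \<subseteq> B''"
        then show "card (A2 \<inter> B2) \<le> card (A'' \<inter> B'')" using mn[of A'' B''] P2 by (simp add: P_def)
      qed
      then obtain g where g: "\<forall>x\<in>A2 \<inter> B2. gpath E (g x) \<and> hd (g x) = x \<and> last (g x) \<in> A \<inter> B \<and> set (g x) \<subseteq> B2 \<and>
        set (g x) \<inter> (A2 \<inter> B2) = {x} \<and> set (g x) \<inter> (A \<inter> B) = {last (g x)}"
        "disjoint_family_on (\<lambda>x. set (g x)) (A2 \<inter> B2)" by blast
      have B2A: "B2 \<subseteq> A" using P2 by (auto simp: P_def separation_def)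
      have "set (g x) \<inter> B = {last (g x)}" if "x \<in> A2 \<inter> B2" for x
      proof -
        have "set (g x) \<inter> B = set (g x) \<inter> (A \<inter> B)" using g(1) that B2A by blast
        then show ?thesis using g(1) that by simp
      qed
      then have l: "linked (B2 \<union> B) E (A2 \<inter> B2)"
        using g by (intro linked_reroute[OF sym linked_mono[OF s(5)], where g = g]) (auto)
      then show ?thesis by (auto intro: linked_mono)
    qed
    show ?thesis
    proof (cases "card (A' \<inter> B') = card T")
      case True
      have "T \<inter> A = T" using s by auto
      then show ?thesis using reroute[OF \<open>P T A\<close>] True V s(2) by (simp add: Un_absorb1)
    next
      case False
      have "card (T \<inter> A) = card T" using s(2) by (simp add: Int_absorb2)
      then have lt: "card (A' \<inter> B') < card T" using mn[OF \<open>P T A\<close>] False by simp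
      have sp: "separation A E A' B'" "T \<subseteq> A'" "A \<inter> B \<subseteq> B'" using P by (auto simp: P_def)
      note e = separation_extend_left[OF s(1) sp(1,3)]
      have "rigid V E T A' (B' \<union> B)"
        using e lt s(4) sp(2) reroute[OF P] by (auto simp: rigid_def)
      then have "A' = A" using smaller e(3) by blast
      then have "A \<inter> B \<subseteq> A' \<inter> B'" using sp by auto
      then have "card (A \<inter> B) \<le> card (A' \<inter> B')" using \<open>A' = A\<close> fA by (simp add: card_mono)
      then show ?thesis using lt True by simp
    qed
  next
    case False
    then have lt: "card (A \<inter> B) < card T" using s(3) by simp
    define E2 where "E2 = complete_on E (A \<inter> B)"
    have EE2: "E a b \<Longrightarrow> E2 a b" for a b by (simp add: E2_def complete_on_def)
    have sym2: "symp E2" using symp_complete_on[OF sym] by (simp add: E2_def)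
    have irr2: "irreflp E2" using irr by (auto simp: E2_def complete_on_def irreflp_def)
    have cA: "card A < n"
      using psubset_card_mono[OF fin, of A] s(4) V n by (metis le_sup_iff order.strict_trans2 psubsetI subset_refl sup_ge1)
    define Q where "Q A' B' \<longleftrightarrow> separation A E2 A' B' \<and> T \<subseteq> A' \<and> card (A' \<inter> B') < card T \<and>
      2 * c * card (B' - A') < rho A E2 (B' - A')" for A' B'
    have "linked A E2 T"
    proof (rule IH[OF fA(1) sym2 irr2 s(2) TV(2) cA], unfold massed_def, intro conjI allI impI)
      have VT: "V - T = (A - T) \<union> (B - A)" "(A - T) \<inter> (B - A) = {}" using V s(2) by auto
      \<comment> \<open>Edges at \<open>V - T\<close> are edges at \<open>A - T\<close> inside
        \<open>A\<close> or edges at \<open>B - A\<close>; the latter are few because the separator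
        is smaller than \<open>T\<close>.\<close>
      have "touch V E (V - T) \<subseteq> touch A E2 (A - T) \<union> touch V E (B - A)"
        using EE2 V s(2) by (auto simp: touch_def)
      then have "rho V E (V - T) \<le> card (touch A E2 (A - T) \<union> touch V E (B - A))"
        unfolding rho_def using finite_touch fA fin by (intro card_mono) auto
      also have "\<dots> \<le> rho A E2 (A - T) + rho V E (B - A)" unfolding rho_def by (rule card_Un_le)
      finally have "rho V E (V - T) \<le> rho A E2 (A - T) + rho V E (B - A)" .
      moreover have "rho V E (B - A) \<le> 2 * c * card (B - A)" using ms s lt by (simp add: massed_def)
      moreover have "2 * c * card (V - T) < rho V E (V - T)" using ms by (simp add: massed_def)
      moreover have "card (V - T) = card (A - T) + card (B - A)" unfolding VT(1) using VT(2) fA by (intro card_Un_disjoint) auto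
      ultimately show "2 * c * card (A - T) < rho A E2 (A - T)" by (simp add: algebra_simps)
    next
      fix A1 B1 assume a: "separation A E2 A1 B1 \<and> T \<subseteq> A1 \<and> card (A1 \<inter> B1) < card T"
      show "rho A E2 (B1 - A1) \<le> 2 * c * card (B1 - A1)"
      proof (rule ccontr)
        assume "\<not> ?thesis"
        then have "Q A1 B1" using a by (simp add: Q_def)
        then obtain A1 B1 where Q: "Q A1 B1" and mn: "\<And>A' B'. Q A' B' \<Longrightarrow> card B1 \<le> card B'"
          by (rule ex_min_pair[of Q A1 B1 "\<lambda>A B. card B"]) blast
        have q: "separation A E2 A1 B1" "T \<subseteq> A1" "card (A1 \<inter> B1) < card T" "2 * c * card (B1 - A1) < rho A E2 (B1 - A1)"
          using Q by (auto simp: Q_def)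
        have A1: "A1 \<union> B1 = A" using q by (simp add: separation_def)
        have sE: "separation A E A1 B1" using q(1) EE2 by (auto simp: separation_def)
        \<comment> \<open>No separation splits a clique.\<close>
        have clique: "A \<inter> B \<subseteq> A1 \<or> A \<inter> B \<subseteq> B1"
        proof (rule ccontr)
          assume "\<not> ?thesis"
          then obtain u v where "u \<in> A \<inter> B" "u \<notin> A1" "v \<in> A \<inter> B" "v \<notin> B1" by blast
          then have "v \<in> A1 - B1" "u \<in> B1 - A1" "E2 v u" using A1 by (auto simp: E2_def complete_on_def)
          then show False using q(1) by (auto simp: separation_def)
        qed
        then show False
        proof
          \<comment> \<open>With the clique on the left, \<open>B\<close> can be added there; the
            right side touches no edge of the clique that \<open>E\<close> lacks.\<close>
          assume c1: "A \<inter> B \<subseteq> A1"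
          have "separation V E (A1 \<union> B) B1"
            unfolding separation_def
          proof (intro conjI ballI)
            show "A1 \<union> B \<union> B1 = V" using A1 V by auto
            fix u v assume "u \<in> A1 \<union> B - B1" "v \<in> B1 - (A1 \<union> B)"
            then have uv: "u \<in> A1 - B1 \<or> u \<in> B - A" "v \<in> B1 - A1" "v \<in> A - B" using A1 by auto
            show "\<not> E u v"
            proof (cases "u \<in> A1 - B1")
              case True then show ?thesis using sE uv by (auto simp: separation_def)
            next
              case False then show ?thesis using s(1) uv sympD[OF sym, of u v] by (auto simp: separation_def)
            qed
          qed
          moreover have "(A1 \<union> B) \<inter> B1 = A1 \<inter> B1" "B1 - (A1 \<union> B) = B1 - A1" using c1 A1 by auto
          ultimately have "rho V E (B1 - A1) \<le> 2 * c * card (B1 - A1)"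
            using ms q(2,3) unfolding massed_def by (metis le_supI1)
          moreover have "rho A E2 (B1 - A1) \<le> rho V E (B1 - A1)"
            by (rule rho_le[OF fin]) (use c1 V in \<open>auto simp: touch_def E2_def complete_on_def\<close>)
          ultimately show False using q(4) by simp
        next
          \<comment> \<open>With the clique on the right, \<open>B\<close> returns in its place; the
            right side becomes rigid, against the choice of \<open>A\<close>.\<close>
          assume c2: "A \<inter> B \<subseteq> B1"
          have eqB: "B1 \<inter> B = A \<inter> B" using c2 A1 by auto
          have "linked B1 E2 (A1 \<inter> B1)"
          proof (rule minimal_dense_linked[OF fA(1) sym2 irr2 q(1) _ q(4)])
            show "card (A1 \<inter> B1) \<le> 2 * K" using q(3) TV(2) by simp
            show "card B1 < n" using card_mono[OF fA(1), of B1] A1 cA by auto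
            fix A' B' assume "separation A E2 A' B'" "A1 \<subseteq> A'" "B' \<subseteq> B1" "card (A' \<inter> B') < card (A1 \<inter> B1)"
              "2 * c * card (B' - A') < rho A E2 (B' - A')"
            then show "card B1 \<le> card B'" using q by (intro mn[of A']) (auto simp: Q_def)
          qed
          then have l1: "linked B1 (complete_on E (B1 \<inter> B)) (A1 \<inter> B1)"
            using eqB by (simp only: E2_def)
          have l2: "linked B E (B1 \<inter> B)" using s(5) eqB by (simp only:)
          have "linked (B1 \<union> B) E (A1 \<inter> B1)"
            by (rule linked_clique_replace[OF sym refl l2 _ l1]) simp
          moreover note e = separation_extend_left[OF s(1) sE c2]
          ultimately have "rigid V E T A1 (B1 \<union> B)" using q(2,3) s(4) by (auto simp: rigid_def)
          then have "A1 = A" using smaller e(3) by blast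
          then have "B1 - A1 = {}" using A1 by auto
          then show False using q(4) by (simp only: rho_empty)
        qed
      qed
    qed
    then show ?thesis using linked_clique_replace[OF sym V s(5) s(2)] by (simp add: E2_def)
  qed
qed

end

section \<open>A minimal counterexample\<close>

lemma merge_sym: "symp E \<Longrightarrow> symp (merge E u v)"
  by (auto simp: merge_def symp_def)

context massed_step
begin

context
  fixes V T :: "'a set" and E
  assumes fin: "finite V" and sym: "symp E" and irr: "irreflp E" and TV: "T \<subseteq> V" "card T \<le> 2 * K" and n: "card V \<le> n"
    and ms: "massed c V E T" and nl: "\<not> linked V E T"
begin

lemma symE: "E a b \<longleftrightarrow> E b a" using sym by (auto dest: sympD)
lemma irrE: "\<not> E a a" using irr by (simp add: irreflp_def)

lemma no_rigid: "\<not> rigid V E T A B"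
  using rigid_linked[OF fin sym irr TV n ms] nl by blast

text \<open>Lost are the contracted edge itself, the doubled edges to common neighbours, and, if
  \<open>u\<close> is a terminal, the edges from \<open>v\<close> to \<open>T\<close>, which become
  edges inside \<open>T\<close>. Each counts twice, as an ordered pair.\<close>

lemma contract_edges:
  assumes v: "v \<in> V" "v \<notin> T" and u: "u \<in> V" "E u v"
  shows "rho V E (V - T) \<le> rho (V - {v}) (merge E u v) (V - {v} - T)
     + 2 * card {w \<in> nbrs V E v - {u}. E u w \<or> u \<in> T \<and> w \<in> T} + 2"
proof -
  define S where "S = {w \<in> nbrs V E v - {u}. E u w \<or> u \<in> T \<and> w \<in> T}"
  define Bad where "Bad = {(v, u), (u, v)} \<union> (Pair v ` S \<union> (\<lambda>w. (w, v)) ` S)"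
  define f where "f = (\<lambda>(a, b). (if a = v then u else a, if b = v then u else b))"
  have uv: "u \<noteq> v" using u irrE by auto
  have finS: "finite S" unfolding S_def using fin by (auto simp: nbrs_def)
  have "card (Pair v ` S \<union> (\<lambda>w. (w, v)) ` S) \<le> card S + card S"
    by (rule order_trans[OF card_Un_le]) (intro add_mono card_image_le finS)
  moreover have "card {(v, u), (u, v)} \<le> 2" using card_length[of "[(v, u), (u, v)]"] by simp
  moreover have "card Bad \<le> card {(v, u), (u, v)} + card (Pair v ` S \<union> (\<lambda>w. (w, v)) ` S)"
    unfolding Bad_def by (rule card_Un_le)
  ultimately have cB: "card Bad \<le> 2 * card S + 2" by linarith
  have inS: "w \<in> S" if "w \<in> V" "E v w" "w \<noteq> u" "E u w \<or> u \<in> T \<and> w \<in> T" for w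
    using that by (simp add: S_def nbrs_def)
  have good: "(E a b \<and> a \<in> V \<and> b \<in> V \<and> (a \<notin> T \<or> b \<notin> T)) \<and> (a = v \<longrightarrow> b \<noteq> u \<and> b \<noteq> v \<and> \<not> E u b \<and> (u \<notin> T \<or> b \<notin> T)) \<and>
     (b = v \<longrightarrow> a \<noteq> u \<and> a \<noteq> v \<and> \<not> E a u \<and> (u \<notin> T \<or> a \<notin> T))"
    if g: "(a, b) \<in> touch V E (V - T) - Bad" for a b
  proof -
    have 1: "E a b" "a \<in> V" "b \<in> V" "a \<notin> T \<or> b \<notin> T" "(a, b) \<notin> Bad" using g by (auto simp: touch_def)
    have 2: "b \<noteq> u \<and> b \<noteq> v \<and> \<not> E u b \<and> (u \<notin> T \<or> b \<notin> T)" if av: "a = v"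
    proof -
      have "b \<noteq> u" "b \<notin> S" using 1(5) av by (auto simp: Bad_def)
      then show ?thesis using inS[of b] 1 av irrE by auto
    qed
    have 3: "a \<noteq> u \<and> a \<noteq> v \<and> \<not> E a u \<and> (u \<notin> T \<or> a \<notin> T)" if bv: "b = v"
    proof -
      have "a \<noteq> u" "a \<notin> S" using 1(5) bv by (auto simp: Bad_def)
      then show ?thesis using inS[of a] 1 bv irrE symE by auto
    qed
    show ?thesis using 1 2 3 by blast
  qed
  have inj: "inj_on f (touch V E (V - T) - Bad)"
  proof (rule inj_onI)
    fix p q assume g: "p \<in> touch V E (V - T) - Bad" "q \<in> touch V E (V - T) - Bad" and e0: "f p = f q"
    obtain a b a' b' where pq: "p = (a, b)" "q = (a', b')" by (cases p, cases q) auto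
    note e = e0[unfolded pq]
    have 1: "(a, b) \<in> touch V E (V - T) - Bad" "(a', b') \<in> touch V E (V - T) - Bad" using g pq by auto
    have "a = a' \<and> b = b'"
      using good[OF 1(1)] good[OF 1(2)] e uv by (auto simp: f_def split: if_splits)
    then show "p = q" using pq by simp
  qed
  have img: "f ` (touch V E (V - T) - Bad) \<subseteq> touch (V - {v}) (merge E u v) (V - {v} - T)"
  proof (rule image_subsetI)
    fix z assume z: "z \<in> touch V E (V - T) - Bad"
    obtain a b where ab: "z = (a, b)" by (cases z)
    have "f (a, b) \<in> touch (V - {v}) (merge E u v) (V - {v} - T)"
      using good[OF z[unfolded ab]] uv u irrE by (auto simp: f_def touch_def merge_def symE)
    then show "f z \<in> touch (V - {v}) (merge E u v) (V - {v} - T)" using ab by simp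
  qed
  have "card (touch V E (V - T) - Bad) \<le> rho (V - {v}) (merge E u v) (V - {v} - T)"
    unfolding rho_def by (rule card_inj_on_le[OF inj img]) (use fin in \<open>simp add: finite_touch\<close>)
  moreover have "rho V E (V - T) \<le> card (touch V E (V - T) - Bad) + card Bad"
    unfolding rho_def using diff_card_le_card_Diff[of Bad "touch V E (V - T)"] finS by (auto simp: Bad_def)
  ultimately show ?thesis using cB unfolding S_def by linarith
qed

text \<open>Otherwise contracting \<open>v\<close> into \<open>u\<close> would leave a smaller massed graph.\<close>

lemma contract_bound:
  assumes v: "v \<in> V" "v \<notin> T" and u: "u \<in> V" "E u v"
  shows "c \<le> card {w \<in> nbrs V E v - {u}. E u w \<or> u \<in> T \<and> w \<in> T}"
proof (rule ccontr)
  let ?d = "card {w \<in> nbrs V E v - {u}. E u w \<or> u \<in> T \<and> w \<in> T}"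
  let ?V = "V - {v}"
  define E' where "E' = merge E u v"
  assume "\<not> c \<le> ?d"
  then have d: "?d + 1 \<le> c" by simp
  have uv: "u \<noteq> v" using u irrE by auto
  have EE': "E' a b" if "E a b" for a b using that irrE by (auto simp: E'_def merge_def)
  have Eu: "E' u b" if "E v b" "b \<noteq> u" for b using that by (auto simp: E'_def merge_def)
  have sym': "symp E'" using merge_sym[OF sym] by (simp add: E'_def)
  have irr': "irreflp E'" by (auto simp: E'_def merge_def irreflp_def)
  have fin': "finite ?V" using fin by simp
  have n': "card ?V < n" using n v fin by (metis card_Diff1_less le_trans not_le)
  have ins: "insert v ?V = V" using v by auto
  have TV': "T \<subseteq> ?V" using TV v by auto
  define P where "P A B \<longleftrightarrow> separation ?V E' A B \<and> T \<subseteq> A \<and> card (A \<inter> B) < card T \<and>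
      2 * c * card (B - A) < rho ?V E' (B - A)" for A B
  have M1: "2 * c * card (?V - T) < rho ?V E' (?V - T)"
  proof -
    have "?V - T = V - T - {v}" by auto
    then have "card (V - T) = card (?V - T) + 1" using v fin card_Suc_Diff1[of "V - T" v] by simp
    then have "2 * c * card (V - T) = 2 * c * card (?V - T) + 2 * c" by simp
    moreover have "2 * c * card (V - T) < rho V E (V - T)" using ms by (simp add: massed_def)
    ultimately show ?thesis using contract_edges[OF assms] d unfolding E'_def by linarith
  qed
  have "\<not> massed c ?V E' T"
  proof
    assume "massed c ?V E' T"
    then have "linked ?V E' T" by (rule IH[OF fin' sym' irr' TV' TV(2) n'])
    then have "linked (insert v ?V) E T" unfolding E'_def by (intro linked_unmerge[OF sym u(2)]) (use v in auto)
    then show False using nl ins by simp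
  qed
  \<comment> \<open>The density condition survives the contraction, so a separation must violate the
    second one.\<close>
  then obtain A0 B0 where "P A0 B0" using M1 unfolding massed_def P_def by (metis not_le)
  then obtain A B where AB: "P A B" and mn: "\<And>A' B'. P A' B' \<Longrightarrow> card B \<le> card B'"
    by (rule ex_min_pair[of P A0 B0 "\<lambda>A B. card B"]) blast
  have s: "separation ?V E' A B" "T \<subseteq> A" "card (A \<inter> B) < card T" "2 * c * card (B - A) < rho ?V E' (B - A)"
    using AB by (auto simp: P_def)
  have U: "A \<union> B = ?V" using s(1) by (simp add: separation_def)
  have vAB: "v \<notin> A" "v \<notin> B" using U by auto
  have noE': "\<not> E' x y" "\<not> E' y x" if "x \<in> A - B" "y \<in> B - A" for x y
    using s(1) that sympD[OF sym'] unfolding separation_def by blast+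
  have noE: "\<not> E x y" "\<not> E y x" if "x \<in> A - B" "y \<in> B - A" for x y
    using noE'[OF that] EE' by blast+
  have fAB: "finite A" "finite B" using U fin' by (metis finite_Un)+
  have nT: "\<not> T \<subseteq> A \<inter> B"
  proof
    assume "T \<subseteq> A \<inter> B"
    then have "card T \<le> card (A \<inter> B)" using fAB by (intro card_mono) auto
    then show False using s(3) by simp
  qed
  consider "u \<in> A - B" | "u \<in> B - A" | "u \<in> A \<inter> B" using u uv U by auto
  then show False
  proof cases
    case 1
    \<comment> \<open>\<open>v\<close> joins \<open>u\<close> on the left, and the edges touching
      \<open>B - A\<close> are old ones.\<close>
    have "separation V E (insert v A) B"
      unfolding separation_def
    proof (intro conjI ballI)
      show "insert v A \<union> B = V" using U ins by auto
      fix x y assume xy: "x \<in> insert v A - B" "y \<in> B - insert v A"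
      show "\<not> E x y"
      proof (cases "x = v")
        case True
        then show ?thesis using noE'(1)[OF 1, of y] Eu[of y] xy 1 by auto
      next
        case False then show ?thesis using noE xy by auto
      qed
    qed
    moreover have "insert v A \<inter> B = A \<inter> B" "B - insert v A = B - A" using vAB by auto
    ultimately have "rho V E (B - A) \<le> 2 * c * card (B - A)"
      using ms s(2,3) unfolding massed_def by (metis subset_insertI2)
    moreover have "touch ?V E' (B - A) \<subseteq> touch V E (B - A)"
    proof clarify
      fix x y assume xy: "(x, y) \<in> touch ?V E' (B - A)"
      then have "x \<noteq> u \<and> y \<noteq> u" using noE'[OF 1] 1 by (auto simp: touch_def)
      then show "(x, y) \<in> touch V E (B - A)" using xy by (auto simp: touch_def E'_def merge_def)
    qed
    then have "rho ?V E' (B - A) \<le> rho V E (B - A)" by (rule rho_le[OF fin])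
    ultimately show False using s(4) by linarith
  next
    case 2
    \<comment> \<open>\<open>u\<close> and \<open>v\<close> belong to the right side. It is linked
      by minimality, and undoing the contraction there gives a rigid separation.\<close>
    have "linked B E' (A \<inter> B)"
    proof (rule minimal_dense_linked[OF fin' sym' irr' s(1) _ s(4)])
      show "card (A \<inter> B) \<le> 2 * K" using s(3) TV by simp
      have "card B \<le> card ?V" using U fin' by (intro card_mono) auto
      then show "card B < n" using n' by simp
      fix A1 B1 assume "separation ?V E' A1 B1" "A \<subseteq> A1" "B1 \<subseteq> B" "card (A1 \<inter> B1) < card (A \<inter> B)"
        "2 * c * card (B1 - A1) < rho ?V E' (B1 - A1)"
      then show "card B \<le> card B1" using s by (intro mn[of A1]) (auto simp: P_def)
    qed
    then have "linked (insert v B) E (A \<inter> B)" unfolding E'_def using vAB by (intro linked_unmerge[OF sym u(2)]) auto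
    moreover have eq: "A \<inter> insert v B = A \<inter> B" using vAB by auto
    moreover have "separation V E A (insert v B)"
      unfolding separation_def
    proof (intro conjI ballI)
      show "A \<union> insert v B = V" using U ins by auto
      fix x y assume xy: "x \<in> A - insert v B" "y \<in> insert v B - A"
      then have x: "x \<in> A - B" by auto
      show "\<not> E x y"
      proof (cases "y = v")
        case True
        then show ?thesis using noE'(2)[OF x 2] Eu[of x] x 2 symE[of x v] by auto
      next
        case False then show ?thesis using noE xy by auto
      qed
    qed
    ultimately have "rigid V E T A (insert v B)" using s(2,3) vAB by (simp add: rigid_def)
    then show False using no_rigid by blast
  next
    case 3
    \<comment> \<open>\<open>v\<close> enters the separator, whose order may now equal that of
      \<open>T\<close>; for this case \<open>rho_light\<close> admits equality.\<close>
    have "separation V E (insert v A) (insert v B)"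
      unfolding separation_def using U ins noE by blast
    moreover have "insert v A \<inter> insert v B = insert v (A \<inter> B)" "insert v B - insert v A = B - A"
      "insert v A - insert v B = A - B" using vAB by auto
    moreover have "card (insert v (A \<inter> B)) \<le> card T" using s(3) fAB vAB by simp
    moreover have "A - B \<noteq> {}" using nT s(2) by blast
    ultimately have l: "rho V E (B - A) \<le> 2 * c * card (B - A)"
      using rho_light[OF fin sym irr TV(2) n no_rigid, of "insert v A" "insert v B"] s(2) by auto
    \<comment> \<open>Sends an edge created by the contraction to the edge at \<open>v\<close> from
      which it arose.\<close>
    define h where "h = (\<lambda>(x, y). if E x y then (x, y) else if x = u then (v, y) else (x, v))"
    have hp: "a \<in> V \<and> a \<noteq> v \<and> b \<in> V \<and> b \<noteq> v \<and> a \<noteq> b \<and> (a \<in> B - A \<or> b \<in> B - A) \<and>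
        (E a b \<or> a = u \<and> E v b \<or> b = u \<and> E a v)"
      if "(a, b) \<in> touch ?V E' (B - A)" for a b
      using that by (auto simp: touch_def E'_def merge_def)
    have inj: "inj_on h (touch ?V E' (B - A))"
    proof (rule inj_onI)
      fix p q assume g: "p \<in> touch ?V E' (B - A)" "q \<in> touch ?V E' (B - A)" and e: "h p = h q"
      obtain a b a' b' where pq: "p = (a, b)" "q = (a', b')" by (cases p, cases q) auto
      show "p = q"
        using hp[of a b] hp[of a' b'] g e 3 unfolding pq h_def by (auto split: if_splits)
    qed
    have img: "h ` touch ?V E' (B - A) \<subseteq> touch V E (B - A)"
    proof (rule image_subsetI)
      fix z assume z: "z \<in> touch ?V E' (B - A)"
      obtain a b where ab: "z = (a, b)" by (cases z)
      show "h z \<in> touch V E (B - A)" using hp[OF z[unfolded ab]] 3 v ab by (auto simp: h_def touch_def)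
    qed
    have "rho ?V E' (B - A) \<le> rho V E (B - A)"
      unfolding rho_def by (rule card_inj_on_le[OF inj img finite_touch[OF fin]])
    then show False using l s(4) by linarith
  qed
qed

text \<open>Deleting an isolated vertex would leave a smaller massed graph. It provides an edge at
  \<open>v\<close> to which \<open>contract_bound\<close> applies.\<close>

lemma no_isolated:
  assumes v: "v \<in> V" "v \<notin> T"
  shows "\<exists>u\<in>V. E u v"
proof (rule ccontr)
  let ?V = "V - {v}"
  assume "\<not> ?thesis"
  then have iso: "\<not> E u v" "\<not> E v u" if "u \<in> V" for u using symE that by blast+
  have fin': "finite ?V" using fin by simp
  have "massed c ?V E T"
    unfolding massed_def
  proof (intro conjI allI impI)
    have "touch V E (V - T) \<subseteq> touch ?V E (?V - T)" using iso by (auto simp: touch_def)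
    then have "rho V E (V - T) \<le> rho ?V E (?V - T)" by (rule rho_le[OF fin'])
    moreover have "card (?V - T) \<le> card (V - T)" using fin by (intro card_mono) auto
    then have "2 * c * card (?V - T) \<le> 2 * c * card (V - T)" by simp
    moreover have "2 * c * card (V - T) < rho V E (V - T)" using ms by (simp add: massed_def)
    ultimately show "2 * c * card (?V - T) < rho ?V E (?V - T)" by linarith
    fix A B assume a: "separation ?V E A B \<and> T \<subseteq> A \<and> card (A \<inter> B) < card T"
    then have U: "A \<union> B = ?V" and vB: "v \<notin> B" by (auto simp: separation_def)
    have "separation V E (insert v A) B"
      unfolding separation_def
    proof (intro conjI ballI)
      show "insert v A \<union> B = V" using U v by auto
      fix x y assume "x \<in> insert v A - B" "y \<in> B - insert v A"
      then show "\<not> E x y" using a iso[of y] U by (auto simp: separation_def)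
    qed
    moreover have "insert v A \<inter> B = A \<inter> B" "B - insert v A = B - A" using vB by auto
    ultimately have "rho V E (B - A) \<le> 2 * c * card (B - A)"
      using ms a unfolding massed_def by (metis subset_insertI2)
    moreover have "rho ?V E (B - A) \<le> rho V E (B - A)" by (rule rho_le[OF fin]) (auto simp: touch_def)
    ultimately show "rho ?V E (B - A) \<le> 2 * c * card (B - A)" by simp
  qed
  then have "linked ?V E T"
  proof (rule IH[OF fin' sym irr _ TV(2), rotated 2])
    show "T \<subseteq> ?V" using TV v by auto
    show "card ?V < n" using n v fin by (metis card_Diff1_less le_trans not_le)
  qed
  then have "linked V E T" by (rule linked_mono) auto
  then show False using nl by blast
qed

text \<open>It carries the failure of linking into \<open>M\<close>: take a separation of least
  order between \<open>T\<close> and \<open>M\<close> and follow its disjoint paths. If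
  \<open>M\<close> linked their ends, the separation would be rigid; the size of \<open>M\<close>
  keeps its right side from lying in the left one.\<close>

lemma landed:
  assumes M: "M \<subseteq> V" "2 * K < card M"
  obtains W where "W \<subseteq> M" "card W \<le> 2 * K" "T \<inter> M \<subseteq> W" "\<not> linked M E W"
proof -
  define P where "P A B \<longleftrightarrow> separation V E A B \<and> T \<subseteq> A \<and> M \<subseteq> B" for A B
  have P0: "P T V" using TV M by (auto simp: P_def separation_def)
  then obtain A B where P: "P A B" and mn: "\<And>A' B'. P A' B' \<Longrightarrow> card (A \<inter> B) \<le> card (A' \<inter> B')"
    by (rule ex_min_pair[of P T V "\<lambda>A B. card (A \<inter> B)"]) blast
  have s: "separation V E A B" "T \<subseteq> A" "M \<subseteq> B" using P by (auto simp: P_def)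
  have finB: "finite B" using s fin by (auto simp: separation_def)
  have "T \<inter> V = T" using TV by auto
  then have le: "card (A \<inter> B) \<le> card T" using mn[OF P0] by simp
  have "\<exists>g. (\<forall>x\<in>A \<inter> B. gpath E (g x) \<and> hd (g x) = x \<and> last (g x) \<in> M \<and> set (g x) \<subseteq> B \<and>
      set (g x) \<inter> (A \<inter> B) = {x} \<and> set (g x) \<inter> M = {last (g x)}) \<and>
     disjoint_family_on (\<lambda>x. set (g x)) (A \<inter> B)"
  proof (rule landing[OF fin sym s])
    fix A'' B'' assume "separation V E A'' B''" "T \<subseteq> A''" "M \<subseteq> B''"
    then show "card (A \<inter> B) \<le> card (A'' \<inter> B'')" using mn[of A'' B''] by (simp add: P_def)
  qed
  then obtain g where g: "\<forall>x\<in>A \<inter> B. gpath E (g x) \<and> hd (g x) = x \<and> last (g x) \<in> M \<and> set (g x) \<subseteq> B \<and>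
      set (g x) \<inter> (A \<inter> B) = {x} \<and> set (g x) \<inter> M = {last (g x)}"
    and dj: "disjoint_family_on (\<lambda>x. set (g x)) (A \<inter> B)" by blast
  define W where "W = (\<lambda>x. last (g x)) ` (A \<inter> B)"
  show thesis
  proof (rule that[of W])
    show "W \<subseteq> M" using g by (auto simp: W_def)
    have "card W \<le> card (A \<inter> B)" unfolding W_def using finB by (intro card_image_le) auto
    then show "card W \<le> 2 * K" using le TV by simp
    show "T \<inter> M \<subseteq> W"
    proof
      fix z assume z: "z \<in> T \<inter> M"
      then have zAB: "z \<in> A \<inter> B" using s by auto
      then have "z \<in> set (g z) \<inter> (A \<inter> B)" "set (g z) \<inter> M = {last (g z)}" using g by blast+
      then have "z = last (g z)" using z by blast
      then show "z \<in> W" using zAB unfolding W_def by (metis imageI)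
    qed
    show "\<not> linked M E W"
    proof
      assume l: "linked M E W"
      have "linked B E (A \<inter> B)"
        by (rule linked_reroute[OF sym l[unfolded W_def] s(3) _ dj]) (use g in blast)
      moreover have "\<not> B \<subseteq> A"
      proof
        assume "B \<subseteq> A"
        then have "card M \<le> card (A \<inter> B)" using s finB by (intro card_mono) auto
        then show False using M le TV by simp
      qed
      ultimately show False using no_rigid[of A B] s le by (simp add: rigid_def)
    qed
  qed
qed

text \<open>Delete an edge between two vertices outside \<open>T\<close>. If the density condition
  survived, a separation would have become dense by losing that edge from across, and
  \<open>rho_light\<close> forbids this. Such an edge exists, as otherwise only
  \<open>card T\<close> edges per vertex are possible.\<close>

lemma few_edges:
  assumes mn: "\<And>E'. symp E' \<Longrightarrow> (\<And>a b. E' a b \<Longrightarrow> E a b) \<Longrightarrow> massed c V E' T \<Longrightarrow> rho V E V \<le> rho V E' V"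
  shows "rho V E (V - T) \<le> 2 * c * card (V - T) + 2"
proof (rule ccontr)
  assume "\<not> ?thesis"
  then have big: "2 * c * card (V - T) + 2 < rho V E (V - T)" by simp
  have fT: "finite T" using TV fin finite_subset by blast
  have "\<exists>u v. u \<in> V - T \<and> v \<in> V - T \<and> E u v"
  proof (rule ccontr)
    assume "\<not> ?thesis"
    then have "touch V E (V - T) \<subseteq> (T \<times> (V - T)) \<union> ((V - T) \<times> T)" by (auto simp: touch_def)
    then have "rho V E (V - T) \<le> card ((T \<times> (V - T)) \<union> ((V - T) \<times> T))"
      unfolding rho_def using fT fin by (intro card_mono) auto
    also have "\<dots> \<le> card (T \<times> (V - T)) + card ((V - T) \<times> T)" by (rule card_Un_le)
    also have "\<dots> = 2 * card T * card (V - T)" by (simp add: card_cartesian_product)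
    also have "\<dots> \<le> 2 * c * card (V - T)" using TV(2) cK K0 by (intro mult_right_mono) auto
    finally show False using big by simp
  qed
  then obtain u v where uv: "u \<in> V" "u \<notin> T" "v \<in> V" "v \<notin> T" "E u v" by auto
  define E' where "E' a b \<longleftrightarrow> E a b \<and> {a, b} \<noteq> {u, v}" for a b
  have sub: "E a b" if "E' a b" for a b using that by (simp add: E'_def)
  have sym': "symp E'" using symE by (auto simp: E'_def symp_def insert_commute)
  have miss: "{a, b} = {u, v}" if "E a b" "\<not> E' a b" for a b using that by (simp add: E'_def)
  have "touch V E' V \<subset> touch V E V" using uv sub by (auto simp: touch_def E'_def)
  then have "rho V E' V < rho V E V" unfolding rho_def by (rule psubset_card_mono[OF finite_touch[OF fin]])
  then have "\<not> massed c V E' T" using mn[OF sym' sub] by force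
  moreover have "2 * c * card (V - T) < rho V E' (V - T)"
  proof -
    have "touch V E (V - T) \<subseteq> touch V E' (V - T) \<union> {(u, v), (v, u)}"
      using miss by (auto simp: touch_def doubleton_eq_iff)
    then have "rho V E (V - T) \<le> card (touch V E' (V - T) \<union> {(u, v), (v, u)})"
      unfolding rho_def using finite_touch[OF fin] by (intro card_mono) auto
    also have "\<dots> \<le> rho V E' (V - T) + card {(u, v), (v, u)}" unfolding rho_def by (rule card_Un_le)
    also have "\<dots> \<le> rho V E' (V - T) + 2" using card_length[of "[(u, v), (v, u)]"] by simp
    finally show ?thesis using big by simp
  qed
  ultimately obtain A B where s: "separation V E' A B" "T \<subseteq> A" "card (A \<inter> B) < card T"
    "2 * c * card (B - A) < rho V E' (B - A)" unfolding massed_def by (metis not_le)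
  have "rho V E' (B - A) \<le> rho V E (B - A)" by (rule rho_le[OF fin]) (use sub in \<open>auto simp: touch_def\<close>)
  then have big': "2 * c * card (B - A) < rho V E (B - A)" using s(4) by simp
  have fAB: "finite A" "finite B" using s(1) fin by (auto simp: separation_def)
  show False
  proof (cases "separation V E A B")
    case True
    then show False using ms s big' unfolding massed_def by (metis not_le)
  next
    case False
    then obtain x y where xy: "x \<in> A - B" "y \<in> B - A" "E x y" using s(1) by (auto simp: separation_def)
    then have eq: "{x, y} = {u, v}" using miss s(1) by (auto simp: separation_def)
    then have xT: "x \<notin> T" using uv by (auto simp: doubleton_eq_iff)
    \<comment> \<open>The deleted edge is the only one across; moving its end \<open>x\<close> into
      the separator raises the order by one.\<close>
    have "separation V E A (insert x B)"
      unfolding separation_def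
    proof (intro conjI ballI)
      show "A \<union> insert x B = V" using s(1) xy by (auto simp: separation_def)
      fix a b assume ab: "a \<in> A - insert x B" "b \<in> insert x B - A"
      show "\<not> E a b"
      proof
        assume "E a b"
        moreover have "\<not> E' a b" using s(1) ab xy by (auto simp: separation_def)
        ultimately have "{a, b} = {x, y}" using miss eq by simp
        then show False using ab xy by (auto simp: doubleton_eq_iff)
      qed
    qed
    moreover have "A \<inter> insert x B = insert x (A \<inter> B)" "insert x B - A = B - A" using xy by auto
    moreover have "card (insert x (A \<inter> B)) \<le> card T" using s(3) fAB xy by simp
    moreover have "A - insert x B \<noteq> {}"
    proof
      assume "A - insert x B = {}"
      then have "T \<subseteq> A \<inter> B" using s(2) xT by auto
      then have "card T \<le> card (A \<inter> B)" using fAB by (intro card_mono) auto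
      then show False using s(3) by simp
    qed
    ultimately have "rho V E (B - A) \<le> 2 * c * card (B - A)"
      using rho_light[OF fin sym irr TV(2) n no_rigid, of A "insert x B"] s(2) by simp
    then show False using big' by simp
  qed
qed

text \<open>If all degrees exceeded \<open>2 * c\<close>, the degree sum would leave at most two
  vertices outside \<open>T\<close>, too few for such degrees.\<close>

lemma low_degree:
  assumes few: "rho V E (V - T) \<le> 2 * c * card (V - T) + 2"
  shows "\<exists>v\<in>V - T. card (nbrs V E v) \<le> 2 * c"
proof (rule ccontr)
  assume a: "\<not> ?thesis"
  have fT: "finite T" using TV fin finite_subset by blast
  have pos: "V - T \<noteq> {}"
  proof
    assume e: "V - T = {}"
    have "2 * c * card (V - T) < rho V E (V - T)" using ms by (simp add: massed_def)
    then show False unfolding e by simp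
  qed
  have "(SIGMA v:V - T. nbrs V E v) \<subseteq> touch V E (V - T)" by (auto simp: touch_def nbrs_def)
  then have "card (SIGMA v:V - T. nbrs V E v) \<le> rho V E (V - T)"
    unfolding rho_def using finite_touch[OF fin] by (intro card_mono) auto
  moreover have "card (SIGMA v:V - T. nbrs V E v) = (\<Sum>v\<in>V - T. card (nbrs V E v))"
    using fin by (intro card_SigmaI) auto
  moreover have "(\<Sum>v\<in>V - T. 2 * c + 1) \<le> (\<Sum>v\<in>V - T. card (nbrs V E v))"
    using a by (intro sum_mono) (simp add: not_le Suc_le_eq)
  moreover have "(\<Sum>v\<in>V - T. 2 * c + 1) = 2 * c * card (V - T) + card (V - T)" by (simp add: algebra_simps)
  ultimately have "card (V - T) \<le> 2" using few by linarith
  moreover have "card V = card (V - T) + card T" using TV(1) fT fin by (simp add: card_Diff_subset card_mono)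
  ultimately have "card V \<le> 2 * K + 2" using TV(2) by simp
  moreover obtain v where v: "v \<in> V - T" using pos by blast
  then have "2 * c + 1 \<le> card (nbrs V E v)" using a by (simp add: not_le Suc_le_eq)
  moreover have "nbrs V E v \<subseteq> V - {v}" using irrE by (auto simp: nbrs_def)
  then have "card (nbrs V E v) \<le> card (V - {v})" using fin by (intro card_mono) auto
  then have "card (nbrs V E v) + 1 \<le> card V" using v fin card_Suc_Diff1[of V v] by simp
  ultimately show False using cK K0 by simp
qed

text \<open>The failure of linking is carried twice by \<open>landed\<close>: into the closed
  neighbourhood of a vertex of low degree, where it produces a dense set \<open>D\<close>, and then
  into \<open>D\<close>, where \<open>dense_linked\<close> refutes it.\<close>

lemma minimal_counterexample_False:
  assumes mn: "\<And>E'. symp E' \<Longrightarrow> (\<And>a b. E' a b \<Longrightarrow> E a b) \<Longrightarrow> massed c V E' T \<Longrightarrow> rho V E V \<le> rho V E' V"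
  shows False
proof -
  obtain v where v: "v \<in> V" "v \<notin> T" "card (nbrs V E v) \<le> 2 * c"
    using low_degree[OF few_edges[OF mn]] by blast
  let ?N = "nbrs V E v"
  define L where "L = insert v ?N"
  have finN: "finite ?N" and vN: "v \<notin> ?N" using fin irrE by (auto simp: nbrs_def)
  obtain u where u: "u \<in> V" "E u v" using no_isolated[OF v(1,2)] by blast
  have uN: "u \<in> ?N" using u symE by (simp add: nbrs_def)
  have "c \<le> card (?N - {u})"
    by (rule order_trans[OF contract_bound[OF v(1,2) u]]) (use finN in \<open>auto intro!: card_mono\<close>)
  then have degv: "c + 1 \<le> card ?N" using card_Suc_Diff1[OF finN uN] by simp
  have LV: "L \<subseteq> V" "finite L" using v finN by (auto simp: L_def nbrs_def)
  have cL: "card L = card ?N + 1" using finN vN by (simp add: L_def)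
  have cb: "c \<le> card {w \<in> ?N - {f}. E f w \<or> f \<in> T \<and> w \<in> T}" if "f \<in> ?N" for f
    using contract_bound[OF v(1,2), of f] that symE by (simp add: nbrs_def)
  have h1: "c + 1 \<le> card (nbrs L E f)" if f: "f \<in> L - T" for f
  proof (cases "f = v")
    case True
    have "?N \<subseteq> nbrs L E v" by (auto simp: L_def nbrs_def)
    then have "card ?N \<le> card (nbrs L E v)" using LV by (intro card_mono) auto
    then show ?thesis using degv True by simp
  next
    case False
    then have fN: "f \<in> ?N" "f \<notin> T" using f by (auto simp: L_def)
    let ?S = "{w \<in> ?N - {f}. E f w \<or> f \<in> T \<and> w \<in> T}"
    have "insert v ?S \<subseteq> nbrs L E f" using fN symE by (auto simp: L_def nbrs_def)
    then have "card (insert v ?S) \<le> card (nbrs L E f)" using LV by (intro card_mono) auto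
    moreover have "card (insert v ?S) = card ?S + 1" using finN vN by simp
    ultimately show ?thesis using cb[OF fN(1)] by simp
  qed
  \<comment> \<open>For \<open>w\<close> in \<open>T\<close>, the count of
    \<open>contract_bound\<close> may include vertices of \<open>T\<close> that are not neighbours
    of \<open>w\<close>. They lie in \<open>W\<close>, so after removing \<open>W\<close> only true
    neighbours are left.\<close>
  have h2: "c + 2 \<le> card (nbrs (L - W) E w) + 2 * K" if W: "W \<subseteq> L" "card W \<le> 2 * K" "T \<inter> L \<subseteq> W" "w \<in> W" for W w
  proof -
    have finW: "finite W" using W LV finite_subset by blast
    have "\<exists>R. c + 1 \<le> card R \<and> R \<subseteq> nbrs (L - W) E w \<union> (W - {w})"
    proof (cases "w = v")
      case True
      have "?N \<subseteq> nbrs (L - W) E w \<union> (W - {w})" using True vN by (auto simp: L_def nbrs_def)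
      then show ?thesis using degv by blast
    next
      case False
      then have wN: "w \<in> ?N" using W by (auto simp: L_def)
      let ?S = "{x \<in> ?N - {w}. E w x \<or> w \<in> T \<and> x \<in> T}"
      have "insert v ?S \<subseteq> nbrs (L - W) E w \<union> (W - {w})"
      proof
        fix x assume x: "x \<in> insert v ?S"
        have xw: "x \<noteq> w" "x \<in> L" using x False by (auto simp: L_def)
        show "x \<in> nbrs (L - W) E w \<union> (W - {w})"
        proof (cases "x \<in> W")
          case False
          then have "x \<notin> T" using W(3) xw by auto
          then have "E w x" using x wN symE by (auto simp: nbrs_def)
          then show ?thesis using False xw by (auto simp: nbrs_def)
        qed (use xw in auto)
      qed
      moreover have "card (insert v ?S) = card ?S + 1" using finN vN by simp
      then have "c + 1 \<le> card (insert v ?S)" using cb[OF wN] by linarith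
      ultimately show ?thesis by (intro exI conjI)
    qed
    then obtain R where R: "c + 1 \<le> card R" "R \<subseteq> nbrs (L - W) E w \<union> (W - {w})" by blast
    have "card R \<le> card (nbrs (L - W) E w \<union> (W - {w}))" using R(2) finW LV by (intro card_mono) auto
    also have "\<dots> \<le> card (nbrs (L - W) E w) + card (W - {w})" by (rule card_Un_le)
    finally have "c + 1 \<le> card (nbrs (L - W) E w) + card (W - {w})" using R(1) by simp
    moreover have "card W = card (W - {w}) + 1" using card_Suc_Diff1[OF finW W(4)] by simp
    ultimately show ?thesis using W(2) by simp
  qed
  have bigL: "2 * K < card L" using cL degv cK K0 by simp
  obtain W where W: "W \<subseteq> L" "card W \<le> 2 * K" "T \<inter> L \<subseteq> W" "\<not> linked L E W" by (rule landed[OF LV(1) bigL])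
  then obtain I x y where p: "pairs x y I W" and nC: "\<not> (\<exists>C. (\<forall>i\<in>I. C i \<subseteq> L \<and> x i \<in> C i \<and> y i \<in> C i \<and> conn E (C i) \<and> C i \<inter> W = {x i, y i}) \<and> disjoint_family_on C I)"
    unfolding linked_def by blast
  interpret FL: first_level L E W c K I x y
  proof
    show "finite L" "symp E" "irreflp E" "W \<subseteq> L" "card W \<le> 2 * K" "pairs x y I W" using LV sym irr W p by auto
    show "card L \<le> 2 * c + 1" using cL v(3) by simp
    show "6 * K \<le> c + 2" using cK K0 by simp
    show "c + 1 \<le> card (nbrs L E f)" if "f \<in> L - W" for f by (rule h1) (use that W(3) in blast)
    show "c + 2 \<le> card (nbrs (L - W) E w) + 2 * K" if "w \<in> W" for w by (rule h2[OF W(1,2,3) that])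
  qed
  obtain D \<delta> where D: "D \<subseteq> L - W" "\<forall>v\<in>D. \<delta> \<le> card (nbrs D E v)" "2 * c + 8 + 2 * card D \<le> 4 * \<delta> + 7 * K"
    "c + 4 \<le> card D + 3 * K" using FL.linked_or_dense nC by blast
  have DV: "D \<subseteq> V" "finite D" using D LV finite_subset[of D L] by auto
  have bigD: "2 * K < card D" "3 * K \<le> card D" using D(4) cK K0 by simp_all
  obtain W' where W': "W' \<subseteq> D" "card W' \<le> 2 * K" "\<not> linked D E W'" by (rule landed[OF DV(1) bigD(1)])
  have "linked D E W'"
  proof (rule dense_linked[where \<mu> = "2 * \<delta> - card D" and \<delta> = \<delta>])
    show "finite D" "symp E" "irreflp E" "3 * K \<le> card D" "W' \<subseteq> D" "card W' \<le> 2 * K" using DV sym irr bigD W' by auto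
    show "\<And>v. v \<in> D \<Longrightarrow> \<delta> \<le> card (nbrs D E v)" using D by blast
    have "2 * c + 8 \<le> 2 * (2 * \<delta> - card D) + 7 * K" and le: "card D \<le> 2 * \<delta>" using D(3) cK K0 by simp_all
    \<comment> \<open>Substituting the density of \<open>D\<close> turns this into
      \<open>37 * K < 6 * c + 52\<close>; as 37/6 is below 31/5, it follows from
      \<open>31 * K \<le> 5 * c + 4\<close>.\<close>
    then show "8 * K < 3 * (2 * \<delta> - card D) + 14" using cK by simp
    show "card D + (2 * \<delta> - card D) \<le> 2 * \<delta>" using le by simp
  qed
  then show False using W'(3) by blast
qed

end

end

text \<open>Induction on the number of vertices; within a step, the edge relation is replaced by a
  massed subrelation with fewest edges, to which the lemmas on a minimal counterexample
  apply.\<close>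

theorem massed_linked:
  fixes V :: "'a set"
  assumes "0 < K" "31 * K \<le> 5 * c + 4" "finite V" "symp E" "irreflp E" "T \<subseteq> V" "card T \<le> 2 * K" "massed c V E T"
  shows "linked V E T"
  using assms(3-8)
proof (induction "card V" arbitrary: V E T rule: less_induct)
  case (less V E T)
  interpret massed_step c K "card V" "TYPE('a)"
  proof
    show "0 < K" "31 * K \<le> 5 * c + 4" by (fact assms)+
    show "linked V' E' T'" if "finite V'" "symp E'" "irreflp E'" "T' \<subseteq> V'" "card T' \<le> 2 * K" "card V' < card V" "massed c V' E' T'"
      for V' :: "'a set" and E' T'
      by (rule less.hyps[OF that(6,1,2,3,4,5,7)])
  qed
  show ?case
  proof (rule ccontr)
    assume nl: "\<not> linked V E T"
    \<comment> \<open>The second argument is a dummy of type \<open>unit\<close>, to fit the two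
      arguments of \<open>ex_min_pair\<close>.\<close>
    define P where "P F (z::unit) \<longleftrightarrow> symp F \<and> (\<forall>a b. F a b \<longrightarrow> E a b) \<and> massed c V F T" for F z
    have "P E ()" using less.prems by (simp add: P_def)
    then obtain F z where F: "P F z" and mn: "\<And>F' z. P F' z \<Longrightarrow> rho V F V \<le> rho V F' V"
      by (rule ex_min_pair[of P E "()" "\<lambda>F z. rho V F V"]) blast
    have f: "symp F" "massed c V F T" and sub: "\<And>a b. F a b \<Longrightarrow> E a b" using F by (auto simp: P_def)
    have irr: "irreflp F" using less.prems(3) sub by (auto simp: irreflp_def)
    have nl': "\<not> linked V F T" using nl linked_mono[of V F T V T E] sub by blast
    show False
    proof (rule minimal_counterexample_False[OF less.prems(1) f(1) irr less.prems(4,5) le_refl f(2) nl'])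
      fix E' assume e: "symp E'" "\<And>a b. E' a b \<Longrightarrow> F a b" "massed c V E' T"
      show "rho V F V \<le> rho V E' V" by (rule mn[of E' "()"]) (use e sub in \<open>auto simp: P_def\<close>)
    qed
  qed
qed

section \<open>Hosts: linked bipartite subgraphs\<close>

lemma rho_delete_vertex:
  assumes fin: "finite V" and sym: "symp E" and irr: "irreflp E" and v: "v \<in> V"
  shows "rho V E V = rho (V - {v}) E (V - {v}) + 2 * card (nbrs V E v)"
proof -
  let ?N = "nbrs V E v"
  have vN: "v \<notin> ?N" and fN: "finite ?N" using irr fin by (auto simp: nbrs_def irreflp_def)
  have "touch V E V = touch (V - {v}) E (V - {v}) \<union> (Pair v ` ?N \<union> (\<lambda>u. (u, v)) ` ?N)"
    using v sympD[OF sym] by (auto simp: touch_def nbrs_def)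
  moreover have "touch (V - {v}) E (V - {v}) \<inter> (Pair v ` ?N \<union> (\<lambda>u. (u, v)) ` ?N) = {}" by (auto simp: touch_def)
  moreover have "card (Pair v ` ?N \<union> (\<lambda>u. (u, v)) ` ?N) = card (Pair v ` ?N) + card ((\<lambda>u. (u, v)) ` ?N)"
    using fN vN by (intro card_Un_disjoint) auto
  moreover have "card (Pair v ` ?N) = card ?N" "card ((\<lambda>u. (u, v)) ` ?N) = card ?N"
    by (auto intro!: card_image inj_onI)
  ultimately show ?thesis
    unfolding rho_def using fin fN finite_touch[of "V - {v}" E "V - {v}"] by (simp add: card_Un_disjoint)
qed

text \<open>In a colouring with most bichromatic edges, recolouring \<open>v\<close> exchanges its
  mono- and bichromatic edges and cannot be a gain.\<close>

lemma max_cut: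
  assumes fin: "finite V" and sym: "symp E" and irr: "irreflp E"
  shows "\<exists>col::'a \<Rightarrow> bool. \<forall>v\<in>V. card (nbrs V E v) \<le> 2 * card (nbrs V (\<lambda>a b. E a b \<and> col a \<noteq> col b) v)"
proof -
  define F where "F col = (\<lambda>a b. E a b \<and> col a \<noteq> (col b :: bool))" for col
  have "rho V (F col) V \<le> card (V \<times> V)" for col
    unfolding rho_def using fin by (intro card_mono) (auto simp: touch_def)
  then obtain col where mx: "\<And>col'. rho V (F col') V \<le> rho V (F col) V"
    using ex_has_greatest_nat[of "\<lambda>_. True" undefined "\<lambda>col. rho V (F col) V" "card (V \<times> V) + 1"] by (auto simp: less_Suc_eq_le)
  have symF: "symp (F col)" and irrF: "irreflp (F col)" for col
    using irr sympD[OF sym] by (auto simp: F_def irreflp_def intro!: sympI)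
  have "card (nbrs V E v) \<le> 2 * card (nbrs V (F col) v)" if v: "v \<in> V" for v
  proof -
    let ?c = "col(v := \<not> col v)"
    have "touch (V - {v}) (F ?c) (V - {v}) = touch (V - {v}) (F col) (V - {v})" by (auto simp: touch_def F_def)
    then have "rho (V - {v}) (F ?c) (V - {v}) = rho (V - {v}) (F col) (V - {v})" by (simp add: rho_def)
    then have le: "card (nbrs V (F ?c) v) \<le> card (nbrs V (F col) v)"
      using mx[of ?c] rho_delete_vertex[OF fin symF irrF v, of ?c] rho_delete_vertex[OF fin symF irrF v, of col] by simp
    have "nbrs V E v \<subseteq> nbrs V (F ?c) v \<union> nbrs V (F col) v"
      using irr by (auto simp: nbrs_def F_def irreflp_def)
    then have "card (nbrs V E v) \<le> card (nbrs V (F ?c) v \<union> nbrs V (F col) v)" using fin by (intro card_mono) auto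
    also have "\<dots> \<le> card (nbrs V (F ?c) v) + card (nbrs V (F col) v)" by (rule card_Un_le)
    finally show ?thesis using le by simp
  qed
  then show ?thesis unfolding F_def by blast
qed

lemma bipartite_rho:
  assumes fin: "finite V" and col: "\<And>a b. a \<in> V \<Longrightarrow> b \<in> V \<Longrightarrow> E a b \<Longrightarrow> col a \<noteq> (col b :: bool)"
  shows "2 * rho V E V \<le> card V * card V"
proof -
  let ?P = "{a \<in> V. col a}" and ?Q = "{a \<in> V. \<not> col a}"
  have fPQ: "finite ?P" "finite ?Q" using fin by auto
  have "touch V E V \<subseteq> ?P \<times> ?Q \<union> ?Q \<times> ?P" using col by (auto simp: touch_def)
  then have "rho V E V \<le> card (?P \<times> ?Q \<union> ?Q \<times> ?P)" unfolding rho_def using fPQ by (intro card_mono) auto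
  also have "\<dots> \<le> card (?P \<times> ?Q) + card (?Q \<times> ?P)" by (rule card_Un_le)
  finally have 1: "rho V E V \<le> 2 * (card ?P * card ?Q)" by (simp add: card_cartesian_product mult.commute)
  have "V = ?P \<union> ?Q" by auto
  then have eq: "card V = card ?P + card ?Q" using card_Un_disjoint[OF fPQ] by auto
  have amgm: "4 * (p * q) \<le> (p + q) * (p + q)" for p q :: nat
  proof -
    have "0 \<le> (int p - int q) * (int p - int q)" by simp
    then have "int (4 * (p * q)) \<le> int ((p + q) * (p + q))" by (simp add: algebra_simps)
    then show ?thesis by (simp only: of_nat_le_iff)
  qed
  have "2 * rho V E V \<le> 4 * (card ?P * card ?Q)" using 1 by linarith
  then show ?thesis unfolding eq by (rule order_trans[OF _ amgm])
qed

text \<open>As \<open>2 * c\<close> is at most 24.8 k, the density \<open>25 * k\<close> leaves at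
  least 0.2 k for each of the \<open>m\<close> vertices, and \<open>40 * k \<le> m\<close> makes
  this cover the \<open>8 * (k * k)\<close> ordered edges inside the terminal set.\<close>

lemma host_arith:
  assumes "25 * (k * m) < r" "r \<le> r' + 8 * (k * k)" "40 * k \<le> m" "5 * c \<le> 62 * (k::nat)"
  shows "2 * c * m < r'"
proof -
  have "(5 * c) * m \<le> (62 * k) * m" using assms(4) by (rule mult_le_mono1)
  then have 1: "5 * (c * m) \<le> 62 * (k * m)" by (simp only: mult.assoc)
  have "k * (40 * k) \<le> k * m" using assms(3) by (rule mult_le_mono2)
  then have 2: "40 * (k * k) \<le> k * m" by (simp only: mult.left_commute)
  have "2 * (c * m) < r'" using assms(1,2) 1 2 by linarith
  then show ?thesis by (simp only: mult.assoc)
qed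

text \<open>With \<open>K = 2 k\<close>, the value \<open>62 k div 5\<close> is the least \<open>c\<close> that \<open>massed_linked\<close> admits.\<close>

lemma host_linked:
  assumes fin: "finite U" and sym: "symp F" and irr: "irreflp F" and k: "0 < k"
    and col: "\<And>a b. a \<in> U \<Longrightarrow> b \<in> U \<Longrightarrow> F a b \<Longrightarrow> col a \<noteq> (col b :: bool)"
    and big: "44 * k \<le> card U" and dens: "25 * (k * (card U - 4 * k)) < rho U F U"
    and sep: "\<And>A B. separation U F A B \<Longrightarrow> card (A \<inter> B) < 4 * k \<Longrightarrow> A - B = {} \<or> B - A = {}"
    and T0: "T0 \<subseteq> U" "card T0 \<le> 4 * k"
  shows "linked U F T0"
proof -
  \<comment> \<open>Enlarging \<open>T0\<close> to exactly \<open>4 * k\<close> vertices makes the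
    second condition of \<open>massed\<close> speak of the separations of order below
    \<open>4 * k\<close>, which are trivial by assumption.\<close>
  obtain T where T: "T0 \<subseteq> T" "T \<subseteq> U" "card T = 4 * k"
    using exists_subset_between[of T0 "4 * k" U] T0 big fin by auto
  have fT: "finite T" using T fin finite_subset by blast
  define c where "c = 62 * k div 5"
  have c: "5 * c \<le> 62 * k" "31 * (2 * k) \<le> 5 * c + 4" by (simp_all add: c_def)
  have "massed c U F T"
    unfolding massed_def
  proof (intro conjI allI impI)
    have "touch U F U \<subseteq> touch U F (U - T) \<union> touch T F T" by (auto simp: touch_def)
    then have "rho U F U \<le> card (touch U F (U - T) \<union> touch T F T)"
      unfolding rho_def using finite_touch fin fT by (intro card_mono) auto
    also have "\<dots> \<le> rho U F (U - T) + rho T F T" unfolding rho_def by (rule card_Un_le)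
    finally have "rho U F U \<le> rho U F (U - T) + rho T F T" .
    moreover have "2 * rho T F T \<le> card T * card T" by (rule bipartite_rho[OF fT, of F col]) (use col T in blast)
    ultimately have "rho U F U \<le> rho U F (U - T) + 8 * (k * k)" using T by simp
    moreover have "card (U - T) = card U - 4 * k" using T fT by (simp add: card_Diff_subset)
    ultimately show "2 * c * card (U - T) < rho U F (U - T)"
      using host_arith[OF dens _ _ c(1)] big by simp
    fix A B assume a: "separation U F A B \<and> T \<subseteq> A \<and> card (A \<inter> B) < card T"
    then have "A - B = {} \<or> B - A = {}" using sep T(3) by simp
    moreover have "A - B \<noteq> {}"
    proof
      assume "A - B = {}"
      then have "T \<subseteq> A \<inter> B" using a by auto
      moreover have "finite (A \<inter> B)" using a fin by (auto simp: separation_def)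
      ultimately have "card T \<le> card (A \<inter> B)" by (simp add: card_mono)
      then show False using a by simp
    qed
    ultimately have "B - A = {}" by simp
    then show "rho U F (B - A) \<le> 2 * c * card (B - A)" by (simp only: rho_empty)
  qed
  then have "linked U F T" using T k by (intro massed_linked[OF _ c(2) fin sym irr T(2)]) simp_all
  then show ?thesis by (rule linked_mono) (use T in auto)
qed

text \<open>Mader's argument: a minimal dense set of vertices is highly connected, and since a bipartite graph on
  \<open>n\<close> vertices has at most \<open>n\<^sup>2 / 4\<close> edges, it has more than \<open>44 k\<close> vertices.\<close>

lemma dense_subgraph_host:
  assumes fin: "finite V" and sym: "symp F" and irr: "irreflp F" and k: "0 < k"
    and col: "\<And>a b. F a b \<Longrightarrow> col a \<noteq> (col b :: bool)"
    and big: "12 * k < card V" and deg: "\<And>v. v \<in> V \<Longrightarrow> 25 * k \<le> card (nbrs V F v)"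
  shows "\<exists>U\<subseteq>V. 44 * k \<le> card U \<and> (\<forall>T\<subseteq>U. card T \<le> 4 * k \<longrightarrow> linked U F T)"
proof -
  \<comment> \<open>Subtracting \<open>4 * k\<close> makes the bound add up over the sides of a
    separation of order below \<open>4 * k\<close>.\<close>
  define P where "P U \<longleftrightarrow> U \<subseteq> V \<and> 12 * k < card U \<and> 25 * (k * (card U - 4 * k)) < rho U F U" for U
  have "(\<Sum>v\<in>V. 25 * k) \<le> (\<Sum>v\<in>V. card (nbrs V F v))" by (intro sum_mono deg)
  also have "\<dots> = card (SIGMA v:V. nbrs V F v)" using fin by (intro card_SigmaI[symmetric]) auto
  also have "(SIGMA v:V. nbrs V F v) = touch V F V" by (auto simp: touch_def nbrs_def)
  finally have "25 * (k * card V) \<le> rho V F V" by (simp add: rho_def mult_ac)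
  moreover have "k * (card V - 4 * k) < k * card V" using k big by simp
  ultimately have "25 * (k * (card V - 4 * k)) < rho V F V" by linarith
  then have "P V" using big by (simp add: P_def)
  then obtain U where U: "P U" and mn: "\<And>U'. P U' \<Longrightarrow> card U \<le> card U'" using ex_has_least_nat[of P V card] by blast
  have u: "U \<subseteq> V" "12 * k < card U" "25 * (k * (card U - 4 * k)) < rho U F U" using U by (auto simp: P_def)
  have fU: "finite U" using u fin finite_subset by blast
  define m where "m = card U - 4 * k"
  have cm: "card U = m + 4 * k" using u by (simp add: m_def)
  have "2 * rho U F U \<le> card U * card U" by (rule bipartite_rho[OF fU, of F col]) (use col in blast)
  then have q: "50 * (k * m) < (m + 4 * k) * (m + 4 * k)" using u(3) cm by simp
  \<comment> \<open>The quadratic inequality \<open>q\<close> fails between \<open>8 * k\<close> and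
    \<open>40 * k\<close>: there the difference of its sides is a sum of nonnegative products. The
    requirement \<open>12 * k < card U\<close> excludes smaller \<open>m\<close>.\<close>
  have m40: "40 * k < m"
  proof (rule ccontr)
    assume "\<not> ?thesis"
    then have le: "8 * int k \<le> int m" "int m \<le> 40 * int k" using u(2) cm by simp_all
    have "0 \<le> (int m - 8 * int k) * (40 * int k - int m)" "0 \<le> int k * (40 * int k - int m)" "0 \<le> int k * int k"
      using le by (intro mult_nonneg_nonneg; simp)+
    then have "0 \<le> (int m - 8 * int k) * (40 * int k - int m) + 6 * (int k * (40 * int k - int m)) + 64 * (int k * int k)"
      by (intro add_nonneg_nonneg mult_nonneg_nonneg[of 6] mult_nonneg_nonneg[of 64]) simp_all
    also have "\<dots> = 50 * (int k * int m) - (int m + 4 * int k) * (int m + 4 * int k)" by (simp add: algebra_simps)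
    finally have "(int m + 4 * int k) * (int m + 4 * int k) \<le> 50 * (int k * int m)" by simp
    also have "\<dots> = int (50 * (k * m))" by simp
    also have "\<dots> < int ((m + 4 * k) * (m + 4 * k))" using q by (simp only: of_nat_less_iff)
    finally show False by simp
  qed
  have small: "rho W F W \<le> 25 * (k * (card W - 4 * k))" if "W \<subset> U" "12 * k < card W" for W
  proof -
    have "card W < card U" using that fU by (simp add: psubset_card_mono)
    then have "\<not> P W" using mn by force
    then show ?thesis using that u by (auto simp: P_def)
  qed
  \<comment> \<open>Deleting a vertex lowers the bound by \<open>25 * k\<close>, while
    \<open>rho\<close> drops by twice its degree.\<close>
  have deg': "25 * k < 2 * card (nbrs U F v)" if v: "v \<in> U" for v
  proof -
    have "card (U - {v}) = m + 4 * k - 1" using v fU cm by simp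
    moreover have "U - {v} \<subset> U" using v by blast
    ultimately have "rho (U - {v}) F (U - {v}) \<le> 25 * (k * (m - 1))" using small[of "U - {v}"] m40 k by simp
    moreover have "k * m = k * (m - 1) + k" using m40 by (cases m) auto
    ultimately show ?thesis using rho_delete_vertex[OF fU sym irr v] u(3) by (simp add: m_def)
  qed
  \<comment> \<open>A vertex off the separator keeps all its neighbours on its side, so each side is
    large enough for \<open>small\<close>.\<close>
  have side: "12 * k < card A" if sp: "separation U F A B" "A - B \<noteq> {}" for A B
  proof -
    obtain v where v: "v \<in> A - B" using sp(2) by auto
    then have "nbrs U F v \<subseteq> A" using sp(1) by (auto simp: nbrs_def separation_def)
    moreover have "finite A" using sp(1) fU by (auto simp: separation_def)
    ultimately have "card (nbrs U F v) \<le> card A" by (simp add: card_mono)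
    moreover have "v \<in> U" using v sp(1) by (auto simp: separation_def)
    ultimately show ?thesis using deg'[of v] k by simp
  qed
  have sepc: "A - B = {} \<or> B - A = {}" if s: "separation U F A B" and lt: "card (A \<inter> B) < 4 * k" for A B
  proof (rule ccontr)
    assume "\<not> ?thesis"
    then have ne: "A - B \<noteq> {}" "B - A \<noteq> {}" by auto
    have AB: "A \<union> B = U" using s by (simp add: separation_def)
    have s': "separation U F B A" using s sympD[OF sym] unfolding separation_def by blast
    have fAB: "finite A" "finite B" using AB fU by auto
    have cA: "12 * k < card A" "12 * k < card B" using side[OF s ne(1)] side[OF s' ne(2)] by auto
    have "A \<subset> U" "B \<subset> U" using ne AB by auto
    then have "rho A F A \<le> 25 * (k * (card A - 4 * k))" "rho B F B \<le> 25 * (k * (card B - 4 * k))"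
      using small cA by auto
    moreover have "rho U F U \<le> rho A F A + rho B F B"
    proof -
      have both: "a \<in> A \<and> b \<in> A \<or> a \<in> B \<and> b \<in> B" if ab: "a \<in> U" "b \<in> U" "F a b" for a b
      proof (rule ccontr)
        assume n: "\<not> ?thesis"
        have "a \<in> A \<or> a \<in> B" "b \<in> A \<or> b \<in> B" using ab AB by auto
        with n have "a \<in> A - B \<and> b \<in> B - A \<or> a \<in> B - A \<and> b \<in> A - B" by blast
        then show False
        proof (elim disjE conjE)
          assume "a \<in> A - B" "b \<in> B - A" then show False using bspec[OF bspec[OF conjunct2[OF s[unfolded separation_def]]]] ab(3) by fast
        next
          assume "a \<in> B - A" "b \<in> A - B" then show False using bspec[OF bspec[OF conjunct2[OF s'[unfolded separation_def]]]] ab(3) by fast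
        qed
      qed
      have "touch U F U \<subseteq> touch A F A \<union> touch B F B"
      proof clarsimp
        fix a b assume t: "(a, b) \<in> touch U F U" "(a, b) \<notin> touch B F B"
        have "F a b" "a \<in> U" "b \<in> U" using t by (auto simp: touch_def)
        with both[of a b] t show "(a, b) \<in> touch A F A" by (auto simp: touch_def)
      qed
      then have "rho U F U \<le> card (touch A F A \<union> touch B F B)"
        unfolding rho_def using finite_touch fAB by (intro card_mono) auto
      also have "\<dots> \<le> rho A F A + rho B F B" unfolding rho_def by (rule card_Un_le)
      finally show ?thesis .
    qed
    moreover have "card A + card B = card U + card (A \<inter> B)" using card_Un_Int[OF fAB] AB by simp
    \<comment> \<open>An overlap below \<open>4 * k\<close> costs less than the amount subtracted
      twice instead of once, so the bounds for the sides sum to at most that for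
      \<open>U\<close>.\<close>
    then have "(card A - 4 * k) + (card B - 4 * k) \<le> m" using lt cA cm by simp
    then have "k * (card A - 4 * k) + k * (card B - 4 * k) \<le> k * m" unfolding add_mult_distrib2[symmetric] by (rule mult_le_mono2)
    ultimately show False using u(3) by (simp add: m_def)
  qed
  have "linked U F T" if "T \<subseteq> U" "card T \<le> 4 * k" for T
  proof (rule host_linked[OF fU sym irr k _ _ u(3) sepc that])
    show "44 * k \<le> card U" using m40 cm by simp
  qed (rule col)
  then show ?thesis using u(1) m40 cm by (intro exI[of _ U]) auto
qed

section \<open>Separations and degrees in highly connected graphs\<close>

lemma kconn_separation:
  assumes g: "simple_graph V E" and kc: "k_connected n V E" and s: "separation V E A B" "card (A \<inter> B) < n"
  shows "A - B = {} \<or> B - A = {}"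
proof (rule ccontr)
  assume "\<not> ?thesis"
  then obtain u v where uv: "u \<in> A - B" "v \<in> B - A" by blast
  have AB: "A \<union> B = V" using s by (simp add: separation_def)
  let ?X = "A \<inter> B"
  let ?R = "\<lambda>x y. del_verts_E E ?X x y \<and> x \<in> V - ?X \<and> y \<in> V - ?X"
  have "connected_graph (V - ?X) (del_verts_E E ?X)" using kc s(2) AB unfolding k_connected_def by auto
  then have "?R\<^sup>*\<^sup>* u v" using uv AB unfolding connected_graph_def by blast
  then have "v \<in> A - B"
  proof (induction rule: rtranclp_induct)
    case (step y z)
    then show ?case using s(1) AB by (auto simp: del_verts_E_def separation_def)
  qed (use uv in simp)
  then show False using uv by simp
qed

lemma kconn_degree:
  assumes g: "simple_graph V E" and kc: "k_connected n V E" and v: "v \<in> V"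
  shows "n \<le> card (nbrs V E v)"
proof (rule ccontr)
  assume lt: "\<not> ?thesis"
  have fin: "finite V" and irr: "\<not> E v v" using g by (auto simp: simple_graph_def)
  have s: "separation V E (insert v (nbrs V E v)) (V - {v})"
    using v by (auto simp: separation_def nbrs_def)
  moreover have "insert v (nbrs V E v) \<inter> (V - {v}) = nbrs V E v" using irr by (auto simp: nbrs_def)
  ultimately have "insert v (nbrs V E v) - (V - {v}) = {} \<or> V - {v} - insert v (nbrs V E v) = {}"
    using kconn_separation[OF g kc s] lt by simp
  then have "V \<subseteq> insert v (nbrs V E v)" by auto
  then have "card V \<le> card (insert v (nbrs V E v))" using fin by (intro card_mono) auto
  also have "\<dots> \<le> card (nbrs V E v) + 1" by (rule card_insert_le_m1[THEN order_trans]) (auto simp: card_insert_if fin)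
  finally show False using lt kc by (simp add: k_connected_def)
qed

section \<open>Closing paths through a host\<close>

lemma gpath_join:
  assumes p: "gpath E p" and r: "gpath E r" and h: "hd r = last p" and i: "set p \<inter> set r = {last p}"
  shows "gpath E (p @ tl r)" "hd (p @ tl r) = hd p" "last (p @ tl r) = last r"
    "set (p @ tl r) = set p \<union> set r" "length (p @ tl r) + 1 = length p + length r"
proof -
  have ne: "p \<noteq> []" using p by (simp add: gpath_def)
  obtain a r' where ra: "r = a # r'" using r by (cases r) (auto simp: gpath_def)
  have a: "a = last p" using h ra by simp
  show "hd (p @ tl r) = hd p" using ne by simp
  show "last (p @ tl r) = last r" using ne ra a by (cases r') auto
  show "set (p @ tl r) = set p \<union> set r" using ne ra a by auto
  show "length (p @ tl r) + 1 = length p + length r" using ra by simp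
  show "gpath E (p @ tl r)"
  proof (cases "r' = []")
    case False
    have "a \<notin> set r'" "E a (hd r')" "gpath E r'" using r ra False by (auto simp: gpath_Cons)
    moreover have "set p \<inter> set r' = {}"
    proof -
      have "set r' \<subseteq> set r" using ra by auto
      then show ?thesis using equalityD1[OF i] \<open>a \<notin> set r'\<close> unfolding a by blast
    qed
    ultimately show ?thesis using gpath_append[OF ne False] p ra a by simp
  qed (use ra p in simp)
qed

lemma is_cycleI:
  assumes p: "gpath E c" and e: "E (last c) (hd c)" and l: "3 \<le> length c" and V: "set c \<subseteq> V"
  shows "is_cycle V E c"
  unfolding is_cycle_def
proof (intro conjI allI impI)
  show "3 \<le> length c" "set c \<subseteq> V" by fact+
  show "distinct c" using p by (simp add: gpath_def)
  fix i assume i: "i < length c"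
  show "E (c ! i) (c ! ((i + 1) mod length c))"
  proof (cases "i + 1 < length c")
    case True
    have "successively E c" using p by (simp add: gpath_def)
    then show ?thesis using True by (simp add: successively_conv_nth)
  next
    case False
    then have "i + 1 = length c" using i by simp
    then have "i = length c - 1" "(i + 1) mod length c = 0" "c \<noteq> []" by auto
    then show ?thesis using e by (simp add: last_conv_nth hd_conv_nth)
  qed
qed

text \<open>The two common ends are counted twice, so the cycle has two vertices fewer than both
  paths together and keeps the parity of their sum.\<close>

lemma close_cycle:
  assumes p: "gpath E p" and r: "gpath E r" and h: "hd r = last p" "last r = hd p" "hd p \<noteq> last p"
    and i: "set p \<inter> set r = {hd p, last p}" and o: "odd (length p + length r)" and V: "set p \<union> set r \<subseteq> V"
  shows "\<exists>c. is_cycle V E c \<and> odd (length c) \<and> set c = set p \<union> set r"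
proof -
  have ner: "r \<noteq> []" and nep: "p \<noteq> []" using r p by (auto simp: gpath_def)
  have "butlast r \<noteq> []"
  proof
    assume "butlast r = []"
    then have "length r = 1" using ner by (metis One_nat_def append_butlast_last_id append_Nil length_Cons list.size(3))
    then have "hd r = last r" by (cases r) auto
    then show False using h by simp
  qed
  then obtain s where rs: "r = s @ [hd p]" "s \<noteq> []" using ner h(2) append_butlast_last_id[OF ner] by metis
  have gs: "gpath E s" "E (last s) (hd p)" "hd p \<notin> set s" using r rs gpath_append[of s "[hd p]" E] by auto
  have hs: "hd s = last p" using rs h by simp
  have ps: "set p \<inter> set s = {last p}"
  proof -
    have "last p \<in> set s" using hs rs(2) by (metis hd_in_set)
    moreover have "set p \<inter> set s \<subseteq> {last p}" using equalityD1[OF i] gs(3) rs(1) by auto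
    ultimately show ?thesis using nep by auto
  qed
  note j = gpath_join[OF p gs(1) hs ps]
  let ?c = "p @ tl s"
  have len: "length ?c + 2 = length p + length r" using j(5) rs by simp
  have o': "odd (length ?c)" using o len by presburger
  have "2 \<le> length ?c"
  proof -
    have "2 \<le> length p" using h(3) nep by (cases p rule: list.exhaust; cases "tl p") auto
    then show ?thesis by simp
  qed
  \<comment> \<open>Oddness excludes the degenerate length two.\<close>
  then have l: "3 \<le> length ?c" using o' by presburger
  have "set r = insert (hd p) (set s)" "hd p \<in> set p" using rs(1) nep by auto
  then have st: "set ?c = set p \<union> set r" unfolding j(4) by auto
  have "E (last ?c) (hd ?c)" using j(2,3) gs(2) by simp
  then have "is_cycle V E ?c" by (rule is_cycleI[OF j(1) _ l]) (use st V in simp)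
  then show ?thesis using o' st by (intro exI[of _ ?c] conjI)
qed

lemma bipartite_path_parity:
  assumes "gpath F r" "set r \<subseteq> U" "\<And>a b. a \<in> U \<Longrightarrow> b \<in> U \<Longrightarrow> F a b \<Longrightarrow> col a \<noteq> (col b :: bool)"
  shows "odd (length r) \<longleftrightarrow> col (hd r) = col (last r)"
  using assms(1,2)
proof (induction r)
  case (Cons a r)
  show ?case
  proof (cases "r = []")
    case False
    have "hd r \<in> U" using Cons.prems(2) False by (metis hd_in_set list.set_intros(2) subsetD)
    then have "col a \<noteq> col (hd r)" using Cons.prems False assms(3)[of a "hd r"] by (auto simp: gpath_Cons)
    moreover have "odd (length r) \<longleftrightarrow> col (hd r) = col (last r)" using Cons False by (auto simp: gpath_Cons)
    ultimately show ?thesis using False by auto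
  qed simp
qed (simp add: gpath_def)

definition spath :: "('a \<Rightarrow> 'a \<Rightarrow> bool) \<Rightarrow> 'a set \<Rightarrow> 'a list \<Rightarrow> bool" where
  "spath E U p \<longleftrightarrow> gpath E p \<and> hd p \<in> U \<and> last p \<in> U \<and> hd p \<noteq> last p \<and> set p \<inter> U = {hd p, last p}"

lemma breaking_spath: "breaking E U col p \<longleftrightarrow> spath E U p \<and> (even (length p) \<longleftrightarrow> col (hd p) = col (last p))"
  by (auto simp: breaking_def spath_def)

lemma Int_singletonI:
  assumes "A \<inter> U = {a, b}" "B \<subseteq> C" "C \<subseteq> U" "a \<notin> C" "b \<in> B"
  shows "A \<inter> B = {b}"
proof -
  have "A \<inter> B = (A \<inter> U) \<inter> B" using assms(2,3) by blast
  also have "\<dots> = {a, b} \<inter> B" by (simp only: assms(1))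
  also have "\<dots> = {b}" using assms(2,4,5) by blast
  finally show ?thesis .
qed

text \<open>Only the edges of \<open>F\<close> inside \<open>U\<close> have to respect
  \<open>col\<close>. In the far case \<open>F\<close> is a cut of the graph; in the near case it is
  \<open>E\<close> itself, and \<open>col\<close> may fail outside \<open>U\<close>.\<close>

locale bip_host =
  fixes V U :: "'a set" and E F :: "'a \<Rightarrow> 'a \<Rightarrow> bool" and col :: "'a \<Rightarrow> bool"
  assumes sym: "symp E" and UV: "U \<subseteq> V" and FE: "\<And>a b. F a b \<Longrightarrow> E a b"
    and col: "\<And>a b. a \<in> U \<Longrightarrow> b \<in> U \<Longrightarrow> F a b \<Longrightarrow> col a \<noteq> col b"
begin

lemma host_path:
  assumes C: "conn F C" "C \<subseteq> U" "a \<in> C" "b \<in> C"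
  obtains r where "gpath E r" "hd r = a" "last r = b" "set r \<subseteq> C" "odd (length r) \<longleftrightarrow> col a = col b"
proof -
  obtain r where r: "gpath F r" "hd r = a" "last r = b" "set r \<subseteq> C" by (rule conn_gpath[OF C(1,3,4)])
  have "odd (length r) \<longleftrightarrow> col (hd r) = col (last r)"
    by (rule bipartite_path_parity[OF r(1) _ col]) (use r(4) C(2) in auto)
  then show ?thesis using that[OF gpath_mono[OF r(1) FE] r(2,3,4)] r by simp
qed

lemma cycle_breaking:
  assumes Z: "breaking E U col Z" "set Z \<subseteq> V" and C: "conn F C" "C \<subseteq> U" "hd Z \<in> C" "last Z \<in> C"
  shows "\<exists>c. is_cycle V E c \<and> odd (length c) \<and> set Z \<subseteq> set c \<and> set c \<subseteq> set Z \<union> C"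
proof -
  have z: "gpath E Z" "hd Z \<noteq> last Z" "set Z \<inter> U = {hd Z, last Z}" "even (length Z) \<longleftrightarrow> col (hd Z) = col (last Z)"
    using Z(1) by (auto simp: breaking_def)
  obtain r where r: "gpath E r" "hd r = last Z" "last r = hd Z" "set r \<subseteq> C" "odd (length r) \<longleftrightarrow> col (last Z) = col (hd Z)"
    by (rule host_path[OF C(1,2,4,3)])
  have rne: "r \<noteq> []" using r by (simp add: gpath_def)
  have "hd Z \<in> set r" "last Z \<in> set r" using r(2,3) hd_in_set[OF rne] last_in_set[OF rne] by auto
  then have "set Z \<inter> set r = {hd Z, last Z}" using z(3) r(4) C(2) by auto
  moreover have "odd (length Z + length r)" using z(4) r(5) by auto
  moreover have "set Z \<union> set r \<subseteq> V" using Z(2) r(4) C(2) UV by auto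
  ultimately obtain c where "is_cycle V E c" "odd (length c)" "set c = set Z \<union> set r"
    using close_cycle[OF z(1) r(1,2,3) z(2)] by blast
  then show ?thesis using r(4) by (intro exI[of _ c]) auto
qed

text \<open>Around the cycle \<open>Z\<close>, \<open>C\<close>, \<open>P\<close> reversed,
  \<open>D\<close>, only \<open>P\<close> contradicts the colouring, so the number of vertices is
  odd.\<close>

lemma cycle_pair:
  assumes Z: "spath E U Z" "\<not> breaking E U col Z" "set Z \<subseteq> V" and P: "breaking E U col P" "set P \<subseteq> V"
    and ZP: "set Z \<inter> set P = {}"
    and C: "conn F C" "C \<subseteq> U" "last Z \<in> C" "last P \<in> C" and D: "conn F D" "D \<subseteq> U" "hd P \<in> D" "hd Z \<in> D" and CD: "C \<inter> D = {}"
  shows "\<exists>c. is_cycle V E c \<and> odd (length c) \<and> set Z \<subseteq> set c \<and> set c \<subseteq> set Z \<union> set P \<union> C \<union> D"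
proof -
  have z: "gpath E Z" "hd Z \<noteq> last Z" "set Z \<inter> U = {hd Z, last Z}" "even (length Z) \<longleftrightarrow> col (hd Z) \<noteq> col (last Z)"
    using Z(1,2) by (auto simp: breaking_spath) (auto simp: spath_def)
  have p: "gpath E P" "hd P \<noteq> last P" "set P \<inter> U = {hd P, last P}" "even (length P) \<longleftrightarrow> col (hd P) = col (last P)"
    using P(1) by (auto simp: breaking_def)
  obtain r where r: "gpath E r" "hd r = last Z" "last r = last P" "set r \<subseteq> C" "odd (length r) \<longleftrightarrow> col (last Z) = col (last P)"
    by (rule host_path[OF C])
  obtain s where s: "gpath E s" "hd s = hd P" "last s = hd Z" "set s \<subseteq> D" "odd (length s) \<longleftrightarrow> col (hd P) = col (hd Z)"
    by (rule host_path[OF D])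
  have rne: "r \<noteq> []" and sne: "s \<noteq> []" and pne: "P \<noteq> []" using r s p by (auto simp: gpath_def)
  have rin: "last Z \<in> set r" "last P \<in> set r" using r(2,3) hd_in_set[OF rne] last_in_set[OF rne] by auto
  have sin: "hd P \<in> set s" "hd Z \<in> set s" using s(2,3) hd_in_set[OF sne] last_in_set[OF sne] by auto
  have nC: "hd Z \<notin> C" "hd P \<notin> C" and nD: "last Z \<notin> D" "last P \<notin> D" using CD C D by auto
  have "set Z \<inter> set r = {last Z}" by (rule Int_singletonI[OF z(3) r(4) C(2) nC(1) rin(1)])
  note j1 = gpath_join[OF z(1) r(1,2) this]
  let ?Z1 = "Z @ tl r"
  have hP: "gpath E (rev P)" "hd (rev P) = last ?Z1" "last (rev P) = hd P"
    using p(1) gpath_rev[OF sym] j1(3) r(3) pne by (auto simp: hd_rev last_rev)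
  have "set P \<inter> set r = {last P}" by (rule Int_singletonI[OF p(3) r(4) C(2) nC(2) rin(2)])
  then have "set ?Z1 \<inter> set (rev P) = {last ?Z1}" using j1(3,4) r(3) ZP by auto
  note j2 = gpath_join[OF j1(1) hP(1,2) this]
  let ?Z2 = "?Z1 @ tl (rev P)"
  have h2: "hd ?Z2 = hd Z" "last ?Z2 = hd P" "set ?Z2 = set Z \<union> set r \<union> set P" using j2 j1 hP by auto
  have "hd Z \<in> set Z" using z(1) by (simp add: gpath_def)
  moreover have "hd P \<in> set P" using pne by simp
  ultimately have ne: "hd Z \<noteq> hd P" using ZP by auto
  have "set r \<inter> set s = {}" using r(4) s(4) CD by auto
  moreover have "set Z \<inter> set s = {hd Z}"
    using z(3) by (intro Int_singletonI[OF _ s(4) D(2) nD(1) sin(2)]) (simp add: insert_commute)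
  moreover have "set P \<inter> set s = {hd P}"
    using p(3) by (intro Int_singletonI[OF _ s(4) D(2) nD(2) sin(1)]) (simp add: insert_commute)
  ultimately have "set ?Z2 \<inter> set s = {hd ?Z2, last ?Z2}" unfolding h2 Int_Un_distrib2 by (simp add: insert_commute)
  moreover have "odd (length ?Z2 + length s)"
  proof -
    have "length ?Z2 + 2 = length Z + length r + length P" using j1(5) j2(5) by simp
    then have "even (length ?Z2 + length s) \<longleftrightarrow> even (length Z + length r + length P + length s)"
      by (metis even_add even_numeral)
    moreover have "odd (length Z + length r + length P + length s)"
      using z(4) p(4) r(5) s(5) by (auto simp: even_add)
    ultimately show ?thesis by simp
  qed
  moreover have "set ?Z2 \<union> set s \<subseteq> V" unfolding h2 using Z(3) P(2) r(4) s(4) C(2) D(2) UV by auto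
  ultimately obtain c where "is_cycle V E c" "odd (length c)" "set c = set ?Z2 \<union> set s"
    using close_cycle[OF j2(1) s(1)] h2 s(2,3) ne by metis
  then show ?thesis using r(4) s(4) h2 by (intro exI[of _ c]) auto
qed

lemma assemble:
  assumes fU: "finite U" and lk: "\<And>T. T \<subseteq> U \<Longrightarrow> card T \<le> 4 * k \<Longrightarrow> linked U F T"
    and Z: "\<And>i. i < k \<Longrightarrow> spath E U (Z i) \<and> set (Z i) \<subseteq> V \<and> set (Z i) \<inter> S \<noteq> {}"
    and P: "\<And>i. i < k \<Longrightarrow> \<not> breaking E U col (Z i) \<Longrightarrow>
      breaking E U col (P i) \<and> set (P i) \<subseteq> V \<and> set (Z i) \<inter> set (P i) = {}"
    and G: "\<And>i. G i = set (Z i) \<union> (if breaking E U col (Z i) then {} else set (P i))"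
    and dj: "\<And>i j. i < k \<Longrightarrow> j < k \<Longrightarrow> i \<noteq> j \<Longrightarrow> G i \<inter> G j = {}"
  shows "\<exists>cs. length cs = k \<and> (\<forall>c\<in>set cs. odd_S_cycle V E S c) \<and>
            (\<forall>i<k. \<forall>j<k. i \<noteq> j \<longrightarrow> set (cs ! i) \<inter> set (cs ! j) = {})"
proof -
  define br where "br i = breaking E U col (Z i)" for i
  \<comment> \<open>Index \<open>2 * i\<close> closes \<open>Z i\<close> at once if it is breaking,
    and otherwise leads from \<open>Z i\<close> to \<open>P i\<close>; index
    \<open>2 * i + 1\<close> occurs only in the second case and leads back. This makes at most
    \<open>2 * k\<close> pairs.\<close>
  define I where "I = {j. j < 2 * k \<and> (even j \<or> \<not> br (j div 2))}"
  define x where "x j = (if even j then last (Z (j div 2)) else hd (P (j div 2)))" for j :: nat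
  define y where "y j = (if even j then (if br (j div 2) then hd (Z (j div 2)) else last (P (j div 2))) else hd (Z (j div 2)))" for j :: nat
  define T where "T = x ` I \<union> y ` I"
  have finI: "finite I" by (simp add: I_def)
  have "card I \<le> card {..<2 * k}" by (rule card_mono) (auto simp: I_def)
  then have cI: "card I \<le> 2 * k" by simp
  have z: "gpath E (Z i)" "hd (Z i) \<in> U" "last (Z i) \<in> U" "hd (Z i) \<noteq> last (Z i)" "set (Z i) \<inter> U = {hd (Z i), last (Z i)}"
    "hd (Z i) \<in> G i" "last (Z i) \<in> G i" "hd (Z i) \<in> set (Z i)" "last (Z i) \<in> set (Z i)" if "i < k" for i
  proof -
    show 1: "gpath E (Z i)" "hd (Z i) \<in> U" "last (Z i) \<in> U" "hd (Z i) \<noteq> last (Z i)" "set (Z i) \<inter> U = {hd (Z i), last (Z i)}"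
      using Z[OF that] by (auto simp: spath_def)
    then show "hd (Z i) \<in> G i" "last (Z i) \<in> G i" "hd (Z i) \<in> set (Z i)" "last (Z i) \<in> set (Z i)" by (auto simp: G gpath_def)
  qed
  have p: "hd (P i) \<in> U" "last (P i) \<in> U" "hd (P i) \<noteq> last (P i)" "set (P i) \<inter> U = {hd (P i), last (P i)}"
    "hd (P i) \<in> G i" "last (P i) \<in> G i" "hd (P i) \<notin> set (Z i)" "last (P i) \<notin> set (Z i)" if ik: "i < k" "\<not> br i" for i
  proof -
    have b: "breaking E U col (P i)" "set (Z i) \<inter> set (P i) = {}" using P[OF ik(1)] ik(2) by (auto simp: br_def)
    show 1: "hd (P i) \<in> U" "last (P i) \<in> U" "hd (P i) \<noteq> last (P i)" "set (P i) \<inter> U = {hd (P i), last (P i)}"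
      using b(1) by (auto simp: breaking_def)
    have "hd (P i) \<in> set (P i)" "last (P i) \<in> set (P i)" using 1(4) by auto
    then show "hd (P i) \<in> G i" "last (P i) \<in> G i" "hd (P i) \<notin> set (Z i)" "last (P i) \<notin> set (Z i)"
      using b(2) ik(2) by (auto simp: G br_def)
  qed
  have dk: "j div 2 < k" if "j \<in> I" for j using that by (auto simp: I_def)
  have xyG: "x j \<in> G (j div 2) \<inter> U" "y j \<in> G (j div 2) \<inter> U" "x j \<noteq> y j" if jI: "j \<in> I" for j
  proof -
    have k: "j div 2 < k" by (rule dk[OF jI])
    have o: "\<not> br (j div 2)" if "odd j" using that jI by (simp add: I_def)
    show "x j \<in> G (j div 2) \<inter> U" using z[OF k] p[OF k] o by (auto simp: x_def)
    show "y j \<in> G (j div 2) \<inter> U" using z[OF k] p[OF k] by (auto simp: y_def)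
    show "x j \<noteq> y j" using z(4,8,9)[OF k] p(7,8)[OF k] o by (auto simp: x_def y_def)
  qed
  have "pairs x y I T"
    unfolding pairs_def
  proof (intro conjI ballI impI)
    fix i assume i: "i \<in> I"
    show "x i \<in> T" "y i \<in> T" using i by (auto simp: T_def)
    show "x i \<noteq> y i" by (rule xyG(3)[OF i])
    fix j assume j: "j \<in> I" "i \<noteq> j"
    show "{x i, y i} \<inter> {x j, y j} = {}"
    proof (cases "i div 2 = j div 2")
      case False
      then have "G (i div 2) \<inter> G (j div 2) = {}" using dj dk i j by blast
      then show ?thesis using xyG(1,2)[OF i] xyG(1,2)[OF j(1)] by auto
    next
      case True
      have k: "j div 2 < k" by (rule dk[OF j(1)])
      have par: "even i \<longleftrightarrow> odd j" using True j(2) by (metis dvd_mult_div_cancel odd_two_times_div_two_succ)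
      have nb: "\<not> br (j div 2)" using par i j True by (auto simp: I_def)
      show ?thesis using z(4,8,9)[OF k] p(3,7,8)[OF k nb] par nb True by (cases "even i") (auto simp: x_def y_def)
    qed
  qed (rule finI)
  moreover have TU: "T \<subseteq> U" using xyG by (auto simp: T_def)
  moreover have "card T \<le> 4 * k"
  proof -
    have "card T \<le> card (x ` I) + card (y ` I)" unfolding T_def by (rule card_Un_le)
    also have "\<dots> \<le> card I + card I" by (intro add_mono card_image_le finI)
    finally show ?thesis using cI by simp
  qed
  ultimately have lT: "linked U F T" and prT: "pairs x y I T" using lk by auto
  obtain C where C: "\<And>i. i \<in> I \<Longrightarrow> C i \<subseteq> U" "\<And>i. i \<in> I \<Longrightarrow> x i \<in> C i" "\<And>i. i \<in> I \<Longrightarrow> y i \<in> C i"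
    "\<And>i. i \<in> I \<Longrightarrow> conn F (C i)" "\<And>i. i \<in> I \<Longrightarrow> C i \<inter> T = {x i, y i}"
    "\<And>i j. i \<in> I \<Longrightarrow> j \<in> I \<Longrightarrow> i \<noteq> j \<Longrightarrow> C i \<inter> C j = {}"
    by (rule linkedE[OF lT prT]) (rule that)
  define C' where "C' i = C (2 * i) \<union> (if br i then {} else C (2 * i + 1))" for i
  have I2: "2 * i \<in> I" "\<not> br i \<Longrightarrow> 2 * i + 1 \<in> I" if "i < k" for i using that by (auto simp: I_def)
  \<comment> \<open>All contacts of \<open>G i\<close> with \<open>U\<close> are terminals, and a
    linking set contains no terminals but its own; this keeps it off the paths of the other
    cycles.\<close>
  have GT: "G i \<inter> U \<subseteq> T" if "i < k" for i
  proof -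
    have "hd (Z i) \<in> T \<and> last (Z i) \<in> T"
    proof
      show "last (Z i) \<in> T" using I2(1)[OF that] imageI[of "2 * i" I x] by (simp add: T_def x_def)
      show "hd (Z i) \<in> T"
        using I2[OF that] imageI[of "2 * i" I y] imageI[of "2 * i + 1" I y] by (cases "br i") (simp_all add: T_def y_def)
    qed
    moreover have "hd (P i) \<in> T \<and> last (P i) \<in> T" if nb: "\<not> br i"
      using I2[OF \<open>i < k\<close>] imageI[of "2 * i" I y] imageI[of "2 * i + 1" I x] nb by (simp add: T_def y_def x_def)
    ultimately show ?thesis
      using equalityD1[OF z(5)[OF that]] equalityD1[OF p(4)[OF that]] unfolding G br_def by (auto split: if_splits)
  qed
  have Csub: "\<exists>c. is_cycle V E c \<and> odd (length c) \<and> set (Z i) \<subseteq> set c \<and> set c \<subseteq> G i \<union> C' i" if i: "i < k" for i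
  proof (cases "br i")
    case True
    have "hd (Z i) \<in> C (2 * i)" "last (Z i) \<in> C (2 * i)" using C(2,3)[OF I2(1)[OF i]] True by (auto simp: x_def y_def)
    then show ?thesis
      using cycle_breaking[of "Z i" "C (2 * i)"] Z[OF i] C(1,4)[OF I2(1)[OF i]] True by (auto simp: br_def G C'_def)
  next
    case False
    have "last (Z i) \<in> C (2 * i)" "last (P i) \<in> C (2 * i)" using C(2,3)[OF I2(1)[OF i]] False by (auto simp: x_def y_def)
    moreover have "hd (P i) \<in> C (2 * i + 1)" "hd (Z i) \<in> C (2 * i + 1)" using C(2,3)[OF I2(2)[OF i False]] by (auto simp: x_def y_def)
    moreover have "C (2 * i) \<inter> C (2 * i + 1) = {}" using C(6)[OF I2(1)[OF i] I2(2)[OF i False]] by simp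
    ultimately have "\<exists>c. is_cycle V E c \<and> odd (length c) \<and> set (Z i) \<subseteq> set c \<and> set c \<subseteq> set (Z i) \<union> set (P i) \<union> C (2 * i) \<union> C (2 * i + 1)"
      using Z[OF i] P[OF i] False C(1,4)[OF I2(1)[OF i]] C(1,4)[OF I2(2)[OF i False]]
      by (intro cycle_pair) (auto simp: br_def)
    then show ?thesis using False by (auto simp: br_def G C'_def)
  qed
  then obtain f where f: "\<And>i. i < k \<Longrightarrow> is_cycle V E (f i) \<and> odd (length (f i)) \<and> set (Z i) \<subseteq> set (f i) \<and> set (f i) \<subseteq> G i \<union> C' i"
    by metis
  have GC: "G i \<inter> C' j = {}" if ij: "i < k" "j < k" "i \<noteq> j" for i j
  proof -
    have one: "G i \<inter> C h = {}" if h: "h \<in> I" "h div 2 = j" for h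
    proof -
      have "G i \<inter> C h \<subseteq> {x h, y h}" using GT[OF ij(1)] C(1,5)[OF h(1)] by blast
      moreover have "x h \<in> G j" "y h \<in> G j" using xyG(1,2)[OF h(1)] h(2) by auto
      ultimately show ?thesis using dj[OF ij] by blast
    qed
    have "G i \<inter> C (2 * j) = {}" by (rule one[OF I2(1)[OF ij(2)]]) simp
    moreover have "G i \<inter> C (2 * j + 1) = {}" if "\<not> br j" by (rule one[OF I2(2)[OF ij(2) that]]) simp
    ultimately show ?thesis by (auto simp: C'_def)
  qed
  have CC: "C' i \<inter> C' j = {}" if ij: "i < k" "j < k" "i \<noteq> j" for i j
  proof -
    have "C a \<inter> C b = {}" if "a \<in> I" "b \<in> I" "a div 2 = i" "b div 2 = j" for a b
      by (rule C(6)[OF that(1,2)]) (use that ij in auto)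
    note this[OF I2(1)[OF ij(1)] I2(1)[OF ij(2)]] this[OF I2(1)[OF ij(1)] I2(2)[OF ij(2)]]
      this[OF I2(2)[OF ij(1)] I2(1)[OF ij(2)]] this[OF I2(2)[OF ij(1)] I2(2)[OF ij(2)]]
    then show ?thesis by (simp add: C'_def Int_Un_distrib Int_Un_distrib2)
  qed
  have "set (f i) \<inter> set (f j) = {}" if ij: "i < k" "j < k" "i \<noteq> j" for i j
  proof -
    have "(G i \<union> C' i) \<inter> (G j \<union> C' j) = {}"
      using dj[OF ij] GC[OF ij] GC[OF ij(2,1)] ij(3) CC[OF ij] by blast
    then show ?thesis using f[OF ij(1)] f[OF ij(2)] by blast
  qed
  moreover have "odd_S_cycle V E S (f i)" if "i < k" for i
    using f[OF that] Z[OF that] unfolding odd_S_cycle_def by blast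
  ultimately show ?thesis by (intro exI[of _ "map f [0..<k]"]) auto
qed

end

section \<open>Graphs far from being bipartite\<close>

lemma gpath_sub: "gpath E (u @ v) \<Longrightarrow> u \<noteq> [] \<Longrightarrow> gpath E u" "gpath E (u @ v) \<Longrightarrow> v \<noteq> [] \<Longrightarrow> gpath E v"
  by (auto simp: gpath_def successively_append_iff)

definition alternates :: "('a \<Rightarrow> bool) \<Rightarrow> 'a list \<Rightarrow> bool" where
  "alternates c q \<longleftrightarrow> successively (\<lambda>u v. c u \<noteq> c v) q"

lemma alternates_sub: "alternates c (u @ v) \<Longrightarrow> alternates c u" "alternates c (u @ v) \<Longrightarrow> alternates c v"
  by (auto simp: alternates_def successively_append_iff)

lemma alternates_rev: "alternates c (rev q) \<longleftrightarrow> alternates c q"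
proof -
  have "(\<lambda>u v. c v \<noteq> c u) = (\<lambda>u v. c u \<noteq> c v)" by (intro ext) auto
  then show ?thesis unfolding alternates_def successively_rev by (simp only:)
qed

lemma alternates_parity: "alternates c q \<Longrightarrow> q \<noteq> [] \<Longrightarrow> odd (length q) \<longleftrightarrow> c (hd q) = c (last q)"
proof (induction q)
  case (Cons a q)
  then show ?case by (cases q) (auto simp: alternates_def)
qed simp

lemma ex_alternates: "distinct q \<Longrightarrow> q \<noteq> [] \<Longrightarrow> \<exists>c. c (hd q) = b \<and> alternates c q"
proof (induction q arbitrary: b)
  case (Cons a q)
  show ?case
  proof (cases "q = []")
    case True then show ?thesis by (intro exI[of _ "\<lambda>_. b"]) (simp add: alternates_def)
  next
    case False
    have "\<exists>c. c (hd q) = (\<not> b) \<and> alternates c q" by (rule Cons.IH) (use Cons.prems False in simp_all)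
    then obtain c where c: "c (hd q) = (\<not> b)" "alternates c q" by blast
    have "a \<notin> set q" "hd q \<noteq> a" using Cons.prems False by auto
    moreover have "successively (\<lambda>u v. (c(a := b)) u \<noteq> (c(a := b)) v) q"
      by (rule successively_mono[OF c(2)[unfolded alternates_def]]) (use \<open>a \<notin> set q\<close> in auto)
    ultimately have "alternates (c(a := b)) (a # q)"
      using c(1) False unfolding alternates_def by (simp add: successively_Cons)
    then show ?thesis by (intro exI[of _ "c(a := b)"] conjI) (simp_all del: fun_upd_apply add: fun_upd_same)
  qed
qed simp

lemma alternates_cong: "alternates c q \<Longrightarrow> (\<And>v. v \<in> set q \<Longrightarrow> c' v = c v) \<Longrightarrow> alternates c' q"
  unfolding alternates_def by (erule successively_mono) auto

text \<open>Two points on the ear are led to \<open>W\<close> in opposite directions along it; a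
  point of \<open>W\<close> is its own tail. The orientations are such that \<open>t\<close>, a path
  from \<open>x\<close> to \<open>y\<close>, and \<open>s\<close> can be concatenated.\<close>

lemma two_tails:
  assumes sym: "symp E" and q: "spath E W q" and alt: "alternates c q"
    and x: "x \<in> W \<union> set q" "y \<in> W \<union> set q" "x \<noteq> y"
  obtains t s where "gpath E t" "last t = x" "hd t \<in> W" "set t \<inter> W = {hd t}" "set t \<subseteq> W \<union> set q" "alternates c t"
    "gpath E s" "hd s = y" "last s \<in> W" "set s \<inter> W = {last s}" "set s \<subseteq> W \<union> set q" "alternates c s" "set t \<inter> set s = {}"
proof -
  have g: "gpath E q" "hd q \<in> W" "last q \<in> W" "hd q \<noteq> last q" "set q \<inter> W = {hd q, last q}" using q by (auto simp: spath_def)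
  have qW: "set q \<inter> W \<subseteq> {hd q, last q}" using g(5) by simp
  have dq: "distinct q" using g(1) by (simp add: gpath_def)
  define start where "start z t \<longleftrightarrow> gpath E t \<and> last t = z \<and> hd t \<in> W \<and> set t \<inter> W = {hd t} \<and> set t \<subseteq> W \<union> set q \<and> alternates c t" for z t
  have single: "start z [z]" if "z \<in> W" for z using that by (auto simp: start_def alternates_def)
  have prefix: "start z (u @ [z])" "hd (u @ [z]) = hd q" and suffix: "start z (rev (z # v))" "hd (rev (z # v)) = last q"
    if z: "q = u @ z # v" "z \<notin> W" for z u v
  proof -
    have une: "u \<noteq> []" "v \<noteq> []" using g(2,3) z by auto
    have 1: "last q \<notin> set (u @ [z])" "hd q \<notin> set (z # v)" using dq z une by (auto simp: disjoint_iff)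
    have q': "q = (u @ [z]) @ v" using z by simp
    show h1: "hd (u @ [z]) = hd q" using une z by simp
    show h2: "hd (rev (z # v)) = last q" using une z by (simp add: hd_rev)
    have p1: "gpath E (u @ [z])" using gpath_sub(1)[of E "u @ [z]" v] g(1) q' by simp
    have p2: "gpath E (z # v)" using gpath_sub(2)[of E u "z # v"] g(1) z by simp
    have a1: "alternates c (u @ [z])" using alternates_sub(1)[of c "u @ [z]" v] alt q' by simp
    have a2: "alternates c (z # v)" using alternates_sub(2)[of c u "z # v"] alt z by simp
    have i1: "hd q \<in> set (u @ [z])" using h1 by (metis hd_in_set append_is_Nil_conv list.distinct(1))
    have i2: "last q \<in> set (z # v)" using une z by simp
    have sub: "set (u @ [z]) \<subseteq> set q" "set (z # v) \<subseteq> set q" using z by auto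
    have "set (u @ [z]) \<inter> W = {hd q}" using qW sub(1) 1(1) i1 g(2) by blast
    then show "start z (u @ [z])" unfolding start_def h1 using p1 a1 sub(1) g(2) by (intro conjI) (simp_all only: last_snoc sup.coboundedI2)
    have "set (z # v) \<inter> W = {last q}" using qW sub(2) 1(2) i2 g(3) by blast
    moreover have "last (rev (z # v)) = z" by simp
    moreover have "set (z # v) \<subseteq> W \<union> set q" by (rule sup.coboundedI2[OF sub(2)])
    ultimately show "start z (rev (z # v))"
      unfolding start_def h2 gpath_rev[OF sym] alternates_rev set_rev using p2 a2 g(3) by - (intro conjI; assumption)
  qed
  have notin: "w \<notin> set t" if st: "start z t" "hd t \<noteq> w" "w \<in> W" for z t w
  proof
    assume "w \<in> set t"
    then have "w \<in> set t \<inter> W" using st(3) by simp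
    moreover have "set t \<inter> W = {hd t}" using st(1) by (simp only: start_def)
    ultimately show False using st(2) by simp
  qed
  have from_one: "\<exists>t. start z t \<and> w \<notin> set t" if z: "z \<in> set q" "z \<notin> W" "w \<in> W" for z w
  proof -
    obtain u v where uv: "q = u @ z # v" using z(1) by (meson split_list)
    show ?thesis
    proof (cases "w = hd q")
      case True
      have "hd (rev (z # v)) \<noteq> w" unfolding suffix(2)[OF uv z(2)] True using g(4) by simp
      with suffix(1)[OF uv z(2)] show ?thesis using notin z(3) by (intro exI conjI)
    next
      case False
      have "hd (u @ [z]) \<noteq> w" unfolding prefix(2)[OF uv z(2)] using False by simp
      with prefix(1)[OF uv z(2)] show ?thesis using notin z(3) by (intro exI conjI)
    qed
  qed
  have "\<exists>t s. start x t \<and> start y s \<and> set t \<inter> set s = {}"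
  proof (cases "x \<in> W")
    case xW: True
    show ?thesis
    proof (cases "y \<in> W")
      case True then show ?thesis using single[OF xW] single[OF True] x(3) by (intro exI[of _ "[x]"] exI[of _ "[y]"] conjI) simp_all
    next
      case False
      then obtain s where "start y s" "x \<notin> set s" using from_one[of y x] x(2) xW by auto
      then show ?thesis using single[OF xW] by (intro exI[of _ "[x]"] exI[of _ s]) auto
    qed
  next
    case xW: False
    show ?thesis
    proof (cases "y \<in> W")
      case True
      then obtain t where "start x t" "y \<notin> set t" using from_one[of x y] x(1) xW by auto
      then show ?thesis using single[OF True] by (intro exI[of _ t] exI[of _ "[y]"]) auto
    next
      case yW: False
      obtain u v where uv: "q = u @ x # v" using x(1) xW by (meson split_list UnE)
      have "y \<in> set u \<or> y \<in> set v" using x(2,3) yW uv by auto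
      then show ?thesis
      proof
        assume "y \<in> set v"
        then obtain v1 v2 where v: "v = v1 @ y # v2" by (meson split_list)
        have "q = (u @ x # v1) @ y # v2" using uv v by simp
        note 1 = prefix(1)[OF uv xW] and 2 = suffix(1)[OF this yW]
        have "set (u @ [x]) \<inter> set (rev (y # v2)) = {}" using dq uv v by auto
        then show ?thesis using 1 2 by (intro exI conjI)
      next
        assume "y \<in> set u"
        then obtain u1 u2 where u: "u = u1 @ y # u2" by (meson split_list)
        have "q = u1 @ y # (u2 @ x # v)" using uv u by simp
        note 1 = suffix(1)[OF uv xW] and 2 = prefix(1)[OF this yW]
        have "set (rev (x # v)) \<inter> set (u1 @ [y]) = {}" using dq uv u by auto
        then show ?thesis using 1 2 by (intro exI conjI)
      qed
    qed
  qed
  then obtain t s where ts: "start x t" "start y s" "set t \<inter> set s = {}" by blast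
  have "s \<noteq> []" using ts by (auto simp: start_def gpath_def)
  then show ?thesis
    using ts by (intro that[of t "rev s"]) (auto simp: start_def gpath_rev[OF sym] alternates_rev hd_rev last_rev)
qed

text \<open>Colour the ear alternately. A breaking path for the enlarged set extends along disjoint parts of the
  ear to a breaking path for \<open>W\<close>.\<close>

lemma ear_no_breaking:
  assumes sym: "symp E" and nb: "\<And>p. set p \<subseteq> V \<Longrightarrow> \<not> breaking E W c p" and q: "spath E W q" "set q \<subseteq> V" and WV: "W \<subseteq> V"
  shows "\<exists>c'. \<forall>p. set p \<subseteq> V \<longrightarrow> \<not> breaking E (W \<union> set q) c' p"
proof -
  have g: "gpath E q" "hd q \<in> W" "last q \<in> W" "hd q \<noteq> last q" "set q \<inter> W = {hd q, last q}" using q by (auto simp: spath_def)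
  have qne: "q \<noteq> []" "distinct q" using g(1) by (auto simp: gpath_def)
  obtain c0 where c0: "c0 (hd q) = c (hd q)" "alternates c0 q" using ex_alternates[OF qne(2,1)] by blast
  define c' where "c' v = (if v \<in> W then c v else c0 v)" for v
  \<comment> \<open>The ear is not breaking, so the alternating colouring that starts with the right
    colour also ends with it.\<close>
  have "odd (length q) \<longleftrightarrow> c (hd q) = c (last q)" using nb[OF q(2)] q(1) by (auto simp: breaking_spath)
  then have "c0 (last q) = c (last q)" using alternates_parity[OF c0(2) qne(1)] c0(1) by auto
  then have "c' v = c0 v" if "v \<in> set q" for v
    using c0(1) equalityD1[OF g(5)] that by (auto simp: c'_def)
  then have alt: "alternates c' q" by (rule alternates_cong[OF c0(2)])
  have cW: "c' v = c v" if "v \<in> W" for v using that by (simp add: c'_def)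
  have "\<not> breaking E (W \<union> set q) c' p" if pV: "set p \<subseteq> V" for p
  proof
    assume b: "breaking E (W \<union> set q) c' p"
    then have p: "gpath E p" "hd p \<in> W \<union> set q" "last p \<in> W \<union> set q" "hd p \<noteq> last p"
      "set p \<inter> (W \<union> set q) \<subseteq> {hd p, last p}" "even (length p) \<longleftrightarrow> c' (hd p) = c' (last p)" by (auto simp: breaking_def)
    obtain t s where t: "gpath E t" "last t = hd p" "hd t \<in> W" "set t \<inter> W = {hd t}" "set t \<subseteq> W \<union> set q" "alternates c' t"
      and s: "gpath E s" "hd s = last p" "last s \<in> W" "set s \<inter> W = {last s}" "set s \<subseteq> W \<union> set q" "alternates c' s"
      and ts: "set t \<inter> set s = {}" by (rule two_tails[OF sym q(1) alt p(2,3,4)])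
    have ne: "t \<noteq> []" "s \<noteq> []" "p \<noteq> []" using t s p by (auto simp: gpath_def)
    have ends: "hd t \<in> set t" "last t \<in> set t" "hd s \<in> set s" "last s \<in> set s" "hd p \<in> set p" "last p \<in> set p" using ne by auto
    have lt: "last p \<notin> set t" using ends(3) s(2) ts by auto
    have hs: "hd p \<notin> set s" using ends(2) t(2) ts by auto
    have "set t \<inter> set p = {last t}" using p(5) t(2,5) lt ends by auto
    note j1 = gpath_join[OF t(1) p(1) t(2)[symmetric] this]
    let ?r1 = "t @ tl p"
    have "set p \<inter> set s = {last p}" using p(5) s(2,5) hs ends by auto
    then have "set ?r1 \<inter> set s = {last ?r1}" unfolding j1(3,4) Int_Un_distrib2 using ts by simp
    moreover have "hd s = last ?r1" using j1(3) s(2) by simp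
    ultimately have j2: "gpath E (?r1 @ tl s)" "hd (?r1 @ tl s) = hd ?r1" "last (?r1 @ tl s) = last s"
       "set (?r1 @ tl s) = set ?r1 \<union> set s" "length (?r1 @ tl s) + 1 = length ?r1 + length s"
      using gpath_join[OF j1(1) s(1)] by blast+
    let ?r = "?r1 @ tl s"
    have hr: "hd ?r = hd t" "last ?r = last s" using j2 j1 by auto
    have sr: "set ?r = set t \<union> set p \<union> set s" unfolding j2(4) j1(4) ..
    have "hd p \<in> W \<Longrightarrow> hd p = hd t" using t(2,4) ends(2) by auto
    moreover have "last p \<in> W \<Longrightarrow> last p = last s" using s(2,4) ends(3) by auto
    moreover have "set p \<inter> W \<subseteq> {hd p, last p}" using p(5) by blast
    ultimately have pW: "set p \<inter> W \<subseteq> {hd t, last s}" by blast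
    have "set ?r \<inter> W = {hd t, last s}"
      unfolding sr Int_Un_distrib2 t(4) s(4) using pW by auto
    moreover have "hd t \<noteq> last s" using ends ts by auto
    moreover have "even (length ?r) \<longleftrightarrow> c (hd ?r) = c (last ?r)"
    proof -
      have "odd (length t) \<longleftrightarrow> c (hd t) = c' (hd p)" using alternates_parity[OF t(6) ne(1)] t(2,3) cW by simp
      moreover have "odd (length s) \<longleftrightarrow> c' (last p) = c (last s)" using alternates_parity[OF s(6) ne(2)] s(2,3) cW by simp
      moreover have "length ?r + 2 = length t + length p + length s" using j1(5) j2(5) by simp
      then have "even (length ?r) \<longleftrightarrow> even (length t + length p + length s)" by (metis even_add even_numeral)
      ultimately show ?thesis unfolding hr using p(6) by (auto simp: even_add)
    qed
    ultimately have "breaking E W c ?r" using j2(1) hr t(3) s(3) by (simp add: breaking_def)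
    moreover have "set ?r \<subseteq> V" unfolding sr using t(5) s(5) pV q(2) WV by blast
    ultimately show False using nb by blast
  qed
  then show ?thesis by blast
qed

text \<open>Menger's theorem gives two disjoint paths to \<open>W\<close> from neighbours of
  \<open>w\<close>, after \<open>w\<close> is removed. A single vertex cutting them off would
  separate \<open>w\<close> from \<open>W\<close> in the whole graph.\<close>

lemma ex_ear:
  assumes fin: "finite V" and sym: "symp E" and W: "W \<subseteq> V" "2 \<le> card W" and w: "w \<in> V" "w \<notin> W"
    and sep: "\<And>A B. separation V E A B \<Longrightarrow> card (A \<inter> B) < 2 \<Longrightarrow> A \<subseteq> B \<or> B \<subseteq> A"
  shows "\<exists>q. spath E W q \<and> set q \<subseteq> V \<and> w \<in> set q"
proof -
  let ?V = "V - {w}" and ?N = "nbrs (V - {w}) E w"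
  have "\<exists>P. (\<forall>i<2::nat. gpath E (P i) \<and> set (P i) \<subseteq> ?V \<and> hd (P i) \<in> ?N \<and> last (P i) \<in> W \<and>
       set (P i) \<inter> ?N = {hd (P i)} \<and> set (P i) \<inter> W = {last (P i)}) \<and> disjoint_family_on (\<lambda>i. set (P i)) {..<2}"
  proof (rule menger[OF _ sym])
    show "finite ?V" "?N \<subseteq> ?V" "W \<subseteq> ?V" using fin W w by (auto simp: nbrs_def)
    fix X assume X: "X \<subseteq> ?V" and h: "\<And>p. gpath E p \<Longrightarrow> set p \<subseteq> ?V \<Longrightarrow> hd p \<in> ?N \<Longrightarrow> last p \<in> W \<Longrightarrow> set p \<inter> X \<noteq> {}"
    have "\<exists>A B. separation ?V E A B \<and> ?N \<subseteq> A \<and> W \<subseteq> B \<and> A \<inter> B = X"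
      by (rule separator_separation[OF sym _ X _ h]) (use W w in \<open>auto simp: nbrs_def\<close>)
    then obtain A B where AB: "separation ?V E A B" "?N \<subseteq> A" "W \<subseteq> B" "A \<inter> B = X" by blast
    have U: "A \<union> B = ?V" using AB(1) by (simp add: separation_def)
    have "separation V E (insert w A) B"
      unfolding separation_def
    proof (intro conjI ballI)
      show "insert w A \<union> B = V" using U w by auto
      fix u v assume uv: "u \<in> insert w A - B" "v \<in> B - insert w A"
      show "\<not> E u v"
      proof (cases "u = w")
        case True
        then show ?thesis using uv AB(2) U by (auto simp: nbrs_def)
      next
        case False then show ?thesis using uv AB(1) by (auto simp: separation_def)
      qed
    qed
    moreover have "insert w A \<inter> B = X" using AB(4) U by auto
    moreover have "\<not> insert w A \<subseteq> B" using U by auto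
    ultimately have "card X < 2 \<Longrightarrow> B \<subseteq> insert w A" using sep by blast
    moreover have "finite X" using X fin finite_subset by blast
    moreover have "B \<subseteq> insert w A \<Longrightarrow> W \<subseteq> X" using AB(3,4) U by auto
    ultimately show "2 \<le> card X" using W(2) by (meson card_mono le_trans not_le)
  qed
  then obtain P where P: "\<And>i. i < 2 \<Longrightarrow> gpath E (P i) \<and> set (P i) \<subseteq> ?V \<and> hd (P i) \<in> ?N \<and> last (P i) \<in> W \<and>
       set (P i) \<inter> ?N = {hd (P i)} \<and> set (P i) \<inter> W = {last (P i)}" and dj: "disjoint_family_on (\<lambda>i. set (P i)) {..<2::nat}" by blast
  note p = P[of 0, simplified] and r = P[of 1, simplified]
  have d: "set (P 0) \<inter> set (P 1) = {}" using dj by (simp add: disjoint_family_on_def)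
  have ne: "P 0 \<noteq> []" "P 1 \<noteq> []" using p r by (auto simp: gpath_def)
  have e: "E w (hd (P 0))" "E w (hd (P 1))" using p r by (auto simp: nbrs_def)
  have g1: "gpath E (w # P 1)" using r e by (auto simp: gpath_Cons)
  have g0: "gpath E (rev (P 0))" using p gpath_rev[OF sym] by blast
  have "E (last (rev (P 0))) w" using e(1) ne sympD[OF sym] by (simp add: last_rev)
  then have g: "gpath E (rev (P 0) @ w # P 1)"
    using g0 g1 p d ne gpath_append[of "rev (P 0)" "w # P 1" E] by auto
  have h: "hd (rev (P 0) @ w # P 1) = last (P 0)" "last (rev (P 0) @ w # P 1) = last (P 1)"
    using ne by (simp_all add: hd_rev)
  have "set (rev (P 0) @ w # P 1) \<inter> W = (set (P 0) \<inter> W) \<union> (set (P 1) \<inter> W)" using w by auto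
  also have "\<dots> = {last (P 0), last (P 1)}" using p r by (simp add: insert_commute)
  finally have i: "set (rev (P 0) @ w # P 1) \<inter> W = {last (P 0), last (P 1)}" .
  have "last (P 0) \<noteq> last (P 1)" using d ne by (metis disjoint_iff last_in_set)
  then have "spath E W (rev (P 0) @ w # P 1)" unfolding spath_def h i using g p r by simp
  moreover have "set (rev (P 0) @ w # P 1) \<subseteq> V" using p r w by auto
  ultimately show ?thesis by (intro exI[of _ "rev (P 0) @ w # P 1"]) simp
qed

text \<open>A largest set with a colouring that admits no breaking path must be \<open>V\<close>,
  because any other could be enlarged by an ear.\<close>

lemma no_breaking_colouring:
  assumes fin: "finite V" and sym: "symp E" and irr: "irreflp E" and A: "A \<subseteq> V" "2 \<le> card A"
    and sep: "\<And>A B. separation V E A B \<Longrightarrow> card (A \<inter> B) < 2 \<Longrightarrow> A \<subseteq> B \<or> B \<subseteq> A"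
    and nb: "\<And>p. set p \<subseteq> V \<Longrightarrow> \<not> breaking E A col p"
  shows "\<exists>c :: 'a \<Rightarrow> bool. \<forall>a\<in>V. \<forall>b\<in>V. E a b \<longrightarrow> c a \<noteq> c b"
proof -
  define Q where "Q W \<longleftrightarrow> A \<subseteq> W \<and> W \<subseteq> V \<and> (\<exists>c. \<forall>p. set p \<subseteq> V \<longrightarrow> \<not> breaking E W c p)" for W
  have "Q A" using A nb by (auto simp: Q_def)
  moreover have "card W < card V + 1" if "Q W" for W using that fin card_mono[of V W] by (auto simp: Q_def)
  ultimately obtain W where W: "Q W" and mx: "\<And>W'. Q W' \<Longrightarrow> card W' \<le> card W"
    using ex_has_greatest_nat[of Q A card "card V + 1"] by auto
  have w: "A \<subseteq> W" "W \<subseteq> V" using W by (auto simp: Q_def)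
  obtain c where c: "\<And>p. set p \<subseteq> V \<Longrightarrow> \<not> breaking E W c p" using W by (auto simp: Q_def)
  have fW: "finite W" using w fin finite_subset by blast
  have "card A \<le> card W" using w(1) fW by (intro card_mono)
  then have c2: "2 \<le> card W" using A(2) by simp
  have "W = V"
  proof (rule ccontr)
    assume "W \<noteq> V"
    then obtain v where v: "v \<in> V" "v \<notin> W" using w by auto
    obtain q where q: "spath E W q" "set q \<subseteq> V" "v \<in> set q" using ex_ear[OF fin sym w(2) c2 v sep] by blast
    have "Q (W \<union> set q)" using ear_no_breaking[OF sym c q(1,2) w(2)] w q(2) by (auto simp: Q_def)
    then have "card (W \<union> set q) \<le> card W" by (rule mx)
    moreover have "W \<subset> W \<union> set q" using v q by auto
    then have "card W < card (W \<union> set q)" using fW by (intro psubset_card_mono) auto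
    ultimately show False by simp
  qed
  have "c a \<noteq> c b" if ab: "a \<in> V" "b \<in> V" "E a b" for a b
  proof
    assume "c a = c b"
    moreover have "a \<noteq> b" using ab(3) irr by (auto simp: irreflp_def)
    \<comment> \<open>Relative to \<open>V\<close>, a monochromatic edge is itself a breaking
      path.\<close>
    ultimately have "breaking E V c [a, b]" using ab by (auto simp: breaking_def gpath_def)
    then show False using c[of "[a, b]"] ab \<open>W = V\<close> by auto
  qed
  then show ?thesis by blast
qed

text \<open>Applied with \<open>R\<close> saying that two vertices lie on a common path
  \<open>P i\<close>: it counts the steps that do not stay on one of these paths.\<close>

fun cost :: "('a \<Rightarrow> 'a \<Rightarrow> bool) \<Rightarrow> 'a list \<Rightarrow> nat" where
  "cost R (x # y # q) = (if R x y then 0 else 1) + cost R (y # q)"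
| "cost R q = 0"

lemma cost_split: "cost R (u @ z # v) = cost R (u @ [z]) + cost R (z # v)"
proof (induction u)
  case (Cons a u) then show ?case by (cases u) auto
qed simp

lemma cost_zero: "(\<And>x y. x \<in> set q \<Longrightarrow> y \<in> set q \<Longrightarrow> R x y) \<Longrightarrow> cost R q = 0"
  by (induction q rule: induct_list012) auto

lemma cost_zero_stays:
  "cost R q = 0 \<Longrightarrow> q \<noteq> [] \<Longrightarrow> hd q \<in> X \<Longrightarrow> (\<And>x y. R x y \<Longrightarrow> x \<in> X \<Longrightarrow> y \<in> X) \<Longrightarrow> last q \<in> X"
proof (induction q rule: induct_list012)
  case (3 x y q)
  have "R x y" "cost R (y # q) = 0" using 3(3) by (auto split: if_splits)
  then show ?case using 3 by auto
qed auto

definition linkage :: "('a \<Rightarrow> 'a \<Rightarrow> bool) \<Rightarrow> 'a set \<Rightarrow> 'a set \<Rightarrow> 'a set \<Rightarrow> ('a \<Rightarrow> 'a list) \<Rightarrow> bool" where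
  "linkage E V U X Q \<longleftrightarrow> (\<forall>s\<in>X. gpath E (Q s) \<and> hd (Q s) = s \<and> last (Q s) \<in> U \<and> set (Q s) \<subseteq> V \<and> set (Q s) \<inter> U \<subseteq> {last (Q s)}) \<and>
     (\<forall>s\<in>X. \<forall>t\<in>X. s \<noteq> t \<longrightarrow> set (Q s) \<inter> set (Q t) = {})"

lemma linkageD:
  assumes "linkage E V U X Q" "s \<in> X"
  shows "gpath E (Q s)" "hd (Q s) = s" "last (Q s) \<in> U" "set (Q s) \<subseteq> V" "set (Q s) \<inter> U \<subseteq> {last (Q s)}"
    "t \<in> X \<Longrightarrow> s \<noteq> t \<Longrightarrow> set (Q s) \<inter> set (Q t) = {}"
  using assms by (auto simp: linkage_def)

text \<open>Otherwise reroute the path through the first hit vertex of \<open>P i\<close> along \<open>P i\<close> into \<open>U\<close>; the abandoned part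
  had to leave \<open>P i\<close>, so the cost drops.\<close>

lemma minimal_linkage_end:
  assumes sym: "symp E" and finX: "finite X" and Q: "linkage E V U X Q"
    and P: "\<And>i. i \<in> N \<Longrightarrow> spath E U (P i) \<and> set (P i) \<subseteq> V"
    and dj: "\<And>i j. i \<in> N \<Longrightarrow> j \<in> N \<Longrightarrow> i \<noteq> j \<Longrightarrow> set (P i) \<inter> set (P j) = {}"
    and R: "\<And>x y. R x y \<longleftrightarrow> (\<exists>i\<in>N. x \<in> set (P i) \<and> y \<in> set (P i))"
    and min: "\<And>Q'. linkage E V U X Q' \<Longrightarrow> (\<Sum>s\<in>X. cost R (Q s)) \<le> (\<Sum>s\<in>X. cost R (Q' s))"
    and i: "i \<in> N" and hit: "t \<in> X" "set (P i) \<inter> set (Q t) \<noteq> {}"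
  shows "\<exists>s\<in>X. last (Q s) \<in> set (P i)"
proof (rule ccontr)
  assume no: "\<not> ?thesis"
  define UQ where "UQ = (\<Union>s\<in>X. set (Q s))"
  have "\<exists>x\<in>set (P i). x \<in> UQ" using hit by (auto simp: UQ_def)
  \<comment> \<open>The first vertex of \<open>P i\<close> on the linkage: the part of
    \<open>P i\<close> before it is free for the new route.\<close>
  from split_list_first_prop[OF this] obtain u z v where
    uzv: "P i = u @ z # v" "z \<in> UQ" "\<forall>x\<in>set u. x \<notin> UQ" by blast
  then obtain s where s: "s \<in> X" "z \<in> set (Q s)" by (auto simp: UQ_def)
  note q = linkageD(1-5)[OF Q s(1)]
  obtain q1 q2 where q12: "Q s = q1 @ z # q2" using s(2) by (meson split_list)
  have zP: "z \<in> set (P i)" using uzv(1) by simp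
  have Pi: "gpath E (P i)" "hd (P i) \<in> U" "set (P i) \<inter> U \<subseteq> {hd (P i), last (P i)}" "set (P i) \<subseteq> V"
    using P[OF i] by (auto simp: spath_def)
  have dP: "distinct (P i)" and dQ: "distinct (Q s)" using Pi q by (auto simp: gpath_def)
  have "last (Q s) \<notin> set (P i)" using no s(1) by blast
  then have zl: "z \<noteq> last (Q s)" using zP by auto
  then have q2: "q2 \<noteq> []" using q12 by auto
  have zU: "z \<notin> U" using q(5) s(2) zl by auto
  have une: "u \<noteq> []" using uzv(1) Pi(2) zU by auto
  have lP: "last (P i) \<in> set (z # v)" using uzv(1) by simp
  define w where "w = z # rev u"
  have "gpath E (u @ [z])" using gpath_sub(1)[of E "u @ [z]" v] Pi(1) uzv(1) by simp
  then have gw: "gpath E w" using gpath_rev[OF sym, of "u @ [z]"] by (simp add: w_def)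
  have gq1: "gpath E (q1 @ [z])" using gpath_sub(1)[of E "q1 @ [z]" q2] q(1) q12 by simp
  have hw: "hd w = last (q1 @ [z])" by (simp add: w_def)
  have lw: "last w = hd (P i)" using une uzv(1) by (simp add: w_def last_rev)
  have uUQ: "set u \<inter> set (Q r) = {}" if "r \<in> X" for r using uzv(3) that by (auto simp: UQ_def)
  have iw: "set (q1 @ [z]) \<inter> set w = {last (q1 @ [z])}" using uUQ[OF s(1)] q12 by (auto simp: w_def)
  note j = gpath_join[OF gq1 gw hw iw]
  define q' where "q' = (q1 @ [z]) @ tl w"
  have sq': "set q' = set (q1 @ [z]) \<union> set u" unfolding q'_def j(4) by (auto simp: w_def)
  have "linkage E V U X (Q(s := q'))"
    unfolding linkage_def
  proof (intro conjI ballI impI)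
    fix r assume r: "r \<in> X"
    have new: "gpath E q'" "hd q' = s" "last q' \<in> U" "set q' \<subseteq> V" "set q' \<inter> U \<subseteq> {last q'}"
    proof -
      show "gpath E q'" using j(1) by (simp add: q'_def)
      show "hd q' = s" unfolding q'_def j(2) using q(2) q12 by (cases q1) auto
      have l: "last q' = hd (P i)" unfolding q'_def j(3) by (rule lw)
      then show "last q' \<in> U" using Pi(2) by simp
      show "set q' \<subseteq> V" unfolding sq' using q(4) q12 Pi(4) uzv(1) by auto
      have "last (Q s) \<notin> set (q1 @ [z])" using dQ q12 q2 zl by (auto simp: disjoint_iff)
      then have "set (q1 @ [z]) \<inter> U = {}" using q(5) q12 by auto
      moreover have "set u \<inter> U \<subseteq> {hd (P i)}"
      proof -
        have "last (P i) \<notin> set u" using lP dP unfolding uzv(1) by (auto simp: disjoint_iff)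
        then show ?thesis using Pi(3) uzv(1) by auto
      qed
      ultimately show "set q' \<inter> U \<subseteq> {last q'}" unfolding sq' l by blast
    qed
    show "gpath E ((Q(s := q')) r)" "hd ((Q(s := q')) r) = r" "last ((Q(s := q')) r) \<in> U" "set ((Q(s := q')) r) \<subseteq> V"
      "set ((Q(s := q')) r) \<inter> U \<subseteq> {last ((Q(s := q')) r)}"
      using new linkageD(1-5)[OF Q r] by (cases "r = s"; simp)+
    fix r' assume r': "r' \<in> X" "r \<noteq> r'"
    have old: "set q' \<inter> set (Q x) = {}" if "x \<in> X" "x \<noteq> s" for x
    proof -
      have "set (Q s) \<inter> set (Q x) = {}" using linkageD(6)[OF Q s(1)] that by blast
      then show ?thesis using uUQ[OF that(1)] unfolding sq' q12 by auto
    qed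
    show "set ((Q(s := q')) r) \<inter> set ((Q(s := q')) r') = {}"
    proof (cases "r = s")
      case True then show ?thesis using old r' by simp
    next
      case rs: False
      show ?thesis
      proof (cases "r' = s")
        case True then show ?thesis using old[OF r rs] rs by (simp add: Int_commute)
      next
        case False then show ?thesis using rs linkageD(6)[OF Q r] r' by simp
      qed
    qed
  qed
  from min[OF this] have le: "(\<Sum>r\<in>X. cost R (Q r)) \<le> (\<Sum>r\<in>X. cost R ((Q(s := q')) r))" .
  have rest: "(\<Sum>r\<in>X - {s}. cost R ((Q(s := q')) r)) = (\<Sum>r\<in>X - {s}. cost R (Q r))" by (rule sum.cong) auto
  have "cost R (Q s) \<le> cost R q'"
    using le rest sum.remove[OF finX s(1), of "\<lambda>r. cost R (Q r)"] sum.remove[OF finX s(1), of "\<lambda>r. cost R ((Q(s := q')) r)"] by simp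
  moreover have "cost R q' = cost R (q1 @ [z]) + cost R (z # rev u)"
    unfolding q'_def w_def using cost_split[of R q1 z "rev u"] by simp
  moreover have "cost R (z # rev u) = 0"
  proof (rule cost_zero)
    fix x y assume "x \<in> set (z # rev u)" "y \<in> set (z # rev u)"
    then have "x \<in> set (P i)" "y \<in> set (P i)" unfolding uzv(1) by auto
    then show "R x y" using i R by blast
  qed
  moreover have "cost R (Q s) = cost R (q1 @ [z]) + cost R (z # q2)" unfolding q12 by (rule cost_split)
  \<comment> \<open>The new route runs along \<open>P i\<close> at no cost, so by minimality the old
    tail has no cost either; hence it stays on \<open>P i\<close>, and so does its end.\<close>
  ultimately have "cost R (z # q2) = 0" by simp
  then have "last (z # q2) \<in> set (P i)"
  proof (rule cost_zero_stays)
    show "hd (z # q2) \<in> set (P i)" using zP by simp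
    fix x y assume "R x y" "x \<in> set (P i)"
    then obtain j where j: "j \<in> N" "x \<in> set (P j)" "y \<in> set (P j)" by (auto simp: R)
    then have "j = i" using dj[OF j(1) i] \<open>x \<in> set (P i)\<close> by blast
    then show "y \<in> set (P i)" using j by simp
  qed simp
  moreover have "last (z # q2) = last (Q s)" using q12 by simp
  ultimately show False using no s(1) by auto
qed

section \<open>Breaking paths and linkages under high connectivity\<close>

lemma greedy_sdr:
  assumes fin: "finite I" and big: "\<And>i. i \<in> I \<Longrightarrow> card I \<le> card (N i)"
  shows "\<exists>f. inj_on f I \<and> (\<forall>i\<in>I. f i \<in> N i)"
proof -
  have "\<exists>f. inj_on f J \<and> (\<forall>i\<in>J. f i \<in> N i)" if "J \<subseteq> I" for J
    using finite_subset[OF that fin] that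
  proof (induction J rule: finite_induct)
    case (insert i J)
    then obtain f where f: "inj_on f J" "\<forall>i\<in>J. f i \<in> N i" by auto
    have "card (insert i J) \<le> card I" using insert fin by (intro card_mono)
    then have "card J < card (N i)" using insert big[of i] by simp
    moreover have "card (f ` J) \<le> card J" using insert by (intro card_image_le)
    ultimately have "\<not> N i \<subseteq> f ` J" using insert card_mono[of "f ` J" "N i"] by auto
    then obtain a where a: "a \<in> N i" "a \<notin> f ` J" by auto
    have "inj_on (f(i := a)) (insert i J)" using f(1) a(2) insert by (auto simp: inj_on_def)
    then show ?case using f(2) a(1) by (intro exI[of _ "f(i := a)"] conjI) (simp_all del: fun_upd_apply add: fun_upd_def)
  qed simp
  then show ?thesis by blast
qed

lemma simple_graphD:
  assumes "simple_graph V E"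
  shows "finite V" "symp E" "irreflp E" "E a b \<Longrightarrow> a \<in> V \<and> b \<in> V"
  using assms by (auto simp: simple_graph_def symp_def irreflp_def)

lemma kconn_delete:
  assumes g: "simple_graph V E" and kc: "k_connected n V E" and X: "X \<subseteq> V"
    and s: "separation (V - X) E A B" "card (A \<inter> B) + card X < n"
  shows "A \<subseteq> B \<or> B \<subseteq> A"
proof -
  have AB: "A \<union> B = V - X" using s(1) by (simp add: separation_def)
  have "separation V E (A \<union> X) (B \<union> X)"
    unfolding separation_def
  proof (intro conjI ballI)
    show "A \<union> X \<union> (B \<union> X) = V" using AB X by auto
    fix u v assume "u \<in> A \<union> X - (B \<union> X)" "v \<in> B \<union> X - (A \<union> X)"
    then have "u \<in> A - B" "v \<in> B - A" by auto
    then show "\<not> E u v" using s(1) by (auto simp: separation_def)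
  qed
  moreover have "card ((A \<union> X) \<inter> (B \<union> X)) < n"
  proof -
    have "(A \<union> X) \<inter> (B \<union> X) = (A \<inter> B) \<union> X" by auto
    then have "card ((A \<union> X) \<inter> (B \<union> X)) \<le> card (A \<inter> B) + card X" using card_Un_le[of "A \<inter> B" X] by simp
    then show ?thesis using s(2) by simp
  qed
  ultimately have "A \<union> X - (B \<union> X) = {} \<or> B \<union> X - (A \<union> X) = {}" by (rule kconn_separation[OF g kc])
  moreover have "A \<inter> X = {}" "B \<inter> X = {}" using AB by auto
  ultimately show ?thesis by blast
qed

text \<open>Otherwise the packing theorem gives a small hitting set \<open>X\<close>. Outside
  \<open>X\<close>, separations of order below two are still trivial, and at least two vertices of
  \<open>U\<close> remain; so \<open>no_breaking_colouring\<close> makes the rest bipartite, against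
  \<open>far\<close>.\<close>

lemma disjoint_breaking_paths:
  assumes g: "simple_graph V E" and kc: "k_connected n V E" and U: "U \<subseteq> V" "2 * r \<le> card U" "2 * r \<le> n" "0 < r"
    and far: "\<And>X c. X \<subseteq> V \<Longrightarrow> card X + 2 \<le> 2 * r \<Longrightarrow> \<exists>a\<in>V - X. \<exists>b\<in>V - X. E a b \<and> c a = (c b :: bool)"
  shows "\<exists>P. (\<forall>i<r. breaking E U col (P i) \<and> set (P i) \<subseteq> V) \<and> disjoint_family_on (\<lambda>i. set (P i)) {..<r}"
proof (rule ccontr)
  note gd = simple_graphD[OF g]
  assume "\<not> ?thesis"
  then obtain X where X: "X \<subseteq> V" "card X + 2 \<le> 2 * r" and hit: "\<And>p. breaking E U col p \<Longrightarrow> set p \<subseteq> V \<Longrightarrow> set p \<inter> X \<noteq> {}"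
    using odd_paths_packing[OF gd(1,2) U(1), of r col] by blast
  have "\<exists>c :: 'a \<Rightarrow> bool. \<forall>a\<in>V - X. \<forall>b\<in>V - X. E a b \<longrightarrow> c a \<noteq> c b"
  proof (rule no_breaking_colouring[where A = "U - X" and col = col])
    show "finite (V - X)" "symp E" "irreflp E" "U - X \<subseteq> V - X" using gd U by auto
    have "card U - card X \<le> card (U - X)" using X gd finite_subset by (intro diff_card_le_card_Diff) blast
    then show "2 \<le> card (U - X)" using X(2) U(2) by simp
    show "A \<subseteq> B \<or> B \<subseteq> A" if "separation (V - X) E A B" "card (A \<inter> B) < 2" for A B
      by (rule kconn_delete[OF g kc X(1) that(1)]) (use that(2) X(2) U(3) in simp)
    fix p assume p: "set p \<subseteq> V - X"
    show "\<not> breaking E (U - X) col p"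
    proof
      assume b: "breaking E (U - X) col p"
      have "set p \<inter> U = set p \<inter> (U - X)" using p by auto
      then have "breaking E U col p" using b by (auto simp: breaking_def)
      then show False using hit[of p] p by auto
    qed
  qed
  then obtain c where "\<forall>a\<in>V - X. \<forall>b\<in>V - X. E a b \<longrightarrow> c a \<noteq> (c b :: bool)" by blast
  then show False using far[OF X, of c] by blast
qed

text \<open>The separation with sides \<open>X\<close> and \<open>V\<close> has least order, because
  by connectivity a smaller separator would contain \<open>X\<close> or \<open>U\<close>; now
  \<open>landing\<close> applies.\<close>

lemma ex_linkage:
  assumes g: "simple_graph V E" and kc: "k_connected n V E" and U: "U \<subseteq> V" "card X \<le> card U" and X: "X \<subseteq> V" "card X \<le> n"
  shows "\<exists>Q. linkage E V U X Q"
proof -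
  note gd = simple_graphD[OF g]
  have finX: "finite X" and finU: "finite U" using X U gd(1) finite_subset by blast+
  have XV: "X \<inter> V = X" using X by auto
  have "\<exists>q. (\<forall>x\<in>X \<inter> V. gpath E (q x) \<and> hd (q x) = x \<and> last (q x) \<in> U \<and> set (q x) \<subseteq> V \<and>
      set (q x) \<inter> (X \<inter> V) = {x} \<and> set (q x) \<inter> U = {last (q x)}) \<and> disjoint_family_on (\<lambda>x. set (q x)) (X \<inter> V)"
  proof (rule landing[OF gd(1,2), where T = X])
    show "separation V E X V" "X \<subseteq> X" "U \<subseteq> V" using X U by (auto simp: separation_def)
    fix A B assume s: "separation V E A B" "X \<subseteq> A" "U \<subseteq> B"
    have fAB: "finite (A \<inter> B)" using s(1) gd(1) by (auto simp: separation_def)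
    show "card (X \<inter> V) \<le> card (A \<inter> B)"
    proof (rule ccontr)
      assume "\<not> ?thesis"
      then have lt: "card (A \<inter> B) < card X" using XV by simp
      then have "A - B = {} \<or> B - A = {}" using kconn_separation[OF g kc s(1)] X(2) by simp
      then have "X \<subseteq> A \<inter> B \<or> U \<subseteq> A \<inter> B" using s(2,3) by auto
      then have "card X \<le> card (A \<inter> B) \<or> card U \<le> card (A \<inter> B)" using card_mono[OF fAB] by blast
      then show False using lt U(2) by auto
    qed
  qed
  then obtain q where q: "\<forall>x\<in>X. gpath E (q x) \<and> hd (q x) = x \<and> last (q x) \<in> U \<and> set (q x) \<subseteq> V \<and>
      set (q x) \<inter> X = {x} \<and> set (q x) \<inter> U = {last (q x)}" "disjoint_family_on (\<lambda>x. set (q x)) X"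
    unfolding XV by blast
  then have "linkage E V U X q" unfolding linkage_def disjoint_family_on_def by simp
  then show ?thesis by blast
qed

text \<open>In a cheapest linkage every hit path contains the end of some leg by
  \<open>minimal_linkage_end\<close>. The paths are disjoint, so at most \<open>card X\<close> of
  them are hit.\<close>

lemma unhit_paths:
  assumes g: "simple_graph V E" and kc: "k_connected n V E" and U: "U \<subseteq> V" "card X \<le> card U" and X: "X \<subseteq> V" "card X \<le> n"
    and P: "\<And>i. i < r \<Longrightarrow> spath E U (P i) \<and> set (P i) \<subseteq> V" and dj: "\<And>i j. i < r \<Longrightarrow> j < r \<Longrightarrow> i \<noteq> j \<Longrightarrow> set (P i) \<inter> set (P j) = {}"
    and r: "card X + k \<le> r"
  shows "\<exists>Q e. linkage E V U X Q \<and> inj_on e {..<k} \<and> (\<forall>i<k. e i < r \<and> (\<forall>s\<in>X. set (P (e i)) \<inter> set (Q s) = {}))"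
proof -
  note gd = simple_graphD[OF g]
  have finX: "finite X" using X gd(1) finite_subset by blast
  define R where "R x y \<longleftrightarrow> (\<exists>i\<in>{..<r}. x \<in> set (P i) \<and> y \<in> set (P i))" for x y
  obtain Q0 where "linkage E V U X Q0" using ex_linkage[OF g kc U X] by blast
  then obtain Q where Q: "linkage E V U X Q"
    and mn: "\<And>Q'. linkage E V U X Q' \<Longrightarrow> (\<Sum>s\<in>X. cost R (Q s)) \<le> (\<Sum>s\<in>X. cost R (Q' s))"
    using ex_has_least_nat[of "linkage E V U X" Q0 "\<lambda>Q. \<Sum>s\<in>X. cost R (Q s)"] by blast
  define H where "H = {i. i < r \<and> (\<exists>t\<in>X. set (P i) \<inter> set (Q t) \<noteq> {})}"
  have "\<exists>s\<in>X. last (Q s) \<in> set (P i)" if h: "i \<in> H" for i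
  proof -
    obtain t where t: "t \<in> X" "set (P i) \<inter> set (Q t) \<noteq> {}" and i: "i \<in> {..<r}" using h by (auto simp: H_def)
    show ?thesis
    proof (rule minimal_linkage_end[OF gd(2) finX Q, where P = P and N = "{..<r}" and i = i and t = t and R = R])
      show "spath E U (P i) \<and> set (P i) \<subseteq> V" if "i \<in> {..<r}" for i using P that by simp
      show "set (P i) \<inter> set (P j) = {}" if "i \<in> {..<r}" "j \<in> {..<r}" "i \<noteq> j" for i j using dj that by simp
      show "R x y \<longleftrightarrow> (\<exists>i\<in>{..<r}. x \<in> set (P i) \<and> y \<in> set (P i))" for x y by (simp add: R_def)
    qed (use mn i t in auto)
  qed
  then obtain f where f: "\<And>i. i \<in> H \<Longrightarrow> f i \<in> X \<and> last (Q (f i)) \<in> set (P i)" by metis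
  have "inj_on f H"
  proof (rule inj_onI)
    fix i j assume ij: "i \<in> H" "j \<in> H" "f i = f j"
    then have "last (Q (f i)) \<in> set (P i) \<inter> set (P j)" using f[of i] f[of j] by simp
    then show "i = j" using dj[of i j] ij by (auto simp: H_def)
  qed
  then have "card H \<le> card X" using f finX by (intro card_inj_on_le[of f]) auto
  moreover have "card ({..<r} - H) = r - card H" by (subst card_Diff_subset) (auto simp: H_def)
  ultimately have "k \<le> card ({..<r} - H)" using r by simp
  then obtain J where J: "J \<subseteq> {..<r} - H" "card J = k" by (meson obtain_subset_with_card_n)
  then have "finite J" using finite_subset by blast
  then obtain e where "bij_betw e {0..<k} J" using ex_bij_betw_nat_finite J(2) by blast
  then have e: "inj_on e {..<k}" "\<And>i. i < k \<Longrightarrow> e i \<in> J" by (auto simp: bij_betw_def atLeast0LessThan)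
  have "e i < r \<and> (\<forall>s\<in>X. set (P (e i)) \<inter> set (Q s) = {})" if "i < k" for i
    using e(2)[OF that] J(1) by (auto simp: H_def)
  then show ?thesis using Q e(1) by blast
qed

text \<open>Each of \<open>k\<close> chosen vertices of \<open>S\<close> gets a private neighbour
  outside the chosen set; the pairs are the starting points of the two legs.\<close>

lemma ex_neighbours:
  assumes g: "simple_graph V E" and kc: "k_connected n V E" and S: "S \<subseteq> V" "k \<le> card S" "2 * k \<le> n"
  obtains x y where "inj_on x {..<k}" "inj_on y {..<k}" "x ` {..<k} \<inter> y ` {..<k} = {}"
    "\<And>i. i < k \<Longrightarrow> x i \<in> S \<and> y i \<in> V \<and> E (x i) (y i)"
proof -
  note gd = simple_graphD[OF g]
  obtain S' where S': "S' \<subseteq> S" "card S' = k" "finite S'" using obtain_subset_with_card_n[OF S(2)] by metis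
  obtain x where x: "bij_betw x {0..<k} S'" using ex_bij_betw_nat_finite[OF S'(3)] S'(2) by blast
  then have xS: "x ` {..<k} = S'" and xi: "inj_on x {..<k}" by (auto simp: bij_betw_def atLeast0LessThan)
  have big: "card {..<k} \<le> card (nbrs V E (x i) - S')" if "i \<in> {..<k}" for i
  proof -
    have "x i \<in> V" using that xS S' S by auto
    then have "n \<le> card (nbrs V E (x i))" by (rule kconn_degree[OF g kc])
    moreover have "card (nbrs V E (x i)) - card S' \<le> card (nbrs V E (x i) - S')" using S'(3) by (rule diff_card_le_card_Diff)
    ultimately show ?thesis using S(3) S'(2) by simp
  qed
  obtain y where y: "inj_on y {..<k}" "\<forall>i\<in>{..<k}. y i \<in> nbrs V E (x i) - S'"
    using greedy_sdr[of "{..<k}" "\<lambda>i. nbrs V E (x i) - S'"] big by auto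
  show ?thesis
  proof (rule that[OF xi y(1)])
    have "y ` {..<k} \<inter> S' = {}" using y(2) by auto
    then show "x ` {..<k} \<inter> y ` {..<k} = {}" unfolding xS by (simp only: Int_commute)
    show "x i \<in> S \<and> y i \<in> V \<and> E (x i) (y i)" if i: "i < k" for i
    proof -
      have "x i \<in> S'" unfolding xS[symmetric] using i by simp
      moreover have "y i \<in> nbrs V E (x i)" using y(2) i by simp
      ultimately show ?thesis using S'(1) by (auto simp: nbrs_def)
    qed
  qed
qed

lemma linkage_join:
  assumes sym: "symp E" and Q: "linkage E V U X Q" and ab: "a \<in> X" "b \<in> X" "a \<noteq> b" "E a b"
  shows "spath E U (rev (Q a) @ Q b)" "a \<in> set (rev (Q a) @ Q b)"
proof -
  note qa = linkageD[OF Q ab(1)] and qb = linkageD[OF Q ab(2)]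
  have ne: "Q a \<noteq> []" "Q b \<noteq> []" using qa qb by (auto simp: gpath_def)
  have d: "set (Q a) \<inter> set (Q b) = {}" by (rule qa(6)[OF ab(2,3)])
  have h: "hd (rev (Q a) @ Q b) = last (Q a)" "last (rev (Q a) @ Q b) = last (Q b)" using ne by (simp_all add: hd_rev)
  have l: "last (Q a) \<in> set (Q a)" "last (Q b) \<in> set (Q b)" using ne by auto
  have "gpath E (rev (Q a))" using qa(1) gpath_rev[OF sym] by blast
  moreover have "E (last (rev (Q a))) (hd (Q b))" using qa(2) qb(2) ne ab(4) by (simp add: last_rev)
  ultimately have "gpath E (rev (Q a) @ Q b)" using gpath_append[of "rev (Q a)" "Q b" E] ne qb(1) d by auto
  moreover have "set (rev (Q a) @ Q b) \<inter> U = {last (Q a), last (Q b)}" using qa(3,5) qb(3,5) l by auto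
  moreover have "last (Q a) \<noteq> last (Q b)" using d l by auto
  ultimately show "spath E U (rev (Q a) @ Q b)" unfolding spath_def h using qa(3) qb(3) by simp
  have "a \<in> set (Q a)" using qa(2) hd_in_set[OF ne(1)] by simp
  then show "a \<in> set (rev (Q a) @ Q b)" by simp
qed

lemma far_case:
  assumes k: "0 < k" and g: "simple_graph V E" and kc: "k_connected (50 * k) V E" and S: "S \<subseteq> V" "k \<le> card S"
    and far: "\<And>X c. X \<subseteq> V \<Longrightarrow> card X + 2 \<le> 6 * k \<Longrightarrow> \<exists>a\<in>V - X. \<exists>b\<in>V - X. E a b \<and> c a = (c b :: bool)"
  shows "\<exists>cs. length cs = k \<and> (\<forall>c\<in>set cs. odd_S_cycle V E S c) \<and>
            (\<forall>i<k. \<forall>j<k. i \<noteq> j \<longrightarrow> set (cs ! i) \<inter> set (cs ! j) = {})"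
proof -
  note gd = simple_graphD[OF g]
  obtain col :: "'a \<Rightarrow> bool" where col: "\<And>v. v \<in> V \<Longrightarrow> card (nbrs V E v) \<le> 2 * card (nbrs V (\<lambda>a b. E a b \<and> col a \<noteq> col b) v)"
    using max_cut[OF gd(1-3)] by blast
  define F where "F = (\<lambda>a b. E a b \<and> col a \<noteq> col b)"
  have symF: "symp F" and irrF: "irreflp F" using gd(2,3) by (auto simp: F_def symp_def irreflp_def)
  have degF: "25 * k \<le> card (nbrs V F v)" if "v \<in> V" for v
    using col[OF that] kconn_degree[OF g kc that] by (simp add: F_def)
  have bigV: "12 * k < card V" using kc k by (simp add: k_connected_def)
  have "\<exists>U\<subseteq>V. 44 * k \<le> card U \<and> (\<forall>T\<subseteq>U. card T \<le> 4 * k \<longrightarrow> linked U F T)"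
    by (rule dense_subgraph_host[OF gd(1) symF irrF k _ bigV degF, of col]) (simp_all add: F_def)
  then obtain U where U: "U \<subseteq> V" "44 * k \<le> card U" and lk: "\<And>T. T \<subseteq> U \<Longrightarrow> card T \<le> 4 * k \<Longrightarrow> linked U F T" by blast
  have "\<exists>P. (\<forall>i<3 * k. breaking E U col (P i) \<and> set (P i) \<subseteq> V) \<and> disjoint_family_on (\<lambda>i. set (P i)) {..<3 * k}"
    by (rule disjoint_breaking_paths[OF g kc U(1)]) (use U(2) k far in auto)
  then obtain P where P: "\<And>i. i < 3 * k \<Longrightarrow> breaking E U col (P i) \<and> set (P i) \<subseteq> V"
    and Pd0: "disjoint_family_on (\<lambda>i. set (P i)) {..<3 * k}" by blast
  have Pd: "set (P i) \<inter> set (P j) = {}" if "i < 3 * k" "j < 3 * k" "i \<noteq> j" for i j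
    using Pd0 that by (simp add: disjoint_family_on_def)
  obtain x y where xy: "inj_on x {..<k}" "inj_on y {..<k}" "x ` {..<k} \<inter> y ` {..<k} = {}"
    "\<And>i. i < k \<Longrightarrow> x i \<in> S \<and> y i \<in> V \<and> E (x i) (y i)"
    by (rule ex_neighbours[OF g kc S]) auto
  define X where "X = x ` {..<k} \<union> y ` {..<k}"
  have "card X = card (x ` {..<k}) + card (y ` {..<k})" unfolding X_def using xy(3) by (intro card_Un_disjoint) auto
  then have cX: "card X = 2 * k" using card_image[OF xy(1)] card_image[OF xy(2)] by simp
  have XV: "X \<subseteq> V" using xy(4) S(1) by (auto simp: X_def)
  have "\<exists>Q e. linkage E V U X Q \<and> inj_on e {..<k} \<and> (\<forall>i<k. e i < 3 * k \<and> (\<forall>s\<in>X. set (P (e i)) \<inter> set (Q s) = {}))"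
  proof (rule unhit_paths[OF g kc U(1) _ XV])
    show "card X \<le> card U" "card X \<le> 50 * k" "card X + k \<le> 3 * k" using cX U(2) by auto
    show "spath E U (P i) \<and> set (P i) \<subseteq> V" if "i < 3 * k" for i using P[OF that] by (simp add: breaking_spath)
  qed (rule Pd)
  then obtain Q e where Q: "linkage E V U X Q" and e: "inj_on e {..<k}"
    and un: "\<And>i s. i < k \<Longrightarrow> s \<in> X \<Longrightarrow> e i < 3 * k \<and> set (P (e i)) \<inter> set (Q s) = {}" by blast
  \<comment> \<open>The two legs are joined by the edge from \<open>x i\<close>, a vertex of
    \<open>S\<close>, to \<open>y i\<close>.\<close>
  define Z where "Z i = rev (Q (x i)) @ Q (y i)" for i
  define P' where "P' i = P (e i)" for i
  define G where "G i = set (Z i) \<union> (if breaking E U col (Z i) then {} else set (P' i))" for i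
  have inX: "x i \<in> X" "y i \<in> X" if "i < k" for i using that by (auto simp: X_def)
  have dist: "x i \<noteq> y j" if "i < k" "j < k" for i j using xy(3) that by (auto simp: disjoint_iff)
  have ek: "e i < 3 * k" if "i < k" for i using un[OF that inX(1)[OF that]] by simp
  have PZ: "set (P' i) \<inter> set (Z j) = {}" if "i < k" "j < k" for i j
    using un[OF that(1) inX(1)[OF that(2)]] un[OF that(1) inX(2)[OF that(2)]] by (auto simp: P'_def Z_def)
  have PP: "set (P' i) \<inter> set (P' j) = {}" if "i < k" "j < k" "i \<noteq> j" for i j
    unfolding P'_def using that e ek by (intro Pd) (auto simp: inj_on_def)
  have ZZ: "set (Z i) \<inter> set (Z j) = {}" if ij: "i < k" "j < k" "i \<noteq> j" for i j
  proof -
    have "x i \<noteq> x j" "y i \<noteq> y j" "x i \<noteq> y j" "y i \<noteq> x j"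
      using xy(1,2) dist[OF ij(1,2)] dist[OF ij(2,1)] ij by (auto simp: inj_on_def)
    then have "set (Q a) \<inter> set (Q b) = {}" if "a \<in> {x i, y i}" "b \<in> {x j, y j}" for a b
      using that inX[OF ij(1)] inX[OF ij(2)] by (intro linkageD(6)[OF Q]) auto
    then show ?thesis by (simp add: Z_def Int_Un_distrib Int_Un_distrib2)
  qed
  interpret bip_host V U E F col
    using gd(2) U(1) by unfold_locales (auto simp: F_def)
  show ?thesis
  proof (rule assemble[OF _ lk, where Z = Z and P = P' and G = G])
    show "finite U" using U(1) gd(1) finite_subset by blast
    fix i assume i: "i < k"
    have "spath E U (Z i)" "x i \<in> set (Z i)"
      unfolding Z_def using linkage_join[OF gd(2) Q inX[OF i] dist[OF i i]] xy(4)[OF i] by simp_all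
    moreover have "set (Z i) \<subseteq> V" unfolding Z_def using linkageD(4)[OF Q inX(1)[OF i]] linkageD(4)[OF Q inX(2)[OF i]] by simp
    ultimately show "spath E U (Z i) \<and> set (Z i) \<subseteq> V \<and> set (Z i) \<inter> S \<noteq> {}" using xy(4)[OF i] by auto
    show "breaking E U col (P' i) \<and> set (P' i) \<subseteq> V \<and> set (Z i) \<inter> set (P' i) = {}"
      using P[OF ek[OF i]] PZ[OF i i] by (auto simp: P'_def)
    fix j assume j: "j < k" "i \<noteq> j"
    show "G i \<inter> G j = {}"
      using ZZ[OF i j] PP[OF i j] PZ[OF i j(1)] PZ[OF j(1) i] by (auto simp: G_def)
  qed (assumption | rule G_def)+
qed

section \<open>Graphs close to being bipartite\<close>

text \<open>Here \<open>V - X\<close> is already bipartite and has minimum degree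
  \<open>44 * k\<close>, so neither a cut nor a dense subgraph has to be chosen.\<close>

lemma near_host:
  assumes k: "0 < k" and g: "simple_graph V E" and kc: "k_connected (50 * k) V E"
    and X: "X \<subseteq> V" "card X + 2 \<le> 6 * k" and col: "\<forall>a\<in>V - X. \<forall>b\<in>V - X. E a b \<longrightarrow> col a \<noteq> (col b :: bool)"
    and T: "T \<subseteq> V - X" "card T \<le> 4 * k"
  shows "linked (V - X) E T"
proof -
  note gd = simple_graphD[OF g]
  let ?U = "V - X"
  have fX: "finite X" and fU: "finite ?U" using X gd(1) finite_subset by auto
  have cU: "card ?U = card V - card X" using fX X by (simp add: card_Diff_subset)
  have deg: "44 * k \<le> card (nbrs ?U E v)" if v: "v \<in> ?U" for v
  proof -
    have "50 * k \<le> card (nbrs V E v)" using v by (intro kconn_degree[OF g kc]) simp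
    moreover have "card (nbrs V E v) - card X \<le> card (nbrs V E v - X)" by (rule diff_card_le_card_Diff[OF fX])
    moreover have "nbrs V E v - X = nbrs ?U E v" by (auto simp: nbrs_def)
    ultimately show ?thesis using X(2) by simp
  qed
  have "50 * k < card V" using kc by (simp add: k_connected_def)
  then have big: "44 * k \<le> card ?U" using X(2) cU by simp
  have "(\<Sum>v\<in>?U. 44 * k) \<le> (\<Sum>v\<in>?U. card (nbrs ?U E v))" by (intro sum_mono deg)
  also have "\<dots> = card (SIGMA v:?U. nbrs ?U E v)" using fU by (intro card_SigmaI[symmetric]) auto
  also have "(SIGMA v:?U. nbrs ?U E v) = touch ?U E ?U" by (auto simp: touch_def nbrs_def)
  finally have r: "44 * (k * card ?U) \<le> rho ?U E ?U" by (simp add: rho_def mult_ac)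
  have "k * (card ?U - 4 * k) \<le> k * card ?U" by simp
  moreover have "0 < k * card ?U" using k big by simp
  ultimately have dens: "25 * (k * (card ?U - 4 * k)) < rho ?U E ?U" using r by linarith
  show ?thesis
  proof (rule host_linked[OF fU gd(2,3) k _ big dens _ T])
    show "col a \<noteq> col b" if "a \<in> ?U" "b \<in> ?U" "E a b" for a b using col that by blast
    show "A - B = {} \<or> B - A = {}" if s: "separation ?U E A B" "card (A \<inter> B) < 4 * k" for A B
    proof -
      have "card (A \<inter> B) + card X < 50 * k" using s(2) X(2) k by simp
      then have "A \<subseteq> B \<or> B \<subseteq> A" by (rule kconn_delete[OF g kc X(1) s(1)])
      then show ?thesis by blast
    qed
  qed
qed

text \<open>Every vertex has \<open>44 * k\<close> neighbours in \<open>V - X\<close>, and a vertex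
  of \<open>X\<close> takes a colour opposed by at least half of its own. The result lets any vertex
  be moved into \<open>V - X\<close> along a bichromatic edge.\<close>

lemma majority_colouring:
  assumes k: "0 < k" and g: "simple_graph V E" and kc: "k_connected (50 * k) V E"
    and X: "X \<subseteq> V" "card X + 2 \<le> 6 * k" and col: "\<forall>a\<in>V - X. \<forall>b\<in>V - X. E a b \<longrightarrow> c0 a \<noteq> (c0 b :: bool)"
  shows "\<exists>col. (\<forall>v\<in>V - X. col v = c0 v) \<and> (\<forall>v\<in>V. 22 * k \<le> card {u \<in> V - X. E v u \<and> col u \<noteq> (col v :: bool)})"
proof -
  note gd = simple_graphD[OF g]
  have fX: "finite X" using X gd(1) finite_subset by auto
  let ?N = "\<lambda>v b. {u \<in> V - X. E v u \<and> c0 u \<noteq> b}"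
  have deg: "44 * k \<le> card (?N v True) + card (?N v False)" if v: "v \<in> V" for v
  proof -
    have "50 * k \<le> card (nbrs V E v)" by (rule kconn_degree[OF g kc v])
    moreover have "card (nbrs V E v) - card X \<le> card (nbrs V E v - X)" by (rule diff_card_le_card_Diff[OF fX])
    moreover have "nbrs V E v - X = ?N v True \<union> ?N v False" by (auto simp: nbrs_def)
    then have "card (nbrs V E v - X) \<le> card (?N v True) + card (?N v False)" by (simp add: card_Un_le)
    ultimately show ?thesis using X(2) by linarith
  qed
  define col where "col v = (if v \<in> V - X then c0 v else 22 * k \<le> card (?N v True))" for v
  have eq: "col v = c0 v" if "v \<in> V - X" for v using that by (simp add: col_def)
  have N: "{u \<in> V - X. E v u \<and> col u \<noteq> col v} = ?N v (col v)" for v using eq by auto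
  have "22 * k \<le> card (?N v (col v))" if v: "v \<in> V" for v
  proof (cases "v \<in> V - X")
    case True
    have "?N v (\<not> col v) = {}" using col True eq[OF True] by auto
    then have "card (?N v (\<not> col v)) = 0" by (simp only: card.empty)
    then show ?thesis using deg[OF v] by (cases "col v") simp_all
  next
    case False
    show ?thesis
    proof (cases "22 * k \<le> card (?N v True)")
      case True
      then have "col v = True" using False unfolding col_def by (simp only: if_False if_True simp_thms)
      then show ?thesis using True by (simp only:)
    next
      case F: False
      then have "col v = False" using False unfolding col_def by (simp only: if_False simp_thms)
      then show ?thesis using F deg[OF v] by (simp only:)
    qed
  qed
  then have "\<forall>v\<in>V. 22 * k \<le> card {u \<in> V - X. E v u \<and> col u \<noteq> col v}" unfolding N by blast
  then show ?thesis using eq by (intro exI[of _ col]) simp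
qed

text \<open>Greedy choice: at most \<open>k - 1\<close> earlier edges cover at most
  \<open>2 * k - 2\<close> vertices.\<close>

lemma matching_of_bad_edges:
  assumes nb: "\<forall>X. X \<subseteq> V \<and> card X \<le> 2 * k - 2 \<longrightarrow> (\<exists>a\<in>V - X. \<exists>b\<in>V - X. Q a b)"
  shows "j \<le> k \<Longrightarrow> \<exists>a b. (\<forall>i<j. a i \<in> V \<and> b i \<in> V \<and> Q (a i) (b i)) \<and> (\<forall>i<j. \<forall>h<j. i \<noteq> h \<longrightarrow> {a i, b i} \<inter> {a h, b h} = {})"
proof (induction j)
  case (Suc j)
  then obtain a b where ab: "\<forall>i<j. a i \<in> V \<and> b i \<in> V \<and> Q (a i) (b i)" "\<forall>i<j. \<forall>h<j. i \<noteq> h \<longrightarrow> {a i, b i} \<inter> {a h, b h} = {}" by auto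
  let ?X = "a ` {..<j} \<union> b ` {..<j}"
  have "card ?X \<le> card (a ` {..<j}) + card (b ` {..<j})" by (rule card_Un_le)
  also have "\<dots> \<le> card {..<j} + card {..<j}" by (intro add_mono card_image_le) auto
  also have "\<dots> \<le> 2 * k - 2" using Suc.prems by simp
  finally have "card ?X \<le> 2 * k - 2" .
  moreover have "?X \<subseteq> V" using ab(1) by auto
  ultimately obtain u v where uv: "u \<in> V - ?X" "v \<in> V - ?X" "Q u v" using nb[rule_format, of ?X] by blast
  have new: "{u, v} \<inter> {a i, b i} = {}" if "i < j" for i
  proof -
    have "a i \<in> ?X" "b i \<in> ?X" using that by auto
    then show ?thesis using uv by auto
  qed
  show ?case
  proof (rule exI[of _ "a(j := u)"], rule exI[of _ "b(j := v)"], intro conjI allI impI)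
    fix i assume i: "i < Suc j"
    show "(a(j := u)) i \<in> V" "(b(j := v)) i \<in> V" "Q ((a(j := u)) i) ((b(j := v)) i)"
      using i ab(1) uv by (cases "i = j"; simp)+
    fix h assume h: "h < Suc j" "i \<noteq> h"
    consider "i = j" "h < j" | "h = j" "i < j" | "i < j" "h < j" using i h by linarith
    then show "{(a(j := u)) i, (b(j := v)) i} \<inter> {(a(j := u)) h, (b(j := v)) h} = {}"
    proof cases
      case 1 then show ?thesis using new[of h] by simp
    next
      case 2 then show ?thesis using new[of i] by (simp add: Int_commute)
    next
      case 3 then show ?thesis using ab(2) h(2) by simp
    qed
  qed
qed simp

text \<open>Moves \<open>v\<close> into \<open>U\<close> by one step to its private neighbour
  \<open>u\<close>, or by none if it is already there.\<close>

definition arm :: "'a set \<Rightarrow> 'a \<Rightarrow> 'a \<Rightarrow> 'a list" where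
  "arm U v u = (if v \<in> U then [v] else [u, v])"

lemma arm_path:
  assumes "symp E" "E v u" "u \<in> U" "col u \<noteq> (col v :: bool)"
  shows "gpath E (arm U v u)" "last (arm U v u) = v" "hd (arm U v u) \<in> U" "set (arm U v u) \<inter> U = {hd (arm U v u)}"
    "set (arm U v u) \<subseteq> {u, v}" "odd (length (arm U v u)) \<longleftrightarrow> col (hd (arm U v u)) = col v" "v \<in> set (arm U v u)"
  using assms by (auto simp: arm_def gpath_def dest: sympD)

text \<open>Both arms respect the colouring and the edge between \<open>a\<close> and
  \<open>b\<close> does not, so the whole path violates it exactly once.\<close>

lemma bad_edge_breaking:
  assumes sym: "symp E" and a: "E a u" "u \<in> U" "col u \<noteq> (col a :: bool)" and b: "E b w" "w \<in> U" "col w \<noteq> col b"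
    and ab: "E a b" "col a = col b" and d: "{a, u} \<inter> {b, w} = {}"
  shows "breaking E U col (arm U a u @ rev (arm U b w))" "set (arm U a u @ rev (arm U b w)) \<subseteq> {a, b, u, w}"
    "{a, b} \<subseteq> set (arm U a u @ rev (arm U b w))"
proof -
  note A = arm_path[where U = U, OF sym a] and B = arm_path[where U = U, OF sym b]
  let ?p = "arm U a u" and ?q = "arm U b w"
  have ne: "?p \<noteq> []" "?q \<noteq> []" by (auto simp: arm_def)
  have dj: "set ?p \<inter> set ?q = {}" using A(5) B(5) d by blast
  have gq: "gpath E (rev ?q)" using B(1) gpath_rev[OF sym] by blast
  have "gpath E (?p @ rev ?q)" using gpath_append[of ?p "rev ?q" E] A(1,2) B(2) gq ab(1) dj ne by (simp add: hd_rev)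
  moreover have h: "hd (?p @ rev ?q) = hd ?p" "last (?p @ rev ?q) = hd ?q" using ne by (simp_all add: last_rev)
  moreover have "set (?p @ rev ?q) \<inter> U = {hd ?p, hd ?q}" using A(4) B(4) by (simp add: Int_Un_distrib2 insert_commute)
  moreover have "hd ?p \<noteq> hd ?q" using dj ne by (metis disjoint_iff hd_in_set)
  moreover have "even (length (?p @ rev ?q)) \<longleftrightarrow> col (hd ?p) = col (hd ?q)" using A(6) B(6) ab(2) by auto
  ultimately show "breaking E U col (?p @ rev ?q)" using A(3) B(3) unfolding breaking_def by simp
  show "set (?p @ rev ?q) \<subseteq> {a, b, u, w}" using A(5) B(5) by auto
  show "{a, b} \<subseteq> set (?p @ rev ?q)" using A(7) B(7) by auto
qed

lemma disjoint_Un_Un: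
  "A \<inter> B = {} \<Longrightarrow> A \<subseteq> Y \<Longrightarrow> B \<subseteq> Y \<Longrightarrow> C \<inter> Y = {} \<Longrightarrow> D \<inter> Y = {} \<Longrightarrow> C \<inter> D = {} \<Longrightarrow> (A \<union> C) \<inter> (B \<union> D) = {}"
  by blast

text \<open>Extend the colouring to \<open>X\<close> by majority, and choose \<open>k\<close> disjoint monochromatic edges. If \<open>m\<close> of them avoid \<open>S\<close>,
  then at least \<open>2 m - 1\<close> vertices of \<open>S\<close> lie off all chosen edges, which suffices to give each of the \<open>m\<close> edges
  a vertex of \<open>S\<close>. All ends are moved into \<open>V - X\<close> along private neighbours.\<close>

lemma near_case:
  assumes k: "0 < k" and g: "simple_graph V E" and kc: "k_connected (50 * k) V E" and S: "S \<subseteq> V" "2 * k \<le> card S + 1"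
    and X: "X \<subseteq> V" "card X + 2 \<le> 6 * k" and c0: "\<forall>a\<in>V - X. \<forall>b\<in>V - X. E a b \<longrightarrow> c0 a \<noteq> (c0 b :: bool)"
    and nb: "\<And>X c. X \<subseteq> V \<Longrightarrow> card X \<le> 2 * k - 2 \<Longrightarrow> \<exists>a\<in>V - X. \<exists>b\<in>V - X. E a b \<and> c a = (c b :: bool)"
  shows "\<exists>cs. length cs = k \<and> (\<forall>c\<in>set cs. odd_S_cycle V E S c) \<and>
            (\<forall>i<k. \<forall>j<k. i \<noteq> j \<longrightarrow> set (cs ! i) \<inter> set (cs ! j) = {})"
proof -
  note gd = simple_graphD[OF g]
  define U where "U = V - X"
  have fU: "finite U" and UV: "U \<subseteq> V" using gd(1) by (auto simp: U_def)
  have fS: "finite S" using S(1) gd(1) finite_subset by blast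
  have "\<exists>col. (\<forall>v\<in>V - X. col v = c0 v) \<and> (\<forall>v\<in>V. 22 * k \<le> card {u \<in> V - X. E v u \<and> col u \<noteq> (col v :: bool)})"
    by (rule majority_colouring[OF k g kc X c0])
  then obtain col where ch: "(\<forall>v\<in>V - X. col v = c0 v) \<and> (\<forall>v\<in>V. 22 * k \<le> card {u \<in> V - X. E v u \<and> col u \<noteq> (col v :: bool)})" ..
  have ceq: "\<forall>v\<in>U. col v = c0 v" unfolding U_def by (rule conjunct1[OF ch])
  have maj: "\<forall>v\<in>V. 22 * k \<le> card {u \<in> U. E v u \<and> col u \<noteq> col v}" unfolding U_def by (rule conjunct2[OF ch])
  have proper: "col a \<noteq> col b" if "a \<in> U" "b \<in> U" "E a b" for a b
    using c0 ceq that by (simp add: U_def)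
  have nb': "\<forall>X. X \<subseteq> V \<and> card X \<le> 2 * k - 2 \<longrightarrow> (\<exists>a\<in>V - X. \<exists>b\<in>V - X. E a b \<and> col a = col b)"
    by (intro allI impI, elim conjE, rule nb[where c = col])
  obtain a b where ab: "\<forall>i<k. a i \<in> V \<and> b i \<in> V \<and> E (a i) (b i) \<and> col (a i) = col (b i)"
    and abd: "\<forall>i<k. \<forall>h<k. i \<noteq> h \<longrightarrow> {a i, b i} \<inter> {a h, b h} = {}"
    using matching_of_bad_edges[OF nb' le_refl] by (elim exE conjE) (rule that)
  define Y where "Y = a ` {..<k} \<union> b ` {..<k}"
  define J where "J = {i. i < k \<and> {a i, b i} \<inter> S = {}}"
  have finJ: "finite J" and finY: "finite Y" by (auto simp: J_def Y_def)
  have cJ: "card J \<le> card (S - Y)"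
  proof (cases "J = {}")
    case False
    have "S \<inter> Y \<subseteq> a ` ({..<k} - J) \<union> b ` ({..<k} - J)" by (auto simp: Y_def J_def)
    then have "card (S \<inter> Y) \<le> card (a ` ({..<k} - J) \<union> b ` ({..<k} - J))" by (intro card_mono) auto
    also have "\<dots> \<le> card (a ` ({..<k} - J)) + card (b ` ({..<k} - J))" by (rule card_Un_le)
    also have "\<dots> \<le> card ({..<k} - J) + card ({..<k} - J)" by (intro add_mono card_image_le) auto
    also have "card ({..<k} - J) = k - card J" by (subst card_Diff_subset) (auto simp: J_def)
    finally have "card (S \<inter> Y) \<le> 2 * (k - card J)" by simp
    moreover have "J \<subseteq> {..<k}" by (auto simp: J_def)
    then have "card J \<le> k" using card_mono[of "{..<k}" J] by simp
    moreover have "0 < card J" using False finJ by (simp add: card_gt_0_iff)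
    moreover have "card S = card (S \<inter> Y) + card (S - Y)" using fS by (metis card_Int_Diff)
    ultimately show ?thesis using S(2) by simp
  qed simp
  obtain s where s: "inj_on s J" "\<forall>i\<in>J. s i \<in> S - Y" using greedy_sdr[OF finJ, of "\<lambda>_. S - Y"] cJ by blast
  define s' where "s' i = (if i \<in> J then s i else a i)" for i
  define Y' where "Y' = Y \<union> s ` J"
  have finY': "finite Y'" using finY finJ by (simp add: Y'_def)
  have cY: "card Y' \<le> 3 * k"
  proof -
    have "card Y \<le> card (a ` {..<k}) + card (b ` {..<k})" unfolding Y_def by (rule card_Un_le)
    also have "\<dots> \<le> card {..<k} + card {..<k}" by (intro add_mono card_image_le) auto
    finally have "card Y \<le> 2 * k" by simp
    moreover have "J \<subseteq> {..<k}" by (auto simp: J_def)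
    then have "card J \<le> k" using card_mono[of "{..<k}" J] by simp
    then have "card (s ` J) \<le> k" using card_image_le[OF finJ, of s] by linarith
    ultimately show ?thesis using card_Un_le[of Y "s ` J"] by (simp add: Y'_def)
  qed
  \<comment> \<open>Four requests for private neighbours per index: one for each end of the edge,
    and two for the vertex of \<open>S\<close>, whose path may have to enter \<open>U\<close> on
    both sides. Outside \<open>J\<close> the last two are placeholders at
    \<open>a i\<close>.\<close>
  define v where "v = (\<lambda>(i, r::nat). if r = 0 then a i else if r = 1 then b i else s' i)"
  define N where "N z = {u \<in> U. E (v z) u \<and> col u \<noteq> col (v z)} - Y'" for z
  define I where "I = {..<k} \<times> {..<4::nat}"
  have sV: "s' i \<in> V" if "i < k" for i using s(2) S(1) ab that by (auto simp: s'_def)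
  have vV: "v z \<in> V" if "z \<in> I" for z using that ab sV by (auto simp: I_def v_def)
  have cI: "card I = 4 * k" by (simp add: I_def card_cartesian_product)
  have "card I \<le> card (N z)" if "z \<in> I" for z
  proof -
    \<comment> \<open>The majority bound leaves \<open>19 * k\<close> candidates off
      \<open>Y'\<close>, more than the \<open>4 * k\<close> requests.\<close>
    have "22 * k - 3 * k \<le> card {u \<in> U. E (v z) u \<and> col u \<noteq> col (v z)} - card Y'" using bspec[OF maj vV[OF that]] cY by simp
    also have "\<dots> \<le> card (N z)" unfolding N_def by (rule diff_card_le_card_Diff[OF finY'])
    finally show ?thesis using cI by simp
  qed
  then obtain f where f: "inj_on f I" "\<forall>z\<in>I. f z \<in> N z" using greedy_sdr[of I N] by (auto simp: I_def)
  have fz: "E (v (i, r)) (f (i, r))" "f (i, r) \<in> U" "col (f (i, r)) \<noteq> col (v (i, r))" "f (i, r) \<notin> Y'"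
    if "i < k" "r < 4" for i r using f(2) that by (auto simp: I_def N_def)
  have fne: "f (i, r) \<noteq> f (j, q)" if "i < k" "r < 4" "j < k" "q < 4" "(i, r) \<noteq> (j, q)" for i r j q
    using inj_onD[OF f(1), of "(i, r)" "(j, q)"] that by (auto simp: I_def)
  have inY: "a i \<in> Y'" "b i \<in> Y'" "i \<in> J \<Longrightarrow> s i \<in> Y'" if "i < k" for i using that by (auto simp: Y'_def Y_def)
  define P where "P i = arm U (a i) (f (i, 0)) @ rev (arm U (b i) (f (i, 1)))" for i
  \<comment> \<open>If the edge meets \<open>S\<close>, its own breaking path serves; otherwise a
    short path through \<open>s i\<close> is used, whose parity need not break the colouring, and
    \<open>P i\<close> remains available as its partner.\<close>
  define Z where "Z i = (if i \<in> J then (if s i \<in> U then [s i, f (i, 2)] else [f (i, 2), s i, f (i, 3)]) else P i)" for i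
  define G where "G i = set (Z i) \<union> (if breaking E U col (Z i) then {} else set (P i))" for i
  have v0: "v (i, 0) = a i" "v (i, Suc 0) = b i" "v (i, 2) = s' i" "v (i, 3) = s' i" for i by (simp_all add: v_def)
  have PP: "breaking E U col (P i)" "set (P i) \<subseteq> {a i, b i, f (i, 0), f (i, 1)}" "{a i, b i} \<subseteq> set (P i)" if i: "i < k" for i
  proof -
    have "a i \<noteq> b i" using ab i gd(3) by (auto simp: irreflp_def)
    moreover have "f (i, 0) \<noteq> f (i, 1)" by (rule fne) (use i in auto)
    moreover have "f (i, 0) \<noteq> b i" "f (i, 1) \<noteq> a i" using fz(4)[OF i, of 0] fz(4)[OF i, of 1] inY[OF i] by auto
    ultimately have d: "{a i, f (i, 0)} \<inter> {b i, f (i, 1)} = {}" by auto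
    note B = bad_edge_breaking[OF gd(2) _ _ _ _ _ _ _ _ d, of U col]
    have 1: "E (a i) (f (i, 0))" "f (i, 0) \<in> U" "col (f (i, 0)) \<noteq> col (a i)" using fz[OF i, of 0] by (simp_all add: v0)
    have 2: "E (b i) (f (i, 1))" "f (i, 1) \<in> U" "col (f (i, 1)) \<noteq> col (b i)" using fz[OF i, of 1] by (simp_all add: v0)
    have 3: "E (a i) (b i)" "col (a i) = col (b i)" using ab i by auto
    show "breaking E U col (P i)" "set (P i) \<subseteq> {a i, b i, f (i, 0), f (i, 1)}" "{a i, b i} \<subseteq> set (P i)"
      unfolding P_def using B[OF 1 2 3] by simp_all
  qed
  have ZJ: "spath E U (Z i)" "set (Z i) \<subseteq> {s i, f (i, 2), f (i, 3)}" "s i \<in> set (Z i)" if i: "i < k" "i \<in> J" for i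
  proof -
    have 2: "E (s i) (f (i, 2))" "f (i, 2) \<in> U" "f (i, 2) \<noteq> s i" and 3: "E (s i) (f (i, 3))" "f (i, 3) \<in> U" "f (i, 3) \<noteq> s i"
      using fz[OF i(1), of 2] fz[OF i(1), of 3] i inY(3)[OF i] by (auto simp: v0 s'_def)
    have "f (i, 2) \<noteq> f (i, 3)" by (rule fne) (use i in auto)
    moreover have "E (f (i, 2)) (s i)" using 2(1) sympD[OF gd(2)] by blast
    ultimately show "spath E U (Z i)" using 2 3 i(2) by (auto simp: Z_def spath_def gpath_def)
    show "set (Z i) \<subseteq> {s i, f (i, 2), f (i, 3)}" "s i \<in> set (Z i)" using i(2) by (auto simp: Z_def)
  qed
  define M where "M i = {a i, b i} \<union> (if i \<in> J then {s i} else {}) \<union> (\<lambda>r. f (i, r)) ` {..<4}" for i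
  have fM: "f (i, r) \<in> M i" if "r < 4" for i r using that by (auto simp: M_def)
  have GM: "G i \<subseteq> M i" if i: "i < k" for i
  proof -
    have "set (P i) \<subseteq> M i" using PP(2)[OF i] fM[of 0 i] fM[of 1 i] by (auto simp: M_def)
    moreover have "set (Z i) \<subseteq> M i" if "i \<in> J" using ZJ(2)[OF i that] fM[of 2 i] fM[of 3 i] that by (auto simp: M_def)
    ultimately show ?thesis by (auto simp: G_def Z_def split: if_splits)
  qed
  have MM: "M i \<inter> M j = {}" if ij: "i < k" "j < k" "i \<noteq> j" for i j
  proof -
    have core: "({a i, b i} \<union> (if i \<in> J then {s i} else {})) \<inter> ({a j, b j} \<union> (if j \<in> J then {s j} else {})) = {}"
    proof -
      have "{a i, b i} \<inter> {a j, b j} = {}" using abd ij by blast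
      moreover have sab: "a l \<noteq> s h \<and> b l \<noteq> s h" if hl: "h \<in> J" "l < k" for h l
      proof -
        have "s h \<notin> Y" using s(2) hl(1) by blast
        moreover have "a l \<in> Y" "b l \<in> Y" using hl(2) by (auto simp: Y_def)
        ultimately show ?thesis by auto
      qed
      moreover have "s i \<noteq> s j" if "i \<in> J" "j \<in> J" using inj_onD[OF s(1)] that ij by auto
      ultimately show ?thesis using ij sab[of i j] sab[of j i] by (cases "i \<in> J"; cases "j \<in> J"; force)
    qed
    have sub: "{a h, b h} \<union> (if h \<in> J then {s h} else {}) \<subseteq> Y'" if "h < k" for h using inY[OF that] by auto
    have ff: "(\<lambda>r. f (h, r)) ` {..<4} \<inter> Y' = {}" if "h < k" for h using fz(4)[OF that] by auto
    have "f (i, r) \<noteq> f (j, q)" if "r < 4" "q < 4" for r q by (rule fne) (use ij that in auto)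
    then have fd: "(\<lambda>r. f (i, r)) ` {..<4} \<inter> (\<lambda>r. f (j, r)) ` {..<4} = {}" by auto
    show ?thesis unfolding M_def
      by (rule disjoint_Un_Un[OF core sub[OF ij(1)] sub[OF ij(2)] ff[OF ij(1)] ff[OF ij(2)] fd])
  qed
  have MV: "M i \<subseteq> V" if "i < k" for i
    using ab that S(1) s(2) fz(2)[OF that] UV by (auto simp: M_def)
  interpret bip_host V U E E col
    using gd(2) UV proper by unfold_locales
  show ?thesis
  proof (rule assemble[OF fU, where Z = Z and P = P and G = G])
    show "linked U E T" if "T \<subseteq> U" "card T \<le> 4 * k" for T
      unfolding U_def by (rule near_host[OF k g kc X c0]) (use that in \<open>simp_all add: U_def\<close>)
    fix i assume i: "i < k"
    have "spath E U (Z i) \<and> set (Z i) \<inter> S \<noteq> {}"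
    proof (cases "i \<in> J")
      case True
      then show ?thesis using ZJ(1,3)[OF i True] s(2) by auto
    next
      case False
      then have "{a i, b i} \<inter> S \<noteq> {}" using i by (simp add: J_def)
      then have "set (P i) \<inter> S \<noteq> {}" using PP(3)[OF i] by auto
      then show ?thesis using PP(1)[OF i] False by (simp add: Z_def breaking_spath)
    qed
    moreover have ZV: "set (Z i) \<subseteq> V" using GM[OF i] MV[OF i] by (auto simp: G_def)
    ultimately show "spath E U (Z i) \<and> set (Z i) \<subseteq> V \<and> set (Z i) \<inter> S \<noteq> {}" by simp
    show "breaking E U col (P i) \<and> set (P i) \<subseteq> V \<and> set (Z i) \<inter> set (P i) = {}" if nbr: "\<not> breaking E U col (Z i)"
    proof (intro conjI)
      show "breaking E U col (P i)" by (rule PP(1)[OF i])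
      show "set (P i) \<subseteq> V" using GM[OF i] MV[OF i] nbr by (auto simp: G_def)
      have iJ: "i \<in> J"
      proof (rule ccontr)
        assume "i \<notin> J"
        then have "Z i = P i" by (simp add: Z_def)
        then show False using nbr PP(1)[OF i] by simp
      qed
      have "s i \<notin> Y" using s(2) iJ by auto
      then have "s i \<noteq> a i" "s i \<noteq> b i" using i by (auto simp: Y_def)
      moreover have "f (i, q) \<noteq> s i" "a i \<noteq> f (i, q)" "b i \<noteq> f (i, q)" if "q < 4" for q using fz(4)[OF i that] inY[OF i] iJ by auto
      moreover have "f (i, q) \<noteq> f (i, r)" if "q < 4" "r < 4" "q \<noteq> r" for q r by (rule fne) (use i that in auto)
      ultimately have "{s i, f (i, 2), f (i, 3)} \<inter> {a i, b i, f (i, 0), f (i, 1)} = {}" by auto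
      then show "set (Z i) \<inter> set (P i) = {}" using ZJ(2)[OF i iJ] PP(2)[OF i] by blast
    qed
    fix j assume "j < k" "i \<noteq> j"
    then show "G i \<inter> G j = {}" using GM[OF i] GM[of j] MM[OF i, of j] by blast
  qed (rule G_def)
qed

section \<open>Combining the two cases\<close>

lemma coloured_cycle_even:
  assumes cyc: "is_cycle V E c" and col: "\<And>a b. E a b \<Longrightarrow> col a \<noteq> (col b :: bool)"
  shows "even (length c)"
proof -
  have l: "3 \<le> length c" and e: "\<And>i. i < length c \<Longrightarrow> E (c ! i) (c ! ((i + 1) mod length c))"
    using cyc by (auto simp: is_cycle_def)
  have par: "i < length c \<Longrightarrow> (col (c ! i) = col (c ! 0)) = even i" for i
  proof (induction i)
    case (Suc i)
    then have "E (c ! i) (c ! Suc i)" using e[of i] by simp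
    then have "col (c ! i) \<noteq> col (c ! Suc i)" by (rule col)
    then show ?case using Suc by auto
  qed simp
  have "length c - 1 + 1 = length c" using l by simp
  then have "E (c ! (length c - 1)) (c ! 0)" using e[of "length c - 1"] l by simp
  then have "col (c ! (length c - 1)) \<noteq> col (c ! 0)" by (rule col)
  then have "odd (length c - 1)" using par[of "length c - 1"] l by simp
  then show ?thesis using l by simp
qed

theorem theorem11:
  fixes V S :: "'a set" and E :: "'a \<Rightarrow> 'a \<Rightarrow> bool" and k :: nat
  assumes "k > 0"
    and "simple_graph V E"
    and "k_connected (50 * k) V E"
    and "S \<subseteq> V"
  shows "(\<exists>cs. length cs = k \<and> (\<forall>c\<in>set cs. odd_S_cycle V E S c) \<and>
            (\<forall>i<k. \<forall>j<k. i \<noteq> j \<longrightarrow> set (cs ! i) \<inter> set (cs ! j) = {}))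
       \<or> (\<exists>X. X \<subseteq> V \<and> card X \<le> 2 * k - 2 \<and>
            \<not> (\<exists>c. odd_S_cycle (V - X) (del_verts_E E X) S c))"
proof (rule disjCI)
  note gd = simple_graphD[OF assms(2)]
  assume "\<not> (\<exists>X. X \<subseteq> V \<and> card X \<le> 2 * k - 2 \<and> \<not> (\<exists>c. odd_S_cycle (V - X) (del_verts_E E X) S c))"
  then have ex: "\<exists>c. odd_S_cycle (V - X) (del_verts_E E X) S c" if "X \<subseteq> V" "card X \<le> 2 * k - 2" for X
    using that by blast
  have S: "2 * k \<le> card S + 1"
  proof (rule ccontr)
    assume "\<not> ?thesis"
    then have "card S \<le> 2 * k - 2" by simp
    \<comment> \<open>Deleting all of \<open>S\<close> would leave no
      \<open>S\<close>-cycle.\<close>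
    then show False using ex[OF assms(4)] by (auto simp: odd_S_cycle_def is_cycle_def)
  qed
  \<comment> \<open>An odd cycle outside \<open>X\<close> excludes every proper 2-colouring
    there.\<close>
  have nb: "\<exists>a\<in>V - X. \<exists>b\<in>V - X. E a b \<and> c a = (c b :: bool)" if X: "X \<subseteq> V" "card X \<le> 2 * k - 2" for X c
  proof (rule ccontr)
    assume n: "\<not> ?thesis"
    obtain p where p: "is_cycle (V - X) (del_verts_E E X) p" "odd (length p)"
      using ex[OF X] by (auto simp: odd_S_cycle_def)
    have "c a \<noteq> c b" if "del_verts_E E X a b" for a b
      using n that gd(4)[of a b] by (auto simp: del_verts_E_def)
    then show False using coloured_cycle_even[OF p(1), of c] p(2) by blast
  qed
  show "\<exists>cs. length cs = k \<and> (\<forall>c\<in>set cs. odd_S_cycle V E S c) \<and>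
            (\<forall>i<k. \<forall>j<k. i \<noteq> j \<longrightarrow> set (cs ! i) \<inter> set (cs ! j) = {})"
  proof (cases "\<exists>X (c :: 'a \<Rightarrow> bool). X \<subseteq> V \<and> card X + 2 \<le> 6 * k \<and> (\<forall>a\<in>V - X. \<forall>b\<in>V - X. E a b \<longrightarrow> c a \<noteq> c b)")
    case True
    then obtain X and c :: "'a \<Rightarrow> bool" where X: "X \<subseteq> V" "card X + 2 \<le> 6 * k" "\<forall>a\<in>V - X. \<forall>b\<in>V - X. E a b \<longrightarrow> c a \<noteq> c b" by blast
    show ?thesis
    proof (rule near_case[OF assms S X])
      fix Y and c' :: "'a \<Rightarrow> bool" assume "Y \<subseteq> V" "card Y \<le> 2 * k - 2"
      then show "\<exists>a\<in>V - Y. \<exists>b\<in>V - Y. E a b \<and> c' a = c' b" by (rule nb)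
    qed
  next
    case False
    have "k \<le> card S" using S assms(1) by simp
    then show ?thesis
    proof (rule far_case[OF assms])
      fix Y and c :: "'a \<Rightarrow> bool" assume "Y \<subseteq> V" "card Y + 2 \<le> 6 * k"
      then show "\<exists>a\<in>V - Y. \<exists>b\<in>V - Y. E a b \<and> c a = c b" using False by blast
    qed
  qed
qed

end
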